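(* Let $\Omega\subseteq\mathbb{R}^n$ be an open neighborhood of $x_0$ and let $P(x,D)=P_0(D)+\sum_{j=1}^rc_j(x)P_j(D)$ with $c_j\in\mathcal{C}^\infty(\Omega)$ for all $j$. Assume that: (h1) for all $j=1,\dots,r$, $c_j(x_0)=0$, and $P_0(D)$, $P_j(D)$ are differential operators with constant coefficients in $\widetilde{\mathbb{C}}$; (h2) $\widetilde{P_0}(\xi)$ is invertible in $\widetilde{\mathbb{R}}$ for some $\xi\in\mathbb{R}^n$; (h3) $P_0(D)$ is stronger than every $P_j(D)$, $j=1,\dots,r$; (h4) for a certain choice of representatives, for all $j=1,\dots,r$, $\widetilde{P_{j,\varepsilon}}(\xi)\le\lambda_{j,\varepsilon}\widetilde{P_{0,\varepsilon}}(\xi)$ for all $\xi\in\mathbb{R}^n$ and $\varepsilon\in(0,1]$, where $\lambda_{j,\varepsilon}=O(1)$ as $\varepsilon\to0$. Then there exists a sufficiently small neighborhood $\Omega_\delta:=\{x:|x-x_0|<\delta\}$ of $x_0$ such that (i) for all $F\in\mathcal{L}_b(\mathcal{G}(\mathbb{R}^n),\widetilde{\mathbb{C}})$ there exists $T\in\mathcal{L}_b(\mathcal{G}(\mathbb{R}^n),\widetilde{\mathbb{C}})$ solving $P(x,D)T=F$ on $\Omega_\delta$; (ii) for all $v\in\mathcal{G}_c(\mathbb{R}^n)$ there exists $u\in\mathcal{G}_c(\mathbb{R}^n)$ solving $P(x,D)u=v$ on $\Omega_\delta$.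
   Context: All nets are indexed by $\varepsilon\in(0,1]$ and $O(\cdot)$ refers to $\varepsilon\to0$. For a locally convex space $E$ with seminorms $\{p_i\}$: $\mathcal{M}_E$ is the set of nets $(u_\varepsilon)_\varepsilon\in E^{(0,1]}$ such that for every $i$ there is $N\in\mathbb{N}$ with $p_i(u_\varepsilon)=O(\varepsilon^{-N})$; $\mathcal{N}_E$ is the set of nets with $p_i(u_\varepsilon)=O(\varepsilon^q)$ for all $i$ and all $q\in\mathbb{N}$; $\mathcal{G}_E=\mathcal{M}_E/\mathcal{N}_E$. $\widetilde{\mathbb{C}}=\mathcal{G}_{\mathbb{C}}$, $\widetilde{\mathbb{R}}=\mathcal{G}_{\mathbb{R}}$; elements of $\mathcal{M}_{\mathbb{C}}$ are called moderate nets. $\mathcal{G}(\Omega)=\mathcal{G}_{\mathcal{C}^\infty(\Omega)}$ for $\Omega\subseteq\mathbb{R}^n$ open, and $\mathcal{G}_c(\Omega)$ is its subalgebra of compactly supported elements. $\mathcal{L}_b(\mathcal{G}(\mathbb{R}^n),\widetilde{\mathbb{C}})$ (basic functionals) is the set of $\widetilde{\mathbb{C}}$-linear functionals $T:\mathcal{G}(\mathbb{R}^n)\to\widetilde{\mathbb{C}}$ of the form $T(u)=[(T_\varepsilon(u_\varepsilon))_\varepsilon]$, where $(T_\varepsilon)_\varepsilon$ is a net in $\mathcal{E}'(\mathbb{R}^n)$ for which there are $K\Subset\mathbb{R}^n$, $j\in\mathbb{N}$, $c>0$, $N\in\mathbb{N}$, $\eta\in(0,1]$ with $|T_\varepsilon(f)|\le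 c\,\varepsilon^{-N}\sup_{x\in K,|\alpha|\le j}|\partial^\alpha f(x)|$ for all $f\in\mathcal{C}^\infty(\mathbb{R}^n)$, $\varepsilon\in(0,\eta]$. Differential operators with Colombeau coefficients on an open set act on functionals by transposition; "$P(x,D)T=F$ on $\Omega_\delta$" means that the restrictions of both sides to $\mathcal{G}_c(\Omega_\delta)$ coincide. Constant coefficient operators: $P(D)=\sum_{|\alpha|\le m}c_\alpha D^\alpha$, $c_\alpha\in\widetilde{\mathbb{C}}$, $D=-i\partial$, with polynomial $P(\xi)=\sum_{|\alpha|\le m}c_\alpha\xi^\alpha$. A representative of $P$ is a net of polynomials $P_\varepsilon(\xi)=\sum_{|\alpha|\le m}c_{\alpha,\varepsilon}\xi^\alpha$ with $(c_{\alpha,\varepsilon})_\varepsilon$ a representative of $c_\alpha$. For a polynomial $Q$, $\widetilde Q(\xi)=(\sum_\alpha|\partial^\alpha Q(\xi)|^2)^{1/2}$, and $\widetilde P(\xi)=[(\widetilde{P_\varepsilon}(\xi))_\varepsilon]\in\widetilde{\mathbb{R}}$. $P(D)$ is stronger than $Q(D)$ (written $Q(D)\prec P(D)$) if there exist representatives $(P_\varepsilon)_\varepsilon$, $(Q_\varepsilon)_\varepsilon$ and a moderate net $(\lambda_\varepsilon)_\varepsilon$ with $\widetilde{Q_\varepsilon}(\xi)\le\lambda_\varepsilon\widetilde{P_\varepsilon}(\xi)$ for all $\xi\in\mathbb{R}^n$, $\varepsilon\in(0,1]$. *)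

theory Defs
  imports
    "HOL-Analysis.Analysis"
    "HOL-Library.Landau_Symbols"
    "HOL-Library.Groups_Big_Fun"
begin

section \<open>Colombeau spaces over a locally convex space\<close>

text \<open>
  A net indexed by \<open>(0,1]\<close> is a function on \<open>real\<close> whose values outside \<open>(0,1]\<close> are ignored.
  A locally convex space is given by its carrier \<open>E\<close> and seminorms \<open>p i\<close>, \<open>i \<in> I\<close>.
\<close>

definition moderate_nets :: "'e set \<Rightarrow> 'i set \<Rightarrow> ('i \<Rightarrow> 'e \<Rightarrow> real) \<Rightarrow> (real \<Rightarrow> 'e) set" where
  "moderate_nets E I p =
     {u. (\<forall>\<epsilon>\<in>{0<..1}. u \<epsilon> \<in> E) \<and>
         (\<forall>i\<in>I. \<exists>N::nat. (\<lambda>\<epsilon>. p i (u \<epsilon>)) \<in> O[at_right 0](\<lambda>\<epsilon>. 1 / \<epsilon> ^ N))}"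

definition negligible_nets :: "'e set \<Rightarrow> 'i set \<Rightarrow> ('i \<Rightarrow> 'e \<Rightarrow> real) \<Rightarrow> (real \<Rightarrow> 'e) set" where
  "negligible_nets E I p =
     {u. (\<forall>\<epsilon>\<in>{0<..1}. u \<epsilon> \<in> E) \<and>
         (\<forall>i\<in>I. \<forall>q::nat. (\<lambda>\<epsilon>. p i (u \<epsilon>)) \<in> O[at_right 0](\<lambda>\<epsilon>. \<epsilon> ^ q))}"

definition colombeau_rel ::
    "'e::minus set \<Rightarrow> 'i set \<Rightarrow> ('i \<Rightarrow> 'e \<Rightarrow> real) \<Rightarrow> ((real \<Rightarrow> 'e) \<times> (real \<Rightarrow> 'e)) set" where
  "colombeau_rel E I p =
     {(u, v). u \<in> moderate_nets E I p \<and> v \<in> moderate_nets E I p \<and>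
              (\<lambda>\<epsilon>. u \<epsilon> - v \<epsilon>) \<in> negligible_nets E I p}"


section \<open>The rings of generalized real and complex numbers\<close>

abbreviation moderate :: "(real \<Rightarrow> 'a::real_normed_field) \<Rightarrow> bool" where
  "moderate u \<equiv> u \<in> moderate_nets UNIV (UNIV :: unit set) (\<lambda>_. norm)"

abbreviation negligible_net :: "(real \<Rightarrow> 'a::real_normed_field) \<Rightarrow> bool" where
  "negligible_net u \<equiv> u \<in> negligible_nets UNIV (UNIV :: unit set) (\<lambda>_. norm)"

lemma moderate_iff:
  "moderate u \<longleftrightarrow> (\<exists>N::nat. (\<lambda>\<epsilon>. norm (u \<epsilon>)) \<in> O[at_right 0](\<lambda>\<epsilon>. 1 / \<epsilon> ^ N))"
  by (simp add: moderate_nets_def)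

lemma negligible_iff:
  "negligible_net u \<longleftrightarrow> (\<forall>q::nat. (\<lambda>\<epsilon>. norm (u \<epsilon>)) \<in> O[at_right 0](\<lambda>\<epsilon>. \<epsilon> ^ q))"
  by (simp add: negligible_nets_def)

lemma eventually_at_right_unit: "\<forall>\<^sub>F \<epsilon> in at_right (0::real). 0 < \<epsilon> \<and> \<epsilon> < 1"
  by (rule eventually_at_rightI[of 0 1]) auto

lemma moderateI_bound: "eventually (\<lambda>\<epsilon>. norm (u \<epsilon>) \<le> C) (at_right 0) \<Longrightarrow> moderate u"
  unfolding moderate_iff
  by (rule exI[of _ 0], rule bigoI[of _ C]) (auto elim!: eventually_mono)

lemma negligible_imp_moderate: "negligible_net u \<Longrightarrow> moderate u"
  unfolding moderate_iff negligible_iff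
  by (rule exI[of _ 0], drule spec[of _ 0]) simp

lemma pow_bigo_mono:
  assumes "N \<le> M"
  shows "(\<lambda>\<epsilon>::real. 1 / \<epsilon> ^ N) \<in> O[at_right 0](\<lambda>\<epsilon>. 1 / \<epsilon> ^ M)"
proof (rule bigoI[of _ 1], rule eventually_mono[OF eventually_at_right_unit])
  fix \<epsilon> :: real assume "0 < \<epsilon> \<and> \<epsilon> < 1"
  then show "norm (1 / \<epsilon> ^ N) \<le> 1 * norm (1 / \<epsilon> ^ M)"
    using power_decreasing[OF assms, of \<epsilon>] by (simp add: frac_le)
qed

lemma norm_add_bigo:
  fixes u v :: "real \<Rightarrow> 'a::real_normed_vector"
  assumes "(\<lambda>\<epsilon>. norm (u \<epsilon>)) \<in> O[F](g)" "(\<lambda>\<epsilon>. norm (v \<epsilon>)) \<in> O[F](g)"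
  shows "(\<lambda>\<epsilon>. norm (u \<epsilon> + v \<epsilon>)) \<in> O[F](g :: real \<Rightarrow> real)"
proof -
  have "(\<lambda>\<epsilon>. norm (u \<epsilon> + v \<epsilon>)) \<in> O[F](\<lambda>\<epsilon>. norm (u \<epsilon>) + norm (v \<epsilon>))"
    by (rule bigoI[of _ 1]) (auto intro!: always_eventually order_trans[OF norm_triangle_ineq])
  also have "(\<lambda>\<epsilon>. norm (u \<epsilon>) + norm (v \<epsilon>)) \<in> O[F](g)"
    by (intro sum_in_bigo assms)
  finally show ?thesis .
qed

lemma moderate_add:
  assumes "moderate u" "moderate v"
  shows "moderate (\<lambda>\<epsilon>. u \<epsilon> + v \<epsilon>)"
proof -
  obtain N M :: nat where
    "(\<lambda>\<epsilon>. norm (u \<epsilon>)) \<in> O[at_right 0](\<lambda>\<epsilon>. 1 / \<epsilon> ^ N)"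
    "(\<lambda>\<epsilon>. norm (v \<epsilon>)) \<in> O[at_right 0](\<lambda>\<epsilon>. 1 / \<epsilon> ^ M)"
    using assms unfolding moderate_iff by blast
  then have
    "(\<lambda>\<epsilon>. norm (u \<epsilon>)) \<in> O[at_right 0](\<lambda>\<epsilon>. 1 / \<epsilon> ^ max N M)"
    "(\<lambda>\<epsilon>. norm (v \<epsilon>)) \<in> O[at_right 0](\<lambda>\<epsilon>. 1 / \<epsilon> ^ max N M)"
    using landau_o.big_trans[OF _ pow_bigo_mono[of N "max N M"]]
      landau_o.big_trans[OF _ pow_bigo_mono[of M "max N M"]] by simp_all
  then show ?thesis
    unfolding moderate_iff by (blast intro: norm_add_bigo)
qed

lemma moderate_mult:
  assumes "moderate u" "moderate v"
  shows "moderate (\<lambda>\<epsilon>. u \<epsilon> * v \<epsilon>)"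
proof -
  obtain N M :: nat where
    "(\<lambda>\<epsilon>. norm (u \<epsilon>)) \<in> O[at_right 0](\<lambda>\<epsilon>. 1 / \<epsilon> ^ N)"
    "(\<lambda>\<epsilon>. norm (v \<epsilon>)) \<in> O[at_right 0](\<lambda>\<epsilon>. 1 / \<epsilon> ^ M)"
    using assms unfolding moderate_iff by blast
  from landau_o.big.mult[OF this]
  have "(\<lambda>\<epsilon>. norm (u \<epsilon> * v \<epsilon>)) \<in> O[at_right 0](\<lambda>\<epsilon>. 1 / \<epsilon> ^ (N + M))"
    by (simp add: norm_mult power_add)
  then show ?thesis unfolding moderate_iff by blast
qed

lemma moderate_uminus: "moderate u \<Longrightarrow> moderate (\<lambda>\<epsilon>. - u \<epsilon>)"
  by (simp add: moderate_iff)

lemma negligible_add: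
  "negligible_net u \<Longrightarrow> negligible_net v \<Longrightarrow> negligible_net (\<lambda>\<epsilon>. u \<epsilon> + v \<epsilon>)"
  unfolding negligible_iff by (blast intro: norm_add_bigo)

lemma negligible_uminus: "negligible_net u \<Longrightarrow> negligible_net (\<lambda>\<epsilon>. - u \<epsilon>)"
  by (simp add: negligible_iff)

lemma negligible_mult:
  assumes "moderate u" "negligible_net v"
  shows "negligible_net (\<lambda>\<epsilon>. u \<epsilon> * v \<epsilon>)"
  unfolding negligible_iff
proof
  fix q :: nat
  obtain N :: nat where N: "(\<lambda>\<epsilon>. norm (u \<epsilon>)) \<in> O[at_right 0](\<lambda>\<epsilon>. 1 / \<epsilon> ^ N)"
    using assms unfolding moderate_iff by blast
  have "(\<lambda>\<epsilon>. norm (v \<epsilon>)) \<in> O[at_right 0](\<lambda>\<epsilon>. \<epsilon> ^ (q + N))"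
    using assms unfolding negligible_iff by blast
  from landau_o.big.mult[OF N this]
  have "(\<lambda>\<epsilon>. norm (u \<epsilon> * v \<epsilon>)) \<in> O[at_right 0](\<lambda>\<epsilon>. 1 / \<epsilon> ^ N * \<epsilon> ^ (q + N))"
    by (simp add: norm_mult)
  also have "(\<lambda>\<epsilon>::real. 1 / \<epsilon> ^ N * \<epsilon> ^ (q + N)) \<in> O[at_right 0](\<lambda>\<epsilon>. \<epsilon> ^ q)"
    by (rule bigoI[of _ 1], rule eventually_mono[OF eventually_at_right_unit])
       (simp add: power_add)
  finally show "(\<lambda>\<epsilon>. norm (u \<epsilon> * v \<epsilon>)) \<in> O[at_right 0](\<lambda>\<epsilon>. \<epsilon> ^ q)" .
qed

definition gen_rel :: "(real \<Rightarrow> 'a::real_normed_field) \<Rightarrow> (real \<Rightarrow> 'a) \<Rightarrow> bool" where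
  "gen_rel u v \<longleftrightarrow> (u, v) \<in> colombeau_rel UNIV (UNIV :: unit set) (\<lambda>_. norm)"

lemma gen_rel_iff:
  "gen_rel u v \<longleftrightarrow> moderate u \<and> moderate v \<and> negligible_net (\<lambda>\<epsilon>. u \<epsilon> - v \<epsilon>)"
  by (simp add: gen_rel_def colombeau_rel_def)

lemma moderate_const: "moderate (\<lambda>_. a)"
  by (rule moderateI_bound[of _ "norm a"]) simp

lemma negligible_zero: "negligible_net (\<lambda>_. 0)"
  by (simp add: negligible_iff)

lemma gen_rel_refl: "moderate u \<Longrightarrow> gen_rel u u"
  by (simp add: gen_rel_iff negligible_zero)

lemma part_equivp_gen_rel:
  "part_equivp (gen_rel :: (real \<Rightarrow> 'a::real_normed_field) \<Rightarrow> (real \<Rightarrow> 'a) \<Rightarrow> bool)"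
proof (rule part_equivpI)
  show "\<exists>u :: real \<Rightarrow> 'a. gen_rel u u"
    using gen_rel_refl moderate_const by blast
  show "symp (gen_rel :: (real \<Rightarrow> 'a) \<Rightarrow> _)"
  proof (rule sympI)
    fix u v :: "real \<Rightarrow> 'a" assume "gen_rel u v"
    then show "gen_rel v u"
      using negligible_uminus[of "\<lambda>\<epsilon>. u \<epsilon> - v \<epsilon>"] by (simp add: gen_rel_iff)
  qed
  show "transp (gen_rel :: (real \<Rightarrow> 'a) \<Rightarrow> _)"
  proof (rule transpI)
    fix u v w :: "real \<Rightarrow> 'a" assume "gen_rel u v" "gen_rel v w"
    then show "gen_rel u w"
      using negligible_add[of "\<lambda>\<epsilon>. u \<epsilon> - v \<epsilon>" "\<lambda>\<epsilon>. v \<epsilon> - w \<epsilon>"] by (simp add: gen_rel_iff)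
  qed
qed

text \<open>The rings of generalized complex and real numbers are \<open>complex gen\<close> and \<open>real gen\<close>.\<close>

quotient_type (overloaded) 'a gen = "real \<Rightarrow> 'a::real_normed_field" / partial: gen_rel
  by (rule part_equivp_gen_rel)

instantiation gen :: (real_normed_field) comm_ring_1
begin

lift_definition zero_gen :: "'a gen" is "\<lambda>_. 0"
  by (simp add: gen_rel_refl moderate_const)

lift_definition one_gen :: "'a gen" is "\<lambda>_. 1"
  by (simp add: gen_rel_refl moderate_const)

lift_definition plus_gen :: "'a gen \<Rightarrow> 'a gen \<Rightarrow> 'a gen" is "\<lambda>u v \<epsilon>. u \<epsilon> + v \<epsilon>"
proof -
  fix u u' v v' :: "real \<Rightarrow> 'a" assume "gen_rel u u'" "gen_rel v v'"
  then show "gen_rel (\<lambda>\<epsilon>. u \<epsilon> + v \<epsilon>) (\<lambda>\<epsilon>. u' \<epsilon> + v' \<epsilon>)"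
    using negligible_add[of "\<lambda>\<epsilon>. u \<epsilon> - u' \<epsilon>" "\<lambda>\<epsilon>. v \<epsilon> - v' \<epsilon>"]
    by (simp add: gen_rel_iff moderate_add algebra_simps)
qed

lift_definition uminus_gen :: "'a gen \<Rightarrow> 'a gen" is "\<lambda>u \<epsilon>. - u \<epsilon>"
proof -
  fix u u' :: "real \<Rightarrow> 'a" assume "gen_rel u u'"
  then show "gen_rel (\<lambda>\<epsilon>. - u \<epsilon>) (\<lambda>\<epsilon>. - u' \<epsilon>)"
    using negligible_uminus[of "\<lambda>\<epsilon>. u \<epsilon> - u' \<epsilon>"]
    by (simp add: gen_rel_iff moderate_uminus algebra_simps)
qed

lift_definition times_gen :: "'a gen \<Rightarrow> 'a gen \<Rightarrow> 'a gen" is "\<lambda>u v \<epsilon>. u \<epsilon> * v \<epsilon>"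
proof -
  fix u u' v v' :: "real \<Rightarrow> 'a" assume "gen_rel u u'" "gen_rel v v'"
  then have *: "moderate u" "moderate u'" "moderate v" "moderate v'"
    "negligible_net (\<lambda>\<epsilon>. u \<epsilon> - u' \<epsilon>)" "negligible_net (\<lambda>\<epsilon>. v \<epsilon> - v' \<epsilon>)"
    by (simp_all add: gen_rel_iff)
  have "negligible_net (\<lambda>\<epsilon>. u \<epsilon> * (v \<epsilon> - v' \<epsilon>) + v' \<epsilon> * (u \<epsilon> - u' \<epsilon>))"
    by (intro negligible_add negligible_mult *)
  then show "gen_rel (\<lambda>\<epsilon>. u \<epsilon> * v \<epsilon>) (\<lambda>\<epsilon>. u' \<epsilon> * v' \<epsilon>)"
    by (simp add: gen_rel_iff moderate_mult * algebra_simps)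
qed

definition minus_gen :: "'a gen \<Rightarrow> 'a gen \<Rightarrow> 'a gen" where
  "minus_gen x y = x + (- y)"

instance
proof
  fix a b c :: "'a gen"
  have [simp]: "gen_rel u u \<longleftrightarrow> moderate u" for u :: "real \<Rightarrow> 'a"
    by (auto simp: gen_rel_iff negligible_zero)
  show "a + b + c = a + (b + c)"
    by transfer (simp add: moderate_add add.assoc)
  show "a + b = b + a"
    by transfer (simp add: moderate_add add.commute)
  show "0 + a = a"
    by transfer simp
  show "- a + a = 0"
    by transfer (simp add: moderate_const)
  show "a - b = a + - b"
    by (simp add: minus_gen_def)
  show "a * b * c = a * (b * c)"
    by transfer (simp add: moderate_mult mult.assoc)
  show "a * b = b * a"
    by transfer (simp add: moderate_mult mult.commute)
  show "1 * a = a"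
    by transfer simp
  show "(a + b) * c = a * c + b * c"
    by transfer (simp add: moderate_mult moderate_add distrib_right)
  show "(0::'a gen) \<noteq> 1"
  proof transfer
    have "\<not> negligible_net (\<lambda>_. - 1 :: 'a)"
    proof
      assume "negligible_net (\<lambda>_. - 1 :: 'a)"
      then have "(\<lambda>_. 1 :: real) \<in> O[at_right 0](\<lambda>\<epsilon>::real. \<epsilon> ^ 1)"
        unfolding negligible_iff by (metis norm_minus_cancel norm_one)
      then obtain C where "C > 0" and C: "\<forall>\<^sub>F \<epsilon>::real in at_right 0. 1 \<le> C * \<bar>\<epsilon>\<bar>"
        by (auto elim!: landau_o.bigE)
      have "((\<lambda>\<epsilon>::real. C * \<bar>\<epsilon>\<bar>) \<longlongrightarrow> C * \<bar>0\<bar>) (at_right 0)"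
        by (intro tendsto_intros)
      then have "\<forall>\<^sub>F \<epsilon>::real in at_right 0. C * \<bar>\<epsilon>\<bar> < 1"
        by (rule order_tendstoD) simp
      with C have "\<forall>\<^sub>F \<epsilon>::real in at_right 0. False"
        by eventually_elim linarith
      then show False by (simp add: trivial_limit_at_right_real eventually_False)
    qed
    then show "\<not> gen_rel (\<lambda>_. 0 :: 'a) (\<lambda>_. 1)"
      by (simp add: gen_rel_iff)
  qed
qed

end


section \<open>Smooth functions and their seminorms\<close>

type_synonym 'n mindex = "'n \<Rightarrow> nat"

definition mdeg :: "'n::finite mindex \<Rightarrow> nat" where
  "mdeg \<alpha> = (\<Sum>i\<in>UNIV. \<alpha> i)"

definition partial_deriv :: "'n::finite \<Rightarrow> (real^'n \<Rightarrow> complex) \<Rightarrow> real^'n \<Rightarrow> complex" where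
  "partial_deriv i f x = frechet_derivative f (at x) (axis i 1)"

text \<open>
  The variables are differentiated in an arbitrary but fixed order, which is irrelevant for
  smooth functions.
\<close>

definition mpartial :: "'n::finite mindex \<Rightarrow> (real^'n \<Rightarrow> complex) \<Rightarrow> real^'n \<Rightarrow> complex" where
  "mpartial \<alpha> f = foldr (\<lambda>i. partial_deriv i ^^ \<alpha> i) (SOME xs. distinct xs \<and> set xs = UNIV) f"

definition mD :: "'n::finite mindex \<Rightarrow> (real^'n \<Rightarrow> complex) \<Rightarrow> real^'n \<Rightarrow> complex" where
  "mD \<alpha> f x = (- \<i>) ^ mdeg \<alpha> * mpartial \<alpha> f x"

fun C_on :: "nat \<Rightarrow> (real^'n::finite) set \<Rightarrow> (real^'n \<Rightarrow> complex) \<Rightarrow> bool" where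
  "C_on 0 S f \<longleftrightarrow> continuous_on S f"
| "C_on (Suc k) S f \<longleftrightarrow> f differentiable_on S \<and> (\<forall>i. C_on k S (partial_deriv i f))"

text \<open>
  Only used for open \<open>S\<close>; the values of \<open>f\<close> outside \<open>S\<close> are irrelevant.
\<close>

definition smooth_fns :: "(real^'n::finite) set \<Rightarrow> (real^'n \<Rightarrow> complex) set" where
  "smooth_fns S = {f. \<forall>k. C_on k S f}"

text \<open>The element \<open>0\<close> is inserted since \<open>Sup {}\<close> is unspecified for reals (case \<open>K = {}\<close>).\<close>

definition smooth_seminorm ::
    "(real^'n::finite) set \<times> nat \<Rightarrow> (real^'n \<Rightarrow> complex) \<Rightarrow> real" where
  "smooth_seminorm = (\<lambda>(K, j) f.
     Sup (insert 0 {cmod (mpartial \<alpha> f x) | x \<alpha>. x \<in> K \<and> mdeg \<alpha> \<le> j}))"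

definition seminorm_indices :: "(real^'n::finite) set \<Rightarrow> ((real^'n) set \<times> nat) set" where
  "seminorm_indices \<Omega> = {(K, j). compact K \<and> K \<subseteq> \<Omega>}"


section \<open>The Colombeau algebra of an open set\<close>

type_synonym 'n fnet = "real \<Rightarrow> real^'n \<Rightarrow> complex"

definition G_rel :: "(real^'n::finite) set \<Rightarrow> ('n fnet \<times> 'n fnet) set" where
  "G_rel \<Omega> = colombeau_rel (smooth_fns \<Omega>) (seminorm_indices \<Omega>) smooth_seminorm"

definition moderate_fnets :: "(real^'n::finite) set \<Rightarrow> 'n fnet set" where
  "moderate_fnets \<Omega> = moderate_nets (smooth_fns \<Omega>) (seminorm_indices \<Omega>) smooth_seminorm"

definition G :: "(real^'n::finite) set \<Rightarrow> 'n fnet set set" where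
  "G \<Omega> = moderate_fnets \<Omega> // G_rel \<Omega>"

definition G_class :: "(real^'n::finite) set \<Rightarrow> 'n fnet \<Rightarrow> 'n fnet set" where
  "G_class \<Omega> u = G_rel \<Omega> `` {u}"

definition G_rep :: "'n::finite fnet set \<Rightarrow> 'n fnet" where
  "G_rep U = (SOME u. u \<in> U)"

definition G_add :: "(real^'n::finite) set \<Rightarrow> 'n fnet set \<Rightarrow> 'n fnet set \<Rightarrow> 'n fnet set" where
  "G_add \<Omega> U V = G_class \<Omega> (\<lambda>\<epsilon> x. G_rep U \<epsilon> x + G_rep V \<epsilon> x)"

definition G_scale :: "(real^'n::finite) set \<Rightarrow> complex gen \<Rightarrow> 'n fnet set \<Rightarrow> 'n fnet set" where
  "G_scale \<Omega> a U = G_class \<Omega> (\<lambda>\<epsilon> x. rep_gen a \<epsilon> * G_rep U \<epsilon> x)"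

definition G_restrict :: "(real^'n::finite) set \<Rightarrow> 'n fnet set \<Rightarrow> 'n fnet set" where
  "G_restrict V U = G_class V (G_rep U)"

definition G_support :: "(real^'n::finite) set \<Rightarrow> 'n fnet set \<Rightarrow> (real^'n) set" where
  "G_support \<Omega> U =
     \<Omega> - \<Union>{V. open V \<and> V \<subseteq> \<Omega> \<and> G_restrict V U = G_class V (\<lambda>_ _. 0)}"

definition G_c :: "(real^'n::finite) set \<Rightarrow> 'n fnet set set" where
  "G_c \<Omega> = {U \<in> G \<Omega>. compact (G_support \<Omega> U)}"

text \<open>
  Extension by zero, i.e. the embedding of \<open>G_c \<Omega>\<close> into \<open>G UNIV\<close>; existence and uniqueness are
  consequences of the sheaf property.
\<close>

definition G_extend :: "(real^'n::finite) set \<Rightarrow> 'n fnet set \<Rightarrow> 'n fnet set" where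
  "G_extend \<Omega> U =
     (THE W. W \<in> G UNIV \<and> G_restrict \<Omega> W = U \<and> G_support UNIV W = G_support \<Omega> U)"


section \<open>Basic functionals\<close>

definition compact_distributions :: "((real^'n::finite \<Rightarrow> complex) \<Rightarrow> complex) set" where
  "compact_distributions =
     {T. (\<forall>f\<in>smooth_fns UNIV. \<forall>g\<in>smooth_fns UNIV. T (\<lambda>x. f x + g x) = T f + T g) \<and>
         (\<forall>f\<in>smooth_fns UNIV. \<forall>a. T (\<lambda>x. a * f x) = a * T f) \<and>
         (\<exists>K j c. compact K \<and> (\<forall>f\<in>smooth_fns UNIV. cmod (T f) \<le> c * smooth_seminorm (K, j) f))}"

definition basic_functionals :: "('n::finite fnet set \<Rightarrow> complex gen) set" where
  "basic_functionals =
     {T. (\<forall>U\<in>G UNIV. \<forall>V\<in>G UNIV. T (G_add UNIV U V) = T U + T V) \<and>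
         (\<forall>a. \<forall>U\<in>G UNIV. T (G_scale UNIV a U) = a * T U) \<and>
         (\<exists>t. (\<forall>\<epsilon>\<in>{0<..1}. t \<epsilon> \<in> compact_distributions) \<and>
              (\<exists>K j c (N::nat) \<eta>. compact K \<and> c > 0 \<and> \<eta> \<in> {0<..1} \<and>
                 (\<forall>f\<in>smooth_fns UNIV. \<forall>\<epsilon>\<in>{0<..\<eta>}.
                    cmod (t \<epsilon> f) \<le> c * (1 / \<epsilon> ^ N) * smooth_seminorm (K, j) f)) \<and>
              (\<forall>u\<in>moderate_fnets UNIV. T (G_class UNIV u) = abs_gen (\<lambda>\<epsilon>. t \<epsilon> (u \<epsilon>))))}"


section \<open>Operators with constant generalized coefficients\<close>

text \<open>
  \<open>\<Sum>\<^bsub>|\<alpha>|\<le>m\<^esub> c\<^sub>\<alpha> D\<^sup>\<alpha>\<close> with \<open>m = cc_order\<close> and \<open>c = cc_coeff\<close>; coefficients with \<open>|\<alpha>| > m\<close> are ignored.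
\<close>

record 'n cc_operator =
  cc_order :: nat
  cc_coeff :: "'n mindex \<Rightarrow> complex gen"

definition mpoly_fun :: "nat \<Rightarrow> ('n::finite mindex \<Rightarrow> complex) \<Rightarrow> real^'n \<Rightarrow> complex" where
  "mpoly_fun m a \<xi> = (\<Sum>\<alpha> | mdeg \<alpha> \<le> m. a \<alpha> * of_real (\<Prod>i\<in>UNIV. (\<xi> $ i) ^ \<alpha> i))"

definition cc_representatives :: "'n::finite cc_operator \<Rightarrow> (real \<Rightarrow> real^'n \<Rightarrow> complex) set" where
  "cc_representatives P =
     {Q. \<exists>a. (\<forall>\<alpha>. mdeg \<alpha> \<le> cc_order P \<longrightarrow>
                moderate (\<lambda>\<epsilon>. a \<epsilon> \<alpha>) \<and> abs_gen (\<lambda>\<epsilon>. a \<epsilon> \<alpha>) = cc_coeff P \<alpha>) \<and>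
             (\<forall>\<epsilon>\<in>{0<..1}. Q \<epsilon> = mpoly_fun (cc_order P) (a \<epsilon>))}"

text \<open>For a polynomial only finitely many summands are nonzero.\<close>

definition weight :: "(real^'n::finite \<Rightarrow> complex) \<Rightarrow> real^'n \<Rightarrow> real" where
  "weight Q \<xi> = sqrt (Sum_any (\<lambda>\<alpha>. (cmod (mpartial \<alpha> Q \<xi>))\<^sup>2))"

text \<open>The class does not depend on the representative of the polynomial.\<close>

definition gen_weight :: "'n::finite cc_operator \<Rightarrow> real^'n \<Rightarrow> real gen" where
  "gen_weight P \<xi> =
     abs_gen (\<lambda>\<epsilon>. weight (mpoly_fun (cc_order P) (\<lambda>\<alpha>. rep_gen (cc_coeff P \<alpha>) \<epsilon>)) \<xi>)"

definition stronger :: "'n::finite cc_operator \<Rightarrow> 'n cc_operator \<Rightarrow> bool" where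
  "stronger P Q \<longleftrightarrow>
     (\<exists>p\<in>cc_representatives P. \<exists>q\<in>cc_representatives Q. \<exists>\<Lambda>::real \<Rightarrow> real. moderate \<Lambda> \<and>
        (\<forall>\<xi>. \<forall>\<epsilon>\<in>{0<..1}. weight (q \<epsilon>) \<xi> \<le> \<Lambda> \<epsilon> * weight (p \<epsilon>) \<xi>))"


section \<open>Operators with variable coefficients\<close>

definition diffop ::
    "nat \<Rightarrow> ('n::finite mindex \<Rightarrow> real^'n \<Rightarrow> complex) \<Rightarrow> (real^'n \<Rightarrow> complex) \<Rightarrow> real^'n \<Rightarrow> complex" where
  "diffop m a f x = (\<Sum>\<alpha> | mdeg \<alpha> \<le> m. a \<alpha> x * mD \<alpha> f x)"

definition diffop_transpose ::
    "nat \<Rightarrow> ('n::finite mindex \<Rightarrow> real^'n \<Rightarrow> complex) \<Rightarrow> (real^'n \<Rightarrow> complex) \<Rightarrow> real^'n \<Rightarrow> complex" where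
  "diffop_transpose m a f x =
     (\<Sum>\<alpha> | mdeg \<alpha> \<le> m. (- 1) ^ mdeg \<alpha> * mD \<alpha> (\<lambda>y. a \<alpha> y * f y) x)"

text \<open>A net \<open>a\<close> represents the coefficients; the result does not depend on the choice of representatives.\<close>

definition G_op ::
    "(real^'n::finite) set \<Rightarrow> nat \<Rightarrow> (real \<Rightarrow> 'n mindex \<Rightarrow> real^'n \<Rightarrow> complex)
       \<Rightarrow> 'n fnet set \<Rightarrow> 'n fnet set" where
  "G_op \<Omega> m a U = G_class \<Omega> (\<lambda>\<epsilon>. diffop m (a \<epsilon>) (G_rep U \<epsilon>))"

definition G_op_transpose ::
    "(real^'n::finite) set \<Rightarrow> nat \<Rightarrow> (real \<Rightarrow> 'n mindex \<Rightarrow> real^'n \<Rightarrow> complex)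
       \<Rightarrow> 'n fnet set \<Rightarrow> 'n fnet set" where
  "G_op_transpose \<Omega> m a U = G_class \<Omega> (\<lambda>\<epsilon>. diffop_transpose m (a \<epsilon>) (G_rep U \<epsilon>))"

definition cc_net :: "'n::finite cc_operator \<Rightarrow> real \<Rightarrow> 'n mindex \<Rightarrow> complex" where
  "cc_net P \<epsilon> \<alpha> = (if mdeg \<alpha> \<le> cc_order P then rep_gen (cc_coeff P \<alpha>) \<epsilon> else 0)"

text \<open>Order and coefficients of \<open>P(x,D) = P\<^sub>0(D) + \<Sum>\<^bsub>1\<le>j\<le>r\<^esub> c\<^sub>j(x) P\<^sub>j(D)\<close>.\<close>

definition P_order :: "nat \<Rightarrow> (nat \<Rightarrow> 'n::finite cc_operator) \<Rightarrow> nat" where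
  "P_order r P = Max ((\<lambda>j. cc_order (P j)) ` {0..r})"

definition P_coeff ::
    "nat \<Rightarrow> (nat \<Rightarrow> real^'n::finite \<Rightarrow> complex) \<Rightarrow> (nat \<Rightarrow> 'n cc_operator)
       \<Rightarrow> real \<Rightarrow> 'n mindex \<Rightarrow> real^'n \<Rightarrow> complex" where
  "P_coeff r c P \<epsilon> \<alpha> x = cc_net (P 0) \<epsilon> \<alpha> + (\<Sum>j=1..r. c j x * cc_net (P j) \<epsilon> \<alpha>)"

text \<open>
  \<open>P(x,D)T = F\<close> on an open set \<open>S\<close>: the restrictions to \<open>G_c S\<close> of both sides coincide, where
  \<open>P(x,D)\<close> acts on \<open>T\<close> by transposition.
\<close>

definition solves_functional ::
    "(real^'n::finite) set \<Rightarrow> nat \<Rightarrow> (real \<Rightarrow> 'n mindex \<Rightarrow> real^'n \<Rightarrow> complex)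
       \<Rightarrow> ('n fnet set \<Rightarrow> complex gen) \<Rightarrow> ('n fnet set \<Rightarrow> complex gen) \<Rightarrow> bool" where
  "solves_functional S m a T F \<longleftrightarrow>
     (\<forall>U\<in>G_c S. T (G_extend S (G_op_transpose S m a U)) = F (G_extend S U))"

definition solves_function ::
    "(real^'n::finite) set \<Rightarrow> nat \<Rightarrow> (real \<Rightarrow> 'n mindex \<Rightarrow> real^'n \<Rightarrow> complex)
       \<Rightarrow> 'n fnet set \<Rightarrow> 'n fnet set \<Rightarrow> bool" where
  "solves_function S m a u v \<longleftrightarrow> G_op S m a (G_restrict S u) = G_restrict S v"

end

theory Submission
  imports Defs "HOL-Library.FuncSet" "HOL-Computational_Algebra.Polynomial"
begin

text \<open>
  No Hahn-Banach argument is used: for each \<open>\<epsilon>\<close> a local right inverse and a local left inverse of the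
  transpose are written down, with bounds that are powers of \<open>1/\<epsilon>\<close>. Near \<open>x\<^sub>0\<close> functions are expanded
  in exponentials with frequencies in the lattice \<open>k/\<rho>\<close>. Each frequency is shifted by a bounded amount to a
  point \<open>\<xi>\<^sub>k\<close> where \<open>P\<^sub>0(\<xi>\<^sub>k)\<close> is comparable with the weight of \<open>P\<^sub>0\<close> (Lagrange interpolation on the
  shifts); by (h4) the quotients \<open>P\<^sub>j(\<xi>\<^sub>k)/P\<^sub>0(\<xi>\<^sub>k)\<close> are then bounded uniformly in \<open>k\<close> and \<open>\<epsilon>\<close>, and by (h2)
  \<open>1/P\<^sub>0(\<xi>\<^sub>k)\<close> grows at most like a power of \<open>1/\<epsilon>\<close> times a power of \<open>|k|\<close>. Applying \<open>P(x,D)\<close> to the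
  exponential with frequency \<open>\<xi>\<^sub>k\<close>, divided by \<open>P\<^sub>0(\<xi>\<^sub>k)\<close>, gives the exponential with frequency \<open>k/\<rho>\<close> up to
  a relative error that is small for small \<open>\<rho>\<close> because \<open>c\<^sub>j(x\<^sub>0) = 0\<close>. On Fourier coefficients the error
  is a matrix with rapid off-diagonal decay and norm at most \<open>1/2\<close>, and a Neumann series removes it.
  The radius \<open>\<rho>\<close> depends on neither \<open>\<epsilon>\<close> nor the data. The representatives in (h4) differ from the chosen ones by
  negligible nets, which does not affect the generalized equations.
\<close>

text \<open>The symbol may be small or zero at lattice points and its coefficients vary with
  \<epsilon>, so the frequencies must be moved by amounts, and with constants, that do not depend on
  the coefficients. A polynomial of degree at most m is recovered from its values on a fixed finite
  grid; the best grid point therefore controls all derivatives of the symbol, with constants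
  depending only on m and the dimension. The shifts stay bounded while the lattice has mesh
  1/\<rho>: on a ball of radius 2\<rho> the exponential of a shift is as close to 1 as wished, so
  the shift joins the same small error as the coefficients c_j. The bound for the quotients does not
  involve \<rho>, so \<rho> can be chosen after it. Regularity enters through lattice weights whose
  growth is slowed down until they do not spoil the norm 1/2. A right inverse of the operator solves
  the equation for functions. For functionals, F composed with a left inverse of the transpose is a
  solution, because the equation is tested on transposes applied to functions supported near the
  centre.\<close>

section \<open>Functions of class C^k on open sets\<close>

lemma partial_deriv_at: "(f has_derivative f') (at x) \<Longrightarrow> partial_deriv i f x = f' (axis i 1)"
  by (simp add: partial_deriv_def frechet_derivative_at[symmetric])

lemma differentiable_at_open:
  "f differentiable_on S \<Longrightarrow> open S \<Longrightarrow> x \<in> S \<Longrightarrow> f differentiable (at x)"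
  by (metis at_within_open differentiable_on_def)

lemma differentiable_cong_open:
  assumes "open S" "x \<in> S" "\<And>y. y \<in> S \<Longrightarrow> f y = g y"
  shows "f differentiable (at x) \<longleftrightarrow> g differentiable (at x)"
  unfolding differentiable_def
  using has_derivative_transform_within_open[OF _ assms(1,2), of f _ UNIV g]
    has_derivative_transform_within_open[OF _ assms(1,2), of g _ UNIV f] assms(3)
  by (metis)

lemma partial_deriv_cong_open:
  assumes "open S" "x \<in> S" "\<And>y. y \<in> S \<Longrightarrow> f y = g y"
  shows "partial_deriv i f x = partial_deriv i g x"
proof -
  have "(f has_derivative f') (at x) \<longleftrightarrow> (g has_derivative f') (at x)" for f'
    using has_derivative_transform_within_open[OF _ assms(1,2), of f _ UNIV g]
      has_derivative_transform_within_open[OF _ assms(1,2), of g _ UNIV f] assms(3)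
    by metis
  then show ?thesis by (simp add: partial_deriv_def frechet_derivative_def)
qed

lemma C_on_cong:
  assumes "open S" "\<And>y. y \<in> S \<Longrightarrow> f y = g y" "C_on k S f"
  shows "C_on k S g"
  using assms(2,3)
proof (induction k arbitrary: f g)
  case 0
  then show ?case using continuous_on_cong by fastforce
next
  case (Suc k)
  have "g differentiable_on S"
    unfolding differentiable_on_def
  proof
    fix x assume x: "x \<in> S"
    then have "f differentiable (at x)"
      using Suc.prems assms(1) differentiable_at_open by auto
    then have "g differentiable (at x)"
      using differentiable_cong_open[OF assms(1) x, of f g] Suc.prems by auto
    then show "g differentiable (at x within S)"
      by (rule differentiable_at_withinI)
  qed
  moreover have "C_on k S (partial_deriv i g)" for i
    using Suc.IH[of "partial_deriv i f" "partial_deriv i g"] Suc.prems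
      partial_deriv_cong_open[OF assms(1), of _ f g] by auto
  ultimately show ?case by simp
qed

lemma C_on_SucD: "C_on (Suc k) S f \<Longrightarrow> C_on k S f"
  by (induction k arbitrary: f) (auto intro: differentiable_imp_continuous_on)

lemma C_on_subset: "C_on k S f \<Longrightarrow> T \<subseteq> S \<Longrightarrow> C_on k T f"
  by (induction k arbitrary: f) (auto intro: continuous_on_subset differentiable_on_subset)

lemma C_on_local:
  assumes "\<And>x. x \<in> S \<Longrightarrow> \<exists>T. open T \<and> x \<in> T \<and> C_on k T f"
  shows "C_on k S f"
  using assms
proof (induction k arbitrary: f)
  case 0
  show ?case
    unfolding C_on.simps
  proof (rule continuous_at_imp_continuous_on, rule ballI)
    fix x assume "x \<in> S"
    from 0[OF this] obtain T where "open T" "x \<in> T" "continuous_on T f" by auto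
    then show "isCont f x" by (simp add: continuous_on_eq_continuous_at)
  qed
next
  case (Suc k)
  have "f differentiable_on S"
    unfolding differentiable_on_def
  proof
    fix x assume "x \<in> S"
    from Suc.prems[OF this] obtain T where "open T" "x \<in> T" "f differentiable_on T"
      by auto
    then show "f differentiable (at x within S)"
      by (rule differentiable_at_withinI[OF differentiable_at_open[rotated 1]])
  qed
  moreover have "C_on k S (partial_deriv i f)" for i
  proof (rule Suc.IH)
    fix x assume "x \<in> S"
    from Suc.prems[OF this] show "\<exists>T. open T \<and> x \<in> T \<and> C_on k T (partial_deriv i f)"
      by (simp only: C_on.simps) blast
  qed
  ultimately show ?case by simp
qed

lemma partial_deriv_const: "partial_deriv i (\<lambda>_. a) x = 0"
  by (subst partial_deriv_at[of _ "\<lambda>_. 0"]) auto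

lemma partial_deriv_add:
  assumes "f differentiable (at x)" "g differentiable (at x)"
  shows "partial_deriv i (\<lambda>y. f y + g y) x = partial_deriv i f x + partial_deriv i g x"
proof -
  obtain f' g' where *: "(f has_derivative f') (at x)" "(g has_derivative g') (at x)"
    using assms unfolding differentiable_def by blast
  show ?thesis
    by (simp add: partial_deriv_at[OF has_derivative_add[OF *]] partial_deriv_at[OF *(1)]
        partial_deriv_at[OF *(2)])
qed

lemma partial_deriv_mult:
  assumes "f differentiable (at x)" "g differentiable (at x)"
  shows "partial_deriv i (\<lambda>y. f y * g y) x = f x * partial_deriv i g x + partial_deriv i f x * g x"
proof -
  obtain f' g' where *: "(f has_derivative f') (at x)" "(g has_derivative g') (at x)"
    using assms unfolding differentiable_def by blast
  show ?thesis
    by (simp add: partial_deriv_at[OF has_derivative_mult[OF *]] partial_deriv_at[OF *(1)]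
        partial_deriv_at[OF *(2)])
qed

lemma partial_deriv_cmult:
  assumes "f differentiable (at x)"
  shows "partial_deriv i (\<lambda>y. a * f y) x = a * partial_deriv i f x"
  by (simp add: partial_deriv_mult assms partial_deriv_const)

lemma C_on_add:
  assumes "open S" "C_on k S f" "C_on k S g"
  shows "C_on k S (\<lambda>x. f x + g x)"
  using assms(2,3)
proof (induction k arbitrary: f g)
  case 0
  then show ?case by (auto intro: continuous_intros)
next
  case (Suc k)
  have "C_on k S (partial_deriv i (\<lambda>x. f x + g x))" for i
    by (rule C_on_cong[OF assms(1), of "\<lambda>x. partial_deriv i f x + partial_deriv i g x"])
       (use Suc in \<open>auto simp: partial_deriv_add differentiable_at_open[OF _ assms(1)]\<close>)
  with Suc show ?case by (auto intro: differentiable_on_add)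
qed

lemma C_on_mult:
  assumes "open S" "C_on k S f" "C_on k S g"
  shows "C_on k S (\<lambda>x. f x * g x)"
  using assms(2,3)
proof (induction k arbitrary: f g)
  case 0
  then show ?case by (auto intro: continuous_intros)
next
  case (Suc k)
  have "C_on k S (partial_deriv i (\<lambda>x. f x * g x))" for i
    by (rule C_on_cong[OF assms(1),
          of "\<lambda>x. f x * partial_deriv i g x + partial_deriv i f x * g x"])
       (use Suc C_on_SucD[OF Suc.prems(1)] C_on_SucD[OF Suc.prems(2)] in
         \<open>auto simp: partial_deriv_mult differentiable_at_open[OF _ assms(1)]
           intro!: C_on_add[OF assms(1)]\<close>)
  with Suc show ?case by (auto intro: differentiable_on_mult)
qed

lemma C_on_const:
  fixes S :: "(real^'n::finite) set"
  shows "C_on k S (\<lambda>_. a)"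
proof (induction k arbitrary: a)
  case (Suc k)
  have "partial_deriv i (\<lambda>_::real^'n. a) = (\<lambda>_. 0)" for i
    by (rule ext) (rule partial_deriv_const)
  then show ?case using Suc by simp
qed simp

subsection \<open>Smooth functions\<close>

lemma smooth_fns_C_on: "f \<in> smooth_fns S \<Longrightarrow> C_on k S f"
  by (simp add: smooth_fns_def)

lemma smooth_differentiable_on: "f \<in> smooth_fns S \<Longrightarrow> f differentiable_on S"
  using smooth_fns_C_on[of f S "Suc 0"] by simp

lemma smooth_differentiable: "f \<in> smooth_fns S \<Longrightarrow> open S \<Longrightarrow> x \<in> S \<Longrightarrow> f differentiable (at x)"
  by (intro differentiable_at_open smooth_differentiable_on)

lemma smooth_continuous_on: "f \<in> smooth_fns S \<Longrightarrow> continuous_on S f"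
  using smooth_fns_C_on[of f S 0] by simp

lemma smooth_partial: "f \<in> smooth_fns S \<Longrightarrow> partial_deriv i f \<in> smooth_fns S"
  unfolding smooth_fns_def using C_on.simps(2) by blast

lemma smooth_cong:
  "open S \<Longrightarrow> (\<And>y. y \<in> S \<Longrightarrow> f y = g y) \<Longrightarrow> f \<in> smooth_fns S \<Longrightarrow> g \<in> smooth_fns S"
  unfolding smooth_fns_def using C_on_cong by blast

lemma smooth_subset: "f \<in> smooth_fns S \<Longrightarrow> T \<subseteq> S \<Longrightarrow> f \<in> smooth_fns T"
  unfolding smooth_fns_def using C_on_subset by blast

lemma smooth_local:
  assumes "\<And>x. x \<in> S \<Longrightarrow> \<exists>T. open T \<and> x \<in> T \<and> f \<in> smooth_fns T"
  shows "f \<in> smooth_fns S"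
  unfolding smooth_fns_def
proof (intro CollectI allI C_on_local)
  fix k x assume "x \<in> S"
  then obtain T where "open T" "x \<in> T" "f \<in> smooth_fns T" using assms by blast
  then show "\<exists>T. open T \<and> x \<in> T \<and> C_on k T f" using smooth_fns_C_on by blast
qed

lemma smooth_add:
  "open S \<Longrightarrow> f \<in> smooth_fns S \<Longrightarrow> g \<in> smooth_fns S \<Longrightarrow> (\<lambda>x. f x + g x) \<in> smooth_fns S"
  unfolding smooth_fns_def using C_on_add by blast

lemma smooth_mult:
  "open S \<Longrightarrow> f \<in> smooth_fns S \<Longrightarrow> g \<in> smooth_fns S \<Longrightarrow> (\<lambda>x. f x * g x) \<in> smooth_fns S"
  unfolding smooth_fns_def using C_on_mult by blast

lemma smooth_const: "(\<lambda>_. a) \<in> smooth_fns S"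
  unfolding smooth_fns_def using C_on_const by blast

lemma smooth_cmult: "open S \<Longrightarrow> f \<in> smooth_fns S \<Longrightarrow> (\<lambda>x. a * f x) \<in> smooth_fns S"
  by (intro smooth_mult smooth_const)

lemma smooth_minus: "open S \<Longrightarrow> f \<in> smooth_fns S \<Longrightarrow> g \<in> smooth_fns S \<Longrightarrow> (\<lambda>x. f x - g x) \<in> smooth_fns S"
  using smooth_add[of S f "\<lambda>x. (-1) * g x"] smooth_cmult[of S g "-1"] by simp

lemma smooth_sum:
  "open S \<Longrightarrow> (\<And>j. j \<in> J \<Longrightarrow> f j \<in> smooth_fns S) \<Longrightarrow> (\<lambda>x. \<Sum>j\<in>J. f j x) \<in> smooth_fns S"
  by (induction J rule: infinite_finite_induct) (auto intro: smooth_const smooth_add)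

lemma smooth_prod:
  "open S \<Longrightarrow> (\<And>j. j \<in> J \<Longrightarrow> f j \<in> smooth_fns S) \<Longrightarrow> (\<lambda>x. \<Prod>j\<in>J. f j x) \<in> smooth_fns S"
  by (induction J rule: infinite_finite_induct) (auto intro: smooth_const smooth_mult)

lemma smoothI_partial:
  assumes "f differentiable_on S" "\<And>i. partial_deriv i f \<in> smooth_fns S"
  shows "f \<in> smooth_fns S"
  unfolding smooth_fns_def
proof (intro CollectI allI)
  fix k show "C_on k S f"
    using assms by (cases k) (auto simp: smooth_fns_C_on intro: differentiable_imp_continuous_on)
qed

lemma partial_deriv_coord:
  fixes j :: "'n::finite"
  shows "partial_deriv i (\<lambda>x. of_real (x $ j)) x = (if i = j then 1 else 0)"
proof -
  have "((\<lambda>x::real^'n. of_real (x $ j) :: complex) has_derivative (\<lambda>h. of_real (h $ j))) (at x)"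
    by (auto intro!: derivative_eq_intros has_derivative_of_real bounded_linear.has_derivative[OF bounded_linear_vec_nth] )
  from partial_deriv_at[OF this] show ?thesis by (simp add: axis_def)
qed

lemma smooth_coord:
  fixes j :: "'n::finite"
  shows "(\<lambda>x. of_real (x $ j)) \<in> smooth_fns S"
proof (rule smoothI_partial)
  have "((\<lambda>x::real^'n. of_real (x $ j) :: complex) has_derivative (\<lambda>h. of_real (h $ j))) (at x)" for x
    by (auto intro!: derivative_eq_intros has_derivative_of_real bounded_linear.has_derivative[OF bounded_linear_vec_nth])
  then show "(\<lambda>x. of_real (x $ j) :: complex) differentiable_on S"
    by (meson differentiable_on_def differentiable_def has_derivative_at_withinI)
  fix i
  have "partial_deriv i (\<lambda>x. of_real (x $ j)) = (\<lambda>_. if i = j then 1 else 0)"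
    by (rule ext) (rule partial_deriv_coord)
  then show "partial_deriv i (\<lambda>x. of_real (x $ j)) \<in> smooth_fns S"
    by (simp add: smooth_const)
qed

text \<open>The derivative of the reciprocal consists of a derivative of \<open>f\<close> and two
  copies of the reciprocal, so order \<open>Suc k\<close> reduces to order \<open>k\<close> of the
  reciprocal itself.\<close>

lemma smooth_inverse:
  assumes "open S" "f \<in> smooth_fns S" "\<And>x. x \<in> S \<Longrightarrow> f x \<noteq> 0"
  shows "(\<lambda>x. inverse (f x)) \<in> smooth_fns S"
proof -
  have der: "((\<lambda>y. inverse (f y)) has_derivative (\<lambda>h. - (inverse (f x) * f' h * inverse (f x)))) (at x)"
    if "x \<in> S" "(f has_derivative f') (at x)" for x f'
    using that assms(3) by (auto intro!: derivative_eq_intros)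
  have dif: "(\<lambda>x. inverse (f x)) differentiable_on S"
    unfolding differentiable_on_def
  proof
    fix x assume "x \<in> S"
    then obtain f' where "(f has_derivative f') (at x)"
      using smooth_differentiable[OF assms(2,1)] unfolding differentiable_def by blast
    from der[OF \<open>x \<in> S\<close> this] show "(\<lambda>x. inverse (f x)) differentiable (at x within S)"
      unfolding differentiable_def using has_derivative_at_withinI by blast
  qed
  have pd: "partial_deriv i (\<lambda>y. inverse (f y)) x
     = (- 1) * (partial_deriv i f x * (inverse (f x) * inverse (f x)))" if x: "x \<in> S" for i x
  proof -
    obtain f' where f': "(f has_derivative f') (at x)"
      using smooth_differentiable[OF assms(2,1) x] unfolding differentiable_def by blast
    show ?thesis by (simp add: partial_deriv_at[OF der[OF x f']] partial_deriv_at[OF f'])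
  qed
  have "C_on k S (\<lambda>x. inverse (f x))" for k
  proof (induction k)
    case 0
    show ?case using dif by (auto intro: differentiable_imp_continuous_on)
  next
    case (Suc k)
    have "C_on k S (partial_deriv i (\<lambda>x. inverse (f x)))" for i
    proof (rule C_on_cong[OF assms(1) pd[symmetric]])
      show "C_on k S (\<lambda>x. (- 1) * (partial_deriv i f x * (inverse (f x) * inverse (f x))))"
        by (intro C_on_mult assms(1) C_on_const Suc smooth_fns_C_on smooth_partial assms(2))
    qed simp
    then show ?case using dif by simp
  qed
  then show ?thesis by (simp add: smooth_fns_def)
qed

lemma partial_deriv_scale:
  fixes f :: "real^'n \<Rightarrow> complex"
  assumes "f differentiable (at (a *\<^sub>R x + b))"
  shows "partial_deriv i (\<lambda>y. f (a *\<^sub>R y + b)) x = of_real a * partial_deriv i f (a *\<^sub>R x + b)"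
    and "(\<lambda>y. f (a *\<^sub>R y + b)) differentiable (at x)"
proof -
  obtain f' where f': "(f has_derivative f') (at (a *\<^sub>R x + b))"
    using assms unfolding differentiable_def by blast
  have d: "((\<lambda>y. a *\<^sub>R y + b) has_derivative (\<lambda>h. a *\<^sub>R h)) (at x)"
    by (auto intro!: derivative_eq_intros)
  have *: "((\<lambda>y. f (a *\<^sub>R y + b)) has_derivative (\<lambda>h. f' (a *\<^sub>R h))) (at x)"
    using has_derivative_compose[OF d] f' by blast
  then show "(\<lambda>y. f (a *\<^sub>R y + b)) differentiable (at x)"
    unfolding differentiable_def by blast
  show "partial_deriv i (\<lambda>y. f (a *\<^sub>R y + b)) x = of_real a * partial_deriv i f (a *\<^sub>R x + b)"
    unfolding partial_deriv_at[OF *] partial_deriv_at[OF f']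
    by (simp only: linear_scale[OF has_derivative_linear[OF f']]) (simp add: scaleR_conv_of_real)
qed

lemma smooth_scale:
  assumes "f \<in> smooth_fns UNIV"
  shows "(\<lambda>y. f (a *\<^sub>R y + b)) \<in> smooth_fns UNIV"
proof -
  have "C_on k UNIV (\<lambda>y. f (a *\<^sub>R y + b))" if "f \<in> smooth_fns UNIV" for k f
    using that
  proof (induction k arbitrary: f)
    case 0
    have "continuous_on UNIV f" using 0 smooth_continuous_on by blast
    then show ?case
      by (auto intro!: continuous_on_compose2[of UNIV f] continuous_intros)
  next
    case (Suc k)
    have fd: "f differentiable (at x)" for x
      using smooth_differentiable[OF Suc.prems] by simp
    have eq: "partial_deriv i (\<lambda>y. f (a *\<^sub>R y + b)) = (\<lambda>x. of_real a * partial_deriv i f (a *\<^sub>R x + b))" for i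
      using partial_deriv_scale(1)[OF fd] by blast
    have "C_on k UNIV (\<lambda>x. of_real a * partial_deriv i f (a *\<^sub>R x + b))" for i
      by (intro C_on_mult C_on_const Suc.IH smooth_partial Suc.prems open_UNIV)
    then show ?case
      using partial_deriv_scale(2)[OF fd] by (simp add: eq differentiable_on_def)
  qed
  then show ?thesis using assms by (simp add: smooth_fns_def)
qed

subsection \<open>Jet norms\<close>

text \<open>Weighted so that the Leibniz rule makes \<open>jet k r\<close> submultiplicative with constant \<open>1\<close>.\<close>

fun jet :: "nat \<Rightarrow> real \<Rightarrow> (real^'n::finite \<Rightarrow> complex) \<Rightarrow> real^'n \<Rightarrow> real" where
  "jet 0 r f x = cmod (f x)"
| "jet (Suc k) r f x = jet k r f x + r * (\<Sum>i\<in>UNIV. jet k r (partial_deriv i f) x)"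

lemma jet_nonneg: "r \<ge> 0 \<Longrightarrow> jet k r f x \<ge> 0"
  by (induction k arbitrary: f) (auto intro!: add_nonneg_nonneg mult_nonneg_nonneg sum_nonneg)

lemma jet_le_Suc: "r \<ge> 0 \<Longrightarrow> jet k r f x \<le> jet (Suc k) r f x"
  by (auto intro!: mult_nonneg_nonneg sum_nonneg jet_nonneg)

lemma jet_mono: "r \<ge> 0 \<Longrightarrow> k \<le> l \<Longrightarrow> jet k r f x \<le> jet l r f x"
  by (rule lift_Suc_mono_le[of "\<lambda>k. jet k r f x"]) (rule jet_le_Suc)

lemma jet_cong_open:
  assumes "open S" "x \<in> S" "\<And>y. y \<in> S \<Longrightarrow> f y = g y"
  shows "jet k r f x = jet k r g x"
  using assms(3)
proof (induction k arbitrary: f g)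
  case 0
  show ?case using 0[OF assms(2)] by simp
next
  case (Suc k)
  have "jet k r (partial_deriv i f) x = jet k r (partial_deriv i g) x" for i
    by (rule Suc.IH) (rule partial_deriv_cong_open[OF assms(1) _ Suc.prems])
  then show ?case using Suc.IH[of f g, OF Suc.prems] by simp
qed

lemma jet_zero:
  fixes x :: "real^'n::finite"
  shows "jet k r (\<lambda>_. 0) x = 0"
proof (induction k)
  case (Suc k)
  have "partial_deriv i (\<lambda>_::real^'n. 0) = (\<lambda>_. 0)" for i
    by (rule ext) (rule partial_deriv_const)
  with Suc show ?case by simp
qed simp

lemma jet_const:
  fixes x :: "real^'n::finite"
  shows "jet k r (\<lambda>_. a) x = cmod a"
proof (induction k)
  case (Suc k)
  have "partial_deriv i (\<lambda>_::real^'n. a) = (\<lambda>_. 0)" for i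
    by (rule ext) (rule partial_deriv_const)
  with Suc show ?case by (simp add: jet_zero)
qed simp

lemma jet_add:
  assumes S: "open S" "x \<in> S" and "f \<in> smooth_fns S" "g \<in> smooth_fns S" and r: "r \<ge> 0"
  shows "jet k r (\<lambda>y. f y + g y) x \<le> jet k r f x + jet k r g x"
  using assms(3,4)
proof (induction k arbitrary: f g)
  case 0
  then show ?case by (simp add: norm_triangle_ineq)
next
  case (Suc k)
  have "jet k r (partial_deriv i (\<lambda>y. f y + g y)) x \<le> jet k r (partial_deriv i f) x + jet k r (partial_deriv i g) x" for i
  proof -
    have "jet k r (partial_deriv i (\<lambda>y. f y + g y)) x = jet k r (\<lambda>y. partial_deriv i f y + partial_deriv i g y) x"
      by (rule jet_cong_open[OF S]) (intro partial_deriv_add smooth_differentiable[OF _ S(1)] Suc.prems)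
    also have "\<dots> \<le> jet k r (partial_deriv i f) x + jet k r (partial_deriv i g) x"
      by (intro Suc.IH smooth_partial Suc.prems)
    finally show ?thesis .
  qed
  then have "r * (\<Sum>i\<in>UNIV. jet k r (partial_deriv i (\<lambda>y. f y + g y)) x)
    \<le> r * (\<Sum>i\<in>UNIV. jet k r (partial_deriv i f) x + jet k r (partial_deriv i g) x)"
    by (intro mult_left_mono sum_mono r)
  with Suc.IH[OF Suc.prems] show ?case by (simp add: sum.distrib algebra_simps)
qed

lemma jet_mult:
  assumes S: "open S" "x \<in> S" and "f \<in> smooth_fns S" "g \<in> smooth_fns S" and r: "r \<ge> 0"
  shows "jet k r (\<lambda>y. f y * g y) x \<le> jet k r f x * jet k r g x"
  using assms(3,4)
proof (induction k arbitrary: f g)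
  case 0
  then show ?case by (simp add: norm_mult)
next
  case (Suc k)
  let ?a = "jet k r f x" and ?b = "jet k r g x"
  let ?A = "\<Sum>i\<in>UNIV. jet k r (partial_deriv i f) x" and ?B = "\<Sum>i\<in>UNIV. jet k r (partial_deriv i g) x"
  have "jet k r (partial_deriv i (\<lambda>y. f y * g y)) x \<le> ?a * jet k r (partial_deriv i g) x + jet k r (partial_deriv i f) x * ?b" for i
  proof -
    have "jet k r (partial_deriv i (\<lambda>y. f y * g y)) x = jet k r (\<lambda>y. f y * partial_deriv i g y + partial_deriv i f y * g y) x"
      by (rule jet_cong_open[OF S]) (intro partial_deriv_mult smooth_differentiable[OF _ S(1)] Suc.prems)
    also have "\<dots> \<le> jet k r (\<lambda>y. f y * partial_deriv i g y) x + jet k r (\<lambda>y. partial_deriv i f y * g y) x"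
      by (intro jet_add[OF S] smooth_mult S smooth_partial Suc.prems r)
    also have "\<dots> \<le> ?a * jet k r (partial_deriv i g) x + jet k r (partial_deriv i f) x * ?b"
      by (intro add_mono Suc.IH Suc.prems smooth_partial)
    finally show ?thesis .
  qed
  then have "r * (\<Sum>i\<in>UNIV. jet k r (partial_deriv i (\<lambda>y. f y * g y)) x)
    \<le> r * (\<Sum>i\<in>UNIV. ?a * jet k r (partial_deriv i g) x + jet k r (partial_deriv i f) x * ?b)"
    by (intro mult_left_mono sum_mono r)
  also have "\<dots> = r * (?a * ?B + ?A * ?b)"
    by (simp add: sum.distrib sum_distrib_left sum_distrib_right)
  finally have "jet (Suc k) r (\<lambda>y. f y * g y) x \<le> ?a * ?b + r * (?a * ?B + ?A * ?b)"
    using Suc.IH[OF Suc.prems] by simp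
  \<comment> \<open>Adding the nonnegative term with \<open>r * r\<close> completes the expansion of
    the product of the two jets of order \<open>Suc k\<close>.\<close>
  also have "\<dots> \<le> ?a * ?b + r * (?a * ?B + ?A * ?b) + r * r * ?A * ?B"
    by (simp add: r jet_nonneg sum_nonneg)
  also have "\<dots> = jet (Suc k) r f x * jet (Suc k) r g x" by (simp add: algebra_simps)
  finally show ?case .
qed

lemma jet_cmult:
  assumes S: "open S" "x \<in> S" and "f \<in> smooth_fns S"
  shows "jet k r (\<lambda>y. a * f y) x = cmod a * jet k r f x"
  using assms(3)
proof (induction k arbitrary: f)
  case (Suc k)
  have "jet k r (partial_deriv i (\<lambda>y. a * f y)) x = jet k r (\<lambda>y. a * partial_deriv i f y) x" for i
    by (rule jet_cong_open[OF S]) (intro partial_deriv_cmult smooth_differentiable[OF _ S(1)] Suc.prems)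
  moreover have "jet k r (\<lambda>y. a * partial_deriv i f y) x = cmod a * jet k r (partial_deriv i f) x" for i
    by (intro Suc.IH smooth_partial Suc.prems)
  ultimately show ?case
    using Suc.IH[OF Suc.prems] by (simp add: sum_distrib_left algebra_simps)
qed (simp add: norm_mult)

lemma jet_sum:
  assumes S: "open S" "x \<in> S" and "\<And>j. j \<in> J \<Longrightarrow> f j \<in> smooth_fns S" and r: "r \<ge> 0"
  shows "jet k r (\<lambda>y. \<Sum>j\<in>J. f j y) x \<le> (\<Sum>j\<in>J. jet k r (f j) x)"
  using assms(3)
proof (induction J rule: infinite_finite_induct)
  case (insert j J)
  have "jet k r (\<lambda>y. f j y + (\<Sum>j\<in>J. f j y)) x \<le> jet k r (f j) x + jet k r (\<lambda>y. \<Sum>j\<in>J. f j y) x"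
    by (intro jet_add[OF S] smooth_sum S insert.prems r) auto
  with insert show ?case by force
qed (auto simp: jet_zero)

lemma jet_continuous_on: "f \<in> smooth_fns S \<Longrightarrow> continuous_on S (jet k r f)"
proof (induction k arbitrary: f)
  case 0
  then show ?case using smooth_continuous_on by (auto intro!: continuous_intros)
next
  case (Suc k)
  have "continuous_on S (\<lambda>x. jet k r f x + r * (\<Sum>i\<in>UNIV. jet k r (partial_deriv i f) x))"
    by (intro continuous_intros Suc.IH Suc.prems smooth_partial)
  moreover have "jet (Suc k) r f = (\<lambda>x. jet k r f x + r * (\<Sum>i\<in>UNIV. jet k r (partial_deriv i f) x))"
    by (rule ext) simp
  ultimately show ?case by simp
qed

lemma jet_bounded:
  assumes "f \<in> smooth_fns S" "compact K" "K \<subseteq> S"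
  obtains M where "M \<ge> 0" "\<And>x. x \<in> K \<Longrightarrow> jet k r f x \<le> M"
proof -
  have "bounded (jet k r f ` K)"
    using assms by (intro compact_imp_bounded compact_continuous_image
        continuous_on_subset[OF jet_continuous_on])
  then obtain M where "M > 0" "\<forall>x\<in>K. norm (jet k r f x) \<le> M" 
    using bounded_pos by (metis image_eqI)
  then show ?thesis using that[of M] by force
qed

lemma jet_mono_r:
  assumes "0 \<le> r" "r \<le> r'"
  shows "jet k r f x \<le> jet k r' f x"
proof (induction k arbitrary: f)
  case (Suc k)
  have "r * (\<Sum>i\<in>UNIV. jet k r (partial_deriv i f) x) \<le> r' * (\<Sum>i\<in>UNIV. jet k r' (partial_deriv i f) x)"
    using assms Suc by (intro mult_mono sum_mono) (auto intro: sum_nonneg jet_nonneg)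
  then show ?case using Suc[of f] by simp
qed simp

text \<open>A dilation by \<open>a\<close> turns the weight \<open>r\<close> into
  \<open>a * r\<close>. With \<open>a\<close> equal to 1/\<rho> and weight \<rho>, a fixed bump
  function rescaled to radius \<rho> has jets that do not depend on \<rho>.\<close>

lemma jet_scale:
  fixes f :: "real^'n \<Rightarrow> complex"
  assumes "f \<in> smooth_fns UNIV" "a \<ge> 0"
  shows "jet k r (\<lambda>y. f (a *\<^sub>R y + b)) x = jet k (a * r) f (a *\<^sub>R x + b)"
  using assms(1)
proof (induction k arbitrary: f)
  case (Suc k)
  have fd: "f differentiable (at x)" for x
    using smooth_differentiable[OF Suc.prems] by simp
  have eq: "partial_deriv i (\<lambda>y. f (a *\<^sub>R y + b)) = (\<lambda>x. of_real a * partial_deriv i f (a *\<^sub>R x + b))" for i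
    using partial_deriv_scale(1)[OF fd] by blast
  have "jet k r (\<lambda>x. of_real a * partial_deriv i f (a *\<^sub>R x + b)) x
      = a * jet k r (\<lambda>x. partial_deriv i f (a *\<^sub>R x + b)) x" for i
    by (subst jet_cmult[of UNIV]) (auto intro: smooth_scale smooth_partial Suc.prems simp: assms)
  moreover have "jet k r (\<lambda>x. partial_deriv i f (a *\<^sub>R x + b)) x = jet k (a * r) (partial_deriv i f) (a *\<^sub>R x + b)" for i
    by (intro Suc.IH smooth_partial Suc.prems)
  ultimately show ?case
    using Suc.IH[OF Suc.prems] by (simp only: jet.simps eq sum_distrib_left mult.left_commute mult.assoc)
qed simp

subsection \<open>Iterated partial derivatives\<close>

text \<open>Derivatives along a list in any order. The fixed order of \<open>mpartial\<close> is the
  list \<open>mlist \<alpha>\<close>; reordering becomes available with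
  \<open>partials_mset\<close>, which rests on Fourier inversion.\<close>

definition partials :: "'n::finite list \<Rightarrow> (real^'n \<Rightarrow> complex) \<Rightarrow> real^'n \<Rightarrow> complex" where
  "partials is f = foldr partial_deriv is f"

lemma partials_Nil [simp]: "partials [] f = f"
  and partials_Cons [simp]: "partials (i # is) f = partial_deriv i (partials is f)"
  by (simp_all add: partials_def)

lemma partials_append: "partials (is @ js) f = partials is (partials js f)"
  by (simp add: partials_def)

lemma partials_replicate: "partials (replicate k i) f = (partial_deriv i ^^ k) f"
  by (induction k) auto

definition mlist :: "'n::finite mindex \<Rightarrow> 'n list" where
  "mlist \<alpha> = concat (map (\<lambda>i. replicate (\<alpha> i) i) (SOME xs. distinct xs \<and> set xs = UNIV))"

lemma SOME_enum: "distinct (SOME xs. distinct xs \<and> set xs = (UNIV :: 'n::finite set))"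
  "set (SOME xs. distinct xs \<and> set xs = (UNIV :: 'n::finite set)) = UNIV"
proof -
  have "\<exists>xs. distinct xs \<and> set xs = (UNIV :: 'n::finite set)"
    using finite_distinct_list[of "UNIV :: 'n set"] by auto
  from someI_ex[OF this]
  show "distinct (SOME xs. distinct xs \<and> set xs = (UNIV :: 'n::finite set))"
    "set (SOME xs. distinct xs \<and> set xs = (UNIV :: 'n::finite set)) = UNIV" by auto
qed

lemma mpartial_partials: "mpartial \<alpha> f = partials (mlist \<alpha>) f"
proof -
  have "foldr (\<lambda>i. partial_deriv i ^^ \<alpha> i) xs f = partials (concat (map (\<lambda>i. replicate (\<alpha> i) i) xs)) f" for xs
    by (induction xs) (auto simp: partials_append partials_replicate)
  then show ?thesis by (simp add: mpartial_def mlist_def)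
qed

lemma length_mlist: "length (mlist \<alpha>) = mdeg \<alpha>"
proof -
  have "length (concat (map (\<lambda>i. replicate (\<alpha> i) i) xs)) = (\<Sum>i\<in>set xs. \<alpha> i)" if "distinct xs" for xs :: "'a list"
    using that by (induction xs) auto
  from this[OF SOME_enum(1)] show ?thesis by (simp add: mdeg_def mlist_def SOME_enum(2))
qed

lemma count_mlist: "count (mset (mlist \<alpha>)) i = \<alpha> i"
proof -
  have "count (mset (concat (map (\<lambda>i. replicate (\<alpha> i) i) xs))) i = (if i \<in> set xs then \<alpha> i else 0)"
    if "distinct xs" for xs :: "'a list"
    using that by (induction xs) auto
  then show ?thesis using SOME_enum[where 'n='a] by (simp add: mlist_def)
qed

lemma smooth_partials: "f \<in> smooth_fns S \<Longrightarrow> partials is f \<in> smooth_fns S"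
  by (induction "is") (auto intro: smooth_partial)

lemma partials_cong_open:
  assumes "open S" "x \<in> S" "\<And>y. y \<in> S \<Longrightarrow> f y = g y"
  shows "partials is f x = partials is g x"
  using assms(2)
proof (induction "is" arbitrary: x)
  case (Cons i "is")
  show ?case unfolding partials_Cons by (rule partial_deriv_cong_open[OF assms(1) Cons.prems Cons.IH])
qed (use assms(3) in simp)

lemma partials_add:
  assumes S: "open S" "x \<in> S" and fg: "f \<in> smooth_fns S" "g \<in> smooth_fns S"
  shows "partials is (\<lambda>y. f y + g y) x = partials is f x + partials is g x"
  using S(2)
proof (induction "is" arbitrary: x)
  case (Cons i "is")
  have "partials (i # is) (\<lambda>y. f y + g y) x = partial_deriv i (\<lambda>y. partials is f y + partials is g y) x"
    unfolding partials_Cons by (rule partial_deriv_cong_open[OF S(1) Cons.prems Cons.IH])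
  also have "\<dots> = partials (i # is) f x + partials (i # is) g x"
    unfolding partials_Cons
    by (intro partial_deriv_add smooth_differentiable[OF _ S(1)] smooth_partials fg Cons.prems)
  finally show ?case .
qed simp

lemma partials_cmult:
  assumes S: "open S" "x \<in> S" and f: "f \<in> smooth_fns S"
  shows "partials is (\<lambda>y. a * f y) x = a * partials is f x"
  using S(2)
proof (induction "is" arbitrary: x)
  case (Cons i "is")
  have "partials (i # is) (\<lambda>y. a * f y) x = partial_deriv i (\<lambda>y. a * partials is f y) x"
    unfolding partials_Cons by (rule partial_deriv_cong_open[OF S(1) Cons.prems Cons.IH])
  also have "\<dots> = a * partials (i # is) f x"
    unfolding partials_Cons
    by (intro partial_deriv_cmult smooth_differentiable[OF _ S(1)] smooth_partials f Cons.prems)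
  finally show ?case .
qed simp

lemma partials_zero: "partials is (\<lambda>_. 0) = (\<lambda>_. 0)"
proof (induction "is")
  case (Cons i "is")
  then show ?case unfolding partials_Cons Cons by (intro ext partial_deriv_const)
qed simp

text \<open>Every derivative consumes one order of the jet together with the factor \<open>r\<close>
  in front of the sum over the coordinates.\<close>

lemma jet_partials:
  assumes "r \<ge> 0"
  shows "r ^ length is * jet k r (partials is f) x \<le> jet (k + length is) r f x"
proof (induction "is" arbitrary: k)
  case (Cons i "is")
  have "jet k r (partials (i # is) f) x \<le> (\<Sum>j\<in>UNIV. jet k r (partial_deriv j (partials is f)) x)"
    unfolding partials_Cons by (rule member_le_sum) (auto intro: jet_nonneg assms)
  then have "r * jet k r (partials (i # is) f) x \<le> r * (\<Sum>j\<in>UNIV. jet k r (partial_deriv j (partials is f)) x)"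
    using assms by (rule mult_left_mono)
  also have "\<dots> \<le> jet (Suc k) r (partials is f) x" by (simp add: jet_nonneg assms)
  finally have "r ^ length is * (r * jet k r (partials (i # is) f) x) \<le> r ^ length is * jet (Suc k) r (partials is f) x"
    by (intro mult_left_mono) (auto simp: assms)
  also have "\<dots> \<le> jet (Suc k + length is) r f x" by (rule Cons.IH)
  finally show ?case by (simp add: mult.assoc mult.left_commute)
qed simp

lemma partials_le_jet:
  assumes "r \<ge> 0"
  shows "r ^ length is * cmod (partials is f x) \<le> jet (length is) r f x"
  using jet_partials[OF assms, where k=0] by simp

lemma mpartial_le_jet: "cmod (mpartial \<alpha> f x) \<le> jet (mdeg \<alpha>) 1 f x"
  using partials_le_jet[of 1 "mlist \<alpha>" f x] by (simp add: mpartial_partials length_mlist)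

subsection \<open>Exponentials and series of exponentials\<close>

text \<open>Normalized to be 1 at \<open>z\<close>, so that \<open>wave z \<xi> x - 1\<close> is
  small near \<open>z\<close> as long as \<open>\<xi>\<close> stays bounded.\<close>

definition wave :: "real^'n \<Rightarrow> real^'n \<Rightarrow> real^'n \<Rightarrow> complex" where
  "wave z \<xi> x = exp (\<i> * of_real (\<xi> \<bullet> (x - z)))"

text \<open>The sum over all coordinate derivatives of an exponential has exactly this factor, so
  \<open>1 + norm1 \<xi>\<close> is what one order of \<open>jet\<close> with weight 1
  costs.\<close>

definition norm1 :: "real^'n::finite \<Rightarrow> real" where "norm1 \<xi> = (\<Sum>i\<in>UNIV. \<bar>\<xi> $ i\<bar>)"

lemma norm1_nonneg: "norm1 \<xi> \<ge> 0" by (simp add: norm1_def sum_nonneg)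

lemma norm1_pow_nonneg: "0 \<le> (1 + norm1 \<xi>) ^ d" by (simp add: norm1_nonneg)

lemma norm1_add: "norm1 (\<xi> + \<eta>) \<le> norm1 \<xi> + norm1 \<eta>"
  unfolding norm1_def sum.distrib[symmetric] by (intro sum_mono) (simp add: abs_triangle_ineq)

lemma coord_le_norm1: "\<bar>\<xi> $ i\<bar> \<le> norm1 \<xi>"
  unfolding norm1_def by (rule member_le_sum) auto

lemma norm_le_norm1: "norm \<xi> \<le> norm1 \<xi>"
  unfolding norm1_def by (rule norm_le_l1_cart)

lemma norm_wave [simp]: "cmod (wave z \<xi> x) = 1"
  by (simp add: wave_def)

lemma wave_add: "wave z (\<xi> + \<eta>) x = wave z \<xi> x * wave z \<eta> x"
  by (simp add: wave_def inner_add_left exp_add[symmetric] algebra_simps)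

lemma wave_0 [simp]: "wave z 0 x = 1" by (simp add: wave_def)

lemma wave_plus_arg: "wave z \<xi> (x + h) = wave z \<xi> x * exp (\<i> * of_real (\<xi> \<bullet> h))"
  by (simp add: wave_def exp_add[symmetric] inner_diff_right inner_add_right algebra_simps)

lemma exp_i_taylor: "cmod (exp (\<i> * of_real u) - 1 - \<i> * of_real u) \<le> u\<^sup>2"
  using Taylor_exp[of "\<i> * of_real u" 1] by (simp add: norm_mult algebra_simps power2_eq_square)

text \<open>Both the series of exponentials and \<open>flat_exp\<close> at 0 come with a remainder
  that is quadratic for all increments, not only for small ones.\<close>

lemma has_derivative_quadratic:
  assumes "bounded_linear D" "\<And>h. norm (f (x + h) - f x - D h) \<le> C * (norm h)\<^sup>2"
  shows "(f has_derivative D) (at x)"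
proof (rule has_derivativeI_sandwich[of 1])
  show "norm (f y - f x - D (y - x)) / norm (y - x) \<le> C * norm (y - x)" if "y \<noteq> x" for y
    using assms(2)[of "y - x"] that by (simp add: field_simps power2_eq_square)
  have "((\<lambda>y. C * norm (y - x)) \<longlongrightarrow> C * norm (x - x)) (at x)"
    by (intro tendsto_intros)
  then show "((\<lambda>y. C * norm (y - x)) \<longlongrightarrow> 0) (at x)" by simp
qed (use assms in auto)

text \<open>The index type and the frequencies stay arbitrary: the lattice, the reflected lattice,
  the shifted lattice and a single frequency are all instances.\<close>

definition rapid :: "('k \<Rightarrow> complex) \<Rightarrow> ('k \<Rightarrow> real^'n::finite) \<Rightarrow> bool" where
  "rapid a \<xi> \<longleftrightarrow> (\<forall>d. (\<lambda>k. cmod (a k) * (1 + norm1 (\<xi> k)) ^ d) summable_on UNIV)"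

definition wave_series :: "real^'n \<Rightarrow> ('k \<Rightarrow> complex) \<Rightarrow> ('k \<Rightarrow> real^'n::finite) \<Rightarrow> real^'n \<Rightarrow> complex" where
  "wave_series z a \<xi> x = (\<Sum>\<^sub>\<infinity>k. a k * wave z (\<xi> k) x)"

lemma rapidD: "rapid a \<xi> \<Longrightarrow> (\<lambda>k. cmod (a k) * (1 + norm1 (\<xi> k)) ^ d) summable_on UNIV"
  by (simp add: rapid_def)

lemma summable_comparison:
  fixes f :: "'k \<Rightarrow> 'b::banach"
  assumes "g summable_on A" "\<And>k. k \<in> A \<Longrightarrow> norm (f k) \<le> g k"
  shows "f summable_on A" "norm (\<Sum>\<^sub>\<infinity>k\<in>A. f k) \<le> (\<Sum>\<^sub>\<infinity>k\<in>A. g k)" "(\<lambda>k. norm (f k)) summable_on A"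
proof -
  show *: "(\<lambda>k. norm (f k)) summable_on A"
    using assms(1) by (rule summable_on_comparison_test) (use assms(2) in auto)
  then show "f summable_on A" by (rule abs_summable_summable)
  have "norm (\<Sum>\<^sub>\<infinity>k\<in>A. f k) \<le> (\<Sum>\<^sub>\<infinity>k\<in>A. norm (f k))"
    using * by (rule norm_infsum_bound)
  also have "\<dots> \<le> (\<Sum>\<^sub>\<infinity>k\<in>A. g k)"
    using * assms by (intro infsum_mono) auto
  finally show "norm (\<Sum>\<^sub>\<infinity>k\<in>A. f k) \<le> (\<Sum>\<^sub>\<infinity>k\<in>A. g k)" .
qed

lemma infsum_finite_sum:
  fixes f :: "'i \<Rightarrow> 'k \<Rightarrow> 'b::{topological_comm_monoid_add, t2_space}"
  assumes "\<And>i. i \<in> I \<Longrightarrow> f i summable_on A"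
  shows "(\<Sum>\<^sub>\<infinity>k\<in>A. \<Sum>i\<in>I. f i k) = (\<Sum>i\<in>I. \<Sum>\<^sub>\<infinity>k\<in>A. f i k)"
    and "(\<lambda>k. \<Sum>i\<in>I. f i k) summable_on A"
  using assms
proof (induction I rule: infinite_finite_induct)
  case (insert i I)
  {
    case 1
    then show ?case using insert by (simp add: infsum_add)
  next
    case 2
    then show ?case using insert by (simp add: summable_on_add)
  }
qed auto

lemma summable_on_minus:
  fixes f g :: "'k \<Rightarrow> 'b::real_normed_vector"
  assumes "f summable_on A" "g summable_on A"
  shows "(\<lambda>k. f k - g k) summable_on A"
    "(\<Sum>\<^sub>\<infinity>k\<in>A. f k - g k) = infsum f A - infsum g A"
  using summable_on_add[OF assms(1), of "\<lambda>k. - g k"] infsum_add[OF assms(1), of "\<lambda>k. - g k"]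
    assms(2) by (simp_all add: summable_on_uminus infsum_uminus)

lemma rapid_abs: "rapid a \<xi> \<Longrightarrow> (\<lambda>k. cmod (a k)) summable_on UNIV"
  using rapidD[of a \<xi> 0] by simp

lemma rapid_mult:
  assumes "rapid a \<xi>" "\<And>k. cmod (b k) \<le> C * (1 + norm1 (\<xi> k)) ^ e"
  shows "rapid (\<lambda>k. a k * b k) \<xi>"
  unfolding rapid_def
proof
  fix d
  show "(\<lambda>k. cmod (a k * b k) * (1 + norm1 (\<xi> k)) ^ d) summable_on UNIV"
  proof (rule summable_on_comparison_test)
    show "(\<lambda>k. C * (cmod (a k) * (1 + norm1 (\<xi> k)) ^ (e + d))) summable_on UNIV"
      by (intro summable_on_cmult_right rapidD assms)
    fix k
    have "cmod (a k * b k) * (1 + norm1 (\<xi> k)) ^ d \<le> cmod (a k) * (C * (1 + norm1 (\<xi> k)) ^ e) * (1 + norm1 (\<xi> k)) ^ d"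
      unfolding norm_mult by (intro mult_right_mono mult_left_mono assms norm1_pow_nonneg norm_ge_zero)
    then show "cmod (a k * b k) * (1 + norm1 (\<xi> k)) ^ d \<le> C * (cmod (a k) * (1 + norm1 (\<xi> k)) ^ (e + d))"
      by (simp add: power_add algebra_simps)
  qed (simp add: norm1_pow_nonneg)
qed

lemma rapid_partial: "rapid a \<xi> \<Longrightarrow> rapid (\<lambda>k. a k * (\<i> * of_real (\<xi> k $ i))) \<xi>"
proof (rule rapid_mult[where C=1 and e=1])
  fix k show "cmod (\<i> * of_real (\<xi> k $ i)) \<le> 1 * (1 + norm1 (\<xi> k)) ^ 1"
    using coord_le_norm1[of "\<xi> k" i] by (simp add: norm_mult)
qed

text \<open>Each term has a second-order Taylor remainder bounded by its coefficient times the
  square of the frequency and of \<open>norm h\<close>. Rapid decay makes these bounds summable, so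
  the sum has a quadratic remainder too.\<close>

lemma wave_series_has_derivative:
  fixes z :: "real^'n::finite"
  assumes "rapid a \<xi>"
  shows "(wave_series z a \<xi> has_derivative (\<lambda>h. \<Sum>\<^sub>\<infinity>k. a k * wave z (\<xi> k) x * (\<i> * of_real (\<xi> k \<bullet> h)))) (at x)"
    (is "(_ has_derivative ?D) _")
proof (rule has_derivative_quadratic)
  let ?t = "\<lambda>h k. a k * wave z (\<xi> k) x * (\<i> * of_real (\<xi> k \<bullet> h))"
  have ip: "\<bar>\<xi> k \<bullet> h\<bar> \<le> norm1 (\<xi> k) * norm h" for k h
    using Cauchy_Schwarz_ineq2[of "\<xi> k" h] norm_le_norm1[of "\<xi> k"]
    by (meson mult_right_mono norm_ge_zero order_trans)
  have s1: "(\<lambda>k. cmod (a k) * (1 + norm1 (\<xi> k)) ^ 1 * norm h) summable_on UNIV" for h :: "real^'n"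
    by (intro summable_on_cmult_left rapidD assms)
  have b1: "norm (?t h k) \<le> cmod (a k) * (1 + norm1 (\<xi> k)) ^ 1 * norm h" for h k
  proof -
    have "norm (?t h k) = cmod (a k) * \<bar>\<xi> k \<bullet> h\<bar>" by (simp add: norm_mult)
    also have "\<dots> \<le> cmod (a k) * (norm1 (\<xi> k) * norm h)" by (intro mult_left_mono ip) auto
    also have "\<dots> \<le> cmod (a k) * (1 + norm1 (\<xi> k)) ^ 1 * norm h" by (simp add: algebra_simps)
    finally show ?thesis .
  qed
  have sumt: "?t h summable_on UNIV" for h by (rule summable_comparison(1)[OF s1 b1])
  show "bounded_linear ?D"
  proof (rule bounded_linear_intro)
    fix h h' :: "real^'n" and c :: real
    have "?t (h + h') = (\<lambda>k. ?t h k + ?t h' k)" by (auto simp: inner_add_right algebra_simps)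
    then show "?D (h + h') = ?D h + ?D h'" using infsum_add[OF sumt sumt, of h h'] by simp
    have "?t (c *\<^sub>R h) = (\<lambda>k. c *\<^sub>R ?t h k)" by (simp add: fun_eq_iff scaleR_conv_of_real[where 'a=complex] algebra_simps)
    then show "?D (c *\<^sub>R h) = c *\<^sub>R ?D h" using infsum_scaleR_right[of c "?t h" UNIV] by simp
    show "norm (?D h) \<le> norm h * (\<Sum>\<^sub>\<infinity>k. cmod (a k) * (1 + norm1 (\<xi> k)) ^ 1)"
      using summable_comparison(2)[OF s1 b1, of h]
      by (subst (asm) infsum_cmult_left) (auto intro: rapidD[OF assms, of 1, simplified] simp: mult.commute)
  qed
  fix h :: "real^'n"
  let ?e = "\<lambda>x k. a k * wave z (\<xi> k) x"
  have sume: "?e x summable_on UNIV" for x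
    by (rule summable_comparison(1)[OF rapid_abs[OF assms]]) (simp add: norm_mult)
  have s2: "(\<lambda>k. cmod (a k) * (1 + norm1 (\<xi> k)) ^ 2 * (norm h)\<^sup>2) summable_on UNIV"
    by (intro summable_on_cmult_left rapidD assms)
  have "wave_series z a \<xi> (x + h) - wave_series z a \<xi> x - ?D h = (\<Sum>\<^sub>\<infinity>k. ?e (x + h) k - ?e x k - ?t h k)"
    unfolding wave_series_def
    by (simp add: summable_on_minus sume sumt)
  also have "(\<lambda>k. ?e (x + h) k - ?e x k - ?t h k) = (\<lambda>k. a k * wave z (\<xi> k) x * (exp (\<i> * of_real (\<xi> k \<bullet> h)) - 1 - \<i> * of_real (\<xi> k \<bullet> h)))"
    by (simp add: wave_plus_arg left_diff_distrib right_diff_distrib mult.assoc)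
  also have "norm (\<Sum>\<^sub>\<infinity>k. \<dots> k) \<le> (\<Sum>\<^sub>\<infinity>k. cmod (a k) * (1 + norm1 (\<xi> k)) ^ 2 * (norm h)\<^sup>2)"
  proof (rule summable_comparison(2)[OF s2])
    fix k
    have "cmod (exp (\<i> * of_real (\<xi> k \<bullet> h)) - 1 - \<i> * of_real (\<xi> k \<bullet> h)) \<le> (\<xi> k \<bullet> h)\<^sup>2"
      by (rule exp_i_taylor)
    also have "\<dots> \<le> ((1 + norm1 (\<xi> k)) * norm h)\<^sup>2"
    proof (rule power2_le_iff_abs_le[THEN iffD2])
      show "0 \<le> (1 + norm1 (\<xi> k)) * norm h" by (simp add: norm1_nonneg)
      show "\<bar>\<xi> k \<bullet> h\<bar> \<le> (1 + norm1 (\<xi> k)) * norm h"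
        by (rule order_trans[OF ip]) (simp add: algebra_simps)
    qed
    finally show "norm (a k * wave z (\<xi> k) x * (exp (\<i> * of_real (\<xi> k \<bullet> h)) - 1 - \<i> * of_real (\<xi> k \<bullet> h)))
      \<le> cmod (a k) * (1 + norm1 (\<xi> k)) ^ 2 * (norm h)\<^sup>2"
      by (simp add: norm_mult power_mult_distrib mult.assoc mult_left_mono)
  qed
  also have "\<dots> = (\<Sum>\<^sub>\<infinity>k. cmod (a k) * (1 + norm1 (\<xi> k)) ^ 2) * (norm h)\<^sup>2"
    by (intro infsum_cmult_left rapidD assms)
  finally show "norm (wave_series z a \<xi> (x + h) - wave_series z a \<xi> x - ?D h) \<le> (\<Sum>\<^sub>\<infinity>k. cmod (a k) * (1 + norm1 (\<xi> k)) ^ 2) * (norm h)\<^sup>2" .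
qed

lemma partial_deriv_wave_series:
  assumes "rapid a \<xi>"
  shows "partial_deriv i (wave_series z a \<xi>) = wave_series z (\<lambda>k. a k * (\<i> * of_real (\<xi> k $ i))) \<xi>"
proof
  fix x show "partial_deriv i (wave_series z a \<xi>) x = wave_series z (\<lambda>k. a k * (\<i> * of_real (\<xi> k $ i))) \<xi> x"
    unfolding partial_deriv_at[OF wave_series_has_derivative[OF assms]] wave_series_def
    by (simp add: inner_axis algebra_simps)
qed

lemma smooth_wave_series:
  assumes "rapid a \<xi>"
  shows "wave_series z a \<xi> \<in> smooth_fns UNIV"
proof -
  have d: "wave_series z a \<xi> differentiable_on UNIV" if "rapid a \<xi>" for a
    unfolding differentiable_on_def differentiable_def
    using wave_series_has_derivative[OF that] by blast
  have "C_on k UNIV (wave_series z a \<xi>)" if "rapid a \<xi>" for k a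
    using that
  proof (induction k arbitrary: a)
    case 0
    then show ?case using d differentiable_imp_continuous_on by auto
  next
    case (Suc k)
    then show ?case using d by (simp add: partial_deriv_wave_series rapid_partial)
  qed
  then show ?thesis using assms by (simp add: smooth_fns_def)
qed

lemma jet_wave_series:
  assumes "rapid a \<xi>"
  shows "jet d 1 (wave_series z a \<xi>) x \<le> (\<Sum>\<^sub>\<infinity>k. cmod (a k) * (1 + norm1 (\<xi> k)) ^ d)"
  using assms
proof (induction d arbitrary: a)
  case 0
  then show ?case
    using summable_comparison(2)[OF rapid_abs[OF 0], of "\<lambda>k. a k * wave z (\<xi> k) x"]
    by (simp add: norm_mult wave_series_def)
next
  case (Suc d)
  let ?s = "\<lambda>a. \<Sum>\<^sub>\<infinity>k. cmod (a k) * (1 + norm1 (\<xi> k)) ^ d"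
  have sm: "(\<lambda>k. cmod (a k * (\<i> * of_real (\<xi> k $ i))) * (1 + norm1 (\<xi> k)) ^ d) summable_on UNIV" for i
    by (rule rapidD[OF rapid_partial[OF Suc.prems]])
  have "jet (Suc d) 1 (wave_series z a \<xi>) x \<le> ?s a + (\<Sum>i\<in>UNIV. ?s (\<lambda>k. a k * (\<i> * of_real (\<xi> k $ i))))"
    using Suc.IH[OF Suc.prems] Suc.IH[OF rapid_partial[OF Suc.prems]]
    by (simp add: partial_deriv_wave_series[OF Suc.prems] add_mono sum_mono)
  also have "(\<Sum>i\<in>UNIV. ?s (\<lambda>k. a k * (\<i> * of_real (\<xi> k $ i))))
     = (\<Sum>\<^sub>\<infinity>k. \<Sum>i\<in>UNIV. cmod (a k * (\<i> * of_real (\<xi> k $ i))) * (1 + norm1 (\<xi> k)) ^ d)"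
    by (rule infsum_finite_sum(1)[symmetric]) (rule sm)
  also have "(\<lambda>k. \<Sum>i\<in>UNIV. cmod (a k * (\<i> * of_real (\<xi> k $ i))) * (1 + norm1 (\<xi> k)) ^ d)
      = (\<lambda>k. cmod (a k) * norm1 (\<xi> k) * (1 + norm1 (\<xi> k)) ^ d)"
    by (simp add: norm_mult norm1_def sum_distrib_left sum_distrib_right)
  also have "?s a + (\<Sum>\<^sub>\<infinity>k. cmod (a k) * norm1 (\<xi> k) * (1 + norm1 (\<xi> k)) ^ d)
      = (\<Sum>\<^sub>\<infinity>k. cmod (a k) * (1 + norm1 (\<xi> k)) ^ d + cmod (a k) * norm1 (\<xi> k) * (1 + norm1 (\<xi> k)) ^ d)"
  proof (rule infsum_add[symmetric])
    show "(\<lambda>k. cmod (a k) * (1 + norm1 (\<xi> k)) ^ d) summable_on UNIV" by (rule rapidD[OF Suc.prems])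
    have "(\<lambda>k. cmod (a k * of_real (norm1 (\<xi> k))) * (1 + norm1 (\<xi> k)) ^ d) summable_on UNIV"
      by (rule rapidD, rule rapid_mult[OF Suc.prems, of _ 1 1]) (simp add: norm1_nonneg)
    then show "(\<lambda>k. cmod (a k) * norm1 (\<xi> k) * (1 + norm1 (\<xi> k)) ^ d) summable_on UNIV"
      by (simp add: norm_mult norm1_nonneg)
  qed
  finally show ?case by (simp add: algebra_simps)
qed

lemma partials_wave_series:
  assumes "rapid a \<xi>"
  shows "rapid (\<lambda>k. a k * (\<Prod>i\<leftarrow>is. \<i> * of_real (\<xi> k $ i))) \<xi>"
    and "partials is (wave_series z a \<xi>) = wave_series z (\<lambda>k. a k * (\<Prod>i\<leftarrow>is. \<i> * of_real (\<xi> k $ i))) \<xi>"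
proof (induction "is")
  case (Cons i "is")
  {
    case 1
    show ?case using rapid_partial[OF Cons.IH(1), of i] by (simp add: mult_ac)
  next
    case 2
    show ?case using partial_deriv_wave_series[OF Cons.IH(1), of i z] Cons.IH(2) by (simp add: mult_ac)
  }
qed (use assms in auto)

text \<open>A single exponential is a series over the one-point type, so the rules for series also
  give its smoothness, derivatives and jets.\<close>

lemma wave_wave_series: "wave z \<xi> = wave_series z (\<lambda>_::unit. 1) (\<lambda>_. \<xi>)"
  and rapid_unit: "rapid (\<lambda>_::unit. a) (\<lambda>_. \<xi>)"
  by (auto simp: wave_series_def rapid_def fun_eq_iff)

lemma smooth_wave: "wave z \<xi> \<in> smooth_fns S"
  using smooth_wave_series[OF rapid_unit] smooth_subset by (metis wave_wave_series subset_UNIV)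

lemma partials_wave: "partials is (wave z \<xi>) x = (\<Prod>i\<leftarrow>is. \<i> * of_real (\<xi> $ i)) * wave z \<xi> x"
  unfolding wave_wave_series partials_wave_series(2)[OF rapid_unit] by (simp add: wave_series_def)

lemma jet_wave: "jet d 1 (wave z \<xi>) x \<le> (1 + norm1 \<xi>) ^ d"
  using jet_wave_series[OF rapid_unit, of d z 1 \<xi> x] by (simp add: wave_wave_series)

subsection \<open>Bump functions\<close>

text \<open>The function exp(-1/t) with all powers of 1/t attached: differentiation maps the family
  into its own span, which is what an induction on the order of smoothness requires.\<close>

definition flat_exp :: "nat \<Rightarrow> real \<Rightarrow> real" where
  "flat_exp p t = (if t > 0 then exp (- inverse t) * inverse t ^ p else 0)"

lemma power_le_fact_exp: "y \<ge> 0 \<Longrightarrow> y ^ N \<le> fact N * exp (y::real)"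
proof -
  assume y: "y \<ge> 0"
  have "(\<Sum>n\<in>{N}. y ^ n /\<^sub>R fact n) \<le> exp y"
    unfolding exp_def by (rule sum_le_suminf[OF summable_exp_generic]) (use y in auto)
  then show ?thesis by (simp add: field_simps)
qed

text \<open>The term of order \<open>p + 2\<close> of the exponential series absorbs the singular
  factor and leaves \<open>t\<^sup>2\<close>, so every member of the family has derivative 0 at the
  origin.\<close>

lemma flat_exp_bound: "\<bar>flat_exp p t\<bar> \<le> fact (p + 2) * t\<^sup>2"
proof (cases "t > 0")
  case True
  have "inverse t ^ (p + 2) \<le> fact (p + 2) * exp (inverse t)"
    using True by (intro power_le_fact_exp) auto
  then have "inverse t ^ (p + 2) * exp (- inverse t) * t\<^sup>2 \<le> fact (p + 2) * exp (inverse t) * exp (- inverse t) * t\<^sup>2"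
    by (intro mult_right_mono) auto
  moreover have "inverse t ^ (p + 2) * exp (- inverse t) * t\<^sup>2 = flat_exp p t"
    using True by (simp add: flat_exp_def power_add field_simps power2_eq_square)
  moreover have "flat_exp p t \<ge> 0" by (simp add: flat_exp_def)
  ultimately show ?thesis by (simp add: mult.assoc exp_minus)
qed (simp add: flat_exp_def)

lemma flat_exp_deriv: "(flat_exp p has_real_derivative flat_exp (p + 2) t - real p * flat_exp (p + 1) t) (at t)"
proof -
  consider "t > 0" | "t < 0" | "t = 0" by linarith
  then show ?thesis
  proof cases
    case 1
    have y: "(inverse has_real_derivative - ((inverse t)\<^sup>2)) (at t)"
      using DERIV_inverse[of t] 1 by (simp add: power2_eq_square)
    have "((\<lambda>t. exp (- inverse t) * inverse t ^ p) has_real_derivative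
       exp (- inverse t) * (inverse t)\<^sup>2 * inverse t ^ p
        + real p * (- ((inverse t)\<^sup>2) * inverse t ^ (p - Suc 0)) * exp (- inverse t)) (at t)"
      using DERIV_mult[OF DERIV_fun_exp[OF DERIV_minus[OF y]] DERIV_power[OF y, of p]] by simp
    then have "((\<lambda>t. exp (- inverse t) * inverse t ^ p) has_real_derivative flat_exp (p + 2) t - real p * flat_exp (p + 1) t) (at t)"
      by (rule DERIV_cong) (use 1 in \<open>cases p; simp add: flat_exp_def power2_eq_square algebra_simps\<close>)
    then show ?thesis
      by (rule has_field_derivative_transform_within_open[of _ _ _ "{0<..}"]) (use 1 in \<open>auto simp: flat_exp_def\<close>)
  next
    case 2
    have "((\<lambda>t. 0) has_real_derivative flat_exp (p + 2) t - real p * flat_exp (p + 1) t) (at t)"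
      using 2 by (auto simp: flat_exp_def)
    then show ?thesis
      by (rule has_field_derivative_transform_within_open[of _ _ _ "{..<0}"]) (use 2 in \<open>auto simp: flat_exp_def\<close>)
  next
    case 3
    have "(flat_exp p has_derivative (\<lambda>_. 0)) (at 0)"
      by (rule has_derivative_quadratic[of _ _ _ "fact (p + 2)"]) (use flat_exp_bound[of p] in \<open>auto simp: flat_exp_def\<close>)
    then show ?thesis using 3 by (simp add: has_field_derivative_def flat_exp_def lambda_zero[symmetric])
  qed
qed

lemma smooth_flat_exp:
  fixes z :: "real^'n::finite"
  shows "(\<lambda>x. of_real (flat_exp p (c + s * ((x - z) \<bullet> (x - z))))) \<in> smooth_fns UNIV"
proof -
  let ?q = "\<lambda>x. c + s * ((x - z) \<bullet> (x - z))"
  have der: "((\<lambda>x. complex_of_real (flat_exp p (?q x))) has_derivative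
      (\<lambda>h. of_real ((flat_exp (p + 2) (?q x) - real p * flat_exp (p + 1) (?q x)) * (2 * s * ((x - z) \<bullet> h))))) (at x)" for p x
  proof -
    have q: "(?q has_derivative (\<lambda>h. 2 * s * ((x - z) \<bullet> h))) (at x)"
      by (auto intro!: derivative_eq_intros simp: inner_commute algebra_simps)
    have "((\<lambda>x. flat_exp p (?q x)) has_derivative (\<lambda>h. (flat_exp (p + 2) (?q x) - real p * flat_exp (p + 1) (?q x)) * (2 * s * ((x - z) \<bullet> h)))) (at x)"
      by (rule has_derivative_compose[OF q flat_exp_deriv[unfolded has_field_derivative_def]])
    then show ?thesis by (rule has_derivative_of_real)
  qed
  have dif: "(\<lambda>x. complex_of_real (flat_exp p (?q x))) differentiable_on UNIV" for p
    unfolding differentiable_on_def differentiable_def using der by blast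
  have pd: "partial_deriv i (\<lambda>x. complex_of_real (flat_exp p (?q x))) =
     (\<lambda>x. (of_real (flat_exp (p + 2) (?q x)) + (- of_nat p) * of_real (flat_exp (p + 1) (?q x))) * (of_real (2 * s) * (of_real (x $ i) + - of_real (z $ i))))" for p i
    by (rule ext) (simp add: partial_deriv_at[OF der] inner_axis)
  have "C_on k UNIV (\<lambda>x. complex_of_real (flat_exp p (?q x)))" for k p
  proof (induction k arbitrary: p)
    case 0
    show ?case unfolding C_on.simps by (rule differentiable_imp_continuous_on[OF dif])
  next
    case (Suc k)
    have "C_on k UNIV (partial_deriv i (\<lambda>x. complex_of_real (flat_exp p (?q x))))" for i
      unfolding pd by (intro C_on_mult C_on_add open_UNIV Suc C_on_const smooth_fns_C_on[OF smooth_coord])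
    then show ?case using dif by simp
  qed
  then show ?thesis by (simp add: smooth_fns_def)
qed

text \<open>The quotient a/(a+b), where a is positive exactly inside radius \<open>R\<close> and b
  exactly outside radius \<open>r\<close>. Because of \<open>r < R\<close> the denominator never
  vanishes.\<close>

lemma bump_exists:
  fixes z :: "real^'n::finite"
  assumes "0 \<le> r" "r < R"
  obtains f where "f \<in> smooth_fns UNIV" "\<And>x. dist z x \<le> r \<Longrightarrow> f x = 1" "\<And>x. dist z x \<ge> R \<Longrightarrow> f x = 0"
proof -
  define a where "a x = flat_exp 0 (R\<^sup>2 + (- 1) * ((x - z) \<bullet> (x - z)))" for x
  define b where "b x = flat_exp 0 (- r\<^sup>2 + 1 * ((x - z) \<bullet> (x - z)))" for x
  have n: "(x - z) \<bullet> (x - z) = (dist z x)\<^sup>2" for x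
    by (simp add: power2_norm_eq_inner[symmetric] dist_norm norm_minus_commute)
  have rR: "r\<^sup>2 < R\<^sup>2" using assms by (intro power_strict_mono) auto
  have pos: "a x + b x > 0" for x
  proof -
    have "R\<^sup>2 > (dist z x)\<^sup>2 \<or> (dist z x)\<^sup>2 > r\<^sup>2" using rR by linarith
    then show ?thesis by (auto simp: a_def b_def n flat_exp_def add_pos_nonneg add_nonneg_pos)
  qed
  have sm: "(\<lambda>x. complex_of_real (a x)) \<in> smooth_fns UNIV" "(\<lambda>x. complex_of_real (b x)) \<in> smooth_fns UNIV"
    unfolding a_def b_def by (rule smooth_flat_exp)+
  let ?chi = "\<lambda>x. complex_of_real (a x) * inverse (complex_of_real (a x) + complex_of_real (b x))"
  show ?thesis
  proof (rule that[of ?chi])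
    show "?chi \<in> smooth_fns UNIV"
      by (intro smooth_mult smooth_inverse smooth_add sm open_UNIV)
         (metis of_real_add of_real_eq_0_iff less_irrefl pos)
    fix x
    show "?chi x = 1" if "dist z x \<le> r"
    proof -
      have "(dist z x)\<^sup>2 \<le> r\<^sup>2" using that assms by (intro power_mono) auto
      then have "b x = 0" by (simp add: b_def n flat_exp_def)
      then show ?thesis using pos[of x] by simp
    qed
    show "?chi x = 0" if "dist z x \<ge> R"
    proof -
      have "(dist z x)\<^sup>2 \<ge> R\<^sup>2" using that assms by (intro power_mono) auto
      then show ?thesis by (simp add: a_def n flat_exp_def)
    qed
  qed
qed

subsection \<open>Integration by parts\<close>

text \<open>Vanishing off a closed ball stands in for a compact support: the complement is open, so
  the property passes to all derivatives, and the radius is kept explicit.\<close>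

definition supp_cball :: "real^'n \<Rightarrow> real \<Rightarrow> (real^'n::finite \<Rightarrow> complex) \<Rightarrow> bool" where
  "supp_cball z R f \<longleftrightarrow> (\<forall>x. R < dist z x \<longrightarrow> f x = 0)"

lemma supp_cball_partial:
  assumes "supp_cball z R f"
  shows "supp_cball z R (partial_deriv i f)"
  unfolding supp_cball_def
proof (intro allI impI)
  fix x assume x: "R < dist z x"
  have "partial_deriv i f x = partial_deriv i (\<lambda>_. 0) x"
    by (rule partial_deriv_cong_open[of "- cball z R"]) (use x assms in \<open>auto simp: supp_cball_def\<close>)
  then show "partial_deriv i f x = 0" by (simp add: partial_deriv_const)
qed

lemma supp_cball_partials: "supp_cball z R f \<Longrightarrow> supp_cball z R (partials is f)"
  by (induction "is") (auto intro: supp_cball_partial)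

lemma supp_cball_mult1: "supp_cball z R f \<Longrightarrow> supp_cball z R (\<lambda>x. f x * g x)"
  and supp_cball_mult2: "supp_cball z R g \<Longrightarrow> supp_cball z R (\<lambda>x. f x * g x)"
  and supp_cball_mono: "supp_cball z R f \<Longrightarrow> R \<le> R' \<Longrightarrow> supp_cball z R' f"
  by (auto simp: supp_cball_def)

lemma supp_cball_integrable:
  assumes "continuous_on UNIV f" "supp_cball z R f"
  shows "integrable lborel f"
proof -
  have "f = (\<lambda>x. indicator (cball z R) x *\<^sub>R f x)"
    using assms(2) by (auto simp: supp_cball_def indicator_def fun_eq_iff not_le)
  moreover have "integrable lborel (\<lambda>x. indicator (cball z R) x *\<^sub>R f x)"
    by (intro borel_integrable_compact compact_cball continuous_on_subset[OF assms(1)]) auto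
  ultimately show ?thesis by metis
qed

lemma smooth_borel: "f \<in> smooth_fns UNIV \<Longrightarrow> f \<in> borel_measurable borel"
  by (intro borel_measurable_continuous_onI smooth_continuous_on)

lemma supp_cball_bounded:
  assumes "continuous_on UNIV f" "supp_cball z R f"
  obtains M where "M \<ge> 0" "\<And>x. cmod (f x) \<le> M"
proof -
  have "bounded (f ` cball z R)"
    using assms by (intro compact_imp_bounded compact_continuous_image continuous_on_subset[OF assms(1)]) auto
  then obtain M where M: "M > 0" "\<forall>x\<in>cball z R. cmod (f x) \<le> M"
    using bounded_pos by (metis image_eqI)
  show ?thesis
  proof (rule that[of M])
    fix x show "cmod (f x) \<le> M"
      using M assms(2) by (cases "x \<in> cball z R") (auto simp: supp_cball_def not_le)
  qed (use M in simp)
qed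

lemma lborel_integral_shift:
  fixes f :: "'a::euclidean_space \<Rightarrow> complex"
  assumes "f \<in> borel_measurable borel"
  shows "(\<integral>x. f (x + h) \<partial>lborel) = integral\<^sup>L lborel f"
proof -
  have "integral\<^sup>L (distr lborel borel ((+) h)) f = (\<integral>x. f (h + x) \<partial>lborel)"
    by (rule integral_distr) (use assms in auto)
  then show ?thesis by (simp add: lborel_distr_plus add.commute)
qed

text \<open>Difference quotients have integral 0 by translation invariance. They converge to the
  derivative and are dominated by a multiple of the indicator of a ball.\<close>

lemma integral_partial_zero:
  assumes f: "f \<in> smooth_fns UNIV" "supp_cball z R f"
  shows "(\<integral>x. partial_deriv i f x \<partial>lborel) = 0"
proof -
  define a :: "real^'a" where "a = axis i 1"
  \<comment> \<open>Steps of size at most 1, so that every difference quotient vanishes outside the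
    ball of radius \<open>R + 1\<close>.\<close>
  define h where "h m = 1 / (real m + 1)" for m :: nat
  have hpos: "0 < h m" "h m \<le> 1" for m by (auto simp: h_def)
  have na: "norm a = 1" by (simp add: a_def norm_axis_1)
  define s where "s m x = (f (x + h m *\<^sub>R a) - f x) / of_real (h m)" for m x
  have df: "\<exists>f'. (f has_derivative f') (at x)" for x
    using smooth_differentiable[OF f(1)] by (simp add: differentiable_def)
  have int: "integrable lborel f"
    using supp_cball_integrable[OF smooth_continuous_on[OF f(1)] f(2)] .
  have cp: "continuous_on UNIV (partial_deriv i f)" and sp: "supp_cball z R (partial_deriv i f)"
    using smooth_continuous_on[OF smooth_partial[OF f(1)]] supp_cball_partial[OF f(2)] by auto
  obtain M where M: "M \<ge> 0" "\<And>x. cmod (partial_deriv i f x) \<le> M"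
    using supp_cball_bounded[OF cp sp] by blast
  have bnd: "cmod (f (x + t *\<^sub>R a) - f x) \<le> M * \<bar>t\<bar>" for x t
  proof -
    have der: "((\<lambda>t. f (x + t *\<^sub>R a)) has_derivative (\<lambda>u. u *\<^sub>R partial_deriv i f (x + t *\<^sub>R a))) (at t)" for t
    proof -
      obtain f' where f': "(f has_derivative f') (at (x + t *\<^sub>R a))" using df by blast
      have "((\<lambda>t. x + t *\<^sub>R a) has_derivative (\<lambda>u. u *\<^sub>R a)) (at t)"
        by (auto intro!: derivative_eq_intros)
      from has_derivative_compose[OF this f'] show ?thesis
        by (simp add: partial_deriv_at[OF f'] linear_scale[OF has_derivative_linear[OF f']] a_def[symmetric])
    qed
    have "norm (f (x + t *\<^sub>R a) - f (x + 0 *\<^sub>R a)) \<le> M * norm (t - 0)"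
    proof (rule differentiable_bound[of UNIV "\<lambda>t. f (x + t *\<^sub>R a)", OF convex_UNIV der])
      fix t
      show "onorm (\<lambda>u. u *\<^sub>R partial_deriv i f (x + t *\<^sub>R a)) \<le> M"
      proof (rule onorm_le)
        fix u :: real
        show "norm (u *\<^sub>R partial_deriv i f (x + t *\<^sub>R a)) \<le> M * norm u"
          using mult_right_mono[OF M(2)[of "x + t *\<^sub>R a"], of "norm u"] by (simp add: mult.commute)
      qed
    qed auto
    then show ?thesis by simp
  qed
  have lim: "(\<lambda>m. s m x) \<longlonglongrightarrow> partial_deriv i f x" for x
  proof -
    obtain f' where f': "(f has_derivative f') (at x)" using df by blast
    have h0: "h \<longlonglongrightarrow> 0"
      unfolding h_def using LIMSEQ_inverse_real_of_nat by (simp add: inverse_eq_divide add.commute)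
    have "((\<lambda>v. norm (f (x + v) - f x - f' v) / norm v) \<longlongrightarrow> 0) (at 0)"
      using f' by (simp add: has_derivative_at)
    moreover have "filterlim (\<lambda>m. h m *\<^sub>R a) (at 0) sequentially"
      unfolding filterlim_at using tendsto_scaleR[OF h0 tendsto_const[of a]] hpos na
      by (auto simp: less_imp_neq[symmetric])
    ultimately have *: "(\<lambda>m. norm (f (x + h m *\<^sub>R a) - f x - f' (h m *\<^sub>R a)) / norm (h m *\<^sub>R a)) \<longlonglongrightarrow> 0"
      by (rule filterlim_compose)
    have "norm (f (x + h m *\<^sub>R a) - f x - f' (h m *\<^sub>R a)) / norm (h m *\<^sub>R a) = norm (s m x - partial_deriv i f x)" for m
    proof -
      have "f' (h m *\<^sub>R a) = of_real (h m) * partial_deriv i f x"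
        by (simp add: partial_deriv_at[OF f'] linear_scale[OF has_derivative_linear[OF f']] a_def[symmetric] scaleR_conv_of_real[where 'a=complex])
      then have "s m x - partial_deriv i f x = (f (x + h m *\<^sub>R a) - f x - f' (h m *\<^sub>R a)) / of_real (h m)"
        using hpos[of m] by (simp add: s_def field_simps)
      then show ?thesis using hpos[of m] na by (simp add: norm_divide)
    qed
    with * have "(\<lambda>m. norm (s m x - partial_deriv i f x)) \<longlonglongrightarrow> 0" by simp
    then show ?thesis by (simp add: tendsto_norm_zero_iff LIM_zero_iff)
  qed
  have fb: "f \<in> borel_measurable borel" by (rule smooth_borel[OF f(1)])
  have "(\<lambda>m. integral\<^sup>L lborel (s m)) \<longlonglongrightarrow> (\<integral>x. partial_deriv i f x \<partial>lborel)"
  proof (rule integral_dominated_convergence[where w="\<lambda>x. M * indicator (cball z (R + 1)) x"])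
    show "partial_deriv i f \<in> borel_measurable lborel"
      using smooth_borel[OF smooth_partial[OF f(1)]] by simp
    show "s m \<in> borel_measurable lborel" for m
      unfolding s_def using fb by measurable
    show "integrable lborel (\<lambda>x. M * indicator (cball z (R + 1)) x)"
      by (intro integrable_mult_right integrable_real_indicator) (auto simp: emeasure_bounded_finite infinity_ennreal_def[symmetric] simp del: infinity_ennreal_def)
    show "AE x in lborel. (\<lambda>m. s m x) \<longlonglongrightarrow> partial_deriv i f x" using lim by simp
    show "AE x in lborel. norm (s m x) \<le> M * indicator (cball z (R + 1)) x" for m
    proof (rule AE_I2)
      fix x
      show "norm (s m x) \<le> M * indicator (cball z (R + 1)) x"
      proof (cases "x \<in> cball z (R + 1)")
        case True
        then show ?thesis using bnd[of x "h m"] hpos[of m] by (simp add: s_def norm_divide field_simps)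
      next
        case False
        have "dist z x \<le> dist z (x + h m *\<^sub>R a) + h m"
          using dist_triangle[of z x "x + h m *\<^sub>R a"] hpos[of m] na by (simp add: dist_norm)
        then have "R < dist z (x + h m *\<^sub>R a)" "R < dist z x" using False hpos[of m] by auto
        then show ?thesis using f(2) False by (simp add: s_def supp_cball_def)
      qed
    qed
  qed
  moreover have "integral\<^sup>L lborel (s m) = 0" for m
  proof -
    have "integrable lborel (\<lambda>x. f (x + h m *\<^sub>R a))"
    proof (rule supp_cball_integrable)
      show "continuous_on UNIV (\<lambda>x. f (x + h m *\<^sub>R a))"
        by (intro continuous_on_compose2[OF smooth_continuous_on[OF f(1)]] continuous_intros) auto
      show "supp_cball z (R + 1) (\<lambda>x. f (x + h m *\<^sub>R a))"
        unfolding supp_cball_def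
      proof (intro allI impI)
        fix x assume "R + 1 < dist z x"
        moreover have "dist z x \<le> dist z (x + h m *\<^sub>R a) + h m"
          using dist_triangle[of z x "x + h m *\<^sub>R a"] hpos[of m] na by (simp add: dist_norm)
        ultimately have "R < dist z (x + h m *\<^sub>R a)" using hpos[of m] by simp
        then show "f (x + h m *\<^sub>R a) = 0" using f(2) by (simp add: supp_cball_def)
      qed
    qed
    then show ?thesis
      unfolding s_def using int lborel_integral_shift[OF fb] by simp
  qed
  ultimately have "(\<lambda>m. 0 :: complex) \<longlonglongrightarrow> (\<integral>x. partial_deriv i f x \<partial>lborel)" by simp
  then show ?thesis using LIMSEQ_unique tendsto_const by blast
qed

lemma smooth_supp_cball_integrable_wave:
  assumes "f \<in> smooth_fns UNIV" "supp_cball z R f"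
  shows "integrable lborel (\<lambda>x. f x * wave w \<xi> x)"
  by (rule supp_cball_integrable[of _ z R])
     (intro smooth_continuous_on smooth_mult open_UNIV assms smooth_wave supp_cball_mult1)+

lemma integral_partials_wave:
  assumes f: "f \<in> smooth_fns UNIV" "supp_cball z R f"
  shows "(\<integral>x. partials is f x * wave w \<xi> x \<partial>lborel) = (\<Prod>i\<leftarrow>is. - (\<i> * of_real (\<xi> $ i))) * (\<integral>x. f x * wave w \<xi> x \<partial>lborel)"
proof (induction "is")
  case (Cons i "is")
  let ?g = "partials is f"
  have g: "?g \<in> smooth_fns UNIV" "supp_cball z R ?g" using f by (auto intro: smooth_partials supp_cball_partials)
  have eq: "partial_deriv i (\<lambda>x. ?g x * wave w \<xi> x) = (\<lambda>x. (\<i> * of_real (\<xi> $ i)) * (?g x * wave w \<xi> x) + partial_deriv i ?g x * wave w \<xi> x)"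
  proof
    fix x
    show "partial_deriv i (\<lambda>x. ?g x * wave w \<xi> x) x = (\<i> * of_real (\<xi> $ i)) * (?g x * wave w \<xi> x) + partial_deriv i ?g x * wave w \<xi> x"
      using partials_wave[of "[i]" w \<xi> x]
      by (subst partial_deriv_mult) (auto intro!: smooth_differentiable[of _ UNIV] g smooth_wave)
  qed
  have "(\<integral>x. partial_deriv i (\<lambda>x. ?g x * wave w \<xi> x) x \<partial>lborel) = 0"
    by (rule integral_partial_zero[of _ z R]) (intro smooth_mult open_UNIV g smooth_wave supp_cball_mult1)+
  then have "(\<i> * of_real (\<xi> $ i)) * (\<integral>x. ?g x * wave w \<xi> x \<partial>lborel) + (\<integral>x. partial_deriv i ?g x * wave w \<xi> x \<partial>lborel) = 0"
    unfolding eq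
    by (subst (asm) Bochner_Integration.integral_add)
       (auto intro!: smooth_supp_cball_integrable_wave[of _ z R] smooth_partial supp_cball_partial g integrable_mult_right)
  then show ?case using Cons by (simp add: add_eq_0_iff2 mult.assoc)
qed simp

subsection \<open>Interchanging integrals and series\<close>

text \<open>The exponentials have modulus 1, so the distance from a finite partial sum to the series
  is at most the tail of the absolute sum, uniformly in the variable. Integrated against
  \<open>w\<close> it is at most that tail times the L1 norm of \<open>w\<close>.\<close>

lemma integral_wave_series:
  fixes a :: "'k \<Rightarrow> complex"
  assumes a: "rapid a \<xi>" and w: "integrable lborel w"
  shows "(\<integral>x. w x * wave_series z a \<xi> x \<partial>lborel) = (\<Sum>\<^sub>\<infinity>k. a k * (\<integral>x. w x * wave z (\<xi> k) x \<partial>lborel))"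
    and "(\<lambda>k. a k * (\<integral>x. w x * wave z (\<xi> k) x \<partial>lborel)) summable_on UNIV"
    and "integrable lborel (\<lambda>x. w x * wave_series z a \<xi> x)"
proof -
  let ?A = "\<lambda>F. \<Sum>\<^sub>\<infinity>k\<in>-F. cmod (a k)"
  have sa: "(\<lambda>k. cmod (a k)) summable_on F" for F
    using rapid_abs[OF a] summable_on_subset_banach by blast
  have sae: "(\<lambda>k. a k * wave z (\<xi> k) x) summable_on F" for F x
    by (rule summable_comparison(1)[OF sa]) (simp add: norm_mult)
  have wi: "integrable lborel (\<lambda>x. w x * g x)" if "g \<in> borel_measurable borel" "\<And>x. cmod (g x) \<le> M" for g M
  proof (rule Bochner_Integration.integrable_bound)
    show "integrable lborel (\<lambda>x. M *\<^sub>R norm (w x))" by (intro integrable_scaleR_right integrable_norm w)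
    show "(\<lambda>x. w x * g x) \<in> borel_measurable lborel" using w that(1) by measurable
    have "norm (w x * g x) \<le> M * norm (w x)" for x
      using mult_left_mono[OF that(2)[of x], of "norm (w x)"] by (simp add: norm_mult mult.commute)
    then show "AE x in lborel. norm (w x * g x) \<le> norm (M *\<^sub>R norm (w x))"
      by (intro AE_I2) (metis abs_ge_self order_trans real_norm_def real_scaleR_def)
  qed
  have be: "wave z \<eta> \<in> borel_measurable borel" for \<eta> by (intro smooth_borel smooth_wave)
  have bs: "wave_series z a \<xi> \<in> borel_measurable borel" by (intro smooth_borel smooth_wave_series a)
  have es_bd: "cmod (wave_series z a \<xi> x) \<le> ?A {}" for x
    unfolding wave_series_def using summable_comparison(2)[OF sa, of UNIV "\<lambda>k. a k * wave z (\<xi> k) x"] by (simp add: norm_mult)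
  have wex: "integrable lborel (\<lambda>x. w x * wave z \<eta> x)" for \<eta> by (rule wi[OF be, of _ 1]) simp
  show wes: "integrable lborel (\<lambda>x. w x * wave_series z a \<xi> x)" by (rule wi[OF bs es_bd])
  have key: "norm ((\<Sum>k\<in>F. a k * (\<integral>x. w x * wave z (\<xi> k) x \<partial>lborel)) - (\<integral>x. w x * wave_series z a \<xi> x \<partial>lborel))
     \<le> ?A F * (\<integral>x. norm (w x) \<partial>lborel)" if F: "finite F" for F
  proof -
    let ?d = "\<lambda>x. (\<Sum>k\<in>F. a k * wave z (\<xi> k) x) - wave_series z a \<xi> x"
    have d: "cmod (?d x) \<le> ?A F" for x
    proof -
      have "wave_series z a \<xi> x = (\<Sum>\<^sub>\<infinity>k\<in>F \<union> -F. a k * wave z (\<xi> k) x)" by (simp add: wave_series_def)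
      also have "\<dots> = (\<Sum>k\<in>F. a k * wave z (\<xi> k) x) + (\<Sum>\<^sub>\<infinity>k\<in>-F. a k * wave z (\<xi> k) x)"
        by (subst infsum_Un_disjoint) (use F sae in auto)
      finally have "cmod (?d x) = cmod (\<Sum>\<^sub>\<infinity>k\<in>-F. a k * wave z (\<xi> k) x)"
        by (simp add: norm_minus_commute)
      also have "\<dots> \<le> ?A F" by (rule summable_comparison(2)[OF sa]) (simp add: norm_mult)
      finally show ?thesis .
    qed
    have db: "?d \<in> borel_measurable borel" using be bs by measurable
    have "(\<Sum>k\<in>F. a k * (\<integral>x. w x * wave z (\<xi> k) x \<partial>lborel)) - (\<integral>x. w x * wave_series z a \<xi> x \<partial>lborel) = (\<integral>x. w x * ?d x \<partial>lborel)"
    proof -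
      have "(\<integral>x. w x * ?d x \<partial>lborel) = (\<integral>x. (\<Sum>k\<in>F. a k * (w x * wave z (\<xi> k) x)) - w x * wave_series z a \<xi> x \<partial>lborel)"
        by (intro Bochner_Integration.integral_cong) (auto simp: right_diff_distrib sum_distrib_left mult_ac)
      also have "\<dots> = (\<Sum>k\<in>F. a k * (\<integral>x. w x * wave z (\<xi> k) x \<partial>lborel)) - (\<integral>x. w x * wave_series z a \<xi> x \<partial>lborel)"
        by (subst Bochner_Integration.integral_diff, intro Bochner_Integration.integrable_sum integrable_mult_right wex,
          rule wes, subst Bochner_Integration.integral_sum, intro integrable_mult_right wex, simp)
      finally show ?thesis by simp
    qed
    also have "norm \<dots> \<le> (\<integral>x. norm (w x * ?d x) \<partial>lborel)" by (rule integral_norm_bound)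
    also have "\<dots> \<le> (\<integral>x. ?A F * norm (w x) \<partial>lborel)"
    proof (rule integral_mono)
      show "integrable lborel (\<lambda>x. norm (w x * ?d x))" by (intro integrable_norm wi[OF db d])
      show "integrable lborel (\<lambda>x. ?A F * norm (w x))" using w by simp
      show "norm (w x * ?d x) \<le> ?A F * norm (w x)" for x
        using mult_right_mono[OF d[of x], of "norm (w x)"] by (simp add: norm_mult mult.commute)
    qed
    finally show ?thesis by simp
  qed
  have "((\<lambda>k. a k * (\<integral>x. w x * wave z (\<xi> k) x \<partial>lborel)) has_sum (\<integral>x. w x * wave_series z a \<xi> x \<partial>lborel)) UNIV"
    unfolding has_sum_def
  proof (rule LIM_zero_cancel, rule Lim_null_comparison)
    show "\<forall>\<^sub>F F in finite_subsets_at_top UNIV. norm (sum (\<lambda>k. a k * (\<integral>x. w x * wave z (\<xi> k) x \<partial>lborel)) F - (\<integral>x. w x * wave_series z a \<xi> x \<partial>lborel))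
       \<le> ?A F * (\<integral>x. norm (w x) \<partial>lborel)"
      using key by (auto simp: eventually_finite_subsets_at_top)
    have "((\<lambda>F. ?A {} - (\<Sum>k\<in>F. cmod (a k))) \<longlongrightarrow> ?A {} - ?A {}) (finite_subsets_at_top UNIV)"
      using infsum_tendsto[OF sa[of UNIV]] by (intro tendsto_intros) simp
    moreover have "\<forall>\<^sub>F F in finite_subsets_at_top UNIV. ?A {} - (\<Sum>k\<in>F. cmod (a k)) = ?A F"
    proof (rule eventually_finite_subsets_at_top_weakI)
      fix F :: "'k set" assume F: "finite F"
      have "?A {} = (\<Sum>\<^sub>\<infinity>k\<in>F \<union> -F. cmod (a k))" by simp
      also have "\<dots> = (\<Sum>k\<in>F. cmod (a k)) + ?A F" by (subst infsum_Un_disjoint) (use F sa in auto)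
      finally show "?A {} - (\<Sum>k\<in>F. cmod (a k)) = ?A F" by simp
    qed
    ultimately have "(?A \<longlongrightarrow> 0) (finite_subsets_at_top UNIV)" by (simp add: tendsto_cong)
    from tendsto_mult_right[OF this, of "\<integral>x. norm (w x) \<partial>lborel"]
    show "((\<lambda>F. ?A F * (\<integral>x. norm (w x) \<partial>lborel)) \<longlongrightarrow> 0) (finite_subsets_at_top UNIV)" by (simp add: mult.commute)
  qed
  then show "(\<integral>x. w x * wave_series z a \<xi> x \<partial>lborel) = (\<Sum>\<^sub>\<infinity>k. a k * (\<integral>x. w x * wave z (\<xi> k) x \<partial>lborel))"
    "(\<lambda>k. a k * (\<integral>x. w x * wave z (\<xi> k) x \<partial>lborel)) summable_on UNIV"
    by (auto simp: infsumI has_sum_imp_summable)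
qed

subsection \<open>The lattice\<close>

text \<open>A product over the coordinates, so that it is submultiplicative and lattice sums factor
  into one-dimensional ones. The parameter \<open>h\<close> slows down the growth: at 0 the weight
  is identically 1, and all positive values give weights of comparable size.\<close>

definition W :: "real \<Rightarrow> ('n::finite \<Rightarrow> int) \<Rightarrow> real" where
  "W h k = (\<Prod>i\<in>UNIV. 1 + h * \<bar>real_of_int (k i)\<bar>)"

lemma W_ge_1: "h \<ge> 0 \<Longrightarrow> W h k \<ge> 1"
  unfolding W_def by (intro prod_ge_1) auto

lemma W_submult:
  assumes "h \<ge> 0"
  shows "W h (\<lambda>i. k i + l i) \<le> W h k * W h l"
  unfolding W_def prod.distrib[symmetric]
proof (intro prod_mono conjI)
  fix i
  have "h * \<bar>real_of_int (k i + l i)\<bar> \<le> h * (\<bar>real_of_int (k i)\<bar> + \<bar>real_of_int (l i)\<bar>)"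
    using assms by (intro mult_left_mono) auto
  moreover have "0 \<le> h * \<bar>real_of_int (k i)\<bar> * (h * \<bar>real_of_int (l i)\<bar>)" using assms by simp
  ultimately show "1 + h * \<bar>real_of_int (k i + l i)\<bar> \<le> (1 + h * \<bar>real_of_int (k i)\<bar>) * (1 + h * \<bar>real_of_int (l i)\<bar>)"
    by (simp add: algebra_simps)
qed (use assms in auto)

lemma W_minus [simp]: "W h (\<lambda>i. - k i) = W h k"
  by (simp add: W_def)

lemma sum_le_W: "1 + (\<Sum>i\<in>UNIV. \<bar>real_of_int (k i)\<bar>) \<le> W 1 k"
proof -
  have "1 + (\<Sum>i\<in>I. \<bar>real_of_int (k i)\<bar>) \<le> (\<Prod>i\<in>I. 1 + \<bar>real_of_int (k i)\<bar>)" if "finite I" for I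
    using that
  proof (induction I)
    case (insert j I)
    have "1 + (\<Sum>i\<in>I. \<bar>real_of_int (k i)\<bar>) + \<bar>real_of_int (k j)\<bar> * 1 \<le> (1 + (\<Sum>i\<in>I. \<bar>real_of_int (k i)\<bar>)) + \<bar>real_of_int (k j)\<bar> * (1 + (\<Sum>i\<in>I. \<bar>real_of_int (k i)\<bar>))"
      by (intro add_left_mono mult_left_mono) (auto intro: sum_nonneg)
    also have "\<dots> = (1 + \<bar>real_of_int (k j)\<bar>) * (1 + (\<Sum>i\<in>I. \<bar>real_of_int (k i)\<bar>))" by (simp add: algebra_simps)
    also have "\<dots> \<le> (1 + \<bar>real_of_int (k j)\<bar>) * (\<Prod>i\<in>I. 1 + \<bar>real_of_int (k i)\<bar>)"
      by (intro mult_left_mono insert) auto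
    finally show ?case using insert by simp
  qed simp
  then show ?thesis by (simp add: W_def)
qed

lemma summable_int_inverse_square: "(\<lambda>j::int. 1 / (1 + \<bar>real_of_int j\<bar>)\<^sup>2) summable_on UNIV"
proof -
  have "summable (\<lambda>n. 1 / (1 + real n)\<^sup>2)"
    using summable_Suc_iff[of "\<lambda>n. inverse (real n ^ 2)"] inverse_power_summable[of 2, where 'a=real]
    by (simp add: inverse_eq_divide add.commute)
  then have n: "(\<lambda>n. 1 / (1 + real n)\<^sup>2) summable_on UNIV"
    by (subst summable_on_UNIV_nonneg_real_iff) auto
  have "(\<lambda>j::int. 1 / (1 + \<bar>real_of_int j\<bar>)\<^sup>2) summable_on (range int)"
    by (subst summable_on_reindex) (use n in \<open>auto simp: o_def\<close>)
  moreover have "(\<lambda>j::int. 1 / (1 + \<bar>real_of_int j\<bar>)\<^sup>2) summable_on (range (\<lambda>n. - int n))"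
    by (subst summable_on_reindex) (use n in \<open>auto simp: o_def inj_def\<close>)
  ultimately have "(\<lambda>j::int. 1 / (1 + \<bar>real_of_int j\<bar>)\<^sup>2) summable_on (range int \<union> range (\<lambda>n. - int n))"
    by (rule summable_on_union)
  moreover have "range int \<union> range (\<lambda>n. - int n) = UNIV"
  proof -
    have "j \<in> range int \<union> range (\<lambda>n. - int n)" for j :: int by (cases j rule: int_cases2) auto
    then show ?thesis by blast
  qed
  ultimately show ?thesis by simp
qed

text \<open>Any finite set of lattice points lies in a finite box, over which the sum of the
  products is the product of the coordinate sums; these are bounded by the convergent
  one-dimensional series.\<close>

lemma summable_W: "(\<lambda>k :: 'n::finite \<Rightarrow> int. 1 / W 1 k ^ 2) summable_on UNIV"
proof (rule nonneg_bdd_above_summable_on)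
  let ?g = "\<lambda>j::int. 1 / (1 + \<bar>real_of_int j\<bar>)\<^sup>2"
  let ?C = "infsum ?g UNIV"
  show "0 \<le> 1 / W 1 k ^ 2" for k :: "'n \<Rightarrow> int" by simp
  show "bdd_above (sum (\<lambda>k :: 'n \<Rightarrow> int. 1 / W 1 k ^ 2) ` {F. F \<subseteq> UNIV \<and> finite F})"
  proof (rule bdd_aboveI2)
    fix F :: "('n \<Rightarrow> int) set" assume "F \<in> {F. F \<subseteq> UNIV \<and> finite F}"
    then have F: "finite F" by simp
    define B where "B = (\<Union>k\<in>F. range k)"
    have B: "finite B" unfolding B_def by (intro finite_UN_I F finite_imageI finite)
    have Bk: "k i \<in> B" if "k \<in> F" for k i using that by (auto simp: B_def)
    have "(\<Sum>k\<in>F. 1 / W 1 k ^ 2) = (\<Sum>k\<in>F. \<Prod>i\<in>UNIV. ?g (k i))"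
      by (intro sum.cong) (auto simp: W_def prod_dividef prod_power_distrib)
    also have "\<dots> \<le> (\<Sum>k\<in>(UNIV :: 'n set) \<rightarrow>\<^sub>E B. \<Prod>i\<in>UNIV. ?g (k i))"
      by (intro sum_mono2 finite_PiE) (auto simp: B Bk intro: prod_nonneg)
    also have "\<dots> = (\<Prod>i\<in>(UNIV :: 'n set). \<Sum>j\<in>B. ?g j)"
      by (rule prod_sum_PiE[symmetric]) (auto simp: B)
    also have "\<dots> \<le> (\<Prod>i\<in>(UNIV :: 'n set). ?C)"
      by (intro prod_mono conjI sum_nonneg finite_sum_le_infsum B summable_int_inverse_square) auto
    finally show "(\<Sum>k\<in>F. 1 / W 1 k ^ 2) \<le> (\<Prod>i\<in>(UNIV :: 'n set). ?C)" .
  qed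
qed

lemma prod_list_mlist:
  fixes g :: "'n::finite \<Rightarrow> 'b::comm_monoid_mult"
  shows "(\<Prod>i\<leftarrow>mlist \<alpha>. g i) = (\<Prod>i\<in>UNIV. g i ^ \<alpha> i)"
proof -
  have r: "(\<Prod>i\<leftarrow>replicate m i. g i) = g i ^ m" for m i by (induction m) auto
  have "(\<Prod>i\<leftarrow>concat (map (\<lambda>i. replicate (\<alpha> i) i) xs). g i) = (\<Prod>i\<in>set xs. g i ^ \<alpha> i)" if "distinct xs" for xs
    using that by (induction xs) (auto simp: r)
  from this[OF SOME_enum(1)] show ?thesis by (simp add: mlist_def SOME_enum(2))
qed

lemma norm_prod_list: "norm (\<Prod>x\<leftarrow>xs. g x :: 'b::real_normed_field) = (\<Prod>x\<leftarrow>xs. norm (g x))"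
  by (induction xs) (auto simp: norm_mult)

locale lattice =
  fixes z :: "real^'n::finite" and \<rho> :: real
  assumes rho: "\<rho> > 0"
begin

definition lat :: "('n \<Rightarrow> int) \<Rightarrow> real^'n" where
  "lat k = (\<chi> i. of_int (k i) / \<rho>)"

definition neg :: "('n \<Rightarrow> int) \<Rightarrow> 'n \<Rightarrow> int" where "neg k = (\<lambda>i. - k i)"

definition vol :: real where "vol = (2 * pi * \<rho>) ^ CARD('n)"

text \<open>The integral runs over the whole space because the functions concerned are supported in
  the ball of radius 2\<rho>, inside the period cell \<open>Q\<close>. Negating \<open>k\<close>
  conjugates the exponential.\<close>

definition fourier_coeff :: "(real^'n \<Rightarrow> complex) \<Rightarrow> ('n \<Rightarrow> int) \<Rightarrow> complex" where
  "fourier_coeff f k = (\<integral>x. f x * wave z (lat (neg k)) x \<partial>lborel) / of_real vol"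

text \<open>The cube of side 2\<pi>\<rho> is the period cell of the exponentials with frequencies
  \<open>lat k\<close>. Since \<pi> exceeds 2, the ball of radius 2\<rho> fits into it.\<close>

definition Q :: "(real^'n) set" where
  "Q = cbox (z - (\<chi> i. pi * \<rho>)) (z + (\<chi> i. pi * \<rho>))"

lemma Q_iff: "x \<in> Q \<longleftrightarrow> (\<forall>i. \<bar>x $ i - z $ i\<bar> \<le> pi * \<rho>)"
  by (auto simp: Q_def mem_box_cart abs_le_iff algebra_simps)

lemma vol_pos: "vol > 0" using rho by (simp add: vol_def)

lemma lat_add: "lat (\<lambda>i. k i + l i) = lat k + lat l"
  and lat_0: "lat (\<lambda>_. 0) = 0"
  by (simp_all add: lat_def neg_def vec_eq_iff add_divide_distrib)

lemma neg_neg [simp]: "neg (neg k) = k" by (simp add: neg_def)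

lemma norm1_lat: "norm1 (lat k) = (\<Sum>i\<in>UNIV. \<bar>real_of_int (k i)\<bar>) / \<rho>"
  using rho by (simp add: norm1_def lat_def sum_divide_distrib)

lemma norm1_lat_le: "1 + norm1 (lat k) \<le> (1 + 1 / \<rho>) * W 1 k"
proof -
  have "norm1 (lat k) \<le> W 1 k / \<rho>"
    unfolding norm1_lat using sum_le_W[of k] rho by (intro divide_right_mono) auto
  then show ?thesis using W_ge_1[of 1 k] by (simp add: algebra_simps)
qed

lemma cball_Q: "cball z (2 * \<rho>) \<subseteq> Q"
proof
  fix x assume "x \<in> cball z (2 * \<rho>)"
  then have "\<bar>x $ i - z $ i\<bar> \<le> 2 * \<rho>" for i
    using component_le_norm_cart[of "x - z" i] by (simp add: dist_norm norm_minus_commute)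
  moreover have "2 * \<rho> \<le> pi * \<rho>" using pi_ge_two rho by (intro mult_right_mono) auto
  ultimately show "x \<in> Q" unfolding Q_iff by (meson order_trans)
qed

lemma measure_Q: "measure lborel Q = vol" "emeasure lborel Q < \<infinity>" "Q \<in> sets borel" "compact Q"
proof -
  have "cbox (z - (\<chi> i. pi * \<rho>)) (z + (\<chi> i. pi * \<rho>)) \<noteq> {}"
    using cball_Q rho unfolding Q_def[symmetric] by (metis centre_in_cball empty_iff less_eq_real_def mult_nonneg_nonneg subset_iff zero_le_numeral)
  from content_cbox_cart[OF this] show "measure lborel Q = vol"
    by (simp add: Q_def vol_def power_mult_distrib)
  show "emeasure lborel Q < \<infinity>" unfolding Q_def by (rule emeasure_lborel_cbox_finite)
qed (auto simp: Q_def compact_cbox)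

lemma fourier_coeff_bound:
  assumes "f \<in> borel_measurable borel" "supp_cball z (2 * \<rho>) f" "\<And>x. cmod (f x) \<le> M"
  shows "cmod (\<integral>x. f x * wave z \<xi> x \<partial>lborel) \<le> M * vol"
proof -
  have M: "M \<ge> 0" using assms(3)[of z] norm_ge_zero order_trans by blast
  have b: "norm (f x * wave z \<xi> x) \<le> M * indicator Q x" for x
  proof (cases "x \<in> Q")
    case False
    then have "2 * \<rho> < dist z x" using cball_Q by (meson mem_cball not_le subsetD)
    then show ?thesis using assms(2) False by (simp add: supp_cball_def)
  qed (use assms(3) in \<open>simp add: norm_mult\<close>)
  have iQ: "integrable lborel (\<lambda>x. M * indicator Q x)"
    by (intro integrable_mult_right integrable_real_indicator) (use measure_Q in auto)
  have m: "(\<lambda>x. f x * wave z \<xi> x) \<in> borel_measurable lborel"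
    using assms(1) smooth_borel[OF smooth_wave[of z \<xi>]] by measurable
  have i: "integrable lborel (\<lambda>x. f x * wave z \<xi> x)"
    by (rule Bochner_Integration.integrable_bound[OF iQ m]) (use b in \<open>auto intro!: AE_I2 intro: order_trans[OF _ abs_ge_self]\<close>)
  have "cmod (\<integral>x. f x * wave z \<xi> x \<partial>lborel) \<le> (\<integral>x. norm (f x * wave z \<xi> x) \<partial>lborel)" by (rule integral_norm_bound)
  also have "\<dots> \<le> (\<integral>x. M * indicator Q x \<partial>lborel)" by (intro integral_mono iQ integrable_norm i b)
  also have "\<dots> = M * vol" using measure_Q by simp
  finally show ?thesis .
qed

text \<open>Integration by parts gains \<rho>/|k_i| per derivative, and the weight \<rho> of the jet
  compensates the \<rho>. The constant is therefore free of \<rho>, which allows the radius to be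
  chosen after the smallness requirement is known.\<close>

lemma fourier_coeff_decay:
  assumes f: "f \<in> smooth_fns UNIV" "supp_cball z (2 * \<rho>) f" and M: "\<And>x. jet (s * CARD('n)) \<rho> f x \<le> M"
  shows "cmod (fourier_coeff f k) * W 1 k ^ s \<le> 2 ^ (s * CARD('n)) * M"
proof -
  \<comment> \<open>Only coordinates with \<open>k i \<noteq> 0\<close> are differentiated; for
    these \<open>1 + \<bar>k i\<bar>\<close> is at most twice \<open>\<bar>k i\<bar>\<close>, which
    is the origin of the powers of 2.\<close>
  define \<alpha> where "\<alpha> i = (if k i = 0 then 0 else s)" for i
  let ?is = "mlist \<alpha>"
  have len: "length ?is \<le> s * CARD('n)"
    using sum_bounded_above[of UNIV \<alpha> s] by (simp add: length_mlist mdeg_def \<alpha>_def mult.commute)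
  have M0: "M \<ge> 0" using M[of z] jet_nonneg[of \<rho> "s * CARD('n)" f z] rho by simp
  have pb: "cmod (partials ?is f x) \<le> M / \<rho> ^ length ?is" for x
  proof -
    have "\<rho> ^ length ?is * cmod (partials ?is f x) \<le> jet (length ?is) \<rho> f x" using rho by (intro partials_le_jet less_imp_le)
    also have "\<dots> \<le> jet (s * CARD('n)) \<rho> f x" using rho by (intro jet_mono len less_imp_le)
    finally show ?thesis using M[of x] rho by (simp add: field_simps)
  qed
  let ?I = "\<lambda>g. \<integral>x. g x * wave z (lat (neg k)) x \<partial>lborel"
  have "cmod (?I (partials ?is f)) \<le> M / \<rho> ^ length ?is * vol"
    by (rule fourier_coeff_bound) (use f pb in \<open>auto intro!: smooth_borel smooth_partials supp_cball_partials\<close>)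
  also have "?I (partials ?is f) = (\<Prod>i\<leftarrow>?is. - (\<i> * of_real (lat (neg k) $ i))) * ?I f"
    by (rule integral_partials_wave[OF f])
  also have "cmod \<dots> = (\<Prod>i\<leftarrow>?is. \<bar>real_of_int (k i)\<bar> / \<rho>) * cmod (?I f)"
    using rho by (simp add: norm_mult norm_divide norm_prod_list lat_def neg_def)
  also have "(\<Prod>i\<leftarrow>?is. \<bar>real_of_int (k i)\<bar> / \<rho>) = (\<Prod>i\<leftarrow>?is. \<bar>real_of_int (k i)\<bar>) / \<rho> ^ length ?is"
  proof -
    have "(\<Prod>i\<leftarrow>xs. \<bar>real_of_int (k i)\<bar> / \<rho>) = (\<Prod>i\<leftarrow>xs. \<bar>real_of_int (k i)\<bar>) / \<rho> ^ length xs" for xs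
      by (induction xs) auto
    then show ?thesis .
  qed
  finally have *: "(\<Prod>i\<leftarrow>?is. \<bar>real_of_int (k i)\<bar>) * cmod (?I f) \<le> M * vol"
    using rho by (simp add: field_simps)
  have "W 1 k ^ s = (\<Prod>i\<in>UNIV. (1 + \<bar>real_of_int (k i)\<bar>) ^ s)" by (simp add: W_def prod_power_distrib)
  also have "\<dots> \<le> (\<Prod>i\<in>(UNIV :: 'n set). 2 ^ s * \<bar>real_of_int (k i)\<bar> ^ \<alpha> i)"
  proof (intro prod_mono conjI)
    fix i
    show "(1 + \<bar>real_of_int (k i)\<bar>) ^ s \<le> 2 ^ s * \<bar>real_of_int (k i)\<bar> ^ \<alpha> i"
    proof (cases "k i = 0")
      case False
      then have "1 \<le> \<bar>real_of_int (k i)\<bar>" by linarith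
      then have "(1 + \<bar>real_of_int (k i)\<bar>) ^ s \<le> (2 * \<bar>real_of_int (k i)\<bar>) ^ s" by (intro power_mono) auto
      then show ?thesis using False by (simp add: \<alpha>_def power_mult_distrib)
    qed (simp add: \<alpha>_def)
  qed simp
  also have "\<dots> = 2 ^ (s * CARD('n)) * (\<Prod>i\<leftarrow>?is. \<bar>real_of_int (k i)\<bar>)"
    by (simp add: prod.distrib power_mult prod_list_mlist)
  finally have "W 1 k ^ s \<le> 2 ^ (s * CARD('n)) * (\<Prod>i\<leftarrow>?is. \<bar>real_of_int (k i)\<bar>)" .
  then have "cmod (?I f) * W 1 k ^ s \<le> cmod (?I f) * (2 ^ (s * CARD('n)) * (\<Prod>i\<leftarrow>?is. \<bar>real_of_int (k i)\<bar>))"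
    by (intro mult_left_mono) auto
  also have "\<dots> = 2 ^ (s * CARD('n)) * ((\<Prod>i\<leftarrow>?is. \<bar>real_of_int (k i)\<bar>) * cmod (?I f))"
    by (simp add: mult_ac)
  also have "\<dots> \<le> 2 ^ (s * CARD('n)) * (M * vol)" by (intro mult_left_mono *) auto
  finally show ?thesis using vol_pos by (simp add: fourier_coeff_def norm_divide field_simps)
qed

text \<open>Frequencies at bounded distance from the lattice are as good as lattice frequencies,
  because the distance \<open>D\<close> is absorbed into a constant factor of
  \<open>W 1\<close>.\<close>

lemma rapid_lat:
  fixes \<xi> :: "('n \<Rightarrow> int) \<Rightarrow> real^'n"
  assumes "\<And>s. \<exists>M. \<forall>k. cmod (a k) * W 1 k ^ s \<le> M" and D: "D \<ge> 0"
    and \<xi>: "\<And>k. norm1 (\<xi> k) \<le> norm1 (lat k) + D"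
  shows "rapid a \<xi>"
  unfolding rapid_def
proof
  fix d
  let ?c = "1 + 1 / \<rho> + D"
  \<comment> \<open>The exponent \<open>d\<close> pays for the frequencies and 2 for the summability
    over the lattice.\<close>
  obtain M where M: "\<And>k. cmod (a k) * W 1 k ^ (d + 2) \<le> M" using assms(1) by blast
  show "(\<lambda>k. cmod (a k) * (1 + norm1 (\<xi> k)) ^ d) summable_on UNIV"
  proof (rule summable_comparison(1)[where g="\<lambda>k. (?c ^ d * M) * (1 / W 1 k ^ 2)"])
    show "(\<lambda>k. (?c ^ d * M) * (1 / W 1 k ^ 2)) summable_on UNIV"
      by (intro summable_on_cmult_right summable_W)
 fix k :: "'n \<Rightarrow> int"
    have W: "W 1 k \<ge> 1" by (simp add: W_ge_1)
    have "D * 1 \<le> D * W 1 k" by (intro mult_left_mono W D)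
    then have "1 + norm1 (\<xi> k) \<le> ?c * W 1 k" using \<xi>[of k] norm1_lat_le[of k] by (simp add: algebra_simps)
    then have "(1 + norm1 (\<xi> k)) ^ d \<le> (?c * W 1 k) ^ d" by (intro power_mono) (auto simp: norm1_nonneg)
    then have "cmod (a k) * (1 + norm1 (\<xi> k)) ^ d \<le> cmod (a k) * (?c * W 1 k) ^ d"
      by (intro mult_left_mono) auto
    also have "\<dots> = ?c ^ d * (cmod (a k) * W 1 k ^ d)"
      by (simp add: power_mult_distrib mult_ac)
    finally have "cmod (a k) * (1 + norm1 (\<xi> k)) ^ d \<le> ?c ^ d * (cmod (a k) * W 1 k ^ d)" .
    moreover have "cmod (a k) * W 1 k ^ d \<le> M / W 1 k ^ 2"
      using M[of k] W by (simp add: field_simps power_add power2_eq_square)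
    then have "?c ^ d * (cmod (a k) * W 1 k ^ d) \<le> ?c ^ d * (M / W 1 k ^ 2)"
      using rho D by (intro mult_left_mono) auto
    ultimately have "cmod (a k) * (1 + norm1 (\<xi> k)) ^ d \<le> ?c ^ d * (M / W 1 k ^ 2)"
      by (rule order_trans)
    then show "norm (cmod (a k) * (1 + norm1 (\<xi> k)) ^ d) \<le> (?c ^ d * M) * (1 / W 1 k ^ 2)"
      by (simp add: norm1_pow_nonneg norm1_nonneg)
  qed
qed

lemma rapid_fourier_coeff:
  assumes f: "f \<in> smooth_fns UNIV" "supp_cball z (2 * \<rho>) f"
  shows "rapid (fourier_coeff f) lat"
proof (rule rapid_lat[where D=0])
  fix s
  have "\<exists>M. \<forall>x. jet (s * CARD('n)) \<rho> f x \<le> M"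
  proof -
    obtain M where M: "M \<ge> 0" "\<And>x. x \<in> cball z (2 * \<rho>) \<Longrightarrow> jet (s * CARD('n)) \<rho> f x \<le> M"
      using jet_bounded[OF f(1) compact_cball subset_UNIV] by blast
    have "jet (s * CARD('n)) \<rho> f x \<le> M" for x
    proof (cases "x \<in> cball z (2 * \<rho>)")
      case False
      have "jet (s * CARD('n)) \<rho> f x = jet (s * CARD('n)) \<rho> (\<lambda>_. 0) x"
        by (rule jet_cong_open[of "- cball z (2 * \<rho>)"]) (use False f(2) in \<open>auto simp: supp_cball_def\<close>)
      then show ?thesis using M by (simp add: jet_zero)
    qed (use M in auto)
    then show ?thesis by blast
  qed
  then obtain M where "\<And>x. jet (s * CARD('n)) \<rho> f x \<le> M" by blast
  from fourier_coeff_decay[OF f this] show "\<exists>M. \<forall>k. cmod (fourier_coeff f k) * W 1 k ^ s \<le> M" by blast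
qed (auto simp: norm1_def)

end

subsection \<open>Fourier inversion on a cube\<close>

text \<open>Lebesgue measure on vectors is the image of the product measure indexed by
  \<open>Basis\<close>. Since the basis vectors are the \<open>axis i 1\<close>, the product can be
  reindexed by the coordinates.\<close>

lemma lborel_integral_prod:
  fixes g :: "'n::finite \<Rightarrow> real \<Rightarrow> complex"
  assumes g: "\<And>i. integrable lborel (g i)"
  shows "(\<integral>x. (\<Prod>i\<in>UNIV. g i (x $ i)) \<partial>(lborel :: (real^'n) measure)) = (\<Prod>i\<in>UNIV. \<integral>t. g i t \<partial>lborel)"
proof -
  interpret product_sigma_finite "\<lambda>_ :: real^'n. lborel :: real measure" by standard
  define b :: "'n \<Rightarrow> real^'n" where "b i = axis i 1" for i
  have inj: "inj b" by (auto simp: b_def inj_def axis_eq_axis)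
  have Bas: "Basis = range b" by (auto simp: b_def Basis_vec_def)
  define G where "G v = g (the_inv b v)" for v
  have Gb: "G (b i) = g i" for i by (simp add: G_def the_inv_f_f inj)
  have comp: "(\<Sum>v\<in>Basis. f v *\<^sub>R v) $ i = f (b i)" for f :: "real^'n \<Rightarrow> real" and i
  proof -
    have "(\<Sum>v\<in>Basis. f v *\<^sub>R v) $ i = (\<Sum>j\<in>UNIV. (f (b j) *\<^sub>R b j) $ i)"
      unfolding Bas by (simp add: sum.reindex inj)
    also have "\<dots> = (\<Sum>j\<in>UNIV. if j = i then f (b j) else 0)"
      by (intro sum.cong) (auto simp: b_def axis_def)
    finally show ?thesis by simp
  qed
  have gm [measurable]: "g i \<in> borel_measurable borel" for i
    using borel_measurable_integrable[OF g[of i]] by simp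
  have nm [measurable]: "(\<lambda>x :: real^'n. x $ i) \<in> borel_measurable borel" for i
    by (intro borel_measurable_continuous_onI continuous_intros)
  have "(\<integral>x. (\<Prod>i\<in>UNIV. g i (x $ i)) \<partial>(lborel :: (real^'n) measure))
     = (\<integral>f. (\<Prod>i\<in>UNIV. g i ((\<Sum>v\<in>Basis. f v *\<^sub>R v) $ i)) \<partial>(\<Pi>\<^sub>M v\<in>(Basis :: (real^'n) set). lborel))"
    by (subst lborel_eq, rule integral_distr) measurable
  also have "\<dots> = (\<integral>f. (\<Prod>v\<in>Basis. G v (f v)) \<partial>(\<Pi>\<^sub>M v\<in>(Basis :: (real^'n) set). lborel))"
    unfolding comp unfolding Bas by (simp add: prod.reindex inj Gb)
  also have "\<dots> = (\<Prod>v\<in>Basis. \<integral>t. G v t \<partial>lborel)"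
    by (rule product_integral_prod) (auto simp: Bas Gb g)
  also have "\<dots> = (\<Prod>i\<in>UNIV. \<integral>t. g i t \<partial>lborel)"
    unfolding Bas by (simp add: prod.reindex inj Gb)
  finally show ?thesis .
qed

text \<open>Laplace concentration: high powers of \<open>q\<close> put almost all mass near the
  unique maximum \<open>y\<close>, where \<open>r\<close> is positive, so the sign of
  \<open>r y\<close> decides the sign of the integral.\<close>

lemma peak:
  fixes K :: "'a::euclidean_space set" and r q :: "'a \<Rightarrow> real"
  assumes K: "compact K" and d0: "d0 > 0" "ball y d0 \<subseteq> K"
    and r: "continuous_on K r" "r y > 0" and q: "continuous_on K q" "q y = 1"
    "\<And>x. x \<in> K \<Longrightarrow> 0 \<le> q x" "\<And>x. x \<in> K \<Longrightarrow> x \<noteq> y \<Longrightarrow> q x < 1"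
  obtains N where "(\<integral>x. indicator K x *\<^sub>R (r x * q x ^ N) \<partial>lborel) > 0"
proof -
  have yK: "y \<in> K" using d0 by auto
  define \<eta> where "\<eta> = r y / 2"
  have eta: "\<eta> > 0" using r by (simp add: \<eta>_def)
  obtain d where d: "d > 0" "\<And>x. x \<in> K \<Longrightarrow> dist x y < d \<Longrightarrow> dist (r x) (r y) < \<eta>"
    using r(1) yK eta unfolding continuous_on_iff by blast
  define d1 where "d1 = min d d0"
  have d1: "d1 > 0" "ball y d1 \<subseteq> K" "\<And>x. x \<in> ball y d1 \<Longrightarrow> r x > \<eta>"
  proof -
    show "d1 > 0" "ball y d1 \<subseteq> K" using d d0 by (auto simp: d1_def)
    fix x assume x: "x \<in> ball y d1"
    then have "x \<in> K" "dist x y < d" using d0(2) by (auto simp: d1_def dist_commute)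
    then have "dist (r x) (r y) < \<eta>" by (rule d(2))
    then show "r x > \<eta>" unfolding \<eta>_def dist_real_def by linarith
  qed
  obtain s where s: "0 \<le> s" "s < 1" "\<And>x. x \<in> K - ball y d1 \<Longrightarrow> q x \<le> s"
  proof (cases "K - ball y d1 = {}")
    case True
    show ?thesis by (rule that[of 0]) (use True in auto)
  next
    case False
    have "compact (K - ball y d1)" using K by (simp add: compact_diff)
    from continuous_attains_sup[OF this False continuous_on_subset[OF q(1) Diff_subset]]
    obtain x1 where x1: "x1 \<in> K - ball y d1" "\<forall>x\<in>K - ball y d1. q x \<le> q x1" by blast
    then have "x1 \<in> K" "x1 \<noteq> y" using d1(1) by auto
    then have "0 \<le> q x1" "q x1 < 1" by (simp_all add: q)
    then show ?thesis using x1(2) by (intro that[of "q x1"]) auto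
  qed
  \<comment> \<open>Halfway between the supremum \<open>s\<close> of \<open>q\<close> away from
    \<open>y\<close> and the maximal value 1: near \<open>y\<close> the function \<open>q\<close>
    exceeds \<open>s'\<close>, so the two contributions differ by a factor that decays like the
    powers of \<open>s / s'\<close>.\<close>
  define s' where "s' = (1 + s) / 2"
  have s': "s < s'" "0 < s'" using s by (auto simp: s'_def)
  have "0 < 1 - s'" using s by (simp add: s'_def)
  then obtain d2 where d2: "d2 > 0" "\<And>x. x \<in> K \<Longrightarrow> dist x y < d2 \<Longrightarrow> dist (q x) (q y) < 1 - s'"
    using q(1) yK unfolding continuous_on_iff by blast
  define d3 where "d3 = min d1 d2"
  let ?B = "ball y d3"
  have d3: "d3 > 0" "?B \<subseteq> K" "?B \<subseteq> ball y d1" using d1 d2 by (auto simp: d3_def)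
  have qB: "q x > s'" if x: "x \<in> ?B" for x
  proof -
    have "x \<in> K" "dist x y < d2" using x d3(2) by (auto simp: d3_def dist_commute)
    from d2(2)[OF this] show ?thesis unfolding dist_real_def q(2) by linarith
  qed
  obtain M where M: "M > 0" "\<And>x. x \<in> K \<Longrightarrow> \<bar>r x\<bar> \<le> M"
  proof -
    from bounded_pos[THEN iffD1, OF compact_imp_bounded[OF compact_continuous_image[OF r(1) K]]]
    obtain M where "M > 0" "\<forall>t\<in>r ` K. norm t \<le> M" by blast
    then show ?thesis by (intro that[of M]) auto
  qed
  have mB: "measure lborel ?B > 0" using d3(1) by (simp add: content_ball_pos)
  have emK: "emeasure lborel K < \<infinity>" "K \<in> sets borel" by (rule emeasure_bounded_finite[OF compact_imp_bounded[OF K]], rule borel_compact[OF K])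
  have emB: "emeasure lborel ?B < \<infinity>" by (intro emeasure_bounded_finite bounded_ball)
  let ?m = "measure lborel K"
  have "s / s' < 1" using s' by simp
  moreover have "0 < \<eta> * measure lborel ?B / (M * ?m + 1)" using eta mB M(1) by (intro divide_pos_pos mult_pos_pos add_nonneg_pos) auto
  ultimately obtain N where N: "(s / s') ^ N < \<eta> * measure lborel ?B / (M * ?m + 1)"
    using real_arch_pow_inv by blast
  \<comment> \<open>A lower bound for the integrand: a positive contribution near \<open>y\<close>
    minus the worst case elsewhere. In the shell between the two balls \<open>r\<close> is still
    positive, so there the integrand is nonnegative.\<close>
  let ?lo = "\<lambda>x. (\<eta> * s' ^ N) * indicator ?B x - (M * s ^ N) * indicator K x"
  have ilo: "integrable lborel ?lo"
    by (intro Bochner_Integration.integrable_diff integrable_mult_right integrable_real_indicator) (use emK emB in auto)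
  have ir: "integrable lborel (\<lambda>x. indicator K x *\<^sub>R (r x * q x ^ N))"
    by (intro borel_integrable_compact K continuous_intros r q)
  have "?lo x \<le> indicator K x *\<^sub>R (r x * q x ^ N)" for x
  proof -
    consider "x \<in> ?B" | "x \<in> ball y d1" "x \<notin> ?B" | "x \<in> K" "x \<notin> ball y d1" | "x \<notin> K" by blast
    then show ?thesis
    proof cases
      case 1
      then have x: "x \<in> K" "x \<in> ball y d1" using d3 by auto
      have "\<eta> * s' ^ N \<le> r x * q x ^ N"
        using d1(3)[OF x(2)] qB[OF 1] eta s' by (intro mult_mono power_mono) auto
      moreover have "0 \<le> M * s ^ N" using M s by simp
      ultimately show ?thesis using 1 x by simp
    next
      case 2
      then have x: "x \<in> K" using d1 by auto
      have "0 \<le> r x * q x ^ N" using d1(3)[OF 2(1)] q(3)[OF x] eta by simp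
      moreover have "0 \<le> M * s ^ N" using M s by simp
      ultimately show ?thesis using 2 x by simp
    next
      case 3
      then have x: "x \<notin> ?B" using d3 by auto
      have "\<bar>r x * q x ^ N\<bar> \<le> M * s ^ N"
        unfolding abs_mult using M 3 s q(3) by (intro mult_mono) (auto simp: power_abs intro!: power_mono)
      then show ?thesis using 3 x by simp
    next
      case 4
      then have "x \<notin> ?B" using d3 by auto
      then show ?thesis using 4 by simp
    qed
  qed
  then have "integral\<^sup>L lborel ?lo \<le> (\<integral>x. indicator K x *\<^sub>R (r x * q x ^ N) \<partial>lborel)"
    by (intro integral_mono ilo ir)
  moreover have "integral\<^sup>L lborel ?lo = \<eta> * s' ^ N * measure lborel ?B - M * s ^ N * ?m"
    by (subst Bochner_Integration.integral_diff)
       (use emK emB in \<open>auto intro!: integrable_mult_right integrable_real_indicator\<close>)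
  moreover have "M * s ^ N * ?m < \<eta> * s' ^ N * measure lborel ?B"
  proof -
    have "(s / s') ^ N * (M * ?m + 1) < \<eta> * measure lborel ?B"
      using N M(1) by (simp add: pos_less_divide_eq add_nonneg_pos)
    moreover have "(s / s') ^ N * (M * ?m) \<le> (s / s') ^ N * (M * ?m + 1)"
      using s s' by (intro mult_left_mono) auto
    ultimately have "(s / s') ^ N * (M * ?m) < \<eta> * measure lborel ?B" by linarith
    then have "s' ^ N * ((s / s') ^ N * (M * ?m)) < s' ^ N * (\<eta> * measure lborel ?B)"
      using s' by (intro mult_strict_left_mono) auto
    then show ?thesis using s' by (simp add: power_divide mult_ac)
  qed
  ultimately show ?thesis using that[of N] by linarith
qed

context lattice
begin

lemma integral_interval_exp:
  fixes m :: int and c :: real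
  defines "g \<equiv> \<lambda>t. indicator {c - pi * \<rho>..c + pi * \<rho>} t *\<^sub>R exp (\<i> * of_real (of_int m / \<rho> * (t - c)))"
  shows "integrable lborel g" "(\<integral>t. g t \<partial>lborel) = (if m = 0 then of_real (2 * pi * \<rho>) else 0)"
proof -
  let ?f = "\<lambda>t. exp (\<i> * of_real (of_int m / \<rho> * (t - c)))"
  have le: "c - pi * \<rho> \<le> c + pi * \<rho>" using rho by simp
  have cf: "continuous_on {c - pi * \<rho>..c + pi * \<rho>} ?f" by (intro continuous_intros)
  show "integrable lborel g" unfolding g_def by (intro borel_integrable_compact cf) auto
  show "(\<integral>t. g t \<partial>lborel) = (if m = 0 then of_real (2 * pi * \<rho>) else 0)"
  proof (cases "m = 0")
    case True
    have "(\<integral>t. g t \<partial>lborel) = (of_real (c + pi * \<rho>) :: complex) - of_real (c - pi * \<rho>)"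
      unfolding g_def by (rule integral_FTC_Icc[OF le _ cf])
        (auto intro!: derivative_eq_intros simp: True has_vector_derivative_of_real)
    then show ?thesis using True by simp
  next
    case False
    let ?w = "\<i> * of_real (of_int m / \<rho>)"
    have w: "?w \<noteq> 0" using False rho by simp
    have "(\<integral>t. g t \<partial>lborel) = ?f (c + pi * \<rho>) / ?w - ?f (c - pi * \<rho>) / ?w"
      unfolding g_def
    proof (rule integral_FTC_Icc[OF le _ cf, where F="\<lambda>t. ?f t / ?w"])
      fix t
      have "((\<lambda>u::complex. exp (?w * (u - of_real c)) / ?w) has_field_derivative exp (?w * (of_real t - of_real c))) (at (of_real t))"
        using w by (auto intro!: derivative_eq_intros)
      from has_vector_derivative_real_field[OF this]
      show "((\<lambda>t. ?f t / ?w) has_vector_derivative ?f t) (at t within {c - pi * \<rho>..c + pi * \<rho>})"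
        by (auto intro: has_vector_derivative_at_within simp: mult.assoc)
    qed
    moreover have "?f (c + pi * \<rho>) = ?f (c - pi * \<rho>)"
    proof -
      have "exp (\<i> * of_real (of_int m / \<rho> * (c + pi * \<rho> - c))) = exp (\<i> * of_real (of_int m / \<rho> * (c - pi * \<rho> - c)) + of_int (2 * m) * of_real pi * \<i>)"
        using rho by (simp add: field_simps)
      also have "\<dots> = exp (\<i> * of_real (of_int m / \<rho> * (c - pi * \<rho> - c)))"
        unfolding exp_add by (subst exp_eq_1[THEN iffD2]) (auto simp: algebra_simps intro!: exI[of _ m])
      finally show ?thesis .
    qed
    ultimately show ?thesis using False by simp
  qed
qed

lemma integral_Q_wave: "(\<integral>x. indicator Q x *\<^sub>R wave z (lat k) x \<partial>lborel) = (if k = (\<lambda>_. 0) then of_real vol else 0)"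
proof -
  let ?g = "\<lambda>i t. indicator {z $ i - pi * \<rho>..z $ i + pi * \<rho>} t *\<^sub>R exp (\<i> * of_real (of_int (k i) / \<rho> * (t - z $ i)))"
  have "indicator Q x *\<^sub>R wave z (lat k) x = (\<Prod>i\<in>UNIV. ?g i (x $ i))" for x
  proof -
    have "wave z (lat k) x = exp (\<Sum>i\<in>UNIV. \<i> * of_real (of_int (k i) / \<rho> * (x $ i - z $ i)))"
      by (simp add: wave_def inner_vec_def lat_def sum_distrib_left)
    then have e: "wave z (lat k) x = (\<Prod>i\<in>UNIV. exp (\<i> * of_real (of_int (k i) / \<rho> * (x $ i - z $ i))))"
      by (simp add: exp_sum)
    show ?thesis
    proof (cases "x \<in> Q")
      case True
      then have "x $ i \<in> {z $ i - pi * \<rho>..z $ i + pi * \<rho>}" for i unfolding Q_iff by (auto simp: abs_le_iff algebra_simps)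
      then show ?thesis using True by (simp add: e)
    next
      case False
      then obtain i where "x $ i \<notin> {z $ i - pi * \<rho>..z $ i + pi * \<rho>}" unfolding Q_iff by (auto simp: abs_le_iff algebra_simps)
      then have 0: "?g i (x $ i) = 0" by (simp add: indicator_def)
      have "(\<Prod>i\<in>UNIV. ?g i (x $ i)) = 0"
        by (rule prod_zero[OF finite], rule bexI[of _ i], rule 0, rule UNIV_I)
      then show ?thesis using False by simp
    qed
  qed
  then have "(\<integral>x. indicator Q x *\<^sub>R wave z (lat k) x \<partial>lborel) = (\<integral>x. (\<Prod>i\<in>UNIV. ?g i (x $ i)) \<partial>lborel)" by simp
  also have "\<dots> = (\<Prod>i\<in>UNIV. \<integral>t. ?g i t \<partial>lborel)" by (rule lborel_integral_prod) (rule integral_interval_exp)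
  also have "\<dots> = (\<Prod>i\<in>(UNIV :: 'n set). if k i = 0 then of_real (2 * pi * \<rho>) else 0)" by (simp only: integral_interval_exp(2))
  also have "\<dots> = (if k = (\<lambda>_. 0) then of_real vol else 0)"
  proof (cases "k = (\<lambda>_. 0)")
    case False
    then obtain i where "k i \<noteq> 0" by auto
    then have "(\<Prod>i\<in>(UNIV :: 'n set). if k i = 0 then of_real (2 * pi * \<rho>) else (0 :: complex)) = 0"
      by (intro prod_zero) (auto intro!: bexI[of _ i])
    then show ?thesis using False by simp
  qed (simp add: vol_def)
  finally show ?thesis .
qed

section \<open>Completeness of the lattice exponentials\<close>

text \<open>Orthogonality over the cube to every lattice exponential. No periodicity is imposed, and
  accordingly only interior points of the cube are concluded upon.\<close>

definition fourier_null :: "(real^'n \<Rightarrow> complex) \<Rightarrow> bool" where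
  "fourier_null D \<longleftrightarrow> continuous_on UNIV D \<and> (\<forall>k. (\<integral>x. indicator Q x *\<^sub>R (D x * wave z (lat k) x) \<partial>lborel) = 0)"

lemma wave_continuous: "continuous_on S (wave z \<xi>)"
  using smooth_continuous_on[OF smooth_wave] .

lemma integrable_Q: "continuous_on UNIV D \<Longrightarrow> integrable lborel (\<lambda>x. indicator Q x *\<^sub>R (D x :: complex))"
  by (rule borel_integrable_compact[OF measure_Q(4) continuous_on_subset]) auto

lemma fourier_null_lin:
  assumes "fourier_null D" "fourier_null D'"
  shows "fourier_null (\<lambda>x. a * D x + b * D' x)"
  unfolding fourier_null_def
proof (intro conjI allI)
  show c: "continuous_on UNIV (\<lambda>x. a * D x + b * D' x)"
    using assms by (auto simp: fourier_null_def intro!: continuous_intros)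
  fix k
  have i: "integrable lborel (\<lambda>x. indicator Q x *\<^sub>R (D x * wave z (lat k) x))"
    "integrable lborel (\<lambda>x. indicator Q x *\<^sub>R (D' x * wave z (lat k) x))"
    using assms by (auto simp: fourier_null_def intro!: integrable_Q continuous_intros wave_continuous)
  have "(\<integral>x. indicator Q x *\<^sub>R ((a * D x + b * D' x) * wave z (lat k) x) \<partial>lborel)
    = (\<integral>x. a * (indicator Q x *\<^sub>R (D x * wave z (lat k) x)) + b * (indicator Q x *\<^sub>R (D' x * wave z (lat k) x)) \<partial>lborel)"
    by (intro Bochner_Integration.integral_cong) (auto simp: indicator_def algebra_simps)
  also have "\<dots> = 0"
    unfolding Bochner_Integration.integral_add[OF integrable_mult_right[OF i(1)] integrable_mult_right[OF i(2)]]
      integral_mult_right_zero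
    using assms by (simp add: fourier_null_def)
  finally show "(\<integral>x. indicator Q x *\<^sub>R ((a * D x + b * D' x) * wave z (lat k) x) \<partial>lborel) = 0" .
qed

lemma fourier_null_ex:
  assumes "fourier_null D"
  shows "fourier_null (\<lambda>x. D x * wave z (lat l) x)"
  unfolding fourier_null_def
proof (intro conjI allI)
  show "continuous_on UNIV (\<lambda>x. D x * wave z (lat l) x)"
    using assms by (auto simp: fourier_null_def intro!: continuous_intros wave_continuous)
  fix k
  have "(\<lambda>x. indicator Q x *\<^sub>R (D x * wave z (lat l) x * wave z (lat k) x)) = (\<lambda>x. indicator Q x *\<^sub>R (D x * wave z (lat (\<lambda>i. l i + k i)) x))"
    by (simp add: lat_add wave_add mult.assoc)
  then show "(\<integral>x. indicator Q x *\<^sub>R (D x * wave z (lat l) x * wave z (lat k) x) \<partial>lborel) = 0"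
    using assms by (simp add: fourier_null_def)
qed

text \<open>A raised cosine of period 2\<pi>\<rho> in one coordinate is a combination of 1 and two
  lattice exponentials, and multiplication by a lattice exponential only permutes the orthogonality
  conditions.\<close>

lemma fourier_null_cos:
  assumes "fourier_null D"
  shows "fourier_null (\<lambda>x. D x * of_real ((1 + cos ((x $ i - y $ i) / \<rho>)) / 2))"
proof -
  \<comment> \<open>The exponentials are centred at \<open>z\<close> and the cosine at
    \<open>y\<close>; \<open>u\<close> and \<open>v\<close> are the phases that move the
    centre.\<close>
  define u where "u = exp (\<i> * of_real ((z $ i - y $ i) / \<rho>))"
  define v where "v = exp (\<i> * of_real (- (z $ i - y $ i) / \<rho>))"
  let ?l = "\<lambda>s j. if j = i then s else (0::int)"
  have lx: "wave z (lat (?l s)) x = exp (\<i> * of_real (of_int s * (x $ i - z $ i) / \<rho>))" for s x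
  proof -
    have "lat (?l s) \<bullet> (x - z) = (\<Sum>j\<in>UNIV. if j = i then of_int s / \<rho> * (x $ i - z $ i) else 0)"
      unfolding inner_vec_def by (intro sum.cong) (auto simp: lat_def)
    then show ?thesis by (simp add: wave_def)
  qed
  have eq: "D x * of_real ((1 + cos ((x $ i - y $ i) / \<rho>)) / 2)
     = 1 * ((1/2) * D x + (u / 4) * (D x * wave z (lat (?l 1)) x)) + (v / 4) * (D x * wave z (lat (?l (-1))) x)" for x
  proof -
    have e1: "u * wave z (lat (?l 1)) x = exp (\<i> * of_real ((x $ i - y $ i) / \<rho>))"
      unfolding lx u_def exp_add[symmetric] by (simp add: diff_divide_distrib algebra_simps)
    have e2: "v * wave z (lat (?l (-1))) x = exp (- (\<i> * of_real ((x $ i - y $ i) / \<rho>)))"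
      unfolding lx v_def exp_add[symmetric] by (simp add: diff_divide_distrib algebra_simps)
    have e3: "complex_of_real (cos ((x $ i - y $ i) / \<rho>)) = (exp (\<i> * of_real ((x $ i - y $ i) / \<rho>)) + exp (- (\<i> * of_real ((x $ i - y $ i) / \<rho>)))) / 2"
      by (simp add: cos_of_real[symmetric] cos_exp_eq)
    have "1 * ((1/2) * D x + (u / 4) * (D x * wave z (lat (?l 1)) x)) + (v / 4) * (D x * wave z (lat (?l (-1))) x)
      = D x * (1 / 2 + (u * wave z (lat (?l 1)) x) / 4 + (v * wave z (lat (?l (-1))) x) / 4)"
      by (simp add: algebra_simps)
    also have "\<dots> = D x * of_real ((1 + cos ((x $ i - y $ i) / \<rho>)) / 2)"
      unfolding e1 e2 of_real_divide of_real_add e3 by (simp add: add_divide_distrib)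
    finally show ?thesis by simp
  qed
  show ?thesis unfolding eq by (intro fourier_null_lin fourier_null_ex assms)
qed

text \<open>The product of raised cosines centred at \<open>y\<close> peaks on the cube at
  \<open>y\<close> alone, and multiplying by its powers preserves orthogonality. All resulting
  integrals vanish, which contradicts \<open>peak\<close> if \<open>D y\<close> is nonzero.\<close>

lemma fourier_null_zero:
  assumes D: "fourier_null D" and y: "\<And>i. \<bar>y $ i - z $ i\<bar> < pi * \<rho>"
  shows "D y = 0"
proof (rule ccontr)
  assume Dy: "D y \<noteq> 0"
  define q where "q x = (\<Prod>i\<in>UNIV. (1 + cos ((x $ i - y $ i) / \<rho>)) / 2)" for x :: "real^'n"
  have "fourier_null (\<lambda>x. D x * of_real (\<Prod>i\<in>I. (1 + cos ((x $ i - y $ i) / \<rho>)) / 2))" if "fourier_null D" "finite I" for I D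
    using that(2)
  proof (induction I)
    case (insert i I)
    from fourier_null_cos[OF insert.IH, of i y] insert.hyps show ?case by (simp add: mult_ac)
  qed (use that in simp)
  then have kq: "fourier_null (\<lambda>x. D x * of_real (q x))" if "fourier_null D" for D using that by (simp add: q_def)
  have kN: "fourier_null (\<lambda>x. D x * of_real (q x ^ N))" for N
  proof (induction N)
    case (Suc N)
    from kq[OF Suc] show ?case by (simp add: mult_ac)
  qed (use D in simp)
  \<comment> \<open>The real part after rotating \<open>D y\<close> to the positive axis, so that
    \<open>r y\<close> is the squared modulus of \<open>D y\<close>.\<close>
  define r where "r x = Re (cnj (D y) * D x)" for x
  have cD: "continuous_on S D" for S using D continuous_on_subset by (auto simp: fourier_null_def)
  have rq0: "(\<integral>x. indicator Q x *\<^sub>R (r x * q x ^ N) \<partial>lborel) = 0" for N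
  proof -
    let ?h = "\<lambda>x. indicator Q x *\<^sub>R (D x * of_real (q x ^ N))"
    have "(\<integral>x. ?h x \<partial>lborel) = 0"
      using kN[of N] unfolding fourier_null_def by (metis (no_types, lifting) wave_0 lat_0 mult.right_neutral Bochner_Integration.integral_cong)
    then have "(\<integral>x. cnj (D y) * ?h x \<partial>lborel) = 0" by (simp only: integral_mult_right_zero mult_zero_right)
    moreover have "integrable lborel (\<lambda>x. cnj (D y) * ?h x)"
      using kN[of N] by (intro integrable_mult_right integrable_Q) (auto simp: fourier_null_def)
    ultimately have Re0: "(\<integral>x. Re (cnj (D y) * ?h x) \<partial>lborel) = 0" using integral_Re by (metis zero_complex.simps(1))
    have eq: "Re (cnj (D y) * ?h x) = indicator Q x *\<^sub>R (r x * q x ^ N)" for x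
    proof -
      have "cnj (D y) * ?h x = (cnj (D y) * D x) * of_real (indicator Q x * q x ^ N)"
        by (simp add: scaleR_conv_of_real)
      then have "Re (cnj (D y) * ?h x) = r x * (indicator Q x * q x ^ N)"
        unfolding r_def by (simp only: times_complex.sel Re_complex_of_real Im_complex_of_real mult_zero_right diff_zero)
      then show ?thesis by simp
    qed
    from Re0 show ?thesis unfolding eq .
  qed
  define d0 where "d0 = Min (range (\<lambda>i. pi * \<rho> - \<bar>y $ i - z $ i\<bar>))"
  have d0: "d0 > 0" unfolding d0_def using y by (subst Min_gr_iff) auto
  have bQ: "ball y d0 \<subseteq> Q"
  proof
    fix x assume x: "x \<in> ball y d0"
    have "\<bar>x $ i - z $ i\<bar> \<le> pi * \<rho>" for i
    proof -
      have "\<bar>x $ i - y $ i\<bar> < d0"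
        using x component_le_norm_cart[of "x - y" i] by (simp add: dist_norm norm_minus_commute)
      moreover have "d0 \<le> pi * \<rho> - \<bar>y $ i - z $ i\<bar>" unfolding d0_def by (intro Min_le) auto
      ultimately show ?thesis by linarith
    qed
    then show "x \<in> Q" by (simp add: Q_iff)
  qed
  have cr: "continuous_on Q r" unfolding r_def by (intro continuous_intros cD)
  have cq: "continuous_on Q q" unfolding q_def using rho by (intro continuous_intros) auto
  have ry: "r y > 0" using Dy by (simp add: r_def complex_mult_cnj mult.commute[of "cnj _"] sum_power2_gt_zero_iff complex_eq_iff power2_eq_square[symmetric])
  have factor: "0 \<le> (1 + cos t) / 2" for t :: real
    using cos_ge_minus_one[of t] by (simp add: real_0_le_add_iff)
  have factor': "(1 + cos t) / 2 \<le> 1" for t :: real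
    using cos_le_one[of t] by simp
  have q0: "0 \<le> q x" for x unfolding q_def by (intro prod_nonneg ballI factor)
  have q1: "q x < 1" if x: "x \<in> Q" "x \<noteq> y" for x
  proof -
    obtain i where i: "x $ i \<noteq> y $ i" using x by (auto simp: vec_eq_iff)
    let ?t = "(x $ i - y $ i) / \<rho>"
    \<comment> \<open>Here it matters that \<open>y\<close> lies strictly inside the cube: a
      distance of a full period 2\<pi>\<rho> would give a second maximum of the cosine.\<close>
    have "\<bar>x $ i - y $ i\<bar> < 2 * (pi * \<rho>)" using x y[of i] unfolding Q_iff by (smt (verit))
    then have t: "\<bar>?t\<bar> < 2 * pi" using rho by (simp add: abs_divide field_simps)
    have "cos ?t \<noteq> 1"
    proof
      assume "cos ?t = 1"
      then obtain m :: int where m: "?t = of_int m * 2 * pi" using cos_one_2pi_int by blast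
      then have "\<bar>of_int m :: real\<bar> < 1" using t by (simp add: abs_mult)
      then have "m = 0" by linarith
      then show False using m i rho by simp
    qed
    then have c1: "(1 + cos ?t) / 2 < 1" using cos_le_one[of ?t] by (simp add: less_le)
    have "q x = (1 + cos ?t) / 2 * (\<Prod>i\<in>UNIV - {i}. (1 + cos ((x $ i - y $ i) / \<rho>)) / 2)"
      unfolding q_def by (rule prod.remove) auto
    also have "\<dots> \<le> (1 + cos ?t) / 2 * 1"
      by (intro mult_left_mono prod_le_1 conjI factor factor')
    finally show ?thesis using c1 by simp
  qed
  have qy: "q y = 1" by (simp add: q_def)
  from peak[OF measure_Q(4) d0 bQ cr ry cq qy q0 q1] rq0 show False by (metis less_irrefl)
qed

text \<open>The series and the function have the same lattice coefficients over the cube, by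
  orthogonality and termwise integration, so their difference is
  \<open>fourier_null\<close>.\<close>

lemma inversion:
  assumes f: "f \<in> smooth_fns UNIV" "supp_cball z (2 * \<rho>) f" and y: "\<And>i. \<bar>y $ i - z $ i\<bar> < pi * \<rho>"
  shows "wave_series z (fourier_coeff f) lat y = f y"
proof -
  have ra: "rapid (fourier_coeff f) lat" by (rule rapid_fourier_coeff[OF f])
  let ?D = "\<lambda>x. 1 * wave_series z (fourier_coeff f) lat x + (- 1) * f x"
  have cs: "continuous_on UNIV (wave_series z (fourier_coeff f) lat)" by (rule smooth_continuous_on[OF smooth_wave_series[OF ra]])
  have cf: "continuous_on UNIV f" by (rule smooth_continuous_on[OF f(1)])
  have "fourier_null ?D"
    unfolding fourier_null_def
  proof (intro conjI allI)
    show "continuous_on UNIV ?D" by (intro continuous_intros cs cf)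
    fix k
    let ?w = "\<lambda>x. indicator Q x *\<^sub>R wave z (lat k) x"
    have w: "integrable lborel ?w" by (intro integrable_Q wave_continuous)
    have fQ: "indicator Q x *\<^sub>R (f x * wave z (lat k) x) = f x * wave z (lat k) x" for x
    proof (cases "x \<in> Q")
      case False
      then have "2 * \<rho> < dist z x" using cball_Q by (meson mem_cball not_le subsetD)
      then show ?thesis using f(2) False by (simp add: supp_cball_def)
    qed simp
    have "(\<integral>x. ?w x * wave_series z (fourier_coeff f) lat x \<partial>lborel) = (\<Sum>\<^sub>\<infinity>l. fourier_coeff f l * (\<integral>x. ?w x * wave z (lat l) x \<partial>lborel))"
      by (rule integral_wave_series(1)[OF ra w])
    also have "(\<lambda>l. fourier_coeff f l * (\<integral>x. ?w x * wave z (lat l) x \<partial>lborel)) = (\<lambda>l. if l = neg k then fourier_coeff f l * of_real vol else 0)"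
    proof
      fix l
      have "(\<integral>x. ?w x * wave z (lat l) x \<partial>lborel) = (\<integral>x. indicator Q x *\<^sub>R wave z (lat (\<lambda>i. k i + l i)) x \<partial>lborel)"
        by (simp add: lat_add wave_add)
      also have "\<dots> = (if l = neg k then of_real vol else 0)"
        unfolding integral_Q_wave neg_def by (auto simp: fun_eq_iff eq_neg_iff_add_eq_0 add.commute)
      finally show "fourier_coeff f l * (\<integral>x. ?w x * wave z (lat l) x \<partial>lborel) = (if l = neg k then fourier_coeff f l * of_real vol else 0)" by simp
    qed
    also have "(\<Sum>\<^sub>\<infinity>l. if l = neg k then fourier_coeff f l * of_real vol else 0) = (\<Sum>\<^sub>\<infinity>l\<in>{neg k}. fourier_coeff f l * of_real vol)"
      by (rule infsum_cong_neutral) auto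
    also have "\<dots> = (\<integral>x. f x * wave z (lat k) x \<partial>lborel)"
      using vol_pos by (simp add: fourier_coeff_def)
    finally have 1: "(\<integral>x. ?w x * wave_series z (fourier_coeff f) lat x \<partial>lborel) = (\<integral>x. f x * wave z (lat k) x \<partial>lborel)" .
    have "(\<integral>x. indicator Q x *\<^sub>R (?D x * wave z (lat k) x) \<partial>lborel)
      = (\<integral>x. ?w x * wave_series z (fourier_coeff f) lat x - f x * wave z (lat k) x \<partial>lborel)"
      by (intro Bochner_Integration.integral_cong refl) (use fQ in \<open>auto simp: algebra_simps\<close>)
    also have "\<dots> = 0"
      by (subst Bochner_Integration.integral_diff)
         (rule integral_wave_series(3)[OF ra w], rule smooth_supp_cball_integrable_wave[OF f], simp only: 1 diff_self)
    finally show "(\<integral>x. indicator Q x *\<^sub>R (?D x * wave z (lat k) x) \<partial>lborel) = 0" .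
  qed
  from fourier_null_zero[OF this y] show ?thesis by simp
qed

end

subsection \<open>Neumann series for convolution-dominated matrices\<close>

definition matrix_op :: "('k \<Rightarrow> 'k \<Rightarrow> complex) \<Rightarrow> ('k \<Rightarrow> complex) \<Rightarrow> 'k \<Rightarrow> complex" where
  "matrix_op A h k = (\<Sum>\<^sub>\<infinity>l. A k l * h l)"

text \<open>The sign sits inside the iterates, so this inverts 1 + A rather than 1 - A.\<close>

definition neumann_sol :: "('k \<Rightarrow> 'k \<Rightarrow> complex) \<Rightarrow> ('k \<Rightarrow> complex) \<Rightarrow> 'k \<Rightarrow> complex" where
  "neumann_sol A f k = (\<Sum>\<^sub>\<infinity>p. ((\<lambda>h k. - matrix_op A h k) ^^ p) f k)"

text \<open>A Schur-type condition: the matrix is dominated by convolution with \<beta>, whose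
  weighted l1 norm is at most 1/2. Submultiplicativity of \<omega> transfers the weight from column
  to row, so the matrix halves the weighted supremum norm.\<close>

locale contraction =
  fixes A :: "('n \<Rightarrow> int) \<Rightarrow> ('n \<Rightarrow> int) \<Rightarrow> complex" and \<beta> \<omega> :: "('n \<Rightarrow> int) \<Rightarrow> real"
  assumes A_le: "cmod (A k l) \<le> \<beta> (\<lambda>i. k i - l i)"
    and summ: "(\<lambda>m. \<beta> m * \<omega> m) summable_on UNIV"
    and half: "(\<Sum>\<^sub>\<infinity>m. \<beta> m * \<omega> m) \<le> 1 / 2"
    and w1: "\<omega> m \<ge> 1"
    and wsub: "\<omega> (\<lambda>i. k i + l i) \<le> \<omega> k * \<omega> l"
begin

lemma bij_diff: "bij_betw (\<lambda>l i. k i - l i) UNIV (UNIV :: ('n \<Rightarrow> int) set)"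
  by (rule bij_betwI[of _ _ _ "\<lambda>l i. k i - l i"]) auto

lemma summ_shift: "(\<lambda>l. \<beta> (\<lambda>i. k i - l i) * \<omega> (\<lambda>i. k i - l i)) summable_on UNIV"
  "(\<Sum>\<^sub>\<infinity>l. \<beta> (\<lambda>i. k i - l i) * \<omega> (\<lambda>i. k i - l i)) \<le> 1 / 2"
  using summable_on_reindex_bij_betw[OF bij_diff, of "\<lambda>m. \<beta> m * \<omega> m" k] summ
    infsum_reindex_bij_betw[OF bij_diff, of "\<lambda>m. \<beta> m * \<omega> m" k] half by auto

lemma term_le:
  assumes "cmod (h l) * \<omega> l \<le> M"
  shows "cmod (A k l * h l) \<le> M / \<omega> k * (\<beta> (\<lambda>i. k i - l i) * \<omega> (\<lambda>i. k i - l i))"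
proof -
  have w0: "\<omega> m > 0" for m using w1[of m] by linarith
  have b0: "0 \<le> \<beta> (\<lambda>i. k i - l i)" using A_le[of k l] norm_ge_zero order_trans by blast
  have "\<omega> (\<lambda>i. (k i - l i) + l i) \<le> \<omega> (\<lambda>i. k i - l i) * \<omega> l" by (rule wsub)
  then have w: "\<omega> k \<le> \<omega> (\<lambda>i. k i - l i) * \<omega> l" by simp
  have "cmod (h l) * \<omega> k \<le> cmod (h l) * (\<omega> (\<lambda>i. k i - l i) * \<omega> l)" by (intro mult_left_mono w) auto
  also have "\<dots> = (cmod (h l) * \<omega> l) * \<omega> (\<lambda>i. k i - l i)" by simp
  also have "\<dots> \<le> M * \<omega> (\<lambda>i. k i - l i)" using assms w0 by (intro mult_right_mono) (auto intro: less_imp_le)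
  finally have "cmod (h l) \<le> M * \<omega> (\<lambda>i. k i - l i) / \<omega> k" using w0[of k] by (simp add: field_simps)
  then have "cmod (A k l) * cmod (h l) \<le> \<beta> (\<lambda>i. k i - l i) * (M * \<omega> (\<lambda>i. k i - l i) / \<omega> k)"
    by (intro mult_mono A_le b0) auto
  then show ?thesis by (simp add: norm_mult field_simps)
qed

lemma matrix_op_bound:
  assumes "\<And>l. cmod (h l) * \<omega> l \<le> M"
  shows "(\<lambda>l. A k l * h l) summable_on UNIV" "cmod (matrix_op A h k) * \<omega> k \<le> M / 2"
proof -
  let ?g = "\<lambda>l. M / \<omega> k * (\<beta> (\<lambda>i. k i - l i) * \<omega> (\<lambda>i. k i - l i))"
  have w0: "\<omega> k > 0" using w1[of k] by linarith
  have M0: "M \<ge> 0" using assms[of k] w0 by (meson less_imp_le mult_nonneg_nonneg norm_ge_zero order_trans)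
  have g: "?g summable_on UNIV" by (intro summable_on_cmult_right summ_shift)
  show "(\<lambda>l. A k l * h l) summable_on UNIV"
    by (rule summable_comparison(1)[OF g]) (rule term_le[OF assms])
  have "cmod (matrix_op A h k) \<le> (\<Sum>\<^sub>\<infinity>l. ?g l)"
    unfolding matrix_op_def by (rule summable_comparison(2)[OF g]) (rule term_le[OF assms])
  also have "\<dots> = M / \<omega> k * (\<Sum>\<^sub>\<infinity>l. \<beta> (\<lambda>i. k i - l i) * \<omega> (\<lambda>i. k i - l i))"
    by (intro infsum_cmult_right summ_shift)
  also have "\<dots> \<le> M / \<omega> k * (1 / 2)" using M0 w0 by (intro mult_left_mono summ_shift) auto
  finally show "cmod (matrix_op A h k) * \<omega> k \<le> M / 2" using w0 by (simp add: field_simps)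
qed

abbreviation it where "it p f \<equiv> ((\<lambda>h k. - matrix_op A h k) ^^ p) f"

lemma it_bound:
  assumes "\<And>l. cmod (f l) * \<omega> l \<le> M"
  shows "cmod (it p f k) * \<omega> k \<le> M * (1 / 2) ^ p"
proof (induction p arbitrary: k)
  case (Suc p)
  show ?case using matrix_op_bound(2)[OF Suc.IH, of k] by simp
qed (use assms in simp)

lemma half_powers: "(\<lambda>p. c * (1 / 2) ^ p :: real) summable_on UNIV" "(\<Sum>\<^sub>\<infinity>p. c * (1 / 2) ^ p :: real) = c * 2"
proof -
  have "(\<lambda>p. (1 / 2) ^ p :: real) summable_on UNIV"
    by (subst summable_on_UNIV_nonneg_real_iff) (auto intro: summable_geometric)
  moreover have "(\<Sum>\<^sub>\<infinity>p. (1 / 2) ^ p :: real) = 2"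
    using has_sum_imp_sums[OF has_sum_infsum[OF calculation]] geometric_sums[of "1/2 :: real"] sums_unique2 by fastforce
  ultimately show "(\<lambda>p. c * (1 / 2) ^ p :: real) summable_on UNIV" "(\<Sum>\<^sub>\<infinity>p. c * (1 / 2) ^ p :: real) = c * 2"
    by (auto intro: summable_on_cmult_right simp: infsum_cmult_right)
qed

lemma it_summable:
  assumes "\<And>l. cmod (f l) * \<omega> l \<le> M"
  shows "(\<lambda>p. it p f k) summable_on UNIV" "cmod (neumann_sol A f k) * \<omega> k \<le> 2 * M"
proof -
  have w0: "\<omega> k > 0" using w1[of k] by linarith
  have b: "cmod (it p f k) \<le> M / \<omega> k * (1 / 2) ^ p" for p
    using it_bound[OF assms, of p k] w0 by (simp add: field_simps)
  show "(\<lambda>p. it p f k) summable_on UNIV" by (rule summable_comparison(1)[OF half_powers(1) b])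
  have "cmod (neumann_sol A f k) \<le> M / \<omega> k * 2"
    unfolding neumann_sol_def using summable_comparison(2)[OF half_powers(1) b] unfolding half_powers(2) .
  then show "cmod (neumann_sol A f k) * \<omega> k \<le> 2 * M" using w0 by (simp add: field_simps)
qed

text \<open>Applying the matrix to the Neumann series shifts it by one term. The interchange of the
  two sums is justified by the majorant that is the product of the weighted kernel and a geometric
  series.\<close>

lemma neumann_sol_eq:
  fixes k :: "'n \<Rightarrow> int"
  assumes "\<And>l. cmod (f l) * \<omega> l \<le> M"
  shows "neumann_sol A f k + matrix_op A (neumann_sol A f) k = f k"
proof -
  have w0: "\<omega> k > 0" using w1[of k] by linarith
  let ?g = "\<lambda>l. \<beta> (\<lambda>i. k i - l i) * \<omega> (\<lambda>i. k i - l i)"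
  have t: "norm (A k l * it p f l) \<le> (M / \<omega> k) * (?g l * (1 / 2) ^ p)" for l p
    using term_le[where h="it p f" and l=l and k=k, OF it_bound[OF assms]] by (simp add: field_simps)
  have g0: "?g l \<ge> 0" for l
    using A_le[of k l] norm_ge_zero[of "A k l"] w1[of "\<lambda>i. k i - l i"] by (intro mult_nonneg_nonneg) linarith+
  have "(\<lambda>(l, p). ?g l * (1 / 2 :: real) ^ p) summable_on (UNIV \<times> UNIV)"
  proof (rule summable_on_SigmaI[where g="\<lambda>l. ?g l * 2"])
    show "((\<lambda>p. case (l, p) of (l, p) \<Rightarrow> ?g l * (1 / 2 :: real) ^ p) has_sum ?g l * 2) UNIV" for l
      using half_powers[of "?g l"] by (simp add: has_sum_iff)
    show "(\<lambda>l. ?g l * 2) summable_on UNIV" by (intro summable_on_cmult_left summ_shift)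
    show "0 \<le> (case (l, p) of (l, p) \<Rightarrow> ?g l * (1 / 2 :: real) ^ p)" for l p using g0[of l] by simp
  qed
  then have "(\<lambda>x. (M / \<omega> k) * (case x of (l, p) \<Rightarrow> ?g l * (1 / 2 :: real) ^ p)) summable_on (UNIV \<times> UNIV)"
    by (rule summable_on_cmult_right)
  then have sw: "(\<lambda>(l, p). A k l * it p f l) summable_on (UNIV \<times> UNIV)"
    by (rule summable_comparison(1)) (use t in auto)
  have "matrix_op A (neumann_sol A f) k = (\<Sum>\<^sub>\<infinity>l. \<Sum>\<^sub>\<infinity>p. A k l * it p f l)"
    unfolding matrix_op_def neumann_sol_def by (simp add: infsum_cmult_right' )
  also have "\<dots> = (\<Sum>\<^sub>\<infinity>p. \<Sum>\<^sub>\<infinity>l. A k l * it p f l)"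
    by (rule infsum_swap_banach) (use sw in simp)
  also have "\<dots> = (\<Sum>\<^sub>\<infinity>p. - it (Suc p) f k)" by (simp add: matrix_op_def)
  also have "\<dots> = - (\<Sum>\<^sub>\<infinity>p. it (Suc p) f k)" by (rule infsum_uminus)
  also have "(\<Sum>\<^sub>\<infinity>p. it (Suc p) f k) = neumann_sol A f k - f k"
  proof -
    have s: "(\<lambda>p. it p f k) summable_on S" for S
      using it_summable(1)[OF assms] summable_on_subset_banach by blast
    have e: "{0} \<union> range Suc = (UNIV :: nat set)" using UNIV_nat_eq by simp
    have "neumann_sol A f k = (\<Sum>\<^sub>\<infinity>p\<in>{0} \<union> range Suc. it p f k)"
      by (simp only: neumann_sol_def e)
    also have "\<dots> = (\<Sum>\<^sub>\<infinity>p\<in>{0}. it p f k) + (\<Sum>\<^sub>\<infinity>p\<in>range Suc. it p f k)"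
      by (rule infsum_Un_disjoint) (use s in auto)
    also have "(\<Sum>\<^sub>\<infinity>p\<in>range Suc. it p f k) = (\<Sum>\<^sub>\<infinity>p. it (Suc p) f k)"
      by (subst infsum_reindex) (auto simp: o_def)
    finally show ?thesis by simp
  qed
  finally show ?thesis by simp
qed

text \<open>The equation says that \<open>h\<close> is minus its own image, so any bound for its
  weighted supremum can be halved indefinitely.\<close>

lemma unique_zero:
  assumes b: "\<And>l. cmod (h l) * \<omega> l \<le> M" and eq: "\<And>k. h k + matrix_op A h k = 0"
  shows "h k = 0"
proof -
  have "cmod (h k) * \<omega> k \<le> M * (1 / 2) ^ n" for n k
  proof (induction n arbitrary: k)
    case (Suc n)
    have "cmod (h k) = cmod (matrix_op A h k)" using eq[of k] by (simp add: add_eq_0_iff2)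
    then show ?case using matrix_op_bound(2)[OF Suc.IH, of k] by simp
  qed (use b in simp)
  moreover have "(\<lambda>n. M * (1 / 2) ^ n) \<longlonglongrightarrow> M * 0"
    by (intro tendsto_intros LIMSEQ_power_zero) auto
  ultimately have "cmod (h k) * \<omega> k \<le> 0"
    by (intro tendsto_lowerbound[of "\<lambda>n. M * (1 / 2) ^ n" 0 sequentially]) auto
  then show ?thesis using w1[of k] by (simp add: mult_le_0_iff)
qed

lemma unique:
  assumes b: "\<And>l. cmod (h l) * \<omega> l \<le> M" and f: "\<And>l. cmod (f l) * \<omega> l \<le> M'" and eq: "\<And>k. h k + matrix_op A h k = f k"
  shows "h = neumann_sol A f"
proof
  fix k
  let ?d = "\<lambda>k. h k - neumann_sol A f k"
  have nb: "\<And>l. cmod (neumann_sol A f l) * \<omega> l \<le> 2 * M'" by (rule it_summable(2)[OF f])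
  have "?d k = 0"
  proof (rule unique_zero)
    fix l
    have "cmod (?d l) * \<omega> l \<le> (cmod (h l) + cmod (neumann_sol A f l)) * \<omega> l"
      using w1[of l] by (intro mult_right_mono norm_triangle_ineq4) auto
    then show "cmod (?d l) * \<omega> l \<le> M + 2 * M'" using b[of l] nb[of l] by (simp add: algebra_simps)
    have "matrix_op A ?d l = matrix_op A h l - matrix_op A (neumann_sol A f) l"
      unfolding matrix_op_def right_diff_distrib by (rule summable_on_minus(2)[OF matrix_op_bound(1)[OF b] matrix_op_bound(1)[OF nb]])
    then show "?d l + matrix_op A ?d l = 0" using eq[of l] neumann_sol_eq[OF f, of l] by algebra
  qed
  then show "h k = neumann_sol A f k" by simp
qed

text \<open>By uniqueness: the combination of the two solutions is bounded and solves the equation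
  with the combined right-hand side.\<close>

lemma neumann_sol_lin:
  assumes f: "\<And>l. cmod (f l) * \<omega> l \<le> M" and g: "\<And>l. cmod (g l) * \<omega> l \<le> M'"
  shows "neumann_sol A (\<lambda>k. a * f k + b * g k) = (\<lambda>k. a * neumann_sol A f k + b * neumann_sol A g k)"
proof (rule unique[symmetric])
  have w: "0 \<le> \<omega> l" for l using w1[of l] by linarith
  have lin: "cmod (a * x + b * y) * \<omega> l \<le> cmod a * K + cmod b * K'" if "cmod x * \<omega> l \<le> K" "cmod y * \<omega> l \<le> K'" for x y K K' l
  proof -
    have "cmod (a * x + b * y) * \<omega> l \<le> (cmod a * cmod x + cmod b * cmod y) * \<omega> l"
      by (intro mult_right_mono w) (metis norm_mult norm_triangle_ineq)
    also have "\<dots> = cmod a * (cmod x * \<omega> l) + cmod b * (cmod y * \<omega> l)" by (simp add: algebra_simps)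
    also have "\<dots> \<le> cmod a * K + cmod b * K'" using that by (intro add_mono mult_left_mono) auto
    finally show ?thesis .
  qed
  note nf = it_summable(2)[OF f] and ng = it_summable(2)[OF g]
  show "cmod (a * neumann_sol A f l + b * neumann_sol A g l) * \<omega> l \<le> cmod a * (2 * M) + cmod b * (2 * M')" for l
    by (rule lin[OF nf ng])
  show "cmod (a * f l + b * g l) * \<omega> l \<le> cmod a * M + cmod b * M'" for l by (rule lin[OF f g])
  fix k
  have "matrix_op A (\<lambda>k. a * neumann_sol A f k + b * neumann_sol A g k) k = (\<Sum>\<^sub>\<infinity>l. a * (A k l * neumann_sol A f l) + b * (A k l * neumann_sol A g l))"
    unfolding matrix_op_def by (simp add: algebra_simps)
  also have "\<dots> = a * matrix_op A (neumann_sol A f) k + b * matrix_op A (neumann_sol A g) k"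
    unfolding matrix_op_def
    by (subst infsum_add) (auto intro!: summable_on_cmult_right matrix_op_bound(1)[OF nf] matrix_op_bound(1)[OF ng] simp: infsum_cmult_right')
  finally show "a * neumann_sol A f k + b * neumann_sol A g k + matrix_op A (\<lambda>k. a * neumann_sol A f k + b * neumann_sol A g k) k = a * f k + b * g k"
    using neumann_sol_eq[OF f, of k] neumann_sol_eq[OF g, of k] by (simp add: algebra_simps flip: distrib_left)
qed

end

text \<open>
  A matrix that is small in the unweighted norm is a contraction for the weight \<open>W h ^ s\<close> if \<open>h\<close>
  is small enough, whatever \<open>s\<close> is; this is why the radius \<open>\<delta>\<close> does not depend on the regularity.
\<close>

definition wsum :: "'n::finite itself \<Rightarrow> real" where
  "wsum _ = (\<Sum>\<^sub>\<infinity>k :: 'n \<Rightarrow> int. 1 / W 1 k ^ 2)"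

text \<open>The constant \<open>c\<close> has to be small and belongs to the exponent 2, at which
  the lattice sum converges; the constants \<open>M s\<close> may be large. Both are fixed for a
  whole family of matrices.\<close>

definition decay_class :: "real \<Rightarrow> (nat \<Rightarrow> real) \<Rightarrow> (('n::finite \<Rightarrow> int) \<Rightarrow> ('n \<Rightarrow> int) \<Rightarrow> complex) \<Rightarrow> bool" where
  "decay_class c M A \<longleftrightarrow> (\<forall>k l. cmod (A k l) \<le> c / W 1 (\<lambda>i. k i - l i) ^ 2) \<and>
     (\<forall>s k l. cmod (A k l) * W 1 (\<lambda>i. k i - l i) ^ s \<le> M s)"

lemma decay_class_transpose: "decay_class c M A \<Longrightarrow> decay_class c M (\<lambda>k l. A l k)"
proof -
  have "W 1 (\<lambda>i. k i - l i) = W 1 (\<lambda>i. l i - k i)" for k l :: "'a \<Rightarrow> int"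
    using W_minus[of 1 "\<lambda>i. k i - l i"] by simp
  then show "decay_class c M A \<Longrightarrow> decay_class c M (\<lambda>k l. A l k)" unfolding decay_class_def by metis
qed

lemma W_mono_h: "0 \<le> h \<Longrightarrow> h \<le> h' \<Longrightarrow> W h k \<le> W h' k"
  unfolding W_def by (intro prod_mono) (auto intro: mult_right_mono add_nonneg_nonneg)

lemma W_1_le:
  fixes k :: "'n::finite \<Rightarrow> int"
  assumes "0 < h" "h \<le> 1"
  shows "W 1 k \<le> W h k / h ^ CARD('n)"
proof -
  have "W 1 k \<le> (\<Prod>i\<in>(UNIV :: 'n set). (1 + h * \<bar>real_of_int (k i)\<bar>) / h)"
    unfolding W_def using assms by (intro prod_mono) (auto simp: field_simps)
  also have "\<dots> = W h k / h ^ CARD('n)" by (simp add: W_def prod_dividef)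
  finally show ?thesis .
qed

text \<open>Outside a finite set of lattice points the decay of high order makes the kernel sum
  small, and on that set the weight tends to 1 as \<open>h\<close> tends to 0. Since
  \<open>h\<close> and \<beta> depend only on \<open>c\<close>, \<open>M\<close> and
  \<open>s\<close>, they serve all matrices of the class.\<close>

lemma decay_class_contraction:
  fixes M :: "nat \<Rightarrow> real"
  assumes c: "c \<ge> 0" "c * wsum TYPE('n::finite) \<le> 1 / 4"
  obtains h \<beta> where "0 < h" "h \<le> 1"
    "\<And>A :: ('n \<Rightarrow> int) \<Rightarrow> ('n \<Rightarrow> int) \<Rightarrow> complex. decay_class c M A \<Longrightarrow> contraction A \<beta> (\<lambda>k. W h k ^ s)"
proof -
  define K where "K = max 0 (M (s + 2))"
  \<comment> \<open>The first entry provides smallness, the second enough decay to survive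
    multiplication by the weight to the power \<open>s\<close>.\<close>
  define \<beta> where "\<beta> m = min (c / W 1 m ^ 2) (K / W 1 m ^ (s + 2))" for m :: "'n \<Rightarrow> int"
  have W1: "W 1 m \<ge> 1" "W 1 m > 0" for m :: "'n \<Rightarrow> int" using W_ge_1[of 1 m] by auto
  have b0: "\<beta> m \<ge> 0" for m using c W1[of m] by (simp add: \<beta>_def K_def)
  let ?u = "\<lambda>m :: 'n \<Rightarrow> int. K * (1 / W 1 m ^ 2)"
  have su: "?u summable_on S" for S
    using summable_on_cmult_right[OF summable_W] summable_on_subset_banach by blast
  have bW: "\<beta> m * W h m ^ s \<le> ?u m" if "0 \<le> h" "h \<le> 1" for h m
  proof -
    have "\<beta> m * W h m ^ s \<le> (K / W 1 m ^ (s + 2)) * W 1 m ^ s"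
      using that W_ge_1[of h m] W_mono_h[of h 1 m] b0[of m] by (intro mult_mono power_mono) (auto simp: \<beta>_def)
    also have "\<dots> = ?u m" using W1[of m] by (simp add: power_add power2_eq_square field_simps)
    finally show ?thesis .
  qed
  have "\<forall>\<^sub>F F in finite_subsets_at_top UNIV. dist (sum ?u F) (infsum ?u UNIV) < 1 / 8"
    using infsum_tendsto[OF su[of UNIV]] by (rule tendstoD) simp
  \<comment> \<open>This choice precedes that of \<open>h\<close>: the majorant \<open>?u\<close>
    bounds the weighted kernel for every \<open>h\<close> in the unit interval, so \<open>F\<close>
    need not be adapted to \<open>h\<close>.\<close>
  then obtain F where F: "finite F" "dist (sum ?u F) (infsum ?u UNIV) < 1 / 8"
    unfolding eventually_finite_subsets_at_top by blast
  have "infsum ?u (F \<union> -F) = sum ?u F + infsum ?u (-F)"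
    by (subst infsum_Un_disjoint) (use F su in auto)
  then have tail: "infsum ?u (-F) \<le> 1 / 8" using F(2) by (simp add: dist_real_def)
  have "\<forall>\<^sub>F h in at_right 0. \<forall>m\<in>F. W h m ^ s < 3 / 2"
    unfolding eventually_ball_finite_distrib[OF F(1)]
  proof
    fix m
    have "((\<lambda>h. W h m ^ s) \<longlongrightarrow> W 0 m ^ s) (at_right 0)"
      unfolding W_def by (intro tendsto_intros)
    moreover have "W 0 m ^ s < 3 / 2" by (simp add: W_def)
    ultimately show "\<forall>\<^sub>F h in at_right 0. W h m ^ s < 3 / 2" by (rule order_tendstoD)
  qed
  moreover have "\<forall>\<^sub>F h in at_right 0. 0 < h \<and> h < (1::real)" by (rule eventually_at_right_unit)
  ultimately have "\<forall>\<^sub>F h in at_right 0. (0 < h \<and> h < (1::real)) \<and> (\<forall>m\<in>F. W h m ^ s < 3 / 2)"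
    by eventually_elim auto
  then obtain h where h: "0 < h" "h < 1" "\<And>m. m \<in> F \<Longrightarrow> W h m ^ s < 3 / 2"
    using eventually_happens'[OF trivial_limit_at_right_real] by blast
  let ?b = "\<lambda>m. \<beta> m * W h m ^ s"
  have Wh: "W h m \<ge> 1" for m :: "'n \<Rightarrow> int" using h by (simp add: W_ge_1)
  have sb: "?b summable_on S" for S
  proof (rule summable_comparison(1)[OF su])
 fix m :: "'n \<Rightarrow> int"
    have "0 \<le> W h m ^ s" using Wh[of m] by (intro zero_le_power) linarith
    then show "norm (?b m) \<le> ?u m" using bW[of h m] h b0[of m] by (simp add: abs_mult)
  qed
  have "infsum ?b (F \<union> -F) = sum ?b F + infsum ?b (-F)"
    by (subst infsum_Un_disjoint) (use F sb in auto)
  moreover have "infsum ?b (-F) \<le> infsum ?u (-F)" using h by (intro infsum_mono sb su bW) auto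
  moreover have "sum ?b F \<le> (\<Sum>m\<in>F. (3 / 2) * (c * (1 / W 1 m ^ 2)))"
  proof (rule sum_mono)
    fix m assume "m \<in> F"
    then have "?b m \<le> (c / W 1 m ^ 2) * (3 / 2)"
      using h(3) b0 Wh[of m] c by (intro mult_mono) (auto simp: \<beta>_def less_imp_le)
    then show "?b m \<le> (3 / 2) * (c * (1 / W 1 m ^ 2))" by simp
  qed
  moreover have "(\<Sum>m\<in>F. (3 / 2) * (c * (1 / W 1 m ^ 2))) = (3 / 2) * (c * (\<Sum>m\<in>F. 1 / W 1 m ^ 2))" by (simp add: sum_distrib_left)
  moreover have "c * (\<Sum>m\<in>F. 1 / W 1 m ^ 2) \<le> c * wsum TYPE('n)"
    unfolding wsum_def using W1 c by (intro mult_left_mono finite_sum_le_infsum summable_W F) auto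
  ultimately have "infsum ?b UNIV \<le> (3 / 2) * (c * wsum TYPE('n)) + infsum ?u (-F)"
    by simp
  \<comment> \<open>The finite part contributes at most 3/2 times 1/4 and the tail at most 1/8,
    which together make exactly 1/2.\<close>
  then have hb: "infsum ?b UNIV \<le> 1 / 2" using tail c by linarith
  show ?thesis
  proof (rule that[of h \<beta>])
    fix A :: "('n \<Rightarrow> int) \<Rightarrow> ('n \<Rightarrow> int) \<Rightarrow> complex" assume A: "decay_class c M A"
    show "contraction A \<beta> (\<lambda>k. W h k ^ s)"
    proof
      fix k l
      have "cmod (A k l) * W 1 (\<lambda>i. k i - l i) ^ (s + 2) \<le> K" using A unfolding decay_class_def K_def by (meson max.coboundedI2)
      then show "cmod (A k l) \<le> \<beta> (\<lambda>i. k i - l i)"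
        using A W1[of "\<lambda>i. k i - l i"] by (simp add: decay_class_def \<beta>_def pos_le_divide_eq)
      show "W h (\<lambda>i. k i + l i) ^ s \<le> W h k ^ s * W h l ^ s"
        unfolding power_mult_distrib[symmetric] using h W_submult[of h k l] Wh[of "\<lambda>i. k i + l i"]
        by (intro power_mono) auto
    qed (use sb hb Wh in auto)
  qed (use h in auto)
qed

text \<open>Weights with different \<open>h\<close> are equivalent up to powers of \<open>h\<close>,
  so the bound in the slow weight becomes one in \<open>W 1\<close> at the price of a constant. This
  constant is uniform over the class.\<close>

lemma neumann_sol_W_bound:
  fixes M :: "nat \<Rightarrow> real"
  assumes c: "c \<ge> 0" "c * wsum TYPE('n::finite) \<le> 1 / 4"
  obtains C where "C \<ge> 0"
    "\<And>A f K (k :: 'n \<Rightarrow> int). decay_class c M A \<Longrightarrow> (\<And>k. cmod (f k) * W 1 k ^ s \<le> K) \<Longrightarrow> cmod (neumann_sol A f k) * W 1 k ^ s \<le> C * K"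
proof -
  obtain h \<beta> where h: "0 < h" "h \<le> 1"
    and cutoff: "\<And>A :: ('n \<Rightarrow> int) \<Rightarrow> ('n \<Rightarrow> int) \<Rightarrow> complex. decay_class c M A \<Longrightarrow> contraction A \<beta> (\<lambda>k. W h k ^ s)"
    using decay_class_contraction[OF c, of M s] by blast
  let ?C = "2 / (h ^ CARD('n)) ^ s"
  show ?thesis
  proof (rule that[of ?C])
    fix A :: "('n \<Rightarrow> int) \<Rightarrow> ('n \<Rightarrow> int) \<Rightarrow> complex" and f K and k :: "'n \<Rightarrow> int"
    assume A: "decay_class c M A" and f: "\<And>k :: 'n \<Rightarrow> int. cmod (f k) * W 1 k ^ s \<le> K"
    interpret contraction A \<beta> "\<lambda>k. W h k ^ s" by (rule cutoff[OF A])
    have "cmod (f k) * W h k ^ s \<le> K" for k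
    proof -
      have "cmod (f k) * W h k ^ s \<le> cmod (f k) * W 1 k ^ s"
        using h W_ge_1[of h k] by (intro mult_left_mono power_mono W_mono_h) auto
      then show ?thesis using f[of k] by linarith
    qed
    from it_summable(2)[OF this] have b: "cmod (neumann_sol A f k) * W h k ^ s \<le> 2 * K" .
    have "W 1 k ^ s \<le> (W h k / h ^ CARD('n)) ^ s"
      using W_ge_1[of 1 k] by (intro power_mono W_1_le h) auto
    then have "cmod (neumann_sol A f k) * W 1 k ^ s \<le> cmod (neumann_sol A f k) * (W h k ^ s / (h ^ CARD('n)) ^ s)"
      by (intro mult_left_mono) (auto simp: power_divide)
    also have "\<dots> = (cmod (neumann_sol A f k) * W h k ^ s) / (h ^ CARD('n)) ^ s" by simp
    also have "\<dots> \<le> 2 * K / (h ^ CARD('n)) ^ s" using h by (intro divide_right_mono b) auto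
    finally show "cmod (neumann_sol A f k) * W 1 k ^ s \<le> ?C * K" by simp
  qed (use h in auto)
qed

subsection \<open>Symmetry of mixed derivatives\<close>

text \<open>On \<open>S\<close> both factors are smooth and off \<open>K\<close> the product is 0;
  these two open sets cover the space.\<close>

lemma smooth_cutoff:
  assumes "open S" "f \<in> smooth_fns S" "b \<in> smooth_fns UNIV" "closed K" "K \<subseteq> S" "\<And>y. y \<notin> K \<Longrightarrow> b y = 0"
  shows "(\<lambda>y. b y * f y) \<in> smooth_fns UNIV"
proof (rule smooth_local)
  fix x :: "real^'a"
  show "\<exists>T. open T \<and> x \<in> T \<and> (\<lambda>y. b y * f y) \<in> smooth_fns T"
  proof (cases "x \<in> S")
    case True
    then show ?thesis
      by (intro exI[of _ S] conjI smooth_mult assms smooth_subset[OF assms(3)]) auto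
  next
    case False
    have "(\<lambda>y. b y * f y) \<in> smooth_fns (- K)"
      by (rule smooth_cong[OF _ _ smooth_const[of 0]]) (use assms in auto)
    then show ?thesis using False assms by (intro exI[of _ "- K"]) auto
  qed
qed

text \<open>After a cutoff, both mixed derivatives have the same Fourier coefficients, because
  integration by parts turns derivatives into commuting scalar factors. Inversion at the centre then
  identifies their values.\<close>

lemma partial_commute:
  assumes S: "open S" "x \<in> S" and f: "f \<in> smooth_fns S"
  shows "partial_deriv i (partial_deriv j f) x = partial_deriv j (partial_deriv i f) x"
proof -
  obtain e where e: "e > 0" "cball x e \<subseteq> S" using S open_contains_cball by blast
  define \<rho> where "\<rho> = e / 2"
  have re: "\<rho> > 0" "2 * \<rho> = e" using e by (auto simp: \<rho>_def)
  interpret lattice x \<rho> by standard (use re in auto)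
  obtain b where b: "b \<in> smooth_fns UNIV" "\<And>y. dist x y \<le> \<rho> \<Longrightarrow> b y = 1" "\<And>y. dist x y \<ge> 2 * \<rho> \<Longrightarrow> b y = 0"
    using bump_exists[of \<rho> "2 * \<rho>" x] re by auto
  let ?g = "\<lambda>y. b y * f y"
  have g: "?g \<in> smooth_fns UNIV"
    by (rule smooth_cutoff[OF S(1) f b(1) closed_cball e(2)]) (rule b(3), use re(2) in simp)
  have sg: "supp_cball x (2 * \<rho>) ?g" using b(3) by (auto simp: supp_cball_def)
  have eq: "partials [i, j] ?g x = partials [j, i] ?g x"
  proof -
    have inv: "wave_series x (fourier_coeff (partials is ?g)) lat x = partials is ?g x" for "is"
      by (rule inversion[OF smooth_partials[OF g] supp_cball_partials[OF sg]]) (use re in simp)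
    have "fourier_coeff (partials [i, j] ?g) = fourier_coeff (partials [j, i] ?g)"
      unfolding fourier_coeff_def integral_partials_wave[OF g sg] by (simp add: mult_ac)
    then show ?thesis using inv[of "[i, j]"] inv[of "[j, i]"] by simp
  qed
  have "partials is ?g x = partials is f x" for "is"
    by (rule partials_cong_open[of "ball x \<rho>"]) (use b(2) re in auto)
  from this[of "[i, j]"] this[of "[j, i]"] eq show ?thesis by simp
qed

lemma partials_insert:
  assumes S: "open S" "x \<in> S" and f: "f \<in> smooth_fns S"
  shows "partials (is @ i # js) f x = partials (i # is @ js) f x"
  using S(2)
proof (induction "is" arbitrary: x)
  case (Cons k "is")
  have "partials ((k # is) @ i # js) f x = partial_deriv k (partials (i # is @ js) f) x"
    unfolding append_Cons partials_Cons[of k] by (rule partial_deriv_cong_open[OF S(1) Cons.prems Cons.IH])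
  also have "\<dots> = partial_deriv i (partial_deriv k (partials (is @ js) f)) x"
    unfolding partials_Cons by (rule partial_commute[OF S(1) Cons.prems smooth_partials[OF f]])
  finally show ?case by simp
qed simp

lemma partials_mset:
  assumes S: "open S" "x \<in> S" and f: "f \<in> smooth_fns S" and eq: "mset is = mset js"
  shows "partials is f x = partials js f x"
  using S(2) eq
proof (induction "is" arbitrary: x js)
  case (Cons i "is")
  have "i \<in> set js" using Cons.prems(2) by (metis list.set_intros(1) mset_eq_setD)
  then obtain as bs where js: "js = as @ i # bs" by (meson split_list)
  have m: "mset is = mset (as @ bs)" using Cons.prems(2) js by simp
  have "partials js f x = partial_deriv i (partials (as @ bs) f) x"
    unfolding js partials_insert[OF S(1) Cons.prems(1) f] by simp
  also have "\<dots> = partial_deriv i (partials is f) x"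
    by (rule partial_deriv_cong_open[OF S(1) Cons.prems(1)]) (rule Cons.IH[OF _ m, symmetric])
  finally show ?case by simp
qed simp

lemma partials_eq_mpartial:
  assumes "open S" "x \<in> S" "f \<in> smooth_fns S"
  shows "partials is f x = mpartial (count (mset is)) f x" "mdeg (count (mset is)) = length is"
proof -
  have m: "mset (mlist (count (mset is))) = mset is"
    by (intro multiset_eqI) (simp add: count_mlist)
  show "mdeg (count (mset is)) = length is"
    using mset_eq_length[OF m] by (simp add: length_mlist)
  show "partials is f x = mpartial (count (mset is)) f x"
    unfolding mpartial_partials by (rule partials_mset[OF assms m[symmetric]])
qed

lemma jet_le_partials:
  fixes f :: "real^'n::finite \<Rightarrow> complex" and M :: real
  assumes "\<And>js. length js \<le> k \<Longrightarrow> cmod (partials (js @ is) f x) \<le> M"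
  shows "jet k 1 (partials is f) x \<le> (1 + real CARD('n)) ^ k * M"
  using assms
proof (induction k arbitrary: "is")
  case 0
  then show ?case using 0[of "[]"] by simp
next
  case (Suc k)
  have 1: "jet k 1 (partials is f) x \<le> (1 + real CARD('n)) ^ k * M"
    by (rule Suc.IH) (use Suc.prems in auto)
  have 2: "jet k 1 (partials (i # is) f) x \<le> (1 + real CARD('n)) ^ k * M" for i
  proof (rule Suc.IH)
    fix js :: "'n list" assume "length js \<le> k"
    then show "cmod (partials (js @ i # is) f x) \<le> M" using Suc.prems[of "js @ [i]"] by simp
  qed
  have "(\<Sum>i\<in>UNIV. jet k 1 (partial_deriv i (partials is f)) x) \<le> (\<Sum>i\<in>(UNIV :: 'n set). (1 + real CARD('n)) ^ k * M)"
    by (intro sum_mono) (use 2 in simp)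
  then show ?case using 1 by (simp add: algebra_simps)
qed

subsection \<open>The seminorms\<close>

lemma smooth_seminorm_le:
  assumes "M \<ge> 0" "\<And>x. x \<in> K \<Longrightarrow> jet j 1 f x \<le> M"
  shows "smooth_seminorm (K, j) f \<le> M"
  unfolding smooth_seminorm_def prod.case
proof (rule cSup_least)
  fix t assume "t \<in> insert 0 {cmod (mpartial \<alpha> f x) |x \<alpha>. x \<in> K \<and> mdeg \<alpha> \<le> j}"
  then consider "t = 0" | x \<alpha> where "t = cmod (mpartial \<alpha> f x)" "x \<in> K" "mdeg \<alpha> \<le> j" by blast
  then show "t \<le> M"
  proof cases
    case 2
    have "t \<le> jet (mdeg \<alpha>) 1 f x" unfolding 2(1) by (rule mpartial_le_jet)
    also have "\<dots> \<le> jet j 1 f x" using 2 by (intro jet_mono) auto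
    finally show ?thesis using assms(2)[OF 2(2)] by linarith
  qed (use assms in simp)
qed simp

text \<open>A jet of order \<open>j\<close> is a sum of derivatives along lists in all orders.
  Symmetry of the derivatives rewrites each as an \<open>mpartial\<close>, and the power of 1 plus
  the dimension counts the repetitions.\<close>

lemma smooth_seminorm_ge:
  fixes f :: "real^'n::finite \<Rightarrow> complex"
  assumes S: "open S" "f \<in> smooth_fns S" and K: "compact K" "K \<subseteq> S"
  shows "smooth_seminorm (K, j) f \<ge> 0"
    and "x \<in> K \<Longrightarrow> jet j 1 f x \<le> (1 + real CARD('n)) ^ j * smooth_seminorm (K, j) f"
proof -
  let ?X = "insert 0 {cmod (mpartial \<alpha> f x) |x \<alpha>. x \<in> K \<and> mdeg \<alpha> \<le> j}"
  obtain M where M: "M \<ge> 0" "\<And>x. x \<in> K \<Longrightarrow> jet j 1 f x \<le> M" using jet_bounded[OF S(2) K] by blast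
  have bdd: "bdd_above ?X"
  proof (rule bdd_aboveI[of _ M])
    fix t assume "t \<in> ?X"
    then consider "t = 0" | x \<alpha> where "t = cmod (mpartial \<alpha> f x)" "x \<in> K" "mdeg \<alpha> \<le> j" by blast
    then show "t \<le> M"
    proof cases
      case 2
      have "t \<le> jet (mdeg \<alpha>) 1 f x" unfolding 2(1) by (rule mpartial_le_jet)
      also have "\<dots> \<le> jet j 1 f x" using 2 by (intro jet_mono) auto
      finally show ?thesis using M(2)[OF 2(2)] by linarith
    qed (use M in simp)
  qed
  show "smooth_seminorm (K, j) f \<ge> 0"
    unfolding smooth_seminorm_def prod.case by (rule cSup_upper[OF _ bdd]) simp
  assume x: "x \<in> K"
  have "cmod (partials js f x) \<le> smooth_seminorm (K, j) f" if "length js \<le> j" for js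
    unfolding smooth_seminorm_def prod.case
    by (rule cSup_upper[OF _ bdd])
       (use partials_eq_mpartial[OF S(1) _ S(2), of x js] x K that in \<open>auto intro!: exI[of _ x] exI[of _ "count (mset js)"]\<close>)
  then show "jet j 1 f x \<le> (1 + real CARD('n)) ^ j * smooth_seminorm (K, j) f"
    using jet_le_partials[of j "[]" f x "smooth_seminorm (K, j) f"] by simp
qed

subsection \<open>Polynomials\<close>

text \<open>Polynomial functions of degree at most \<open>d\<close>, generated without reference to
  coefficients so that derivatives and growth can be treated by rule induction.\<close>

inductive Pol :: "nat \<Rightarrow> (real^'n::finite \<Rightarrow> complex) \<Rightarrow> bool" where
  const: "Pol 0 (\<lambda>_. a)"
| add: "Pol d f \<Longrightarrow> Pol d g \<Longrightarrow> Pol d (\<lambda>x. f x + g x)"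
| coord: "Pol d f \<Longrightarrow> Pol (Suc d) (\<lambda>x. of_real (x $ i) * f x)"
| up: "Pol d f \<Longrightarrow> Pol (Suc d) f"

lemma Pol_mono: "Pol d f \<Longrightarrow> d \<le> e \<Longrightarrow> Pol e f"
  by (induction e) (auto simp: le_Suc_eq intro: Pol.up)

lemma Pol_const: "Pol d (\<lambda>_. a)"
  using Pol_mono[OF Pol.const] by simp

lemma Pol_cmult: "Pol d f \<Longrightarrow> Pol d (\<lambda>x. a * f x)"
proof (induction rule: Pol.induct)
  case (coord d f i)
  then show ?case using Pol.coord[of d "\<lambda>x. a * f x" i] by (simp add: mult.left_commute)
qed (auto simp: distrib_left intro: Pol.intros)

lemma Pol_mult: "Pol d f \<Longrightarrow> Pol e g \<Longrightarrow> Pol (d + e) (\<lambda>x. f x * g x)"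
proof (induction rule: Pol.induct)
  case (coord d f i)
  then show ?case using Pol.coord[of "d + e" "\<lambda>x. f x * g x" i] by (simp add: mult.assoc)
qed (auto simp: distrib_right intro: Pol.intros Pol_cmult)

lemma Pol_sum: "(\<And>j. j \<in> J \<Longrightarrow> Pol d (f j)) \<Longrightarrow> Pol d (\<lambda>x. \<Sum>j\<in>J. f j x)"
  by (induction J rule: infinite_finite_induct) (auto intro: Pol_const Pol.add)

lemma Pol_prod: "finite J \<Longrightarrow> (\<And>j. j \<in> J \<Longrightarrow> Pol (d j) (f j)) \<Longrightarrow> Pol (\<Sum>j\<in>J. d j) (\<lambda>x. \<Prod>j\<in>J. f j x)"
  by (induction J rule: finite_induct) (auto intro: Pol_const Pol_mult)

lemma Pol_coord_power: "Pol k (\<lambda>x. of_real (x $ i) ^ k)"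
  by (induction k) (auto intro: Pol.intros)

lemma Pol_mpoly:
  fixes a :: "'n::finite mindex \<Rightarrow> complex"
  shows "Pol m (mpoly_fun m a)"
proof -
  have "Pol m (\<lambda>x. \<Sum>\<alpha> | mdeg \<alpha> \<le> m. a \<alpha> * (\<Prod>i\<in>UNIV. of_real (x $ i) ^ \<alpha> i))"
  proof (rule Pol_sum)
    fix \<alpha> :: "'n mindex" assume "\<alpha> \<in> {\<alpha>. mdeg \<alpha> \<le> m}"
    then have "mdeg \<alpha> \<le> m" by simp
    moreover have "Pol (mdeg \<alpha>) (\<lambda>x. \<Prod>i\<in>UNIV. of_real (x $ i) ^ \<alpha> i)"
      unfolding mdeg_def by (intro Pol_prod Pol_coord_power) auto
    ultimately show "Pol m (\<lambda>x. a \<alpha> * (\<Prod>i\<in>UNIV. of_real (x $ i) ^ \<alpha> i))"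
      by (intro Pol_cmult) (rule Pol_mono)
  qed
  moreover have "mpoly_fun m a = (\<lambda>x. \<Sum>\<alpha> | mdeg \<alpha> \<le> m. a \<alpha> * (\<Prod>i\<in>UNIV. of_real (x $ i) ^ \<alpha> i))"
    by (simp add: mpoly_fun_def fun_eq_iff)
  ultimately show ?thesis by simp
qed

lemma Pol_smooth: "Pol d f \<Longrightarrow> f \<in> smooth_fns UNIV"
  by (induction rule: Pol.induct) (auto intro: smooth_const smooth_add smooth_mult smooth_coord)

text \<open>Truncated subtraction leaves degree 0 at degree 0, so the vanishing of the derivative of
  a constant is carried along. Iterated, it kills all derivatives of order beyond the
  degree.\<close>

lemma Pol_partial: "Pol d f \<Longrightarrow> Pol (d - 1) (partial_deriv i f) \<and> (d = 0 \<longrightarrow> partial_deriv i f = (\<lambda>_. 0))"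
proof (induction rule: Pol.induct)
  case (const a)
  have "partial_deriv i (\<lambda>_. a) = (\<lambda>_. 0)" by (rule ext) (rule partial_deriv_const)
  then show ?case by (simp add: Pol_const)
next
  case (add d f g)
  have "partial_deriv i (\<lambda>x. f x + g x) = (\<lambda>x. partial_deriv i f x + partial_deriv i g x)"
    using add.hyps by (intro ext partial_deriv_add smooth_differentiable[OF Pol_smooth]) auto
  then show ?case using add.IH by (auto intro: Pol.add)
next
  case (coord d f j)
  have "partial_deriv i (\<lambda>x. of_real (x $ j) * f x) = (\<lambda>x. of_real (x $ j) * partial_deriv i f x + (if i = j then 1 else 0) * f x)"
    using coord.hyps smooth_differentiable[OF smooth_coord[of _ UNIV]]
    by (intro ext, subst partial_deriv_mult) (auto intro: smooth_differentiable[OF Pol_smooth] simp: partial_deriv_coord)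
  moreover have "Pol d (\<lambda>x. of_real (x $ j) * partial_deriv i f x)"
    using coord.IH Pol.coord[of "d - 1" "partial_deriv i f" j] Pol_const[of d 0] by (cases d) auto
  ultimately show ?case using Pol.add[OF _ Pol_cmult[OF coord.hyps]] by simp
next
  case (up d f)
  then show ?case using Pol_mono[of "d - 1" "partial_deriv i f" d] by auto
qed

lemma Pol_partials: "Pol d f \<Longrightarrow> Pol (d - length is) (partials is f) \<and> (d < length is \<longrightarrow> partials is f = (\<lambda>_. 0))"
proof (induction "is")
  case (Cons i "is")
  have IH: "Pol (d - length is) (partials is f)" using Cons by auto
  from Pol_partial[OF IH, of i] show ?case by (auto simp: less_Suc_eq_le)
qed simp

lemma Pol_growth: "Pol d f \<Longrightarrow> \<exists>C\<ge>0. \<forall>x. cmod (f x) \<le> C * (1 + norm x) ^ d"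
proof (induction rule: Pol.induct)
  case (const a)
  show ?case by (intro exI[of _ "cmod a"]) auto
next
  case (add d f g)
  then obtain C C' where "C \<ge> 0" "C' \<ge> 0" and b: "\<And>x. cmod (f x) \<le> C * (1 + norm x) ^ d" "\<And>x. cmod (g x) \<le> C' * (1 + norm x) ^ d" by blast
  moreover have "cmod (f x + g x) \<le> (C + C') * (1 + norm x) ^ d" for x
    using b[of x] norm_triangle_ineq[of "f x" "g x"] by (simp add: distrib_right)
  ultimately show ?case by (intro exI[of _ "C + C'"]) auto
next
  case (coord d f i)
  then obtain C where C: "C \<ge> 0" "\<And>x. cmod (f x) \<le> C * (1 + norm x) ^ d" by blast
  have "cmod (of_real (x $ i) * f x) \<le> C * (1 + norm x) ^ Suc d" for x
  proof -
    have "\<bar>x $ i\<bar> * cmod (f x) \<le> (1 + norm x) * (C * (1 + norm x) ^ d)"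
      using component_le_norm_cart[of x i] by (intro mult_mono C) auto
    then show ?thesis by (simp add: norm_mult mult_ac)
  qed
  then show ?case using C by blast
next
  case (up d f)
  then obtain C where C: "C \<ge> 0" "\<And>x. cmod (f x) \<le> C * (1 + norm x) ^ d" by blast
  have "cmod (f x) \<le> C * (1 + norm x) ^ Suc d" for x
  proof -
    have "C * (1 + norm x) ^ d \<le> C * (1 + norm x) ^ Suc d" using C by (intro mult_left_mono power_increasing) auto
    then show ?thesis using C(2)[of x] by linarith
  qed
  then show ?case using C by blast
qed

lemma Pol_jet_growth: "Pol d f \<Longrightarrow> \<exists>C\<ge>0. \<forall>x. jet k 1 f x \<le> C * (1 + norm x) ^ d"
proof (induction k arbitrary: f)
  case 0
  then show ?case using Pol_growth by auto
next
  case (Suc k)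
  have "\<exists>C\<ge>0. \<forall>x. jet k 1 (partial_deriv i f) x \<le> C * (1 + norm x) ^ d" for i
    using Suc.IH Pol_mono[of "d - 1" "partial_deriv i f" d] Pol_partial[OF Suc.prems, of i] by auto
  then obtain C where C: "\<And>i. C i \<ge> 0" "\<And>i x. jet k 1 (partial_deriv i f) x \<le> C i * (1 + norm x) ^ d" by metis
  obtain C0 where C0: "C0 \<ge> 0" "\<And>x. jet k 1 f x \<le> C0 * (1 + norm x) ^ d" using Suc.IH[OF Suc.prems] by blast
  have "jet (Suc k) 1 f x \<le> (C0 + (\<Sum>i\<in>UNIV. C i)) * (1 + norm x) ^ d" for x
    using C0(2)[of x] sum_mono[of UNIV "\<lambda>i. jet k 1 (partial_deriv i f) x" "\<lambda>i. C i * (1 + norm x) ^ d"] C(2)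
    by (simp add: distrib_right sum_distrib_right)
  moreover have "0 \<le> C0 + (\<Sum>i\<in>UNIV. C i)" using C0(1) C(1) by (simp add: sum_nonneg)
  ultimately show ?case by blast
qed

lemma finite_mdeg: "finite {\<alpha> :: 'n::finite mindex. mdeg \<alpha> \<le> m}"
proof (rule finite_subset)
  have "\<alpha> i \<le> mdeg \<alpha>" for \<alpha> :: "'n mindex" and i unfolding mdeg_def by (rule member_le_sum) auto
  then show "{\<alpha> :: 'n mindex. mdeg \<alpha> \<le> m} \<subseteq> UNIV \<rightarrow>\<^sub>E {..m}" using order_trans by fastforce
qed (intro finite_PiE; simp)

lemma mpartial_0: "mpartial (\<lambda>_. 0) f = f"
proof -
  have "length (mlist (\<lambda>_ :: 'a. 0)) = 0" unfolding length_mlist by (simp add: mdeg_def)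
  then show ?thesis by (simp add: mpartial_partials)
qed

text \<open>Derivatives of order above the degree vanish, which turns the sum over all multi-indices
  into a finite one.\<close>

lemma weight_Pol:
  assumes "Pol m f"
  shows "weight f \<xi> = L2_set (\<lambda>\<alpha>. cmod (mpartial \<alpha> f \<xi>)) {\<alpha>. mdeg \<alpha> \<le> m}"
proof -
  have "mpartial \<alpha> f = (\<lambda>_. 0)" if "mdeg \<alpha> > m" for \<alpha>
    using Pol_partials[OF assms, of "mlist \<alpha>"] that by (simp add: mpartial_partials length_mlist)
  then have "mdeg \<alpha> \<le> m" if "mpartial \<alpha> f \<xi> \<noteq> 0" for \<alpha>
    using that by (metis not_le)
  then have "{\<alpha>. (cmod (mpartial \<alpha> f \<xi>))\<^sup>2 \<noteq> 0} \<subseteq> {\<alpha>. mdeg \<alpha> \<le> m}"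
    by auto
  then show ?thesis
    unfolding weight_def L2_set_def by (subst Sum_any.expand_superset[OF finite_mdeg[of m]]) auto
qed

lemma weight_ge: "Pol m f \<Longrightarrow> cmod (f \<xi>) \<le> weight f \<xi>"
  unfolding weight_Pol
  using member_le_L2_set[OF finite_mdeg[of m], of "\<lambda>_. 0" "\<lambda>\<alpha>. cmod (mpartial \<alpha> f \<xi>)"]
  by (simp add: mpartial_0 mdeg_def)

lemma weight_nonneg: "Pol m f \<Longrightarrow> 0 \<le> weight f \<xi>"
  using weight_ge norm_ge_zero order_trans by blast

lemma weight_le:
  fixes f :: "real^'n::finite \<Rightarrow> complex"
  assumes "Pol m f"
  shows "weight f \<xi> \<le> card {\<alpha> :: 'n mindex. mdeg \<alpha> \<le> m} * jet m 1 f \<xi>"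
proof -
  have "weight f \<xi> \<le> (\<Sum>\<alpha> | mdeg \<alpha> \<le> m. cmod (mpartial \<alpha> f \<xi>))"
    unfolding weight_Pol[OF assms] by (rule L2_set_le_sum) auto
  also have "\<dots> \<le> (\<Sum>\<alpha> :: 'n mindex | mdeg \<alpha> \<le> m. jet m 1 f \<xi>)"
  proof (rule sum_mono)
    fix \<alpha> :: "'n mindex" assume "\<alpha> \<in> {\<alpha>. mdeg \<alpha> \<le> m}"
    then show "cmod (mpartial \<alpha> f \<xi>) \<le> jet m 1 f \<xi>"
      using mpartial_le_jet[of \<alpha> f \<xi>] jet_mono[of 1 "mdeg \<alpha>" m f \<xi>] by simp
  qed
  finally show ?thesis by simp
qed

section \<open>Lagrange interpolation on an integer grid\<close>

text \<open>The Lagrange basis polynomial of the node \<open>t\<close> among the nodes 0, ...,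
  m.\<close>

definition lag :: "nat \<Rightarrow> nat \<Rightarrow> real \<Rightarrow> real" where
  "lag m t x = (\<Prod>u\<in>{..m} - {t}. (x - real u) / (real t - real u))"

text \<open>Both sides are polynomials in \<open>x\<close> of degree at most \<open>m\<close> that
  agree at the \<open>m + 1\<close> nodes.\<close>

lemma lag_interpolates:
  assumes "a \<le> m"
  shows "(\<Sum>t\<le>m. (c + real t) ^ a * lag m t x) = (c + x) ^ a"
proof -
  define L where "L t = (\<Prod>u\<in>{..m} - {t}. smult (1 / (real t - real u)) [:- real u, 1:])" for t
  have pL: "poly (L t) x = lag m t x" for t x
    by (simp add: L_def lag_def poly_prod diff_divide_distrib)
  have dL: "degree (L t) \<le> m" if "t \<le> m" for t
  proof -
    have "degree (L t) \<le> (\<Sum>u\<in>{..m} - {t}. degree (smult (1 / (real t - real u)) [:- real u, 1:]))"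
      unfolding L_def by (rule degree_prod_sum_le[unfolded o_def]) simp
    also have "\<dots> \<le> (\<Sum>u\<in>{..m} - {t}. 1)"
      by (intro sum_mono order_trans[OF degree_smult_le]) simp
    finally show ?thesis using that by simp
  qed
  define p where "p = (\<Sum>t\<le>m. smult ((c + real t) ^ a) (L t))"
  have "p = [:c, 1:] ^ a"
  proof (rule poly_eqI_degree[where A="real ` {..m}"])
    have card: "card (real ` {..m}) = Suc m" by (subst card_image) (auto simp: inj_on_def)
    have "degree p \<le> m"
      unfolding p_def by (intro degree_sum_le finite_atMost order_trans[OF degree_smult_le] dL) auto
    then show "degree p < card (real ` {..m})" using card by simp
    show "degree ([:c, 1:] ^ a) < card (real ` {..m})"
      using assms card by (simp add: degree_linear_power)
    fix y assume "y \<in> real ` {..m}"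
    then obtain s where s: "s \<le> m" "y = real s" by auto
    have "lag m t y = (if t = s then 1 else 0)" if "t \<le> m" for t
    proof (cases "t = s")
      case True
      then show ?thesis using s unfolding lag_def by (auto intro!: prod.neutral)
    next
      case False
      then have "lag m t y = 0" unfolding lag_def using s by (intro prod_zero) (auto intro!: bexI[of _ s])
      then show ?thesis using False by simp
    qed
    then have "(\<Sum>t\<le>m. (c + real t) ^ a * lag m t y) = (\<Sum>t\<le>m. if t = s then (c + real t) ^ a else 0)"
      by (intro sum.cong) simp_all
    moreover have "poly p y = (\<Sum>t\<le>m. (c + real t) ^ a * lag m t y)" by (simp add: p_def poly_sum pL)
    ultimately have "poly p y = (\<Sum>t\<le>m. if t = s then (c + real t) ^ a else 0)" by simp
    then show "poly p y = poly ([:c, 1:] ^ a) y" using s by (simp add: poly_power)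
  qed
  then have "poly p x = poly ([:c, 1:] ^ a) x" by simp
  then show ?thesis by (simp add: p_def poly_sum pL poly_power)
qed

definition nodes :: "nat \<Rightarrow> ('n::finite \<Rightarrow> nat) set" where
  "nodes m = UNIV \<rightarrow>\<^sub>E {..m}"

definition node :: "('n::finite \<Rightarrow> nat) \<Rightarrow> real^'n" where
  "node \<tau> = (\<chi> i. real (\<tau> i))"

definition Lag :: "nat \<Rightarrow> ('n::finite \<Rightarrow> nat) \<Rightarrow> real^'n \<Rightarrow> complex" where
  "Lag m \<tau> x = (\<Prod>i\<in>UNIV. of_real (lag m (\<tau> i) (x $ i)))"

lemma finite_nodes: "finite (nodes m)"
  unfolding nodes_def by (intro finite_PiE) auto

lemma nodes_nonempty: "nodes m \<noteq> {}"
  by (auto simp: nodes_def PiE_eq_empty_iff)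

lemma Pol_Lag: "Pol (CARD('n) * Suc m) (Lag m \<tau> :: real^'n::finite \<Rightarrow> complex)"
proof -
  have 1: "Pol (Suc m) (\<lambda>x :: real^'n. of_real (lag m t (x $ i)))" for t i
  proof (rule Pol_mono)
    have "Pol 1 (\<lambda>x :: real^'n. complex_of_real (1 / (real t - real u)) * (of_real (x $ i) * 1 + of_real (- real u)))" for u
      using Pol.coord[OF Pol.const[of 1], of i] by (intro Pol_cmult Pol.add Pol_const) simp
    then have "Pol (\<Sum>u\<in>{..m} - {t}. 1) (\<lambda>x :: real^'n. \<Prod>u\<in>{..m} - {t}. complex_of_real (1 / (real t - real u)) * (of_real (x $ i) * 1 + of_real (- real u)))"
      by (intro Pol_prod) auto
    then show "Pol (\<Sum>u\<in>{..m} - {t}. 1) (\<lambda>x :: real^'n. complex_of_real (lag m t (x $ i)))"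
      by (simp add: lag_def)
    show "(\<Sum>u\<in>{..m} - {t}. 1) \<le> Suc m"
      using card_mono[of "{..m}" "{..m} - {t}"] by simp
  qed
  have "Pol (\<Sum>i\<in>(UNIV :: 'n set). Suc m) (\<lambda>x :: real^'n. \<Prod>i\<in>UNIV. of_real (lag m (\<tau> i) (x $ i)))"
    by (intro Pol_prod 1) auto
  then show ?thesis by (simp add: Lag_def[abs_def])
qed

text \<open>Tensor-product interpolation: total degree at most \<open>m\<close> bounds the degree in
  each coordinate by \<open>m\<close>, so every monomial is reproduced coordinate by
  coordinate.\<close>

lemma mpoly_interp:
  fixes a :: "'n::finite mindex \<Rightarrow> complex"
  shows "mpoly_fun m a (\<eta> + x) = (\<Sum>\<tau>\<in>nodes m. mpoly_fun m a (\<eta> + node \<tau>) * Lag m \<tau> x)"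
proof -
  have mono: "(\<Prod>i\<in>UNIV. ((\<eta> + x) $ i) ^ \<alpha> i) = (\<Sum>\<tau>\<in>nodes m. (\<Prod>i\<in>UNIV. ((\<eta> + node \<tau>) $ i) ^ \<alpha> i) * (\<Prod>i\<in>UNIV. lag m (\<tau> i) (x $ i)))"
    if "mdeg \<alpha> \<le> m" for \<alpha> :: "'n mindex"
  proof -
    have a: "\<alpha> i \<le> m" for i
      using member_le_sum[of i UNIV \<alpha>] that unfolding mdeg_def by simp
    have "(\<Prod>i\<in>UNIV. ((\<eta> + x) $ i) ^ \<alpha> i) = (\<Prod>i\<in>UNIV. \<Sum>t\<le>m. (\<eta> $ i + real t) ^ \<alpha> i * lag m t (x $ i))"
      by (simp add: lag_interpolates[OF a])
    also have "\<dots> = (\<Sum>\<tau>\<in>nodes m. \<Prod>i\<in>UNIV. (\<eta> $ i + real (\<tau> i)) ^ \<alpha> i * lag m (\<tau> i) (x $ i))"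
      unfolding nodes_def by (rule prod_sum_PiE) auto
    finally show ?thesis by (simp add: prod.distrib node_def)
  qed
  have "mpoly_fun m a (\<eta> + x) = (\<Sum>\<alpha> | mdeg \<alpha> \<le> m. \<Sum>\<tau>\<in>nodes m. a \<alpha> * of_real (\<Prod>i\<in>UNIV. ((\<eta> + node \<tau>) $ i) ^ \<alpha> i) * Lag m \<tau> x)"
    unfolding mpoly_fun_def
  proof (rule sum.cong[OF refl])
    fix \<alpha> :: "'n mindex" assume "\<alpha> \<in> {\<alpha>. mdeg \<alpha> \<le> m}"
    then have "mdeg \<alpha> \<le> m" by simp
    from mono[OF this]
    show "a \<alpha> * of_real (\<Prod>i\<in>UNIV. ((\<eta> + x) $ i) ^ \<alpha> i) = (\<Sum>\<tau>\<in>nodes m. a \<alpha> * of_real (\<Prod>i\<in>UNIV. ((\<eta> + node \<tau>) $ i) ^ \<alpha> i) * Lag m \<tau> x)"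
      by (simp only: of_real_sum of_real_mult of_real_prod Lag_def sum_distrib_left mult.assoc)
  qed
  also have "\<dots> = (\<Sum>\<tau>\<in>nodes m. mpoly_fun m a (\<eta> + node \<tau>) * Lag m \<tau> x)"
    by (subst sum.swap) (simp add: mpoly_fun_def sum_distrib_right)
  finally show ?thesis .
qed

text \<open>The node with the largest value dominates all coefficients of the interpolation formula,
  and the basis polynomials grow at most polynomially. The constants are fixed before the
  coefficients \<open>a\<close> and the base point \<eta>, which is what gives uniformity in
  \<epsilon> and over the lattice.\<close>

lemma good_shift:
  obtains C D where "C \<ge> (0::real)"
    "\<And>(a :: 'n::finite mindex \<Rightarrow> complex) \<eta>. \<exists>\<tau>\<in>nodes m. \<forall>\<xi>. jet m 1 (mpoly_fun m a) \<xi> \<le> C * (1 + norm (\<xi> - \<eta>)) ^ D * cmod (mpoly_fun m a (\<eta> + node \<tau>))"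
proof -
  define D where "D = CARD('n) * Suc m"
  have "\<exists>C\<ge>0. \<forall>x :: real^'n. jet m 1 (Lag m \<tau>) x \<le> C * (1 + norm x) ^ D" for \<tau> :: "'n \<Rightarrow> nat"
    unfolding D_def by (rule Pol_jet_growth[OF Pol_Lag])
  then obtain c where c: "\<And>\<tau>. c \<tau> \<ge> 0" "\<And>\<tau> (x :: real^'n). jet m 1 (Lag m \<tau>) x \<le> c \<tau> * (1 + norm x) ^ D" by metis
  show ?thesis
  proof (rule that[of "\<Sum>\<tau>\<in>nodes m. c \<tau>" D])
    fix a :: "'n mindex \<Rightarrow> complex" and \<eta> :: "real^'n"
    let ?Q = "mpoly_fun m a"
    let ?v = "\<lambda>\<tau>. cmod (?Q (\<eta> + node \<tau>))"
    have "Max (?v ` nodes m) \<in> ?v ` nodes m" using finite_nodes nodes_nonempty by (intro Max_in) auto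
    then obtain \<tau>0 where t0: "\<tau>0 \<in> nodes m" "Max (?v ` nodes m) = ?v \<tau>0" by auto
    have mx: "?v \<tau> \<le> ?v \<tau>0" if "\<tau> \<in> nodes m" for \<tau>
          proof -
      have "?v \<tau> \<in> ?v ` nodes m" using that by blast
      from Max_ge[OF finite_imageI[OF finite_nodes] this] show ?thesis unfolding t0(2) .
    qed
    have sL: "Lag m \<tau> \<in> smooth_fns UNIV" for \<tau> :: "'n \<Rightarrow> nat" by (rule Pol_smooth[OF Pol_Lag])
    have "jet m 1 ?Q \<xi> \<le> (\<Sum>\<tau>\<in>nodes m. c \<tau>) * (1 + norm (\<xi> - \<eta>)) ^ D * ?v \<tau>0" for \<xi>
    proof -
      have "?Q y = (\<Sum>\<tau>\<in>nodes m. ?Q (\<eta> + node \<tau>) * Lag m \<tau> (1 *\<^sub>R y + (- \<eta>)))" for y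
        using mpoly_interp[of m a \<eta> "y - \<eta>"] by simp
      then have "?Q = (\<lambda>y. \<Sum>\<tau>\<in>nodes m. ?Q (\<eta> + node \<tau>) * Lag m \<tau> (1 *\<^sub>R y + (- \<eta>)))" by blast
      then have "jet m 1 ?Q \<xi> = jet m 1 (\<lambda>y. \<Sum>\<tau>\<in>nodes m. ?Q (\<eta> + node \<tau>) * Lag m \<tau> (1 *\<^sub>R y + (- \<eta>))) \<xi>" by metis
      also have "\<dots> \<le> (\<Sum>\<tau>\<in>nodes m. jet m 1 (\<lambda>y. ?Q (\<eta> + node \<tau>) * Lag m \<tau> (1 *\<^sub>R y + (- \<eta>))) \<xi>)"
        by (rule jet_sum[OF open_UNIV UNIV_I]) (rule smooth_cmult[OF open_UNIV smooth_scale[OF sL]], simp)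
      also have "\<dots> = (\<Sum>\<tau>\<in>nodes m. ?v \<tau> * jet m 1 (Lag m \<tau>) (\<xi> - \<eta>))"
        by (intro sum.cong refl) (simp add: jet_cmult[OF open_UNIV UNIV_I smooth_scale[OF sL]] jet_scale[OF sL] del: scaleR_one add_uminus_conv_diff, simp)
      also have "\<dots> \<le> (\<Sum>\<tau>\<in>nodes m. ?v \<tau>0 * (c \<tau> * (1 + norm (\<xi> - \<eta>)) ^ D))"
        by (intro sum_mono mult_mono mx c) (auto intro: jet_nonneg)
      also have "\<dots> = (\<Sum>\<tau>\<in>nodes m. c \<tau>) * (1 + norm (\<xi> - \<eta>)) ^ D * ?v \<tau>0"
        by (simp add: sum_distrib_left sum_distrib_right mult_ac)
      finally show ?thesis .
    qed
    with t0(1) show "\<exists>\<tau>\<in>nodes m. \<forall>\<xi>. jet m 1 ?Q \<xi> \<le> (\<Sum>\<tau>\<in>nodes m. c \<tau>) * (1 + norm (\<xi> - \<eta>)) ^ D * ?v \<tau>" by blast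
  qed (intro sum_nonneg c)
qed

subsection \<open>The parametrix\<close>

lemma jet_small_scale:
  assumes "0 \<le> r" "r \<le> 1"
  shows "jet d r g x \<le> cmod (g x) + r * jet d 1 g x"
proof (induction d)
  case (Suc d)
  have "(\<Sum>i\<in>UNIV. jet d r (partial_deriv i g) x) \<le> (\<Sum>i\<in>UNIV. jet d 1 (partial_deriv i g) x)"
    by (intro sum_mono jet_mono_r assms)
  then have "r * (\<Sum>i\<in>UNIV. jet d r (partial_deriv i g) x) \<le> r * (\<Sum>i\<in>UNIV. jet d 1 (partial_deriv i g) x)"
    using assms by (intro mult_left_mono) auto
  then show ?case using Suc by (simp add: distrib_left)
qed (use assms in simp)

text \<open>The value is small by continuity at \<open>z\<close>, and every derivative in the jet
  carries at least one factor \<rho>.\<close>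

lemma jet_eventually_small:
  assumes S: "open S" "z \<in> S" and g: "g \<in> smooth_fns S" "g z = 0" and e: "e > 0"
  shows "\<forall>\<^sub>F \<rho> in at_right 0. \<forall>x\<in>cball z (2 * \<rho>). jet d \<rho> g x \<le> e"
proof -
  obtain R where R: "R > 0" "cball z R \<subseteq> S" using S open_contains_cball by blast
  obtain M where M: "M \<ge> 0" "\<And>x. x \<in> cball z R \<Longrightarrow> jet d 1 g x \<le> M"
    using jet_bounded[OF g(1) compact_cball R(2)] by blast
  have "isCont g z" using smooth_continuous_on[OF g(1)] S by (simp add: continuous_on_eq_continuous_at)
  then obtain t where t: "t > 0" "\<And>x. dist x z < t \<Longrightarrow> dist (g x) (g z) < e / 2"
    using e unfolding continuous_at_eps_delta by (metis half_gt_zero)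
  \<comment> \<open>In this order the entries keep the weight at most 1, the ball of radius 2\<rho>
    inside radius \<open>R\<close> and inside the continuity radius \<open>t\<close>, and the
    derivative part below \<open>e / 2\<close>.\<close>
  define r0 where "r0 = Min {1, R / 2, t / 3, e / (2 * (M + 1))}"
  have "r0 \<le> u" if "u \<in> {1, R / 2, t / 3, e / (2 * (M + 1))}" for u
    unfolding r0_def using that by (intro Min_le) auto
  from this[of 1] this[of "R / 2"] this[of "t / 3"] this[of "e / (2 * (M + 1))"]
  have r0: "r0 \<le> 1" "r0 \<le> R / 2" "r0 \<le> t / 3" "r0 \<le> e / (2 * (M + 1))" by simp_all
  have r0p: "r0 > 0" using R t e M by (simp add: r0_def)
  show ?thesis
  proof (rule eventually_at_rightI[of 0 r0])
    fix \<rho> :: real assume rho: "\<rho> \<in> {0<..<r0}"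
    show "\<forall>x\<in>cball z (2 * \<rho>). jet d \<rho> g x \<le> e"
    proof
      fix x assume x: "x \<in> cball z (2 * \<rho>)"
      have "dist (g x) (g z) < e / 2" using x rho r0 t by (intro t) (auto simp: dist_commute)
      then have "cmod (g x) < e / 2" using g(2) by simp
      moreover have "x \<in> cball z R" using x rho r0 by auto
      then have "\<rho> * jet d 1 g x \<le> \<rho> * (M + 1)" using M(2)[of x] rho by (intro mult_left_mono) auto
      moreover have "\<rho> * (M + 1) \<le> e / 2"
      proof -
        have "\<rho> * (M + 1) \<le> e / (2 * (M + 1)) * (M + 1)" using rho r0 M by (intro mult_right_mono) auto
        also have "\<dots> = e / 2" using M by (simp add: field_simps)
        finally show ?thesis .
      qed
      moreover have "jet d \<rho> g x \<le> cmod (g x) + \<rho> * jet d 1 g x"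
        by (rule jet_small_scale) (use rho r0 in auto)
      ultimately show "jet d \<rho> g x \<le> e" by linarith
    qed
  qed (use r0p in auto)
qed

lemma supp_cball_jet:
  assumes "supp_cball z R f" "R < dist z x"
  shows "jet d r f x = 0"
proof -
  have "jet d r f x = jet d r (\<lambda>_. 0) x"
    by (rule jet_cong_open[of "- cball z R"]) (use assms in \<open>auto simp: supp_cball_def\<close>)
  then show ?thesis by (simp add: jet_zero)
qed

lemma norm1_node: "\<tau> \<in> nodes m \<Longrightarrow> norm1 (node \<tau> :: real^'n::finite) \<le> CARD('n) * m"
proof -
  assume t: "\<tau> \<in> nodes m"
  have "norm1 (node \<tau> :: real^'n) \<le> (\<Sum>i\<in>(UNIV :: 'n set). real m)"
    unfolding norm1_def using t by (intro sum_mono) (auto simp: node_def nodes_def PiE_iff)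
  then show ?thesis by simp
qed

text \<open>
  The frequency \<open>\<xi>\<^sub>k = lat k + node (\<tau> k)\<close> is a shift of the lattice point at which the symbol of the
  leading operator takes a large value \<open>q k\<close>, and \<open>\<mu> j k\<close> is the quotient of the symbols of the
  \<open>j\<close>-th operator and of the leading one there; \<open>rel_error\<close> is the resulting relative error.
\<close>

locale parametrix = lattice z \<rho> for z :: "real^'n::finite" and \<rho> :: real +
  fixes S :: "(real^'n) set" and c :: "nat \<Rightarrow> real^'n \<Rightarrow> complex" and r m :: nat and C1 e0 :: real
    and cutoff :: "real^'n \<Rightarrow> complex"
  assumes rho1: "\<rho> \<le> 1"
    and S: "open S" "cball z (2 * \<rho>) \<subseteq> S"
    and c: "\<And>j. j \<in> {1..r} \<Longrightarrow> c j \<in> smooth_fns S"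
    and cutoff: "cutoff \<in> smooth_fns UNIV" "\<And>x. dist z x \<le> \<rho> \<Longrightarrow> cutoff x = 1" "\<And>x. dist z x \<ge> 2 * \<rho> \<Longrightarrow> cutoff x = 0"
    and C1: "C1 \<ge> 0"
    and e0: "e0 \<ge> 0" "2 ^ (2 * CARD('n)) * e0 * wsum TYPE('n) \<le> 1 / 4"
    and small: "\<And>\<tau> \<mu> x. \<tau> \<in> nodes m \<Longrightarrow> (\<And>j. j \<in> {1..r} \<Longrightarrow> cmod (\<mu> j) \<le> C1) \<Longrightarrow> x \<in> cball z (2 * \<rho>) \<Longrightarrow>
       jet (2 * CARD('n)) \<rho> (\<lambda>x. cutoff x * (wave z (node \<tau>) x - 1 + wave z (node \<tau>) x * (\<Sum>j=1..r. c j x * \<mu> j))) x \<le> e0"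
begin

definition rel_error :: "('n \<Rightarrow> nat) \<Rightarrow> (nat \<Rightarrow> complex) \<Rightarrow> real^'n \<Rightarrow> complex" where
  "rel_error \<tau> \<mu> = (\<lambda>x. cutoff x * (wave z (node \<tau>) x - 1 + wave z (node \<tau>) x * (\<Sum>j=1..r. c j x * \<mu> j)))"

lemma smooth_inner: "(\<lambda>x. wave z (node \<tau>) x - 1 + wave z (node \<tau>) x * (\<Sum>j=1..r. c j x * \<mu> j)) \<in> smooth_fns S"
  by (intro smooth_add smooth_minus smooth_mult smooth_sum smooth_const smooth_wave S c)

lemma rel_error_smooth: "rel_error \<tau> \<mu> \<in> smooth_fns UNIV"
  unfolding rel_error_def by (rule smooth_cutoff[OF S(1) smooth_inner cutoff(1) closed_cball S(2)]) (simp add: cutoff(3))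

lemma cutoff_sup: "supp_cball z (2 * \<rho>) cutoff"
  using cutoff(3) by (auto simp: supp_cball_def)

lemma rel_error_sup: "supp_cball z (2 * \<rho>) (rel_error \<tau> \<mu>)"
  unfolding rel_error_def by (rule supp_cball_mult1[OF cutoff_sup])

lemma jet_cutoff: obtains M where "M \<ge> 0" "\<And>x r. 0 \<le> r \<Longrightarrow> r \<le> 1 \<Longrightarrow> jet d r cutoff x \<le> M"
proof -
  obtain M where M: "M \<ge> 0" "\<And>x. x \<in> cball z (2 * \<rho>) \<Longrightarrow> jet d 1 cutoff x \<le> M"
    using jet_bounded[OF cutoff(1) compact_cball subset_UNIV] by blast
  show ?thesis
  proof (rule that[OF M(1)])
    fix x and r :: real assume r: "0 \<le> r" "r \<le> 1"
    have "jet d 1 cutoff x \<le> M"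
      using M supp_cball_jet[OF cutoff_sup, of x d 1] by (cases "x \<in> cball z (2 * \<rho>)") (auto simp: not_le)
    then show "jet d r cutoff x \<le> M" using jet_mono_r[OF r, of d cutoff x] by linarith
  qed
qed

text \<open>Uniform over all grid shifts and all admissible quotients, hence over all lattice points
  and all \<epsilon>. It feeds the large constants of \<open>decay_class\<close>, so the size of
  \<open>M\<close> does not matter.\<close>

lemma rel_error_bounded:
  obtains M where "M \<ge> 0" "\<And>\<tau> \<mu> x. \<tau> \<in> nodes m \<Longrightarrow> (\<And>j. j \<in> {1..r} \<Longrightarrow> cmod (\<mu> j) \<le> C1) \<Longrightarrow> jet d \<rho> (rel_error \<tau> \<mu>) x \<le> M"
proof -
  obtain Mc where Mc: "Mc \<ge> 0" "\<And>x r. 0 \<le> r \<Longrightarrow> r \<le> 1 \<Longrightarrow> jet d r cutoff x \<le> Mc" using jet_cutoff by blast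
  have "\<exists>M\<ge>0. \<forall>x\<in>cball z (2 * \<rho>). j \<in> {1..r} \<longrightarrow> jet d \<rho> (c j) x \<le> M" for j
  proof (cases "j \<in> {1..r}")
    case True
    from jet_bounded[OF c[OF True] compact_cball S(2), where k=d and r=\<rho>] show ?thesis by metis
  qed auto
  then obtain Mj where Mj: "\<And>j. Mj j \<ge> 0" "\<And>j x. x \<in> cball z (2 * \<rho>) \<Longrightarrow> j \<in> {1..r} \<Longrightarrow> jet d \<rho> (c j) x \<le> Mj j" by metis
  define E where "E = (1 + real (CARD('n) * m)) ^ d"
  have E: "E \<ge> 0" by (simp add: E_def)
  have r0: "0 \<le> \<rho>" using rho by simp
  have ex_le: "jet d \<rho> (wave z (node \<tau>)) x \<le> E" if "\<tau> \<in> nodes m" for \<tau> x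
  proof -
    have "jet d \<rho> (wave z (node \<tau>)) x \<le> jet d 1 (wave z (node \<tau>)) x" by (intro jet_mono_r r0 rho1)
    also have "\<dots> \<le> (1 + norm1 (node \<tau> :: real^'n)) ^ d" by (rule jet_wave)
    also have "\<dots> \<le> E" unfolding E_def using norm1_node[OF that] norm1_nonneg[of "node \<tau> :: real^'n"] by (intro power_mono) auto
    finally show ?thesis .
  qed
  let ?T = "\<Sum>j=1..r. Mj j * C1"
  have T: "?T \<ge> 0" using Mj C1 by (intro sum_nonneg mult_nonneg_nonneg) auto
  show ?thesis
  proof (rule that[of "Mc * (E + 1 + E * ?T)"])
    show "0 \<le> Mc * (E + 1 + E * ?T)" using Mc E T by auto
    fix x and \<tau> :: "'n \<Rightarrow> nat" and \<mu> :: "nat \<Rightarrow> complex" assume t: "\<tau> \<in> nodes m" and \<mu>: "\<And>j. j \<in> {1..r} \<Longrightarrow> cmod (\<mu> j) \<le> C1"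
    show "jet d \<rho> (rel_error \<tau> \<mu>) x \<le> Mc * (E + 1 + E * ?T)"
    proof (cases "x \<in> cball z (2 * \<rho>)")
      case False
      then show ?thesis using supp_cball_jet[OF rel_error_sup, where x=x] Mc E T by auto
    next
      case True
      then have xS: "x \<in> S" using S(2) by auto
      let ?e = "wave z (node \<tau>)" and ?s = "\<lambda>x. \<Sum>j=1..r. c j x * \<mu> j"
      have sm: "?s \<in> smooth_fns S" by (intro smooth_sum smooth_mult smooth_const S c)
      have "jet d \<rho> ?s x \<le> (\<Sum>j=1..r. jet d \<rho> (\<lambda>x. c j x * \<mu> j) x)"
        by (rule jet_sum[OF S(1) xS _ r0]) (intro smooth_mult smooth_const S c)
      also have "\<dots> \<le> (\<Sum>j=1..r. Mj j * C1)"
      proof (rule sum_mono)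
        fix j assume j: "j \<in> {1..r}"
        have "jet d \<rho> (\<lambda>x. c j x * \<mu> j) x \<le> jet d \<rho> (c j) x * jet d \<rho> (\<lambda>_. \<mu> j) x"
          by (intro jet_mult[OF S(1) xS _ _ r0] c j smooth_const)
        also have "\<dots> \<le> Mj j * C1" unfolding jet_const using Mj(2)[OF True j] Mj(1) \<mu>[OF j] by (intro mult_mono) auto
        finally show "jet d \<rho> (\<lambda>x. c j x * \<mu> j) x \<le> Mj j * C1" .
      qed
      finally have s: "jet d \<rho> ?s x \<le> ?T" .
      have "jet d \<rho> (\<lambda>x. ?e x * ?s x) x \<le> jet d \<rho> ?e x * jet d \<rho> ?s x"
        by (intro jet_mult[OF S(1) xS _ _ r0] smooth_wave sm)
      also have "\<dots> \<le> E * ?T" by (intro mult_mono ex_le t s E jet_nonneg r0)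
      finally have es: "jet d \<rho> (\<lambda>x. ?e x * ?s x) x \<le> E * ?T" .
      have "jet d \<rho> (\<lambda>x. ?e x + (- 1)) x \<le> jet d \<rho> ?e x + jet d \<rho> (\<lambda>_. - 1) x"
        by (intro jet_add[OF S(1) xS _ _ r0] smooth_wave smooth_const)
      then have e1: "jet d \<rho> (\<lambda>x. ?e x - 1) x \<le> E + 1" using ex_le[OF t, of x] by (simp add: jet_const)
      have "jet d \<rho> (\<lambda>x. (?e x - 1) + ?e x * ?s x) x \<le> jet d \<rho> (\<lambda>x. ?e x - 1) x + jet d \<rho> (\<lambda>x. ?e x * ?s x) x"
        by (intro jet_add[OF S(1) xS _ _ r0] smooth_minus smooth_mult smooth_wave smooth_const sm S)
      then have in_le: "jet d \<rho> (\<lambda>x. ?e x - 1 + ?e x * ?s x) x \<le> E + 1 + E * ?T" using e1 es by linarith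
      have "jet d \<rho> (rel_error \<tau> \<mu>) x \<le> jet d \<rho> cutoff x * jet d \<rho> (\<lambda>x. ?e x - 1 + ?e x * ?s x) x"
        unfolding rel_error_def by (intro jet_mult[OF S(1) xS _ _ r0] smooth_subset[OF cutoff(1)] smooth_inner subset_UNIV)
      also have "\<dots> \<le> Mc * (E + 1 + E * ?T)"
        by (intro mult_mono Mc(2) r0 rho1 in_le Mc(1) jet_nonneg)
      finally show ?thesis .
    qed
  qed
qed

text \<open>Column \<open>k\<close> holds the Fourier coefficients of the lattice exponential of
  index \<open>k\<close> times its own relative error. The error varies with \<open>k\<close>, so
  this is not a convolution, but it is dominated by one.\<close>

definition error_matrix :: "(('n \<Rightarrow> int) \<Rightarrow> 'n \<Rightarrow> nat) \<Rightarrow> (nat \<Rightarrow> ('n \<Rightarrow> int) \<Rightarrow> complex) \<Rightarrow> ('n \<Rightarrow> int) \<Rightarrow> ('n \<Rightarrow> int) \<Rightarrow> complex" where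
  "error_matrix \<tau> \<mu> n k = fourier_coeff (rel_error (\<tau> k) (\<lambda>j. \<mu> j k)) (\<lambda>i. n i - k i)"

definition good_data :: "(('n \<Rightarrow> int) \<Rightarrow> 'n \<Rightarrow> nat) \<Rightarrow> (nat \<Rightarrow> ('n \<Rightarrow> int) \<Rightarrow> complex) \<Rightarrow> bool" where
  "good_data \<tau> \<mu> \<longleftrightarrow> (\<forall>k. \<tau> k \<in> nodes m) \<and> (\<forall>j\<in>{1..r}. \<forall>k. cmod (\<mu> j k) \<le> C1)"

text \<open>The power of 2 is the constant of \<open>fourier_coeff_decay\<close> at exponent
  2.\<close>

definition cA :: real where "cA = 2 ^ (2 * CARD('n)) * e0"

lemma cA: "cA \<ge> 0" "cA * wsum TYPE('n) \<le> 1 / 4"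
  using e0 by (auto simp: cA_def)

lemma error_matrix_decay_class:
  obtains M where "\<And>\<tau> \<mu>. good_data \<tau> \<mu> \<Longrightarrow> decay_class cA M (error_matrix \<tau> \<mu>)"
proof -
  have "\<exists>M. \<forall>\<tau> \<mu> x. \<tau> \<in> nodes m \<longrightarrow> (\<forall>j\<in>{1..r}. cmod (\<mu> j) \<le> C1) \<longrightarrow> jet d \<rho> (rel_error \<tau> \<mu>) x \<le> M" for d
    using rel_error_bounded[of d] by (metis (no_types, lifting))
  then obtain M where M: "\<And>d \<tau> \<mu> x. \<tau> \<in> nodes m \<Longrightarrow> (\<forall>j\<in>{1..r}. cmod (\<mu> j) \<le> C1) \<Longrightarrow> jet d \<rho> (rel_error \<tau> \<mu>) x \<le> M d" by metis
  show ?thesis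
  proof (rule that[of "\<lambda>s. 2 ^ (s * CARD('n)) * M (s * CARD('n))"])
    fix \<tau> \<mu> assume g: "good_data \<tau> \<mu>"
    have t: "\<tau> k \<in> nodes m" "\<forall>j\<in>{1..r}. cmod (\<mu> j k) \<le> C1" for k using g by (auto simp: good_data_def)
    show "decay_class cA (\<lambda>s. 2 ^ (s * CARD('n)) * M (s * CARD('n))) (error_matrix \<tau> \<mu>)"
      unfolding decay_class_def
    proof (intro conjI allI)
      fix k l
      show "cmod (error_matrix \<tau> \<mu> k l) * W 1 (\<lambda>i. k i - l i) ^ s \<le> 2 ^ (s * CARD('n)) * M (s * CARD('n))" for s
        unfolding error_matrix_def by (rule fourier_coeff_decay[OF rel_error_smooth rel_error_sup]) (rule M[OF t])
      have "jet (2 * CARD('n)) \<rho> (rel_error (\<tau> l) (\<lambda>j. \<mu> j l)) x \<le> e0" for x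
        using small[OF t(1)[of l], of "\<lambda>j. \<mu> j l" x] t(2)[of l] supp_cball_jet[OF rel_error_sup, where x=x] e0
        unfolding rel_error_def[symmetric] by (cases "x \<in> cball z (2 * \<rho>)") (auto simp: not_le)
      from fourier_coeff_decay[OF rel_error_smooth rel_error_sup this]
      have "cmod (error_matrix \<tau> \<mu> k l) * W 1 (\<lambda>i. k i - l i) ^ 2 \<le> cA" unfolding error_matrix_def cA_def .
      then show "cmod (error_matrix \<tau> \<mu> k l) \<le> cA / W 1 (\<lambda>i. k i - l i) ^ 2"
        using W_ge_1[of 1 "\<lambda>i. k i - l i"] by (simp add: pos_le_divide_eq)
    qed
  qed
qed

text \<open>The factor \<open>wave z (node \<tau>)\<close> is there for the dual coefficients, which
  pair with shifted frequencies; the node 0 gives the plain case. Finitely many shifts keep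
  \<open>C\<close> uniform.\<close>

lemma cutoff_mult_decay:
  obtains C where "C \<ge> 0" "\<And>f N (\<tau> :: 'n \<Rightarrow> nat) k. f \<in> smooth_fns UNIV \<Longrightarrow> (\<And>x. x \<in> cball z (2 * \<rho>) \<Longrightarrow> jet (s * CARD('n)) 1 f x \<le> N)
     \<Longrightarrow> \<tau> \<in> nodes m \<Longrightarrow> cmod (fourier_coeff (\<lambda>x. cutoff x * (f x * wave z (node \<tau>) x)) k) * W 1 k ^ s \<le> C * N"
proof -
  let ?d = "s * CARD('n)"
  obtain Mc where Mc: "Mc \<ge> 0" "\<And>x r. 0 \<le> r \<Longrightarrow> r \<le> 1 \<Longrightarrow> jet ?d r cutoff x \<le> Mc" using jet_cutoff by blast
  define E where "E = (1 + real (CARD('n) * m)) ^ ?d"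
  have E: "E \<ge> 0" by (simp add: E_def)
  have r0: "0 \<le> \<rho>" using rho by simp
  show ?thesis
  proof (rule that[of "2 ^ ?d * (Mc * E)"])
    show "0 \<le> 2 ^ ?d * (Mc * E)" using Mc E by simp
    fix f N k and \<tau> :: "'n \<Rightarrow> nat"
    assume f: "f \<in> smooth_fns UNIV" and N: "\<And>x. x \<in> cball z (2 * \<rho>) \<Longrightarrow> jet ?d 1 f x \<le> N" and t: "\<tau> \<in> nodes m"
    have sm: "(\<lambda>x. f x * wave z (node \<tau>) x) \<in> smooth_fns UNIV" by (intro smooth_mult f smooth_wave open_UNIV)
    have N0: "N \<ge> 0" using N[of z] jet_nonneg[of 1 ?d f z] rho by simp
    let ?g = "\<lambda>x. cutoff x * (f x * wave z (node \<tau>) x)"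
    have sg: "supp_cball z (2 * \<rho>) ?g" by (rule supp_cball_mult1[OF cutoff_sup])
    have "jet ?d \<rho> ?g x \<le> Mc * (N * E)" for x
    proof (cases "x \<in> cball z (2 * \<rho>)")
      case True
      have "jet ?d \<rho> (wave z (node \<tau>)) x \<le> jet ?d 1 (wave z (node \<tau>)) x" by (intro jet_mono_r r0 rho1)
      also have "\<dots> \<le> (1 + norm1 (node \<tau> :: real^'n)) ^ ?d" by (rule jet_wave)
      also have "\<dots> \<le> E" unfolding E_def using norm1_node[OF t] norm1_nonneg[of "node \<tau> :: real^'n"] by (intro power_mono) auto
      finally have e: "jet ?d \<rho> (wave z (node \<tau>)) x \<le> E" .
      have fN: "jet ?d \<rho> f x \<le> N" using jet_mono_r[OF r0 rho1, of ?d f x] N[OF True] by linarith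
      have "jet ?d \<rho> (\<lambda>x. f x * wave z (node \<tau>) x) x \<le> jet ?d \<rho> f x * jet ?d \<rho> (wave z (node \<tau>)) x"
        by (intro jet_mult[OF open_UNIV UNIV_I f smooth_wave r0])
      also have "\<dots> \<le> N * E" by (intro mult_mono fN e N0 jet_nonneg r0)
      finally have fe: "jet ?d \<rho> (\<lambda>x. f x * wave z (node \<tau>) x) x \<le> N * E" .
      have "jet ?d \<rho> ?g x \<le> jet ?d \<rho> cutoff x * jet ?d \<rho> (\<lambda>x. f x * wave z (node \<tau>) x) x"
        by (intro jet_mult[OF open_UNIV UNIV_I cutoff(1) sm r0])
      also have "\<dots> \<le> Mc * (N * E)" by (intro mult_mono Mc r0 rho1 fe jet_nonneg)
      finally show ?thesis .
    next
      case False
      then show ?thesis using supp_cball_jet[OF sg, where x=x] Mc N0 E by (auto simp: not_le)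
    qed
    from fourier_coeff_decay[OF smooth_mult[OF open_UNIV cutoff(1) sm] sg this, of k]
    show "cmod (fourier_coeff ?g k) * W 1 k ^ s \<le> 2 ^ ?d * (Mc * E) * N" by (simp add: mult_ac)
  qed
qed

lemma wave_series_decay_bound:
  fixes \<xi> :: "('n \<Rightarrow> int) \<Rightarrow> real^'n"
  assumes a: "\<And>k. cmod (a k) * W 1 k ^ (d + 2) \<le> N" and D: "D \<ge> 0" and \<xi>: "\<And>k. norm1 (\<xi> k) \<le> norm1 (lat k) + D"
    and ra: "rapid a \<xi>"
  shows "jet d 1 (wave_series z a \<xi>) x \<le> (1 + 1 / \<rho> + D) ^ d * wsum TYPE('n) * N"
proof -
  let ?c = "1 + 1 / \<rho> + D"
  let ?g = "\<lambda>k :: 'n \<Rightarrow> int. ?c ^ d * N * (1 / W 1 k ^ 2)"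
  have b: "norm (cmod (a k) * (1 + norm1 (\<xi> k)) ^ d) \<le> ?g k" for k
  proof -
    have W: "W 1 k \<ge> 1" by (simp add: W_ge_1)
    have "D * 1 \<le> D * W 1 k" by (intro mult_left_mono W D)
    then have "1 + norm1 (\<xi> k) \<le> ?c * W 1 k" using \<xi>[of k] norm1_lat_le[of k] by (simp add: algebra_simps)
    then have "(1 + norm1 (\<xi> k)) ^ d \<le> (?c * W 1 k) ^ d" by (intro power_mono) (auto simp: norm1_nonneg)
    then have "cmod (a k) * (1 + norm1 (\<xi> k)) ^ d \<le> cmod (a k) * (?c * W 1 k) ^ d" by (intro mult_left_mono) auto
    also have "\<dots> = ?c ^ d * (cmod (a k) * W 1 k ^ d)" by (simp add: power_mult_distrib mult_ac)
    also have "\<dots> \<le> ?c ^ d * (N / W 1 k ^ 2)"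
      using a[of k] W rho D by (intro mult_left_mono) (auto simp: field_simps power_add power2_eq_square)
    finally show ?thesis by (simp add: norm1_pow_nonneg)
  qed
  have "jet d 1 (wave_series z a \<xi>) x \<le> (\<Sum>\<^sub>\<infinity>k. cmod (a k) * (1 + norm1 (\<xi> k)) ^ d)" by (rule jet_wave_series[OF ra])
  also have "\<dots> \<le> (\<Sum>\<^sub>\<infinity>k. ?g k)"
    using b by (intro infsum_mono rapidD ra summable_on_cmult_right summable_W) (auto simp: norm1_pow_nonneg)
  also have "\<dots> = ?c ^ d * N * wsum TYPE('n)" unfolding wsum_def by (intro infsum_cmult_right summable_W)
  finally show ?thesis by (simp add: mult_ac)
qed

end

subsection \<open>Symbols and transposes\<close>

definition symb :: "nat \<Rightarrow> ('n::finite mindex \<Rightarrow> real^'n \<Rightarrow> complex) \<Rightarrow> real^'n \<Rightarrow> real^'n \<Rightarrow> complex" where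
  "symb mo pc x \<xi> = (\<Sum>\<alpha> | mdeg \<alpha> \<le> mo. pc \<alpha> x * of_real (\<Prod>i\<in>UNIV. (\<xi> $ i) ^ \<alpha> i))"

lemma power_mdeg: "(\<Prod>i\<in>UNIV. (w :: complex) ^ \<alpha> i) = w ^ mdeg \<alpha>"
  by (simp add: mdeg_def power_sum)

lemma mD_cong_open:
  assumes "open S" "x \<in> S" "\<And>y. y \<in> S \<Longrightarrow> f y = g y"
  shows "mD \<alpha> f x = mD \<alpha> g x"
  unfolding mD_def mpartial_partials using partials_cong_open[OF assms] by simp

lemma diffop_cong_open:
  assumes "open S" "x \<in> S" "\<And>y. y \<in> S \<Longrightarrow> f y = g y"
  shows "diffop mo pc f x = diffop mo pc g x"
  unfolding diffop_def using mD_cong_open[OF assms] by simp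

text \<open>The factor -\<i> in each D cancels the \<i> produced by differentiating an exponential,
  so every term is multiplied by the symbol at its frequency.\<close>

lemma diffop_wave_series:
  assumes a: "rapid a \<xi>"
  shows "diffop mo pc (wave_series z a \<xi>) x = (\<Sum>\<^sub>\<infinity>k. a k * symb mo pc x (\<xi> k) * wave z (\<xi> k) x)"
proof -
  let ?p = "\<lambda>\<alpha> k. of_real (\<Prod>i\<in>UNIV. (\<xi> k $ i) ^ \<alpha> i) :: complex"
  have pr: "(\<Prod>i\<leftarrow>mlist \<alpha>. \<i> * of_real (\<xi> k $ i)) = \<i> ^ mdeg \<alpha> * ?p \<alpha> k" for \<alpha> k
    by (simp add: prod_list_mlist power_mult_distrib prod.distrib power_mdeg)
  have r: "rapid (\<lambda>k. a k * (\<i> ^ mdeg \<alpha> * ?p \<alpha> k)) \<xi>" for \<alpha>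
    using partials_wave_series(1)[OF a, of "mlist \<alpha>"] by (simp add: pr)
  have mD: "mD \<alpha> (wave_series z a \<xi>) x = (\<Sum>\<^sub>\<infinity>k. a k * ?p \<alpha> k * wave z (\<xi> k) x)"
    and sm: "(\<lambda>k. a k * ?p \<alpha> k * wave z (\<xi> k) x) summable_on UNIV" for \<alpha>
  proof -
    have e: "(- \<i>) ^ mdeg \<alpha> * \<i> ^ mdeg \<alpha> = 1" by (simp flip: power_mult_distrib)
    have "(\<lambda>k. cmod (a k * (\<i> ^ mdeg \<alpha> * ?p \<alpha> k))) summable_on UNIV" by (rule rapid_abs[OF r])
    then show "(\<lambda>k. a k * ?p \<alpha> k * wave z (\<xi> k) x) summable_on UNIV"
      by (rule summable_comparison(1)) (simp add: norm_mult norm_power)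
    have "mD \<alpha> (wave_series z a \<xi>) x = (\<Sum>\<^sub>\<infinity>k. (- \<i>) ^ mdeg \<alpha> * (a k * (\<i> ^ mdeg \<alpha> * ?p \<alpha> k) * wave z (\<xi> k) x))"
      unfolding mD_def mpartial_partials partials_wave_series(2)[OF a] wave_series_def pr by (rule infsum_cmult_right'[symmetric])
    also have "(\<lambda>k. (- \<i>) ^ mdeg \<alpha> * (a k * (\<i> ^ mdeg \<alpha> * ?p \<alpha> k) * wave z (\<xi> k) x)) = (\<lambda>k. ((- \<i>) ^ mdeg \<alpha> * \<i> ^ mdeg \<alpha>) * (a k * ?p \<alpha> k * wave z (\<xi> k) x))"
      by (simp only: mult_ac)
    finally show "mD \<alpha> (wave_series z a \<xi>) x = (\<Sum>\<^sub>\<infinity>k. a k * ?p \<alpha> k * wave z (\<xi> k) x)" unfolding e by simp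
  qed
  have "diffop mo pc (wave_series z a \<xi>) x = (\<Sum>\<alpha> | mdeg \<alpha> \<le> mo. \<Sum>\<^sub>\<infinity>k. pc \<alpha> x * (a k * ?p \<alpha> k * wave z (\<xi> k) x))"
    unfolding diffop_def mD by (simp add: infsum_cmult_right')
  also have "\<dots> = (\<Sum>\<^sub>\<infinity>k. \<Sum>\<alpha> | mdeg \<alpha> \<le> mo. pc \<alpha> x * (a k * ?p \<alpha> k * wave z (\<xi> k) x))"
    by (rule infsum_finite_sum(1)[symmetric]) (intro summable_on_cmult_right sm)
  also have "(\<lambda>k. \<Sum>\<alpha> | mdeg \<alpha> \<le> mo. pc \<alpha> x * (a k * ?p \<alpha> k * wave z (\<xi> k) x)) = (\<lambda>k. a k * symb mo pc x (\<xi> k) * wave z (\<xi> k) x)"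
    unfolding symb_def sum_distrib_left sum_distrib_right by (intro ext sum.cong) (auto simp: mult_ac)
  finally show ?thesis .
qed

lemma pc_smooth_cutoff:
  assumes S: "open S" "cball z R \<subseteq> S" and p: "p \<in> smooth_fns S" and f: "f \<in> smooth_fns UNIV" "supp_cball z R f"
  shows "(\<lambda>y. p y * f y) \<in> smooth_fns UNIV"
proof -
  have "(\<lambda>y. f y * p y) \<in> smooth_fns UNIV"
    by (rule smooth_cutoff[OF S(1) p f(1) closed_cball S(2)]) (use f(2) in \<open>auto simp: supp_cball_def\<close>)
  then show ?thesis by (simp add: mult.commute)
qed

lemma smooth_mD: "open S \<Longrightarrow> f \<in> smooth_fns S \<Longrightarrow> mD \<alpha> f \<in> smooth_fns S"
  unfolding mD_def mpartial_partials by (intro smooth_cmult smooth_partials)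

lemma smooth_diffop_transpose:
  assumes "open S" "\<And>\<alpha>. mdeg \<alpha> \<le> mo \<Longrightarrow> (\<lambda>y. pc \<alpha> y * f y) \<in> smooth_fns S"
  shows "diffop_transpose mo pc f \<in> smooth_fns S"
  unfolding diffop_transpose_def by (intro smooth_sum smooth_cmult smooth_mD assms) auto

lemma supp_cball_diffop_transpose:
  assumes "supp_cball z R f"
  shows "supp_cball z R (diffop_transpose mo pc f)"
proof -
  have "supp_cball z R (mD \<alpha> (\<lambda>y. pc \<alpha> y * f y))" for \<alpha>
    using supp_cball_partials[OF supp_cball_mult2[OF assms, of "pc \<alpha>"], of "mlist \<alpha>"]
    by (simp add: mD_def mpartial_partials supp_cball_def)
  then show ?thesis by (simp add: diffop_transpose_def supp_cball_def)
qed

lemma integral_diffop_transpose: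
  assumes S: "open S" "cball z R \<subseteq> S" and p: "\<And>\<alpha>. mdeg \<alpha> \<le> mo \<Longrightarrow> pc \<alpha> \<in> smooth_fns S"
    and f: "f \<in> smooth_fns UNIV" "supp_cball z R f"
  shows "(\<integral>x. diffop_transpose mo pc f x * wave w \<xi> x \<partial>lborel) = (\<integral>x. f x * symb mo pc x \<xi> * wave w \<xi> x \<partial>lborel)"
proof -
  let ?p = "\<lambda>\<alpha>. of_real (\<Prod>i\<in>UNIV. (\<xi> $ i) ^ \<alpha> i) :: complex"
  have sm: "(\<lambda>y. pc \<alpha> y * f y) \<in> smooth_fns UNIV" and su: "supp_cball z R (\<lambda>y. pc \<alpha> y * f y)" if "mdeg \<alpha> \<le> mo" for \<alpha>
    using pc_smooth_cutoff[OF S p[OF that] f] supp_cball_mult2[OF f(2)] by auto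
  have pr: "(\<Prod>i\<leftarrow>mlist \<alpha>. - (\<i> * of_real (\<xi> $ i))) = (- \<i>) ^ mdeg \<alpha> * ?p \<alpha>" for \<alpha>
  proof -
    have "(\<Prod>i\<leftarrow>mlist \<alpha>. - (\<i> * of_real (\<xi> $ i))) = (\<Prod>i\<in>UNIV. ((- \<i>) * of_real (\<xi> $ i)) ^ \<alpha> i)"
      by (simp add: prod_list_mlist)
    then show ?thesis unfolding power_mult_distrib prod.distrib power_mdeg by simp
  qed
  \<comment> \<open>Three signs meet: one from the transposition, one from the factor -\<i> in D,
    and one from integrating by parts. Their product is 1, so the pairing yields the symbol itself,
    without reflection or conjugation.\<close>
  have e: "(- 1 :: complex) ^ d * (- \<i>) ^ d * (- \<i>) ^ d = 1" for d
    by (simp flip: power_mult_distrib)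
  have i1: "integrable lborel (\<lambda>x. (- 1) ^ mdeg \<alpha> * mD \<alpha> (\<lambda>y. pc \<alpha> y * f y) x * wave w \<xi> x)"
    and v1: "(\<integral>x. (- 1) ^ mdeg \<alpha> * mD \<alpha> (\<lambda>y. pc \<alpha> y * f y) x * wave w \<xi> x \<partial>lborel) = (\<integral>x. pc \<alpha> x * ?p \<alpha> * f x * wave w \<xi> x \<partial>lborel)"
    and i2: "integrable lborel (\<lambda>x. pc \<alpha> x * ?p \<alpha> * f x * wave w \<xi> x)"
    if "mdeg \<alpha> \<le> mo" for \<alpha>
  proof -
    let ?g = "\<lambda>y. pc \<alpha> y * f y"
    note g = sm[OF that] su[OF that]
    have eq1: "(\<lambda>x. (- 1) ^ mdeg \<alpha> * mD \<alpha> ?g x * wave w \<xi> x) = (\<lambda>x. ((- 1) ^ mdeg \<alpha> * (- \<i>) ^ mdeg \<alpha>) * (partials (mlist \<alpha>) ?g x * wave w \<xi> x))"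
      by (simp add: mD_def mpartial_partials mult_ac)
    have eq2: "(\<lambda>x. pc \<alpha> x * ?p \<alpha> * f x * wave w \<xi> x) = (\<lambda>x. ?p \<alpha> * (?g x * wave w \<xi> x))"
      by (simp only: mult_ac)
    show "integrable lborel (\<lambda>x. (- 1) ^ mdeg \<alpha> * mD \<alpha> ?g x * wave w \<xi> x)"
      unfolding eq1 by (intro integrable_mult_right smooth_supp_cball_integrable_wave[OF smooth_partials[OF g(1)] supp_cball_partials[OF g(2)]])
    show "integrable lborel (\<lambda>x. pc \<alpha> x * ?p \<alpha> * f x * wave w \<xi> x)"
      unfolding eq2 by (intro integrable_mult_right smooth_supp_cball_integrable_wave[OF g])
    have "(\<integral>x. (- 1) ^ mdeg \<alpha> * mD \<alpha> ?g x * wave w \<xi> x \<partial>lborel) = ((- 1) ^ mdeg \<alpha> * (- \<i>) ^ mdeg \<alpha> * (- \<i>) ^ mdeg \<alpha>) * (?p \<alpha> * (\<integral>x. ?g x * wave w \<xi> x \<partial>lborel))"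
      unfolding eq1 integral_mult_right_zero integral_partials_wave[OF g] pr by (simp only: mult_ac)
    then show "(\<integral>x. (- 1) ^ mdeg \<alpha> * mD \<alpha> ?g x * wave w \<xi> x \<partial>lborel) = (\<integral>x. pc \<alpha> x * ?p \<alpha> * f x * wave w \<xi> x \<partial>lborel)"
      unfolding eq2 integral_mult_right_zero e by simp
  qed
  have "(\<integral>x. diffop_transpose mo pc f x * wave w \<xi> x \<partial>lborel) = (\<integral>x. (\<Sum>\<alpha> | mdeg \<alpha> \<le> mo. (- 1) ^ mdeg \<alpha> * mD \<alpha> (\<lambda>y. pc \<alpha> y * f y) x * wave w \<xi> x) \<partial>lborel)"
    unfolding diffop_transpose_def sum_distrib_right ..
  also have "\<dots> = (\<Sum>\<alpha> | mdeg \<alpha> \<le> mo. \<integral>x. (- 1) ^ mdeg \<alpha> * mD \<alpha> (\<lambda>y. pc \<alpha> y * f y) x * wave w \<xi> x \<partial>lborel)"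
    by (rule Bochner_Integration.integral_sum) (use i1 in simp)
  also have "\<dots> = (\<Sum>\<alpha> | mdeg \<alpha> \<le> mo. \<integral>x. pc \<alpha> x * ?p \<alpha> * f x * wave w \<xi> x \<partial>lborel)"
    by (rule sum.cong) (use v1 in auto)
  also have "\<dots> = (\<integral>x. (\<Sum>\<alpha> | mdeg \<alpha> \<le> mo. pc \<alpha> x * ?p \<alpha> * f x * wave w \<xi> x) \<partial>lborel)"
    by (rule Bochner_Integration.integral_sum[symmetric]) (use i2 in simp)
  also have "(\<lambda>x. \<Sum>\<alpha> | mdeg \<alpha> \<le> mo. pc \<alpha> x * ?p \<alpha> * f x * wave w \<xi> x) = (\<lambda>x. f x * symb mo pc x \<xi> * wave w \<xi> x)"
    unfolding symb_def sum_distrib_left sum_distrib_right by (intro ext sum.cong) (auto simp: mult_ac)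
  finally show ?thesis .
qed

section \<open>Solution operators and their bounds\<close>

context parametrix
begin

definition freq :: "(('n \<Rightarrow> int) \<Rightarrow> 'n \<Rightarrow> nat) \<Rightarrow> ('n \<Rightarrow> int) \<Rightarrow> real^'n" where
  "freq \<tau> k = lat k + node (\<tau> k)"

text \<open>
  With \<open>A = error_matrix\<close>: \<open>local_sol\<close> comes from solving \<open>(1 + A) g = fourier_coeff f\<close>, and \<open>dual_sol\<close>
  from the transposed equation; \<open>local_sol\<close> is a right inverse of the operator on \<open>ball z \<rho>\<close>, and
  \<open>dual_sol\<close> a left inverse of its transpose on functions supported there.
\<close>

definition sol_coeff where "sol_coeff \<tau> \<mu> f = neumann_sol (error_matrix \<tau> \<mu>) (fourier_coeff (\<lambda>x. cutoff x * f x))"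

definition sol_series where "sol_series \<tau> \<mu> q f = wave_series z (\<lambda>k. sol_coeff \<tau> \<mu> f k / q k) (freq \<tau>)"

definition local_sol where "local_sol \<tau> \<mu> q f = (\<lambda>x. cutoff x * sol_series \<tau> \<mu> q f x)"

text \<open>Up to the cutoff, the normalized pairing of \<open>f\<close> with the exponential of
  frequency \<open>freq \<tau> k\<close>, divided by the symbol there. The index is
  \<open>neg k\<close> because \<open>fourier_coeff\<close> already reflects.\<close>

definition dual_coeff where "dual_coeff \<tau> q f k = fourier_coeff (\<lambda>x. cutoff x * (f x * wave z (node (\<tau> k)) x)) (neg k) / q k"

definition dual_sol_coeff where "dual_sol_coeff \<tau> \<mu> q f = neumann_sol (\<lambda>k n. error_matrix \<tau> \<mu> n k) (dual_coeff \<tau> q f)"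

definition dual_sol where "dual_sol \<tau> \<mu> q f = (\<lambda>x. cutoff x * wave_series z (dual_sol_coeff \<tau> \<mu> q f) (\<lambda>k. lat (neg k)) x)"

text \<open>Division by \<open>q\<close> loses \<open>D\<close> powers of \<open>W 1\<close>, which
  is paid by regularity, and the factor \<open>K\<close>. In the net of parametrices
  \<open>K\<close> is a constant times a power of 1/\<epsilon> and \<open>D\<close> is
  fixed.\<close>

definition good_symbol :: "real \<Rightarrow> nat \<Rightarrow> (('n \<Rightarrow> int) \<Rightarrow> complex) \<Rightarrow> bool" where
  "good_symbol K D q \<longleftrightarrow> (\<forall>k. q k \<noteq> 0 \<and> 1 / cmod (q k) \<le> K * W 1 k ^ D)"

lemma jet_cball_bounded:
  assumes "f \<in> smooth_fns UNIV"
  obtains N where "\<And>x. x \<in> cball z (2 * \<rho>) \<Longrightarrow> jet d 1 f x \<le> N"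
  using jet_bounded[OF assms compact_cball subset_UNIV] by metis

lemma node_0: "(\<lambda>_. 0) \<in> nodes m" "node (\<lambda>_ :: 'n. 0) = 0"
  by (auto simp: nodes_def node_def vec_eq_iff)

lemma cutoff_mult_bound:
  obtains C where "C \<ge> 0" "\<And>f N k. f \<in> smooth_fns UNIV \<Longrightarrow> (\<And>x. x \<in> cball z (2 * \<rho>) \<Longrightarrow> jet (s * CARD('n)) 1 f x \<le> N)
     \<Longrightarrow> cmod (fourier_coeff (\<lambda>x. cutoff x * f x) k) * W 1 k ^ s \<le> C * N"
proof -
  obtain C where C: "C \<ge> 0" "\<And>f N (\<tau> :: 'n \<Rightarrow> nat) k. f \<in> smooth_fns UNIV \<Longrightarrow> (\<And>x. x \<in> cball z (2 * \<rho>) \<Longrightarrow> jet (s * CARD('n)) 1 f x \<le> N)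
     \<Longrightarrow> \<tau> \<in> nodes m \<Longrightarrow> cmod (fourier_coeff (\<lambda>x. cutoff x * (f x * wave z (node \<tau>) x)) k) * W 1 k ^ s \<le> C * N"
    by (rule cutoff_mult_decay[where s="s"]) blast
  from that[OF C(1)] C(2)[OF _ _ node_0(1)] show ?thesis unfolding node_0(2) wave_0 mult_1_right by blast
qed

lemma nonneg_N:
  assumes "\<And>x. x \<in> cball z (2 * \<rho>) \<Longrightarrow> jet d 1 f x \<le> N"
  shows "N \<ge> 0"
  using assms[of z] jet_nonneg[of 1 d f z] rho by simp

lemma W_pos: "W 1 (k :: 'n \<Rightarrow> int) > 0"
  using W_ge_1[of 1 k] by simp

lemma good_symbol_nonneg:
  assumes "good_symbol K D q"
  shows "K \<ge> 0"
proof -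
  have "0 \<le> 1 / cmod (q (\<lambda>_. 0))" by simp
  also have "\<dots> \<le> K * W 1 (\<lambda>_ :: 'n. 0) ^ D" using assms by (simp add: good_symbol_def)
  finally show ?thesis by (simp add: W_def)
qed

lemma div_q_bound:
  assumes q: "good_symbol K D q" and a: "cmod a * W 1 k ^ (s + D) \<le> N"
  shows "cmod (a / q k) * W 1 k ^ s \<le> K * N"
proof -
  have qk: "1 / cmod (q k) \<le> K * W 1 k ^ D" "cmod (q k) > 0" using q by (auto simp: good_symbol_def)
  have K: "K \<ge> 0" by (rule good_symbol_nonneg[OF q])
  have "cmod (a / q k) * W 1 k ^ s = (cmod a * W 1 k ^ s) * (1 / cmod (q k))" by (simp add: norm_divide)
  also have "\<dots> \<le> (cmod a * W 1 k ^ s) * (K * W 1 k ^ D)"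
    using W_pos[of k] by (intro mult_left_mono qk) auto
  also have "\<dots> = K * (cmod a * W 1 k ^ (s + D))" by (simp add: power_add)
  also have "\<dots> \<le> K * N" by (intro mult_left_mono a K)
  finally show ?thesis .
qed

lemma norm1_freq: "good_data \<tau> \<mu> \<Longrightarrow> norm1 (freq \<tau> k) \<le> norm1 (lat k) + CARD('n) * m"
  using norm1_add[of "lat k" "node (\<tau> k)"] norm1_node[of "\<tau> k" m] by (auto simp: good_data_def freq_def intro: order_trans)

lemma norm1_lat_neg: "norm1 (lat (neg k)) = norm1 (lat k)"
  by (simp add: norm1_lat neg_def)

lemma sol_coeff_bound:
  obtains C where "C \<ge> 0" "\<And>\<tau> \<mu> f N k. good_data \<tau> \<mu> \<Longrightarrow> f \<in> smooth_fns UNIV \<Longrightarrow>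
     (\<And>x. x \<in> cball z (2 * \<rho>) \<Longrightarrow> jet (s * CARD('n)) 1 f x \<le> N) \<Longrightarrow> cmod (sol_coeff \<tau> \<mu> f k) * W 1 k ^ s \<le> C * N"
proof -
  obtain M where M: "\<And>\<tau> \<mu>. good_data \<tau> \<mu> \<Longrightarrow> decay_class cA M (error_matrix \<tau> \<mu>)" by (rule error_matrix_decay_class) blast
  obtain C1 where C1: "C1 \<ge> 0" "\<And>f N k. f \<in> smooth_fns UNIV \<Longrightarrow> (\<And>x. x \<in> cball z (2 * \<rho>) \<Longrightarrow> jet (s * CARD('n)) 1 f x \<le> N)
     \<Longrightarrow> cmod (fourier_coeff (\<lambda>x. cutoff x * f x) k) * W 1 k ^ s \<le> C1 * N" by (rule cutoff_mult_bound[where s="s"]) blast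
  obtain C2 where C2: "C2 \<ge> 0" "\<And>A f K (k :: 'n \<Rightarrow> int). decay_class cA M A \<Longrightarrow> (\<And>k. cmod (f k) * W 1 k ^ s \<le> K) \<Longrightarrow> cmod (neumann_sol A f k) * W 1 k ^ s \<le> C2 * K"
    using neumann_sol_W_bound[OF cA, of M s] by metis
  show ?thesis
  proof (rule that[of "C2 * C1"])
    fix \<tau> \<mu> f N k
    assume g: "good_data \<tau> \<mu>" and f: "f \<in> smooth_fns UNIV" "\<And>x. x \<in> cball z (2 * \<rho>) \<Longrightarrow> jet (s * CARD('n)) 1 f x \<le> N"
    from C2(2)[OF M[OF g] C1(2)[OF f]] show "cmod (sol_coeff \<tau> \<mu> f k) * W 1 k ^ s \<le> C2 * C1 * N"
      unfolding sol_coeff_def by (simp add: mult.assoc)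
  qed (use C1 C2 in simp)
qed

text \<open>Here \<open>q\<close> is divided out before the Neumann inversion, so the
  \<open>D\<close> additional orders are already required of \<open>f\<close> at this stage. The
  transposed matrix lies in the same decay class.\<close>

lemma dual_sol_coeff_bound:
  obtains C where "C \<ge> 0" "\<And>\<tau> \<mu> q K f N k. good_data \<tau> \<mu> \<Longrightarrow> good_symbol K D q \<Longrightarrow> f \<in> smooth_fns UNIV \<Longrightarrow>
     (\<And>x. x \<in> cball z (2 * \<rho>) \<Longrightarrow> jet ((s + D) * CARD('n)) 1 f x \<le> N) \<Longrightarrow>
     cmod (dual_coeff \<tau> q f k) * W 1 k ^ s \<le> C * K * N \<and> cmod (dual_sol_coeff \<tau> \<mu> q f k) * W 1 k ^ s \<le> C * K * N"
proof -
  obtain M where M: "\<And>\<tau> \<mu>. good_data \<tau> \<mu> \<Longrightarrow> decay_class cA M (error_matrix \<tau> \<mu>)" by (rule error_matrix_decay_class) blast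
  obtain C1 where C1: "C1 \<ge> 0" "\<And>f N (\<tau> :: 'n \<Rightarrow> nat) k. f \<in> smooth_fns UNIV \<Longrightarrow> (\<And>x. x \<in> cball z (2 * \<rho>) \<Longrightarrow> jet ((s + D) * CARD('n)) 1 f x \<le> N)
     \<Longrightarrow> \<tau> \<in> nodes m \<Longrightarrow> cmod (fourier_coeff (\<lambda>x. cutoff x * (f x * wave z (node \<tau>) x)) k) * W 1 k ^ (s + D) \<le> C1 * N"
    by (rule cutoff_mult_decay[where s="s + D"]) blast
  obtain C2 where C2: "C2 \<ge> 0" "\<And>A f K (k :: 'n \<Rightarrow> int). decay_class cA M A \<Longrightarrow> (\<And>k. cmod (f k) * W 1 k ^ s \<le> K) \<Longrightarrow> cmod (neumann_sol A f k) * W 1 k ^ s \<le> C2 * K"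
    using neumann_sol_W_bound[OF cA, of M s] by metis
  show ?thesis
  proof (rule that[of "max C1 (C2 * C1)"])
    fix \<tau> \<mu> q K f N k
    assume g: "good_data \<tau> \<mu>" and q: "good_symbol K D q"
      and f: "f \<in> smooth_fns UNIV" "\<And>x. x \<in> cball z (2 * \<rho>) \<Longrightarrow> jet ((s + D) * CARD('n)) 1 f x \<le> N"
    have t: "\<tau> k \<in> nodes m" for k using g by (simp add: good_data_def)
    have N0: "N \<ge> 0" by (rule nonneg_N[OF f(2)])
    have K0: "K \<ge> 0" by (rule good_symbol_nonneg[OF q])
    have B: "cmod (dual_coeff \<tau> q f k) * W 1 k ^ s \<le> K * (C1 * N)" for k
      unfolding dual_coeff_def using C1(2)[OF f t[of k], of "neg k"] by (intro div_q_bound[OF q]) (simp add: neg_def)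
    have H: "cmod (dual_sol_coeff \<tau> \<mu> q f k) * W 1 k ^ s \<le> C2 * (K * (C1 * N))"
      unfolding dual_sol_coeff_def by (rule C2(2)[OF decay_class_transpose[OF M[OF g]] B])
    have "K * (C1 * N) \<le> max C1 (C2 * C1) * K * N"
      using mult_right_mono[of C1 "max C1 (C2 * C1)" "K * N"] K0 N0 by (simp add: mult_ac)
    moreover have "C2 * (K * (C1 * N)) \<le> max C1 (C2 * C1) * K * N"
      using mult_right_mono[of "C2 * C1" "max C1 (C2 * C1)" "K * N"] K0 N0 by (simp add: mult_ac)
    ultimately show "cmod (dual_coeff \<tau> q f k) * W 1 k ^ s \<le> max C1 (C2 * C1) * K * N \<and> cmod (dual_sol_coeff \<tau> \<mu> q f k) * W 1 k ^ s \<le> max C1 (C2 * C1) * K * N"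
      using B[of k] H by linarith
  qed (use C1 in simp)
qed

lemma rapid_w:
  assumes g: "good_data \<tau> \<mu>" and q: "good_symbol K D q" and f: "f \<in> smooth_fns UNIV"
  shows "rapid (\<lambda>k. sol_coeff \<tau> \<mu> f k / q k) (freq \<tau>)" "rapid (sol_coeff \<tau> \<mu> f) lat"
proof -
  have gb: "\<exists>M. \<forall>k. cmod (sol_coeff \<tau> \<mu> f k) * W 1 k ^ s \<le> M" for s
  proof -
    obtain C where "C \<ge> 0" and C: "\<And>\<tau> \<mu> f N k. good_data \<tau> \<mu> \<Longrightarrow> f \<in> smooth_fns UNIV \<Longrightarrow>
     (\<And>x. x \<in> cball z (2 * \<rho>) \<Longrightarrow> jet (s * CARD('n)) 1 f x \<le> N) \<Longrightarrow> cmod (sol_coeff \<tau> \<mu> f k) * W 1 k ^ s \<le> C * N" by (rule sol_coeff_bound[where s="s"]) blast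
    obtain N where "\<And>x. x \<in> cball z (2 * \<rho>) \<Longrightarrow> jet (s * CARD('n)) 1 f x \<le> N" by (rule jet_cball_bounded[OF f, where d="s * CARD('n)"]) blast
    from C[OF g f this] show ?thesis by blast
  qed
  show "rapid (sol_coeff \<tau> \<mu> f) lat" by (rule rapid_lat[OF gb, where D=0]) auto
  show "rapid (\<lambda>k. sol_coeff \<tau> \<mu> f k / q k) (freq \<tau>)"
  proof (rule rapid_lat[where D="CARD('n) * m"])
    fix s
    obtain M where "\<And>k. cmod (sol_coeff \<tau> \<mu> f k) * W 1 k ^ (s + D) \<le> M" using gb by blast
    then show "\<exists>M. \<forall>k. cmod (sol_coeff \<tau> \<mu> f k / q k) * W 1 k ^ s \<le> M" using div_q_bound[OF q] by blast
  qed (use norm1_freq[OF g] in auto)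
qed

lemma rapid_h:
  assumes g: "good_data \<tau> \<mu>" and q: "good_symbol K D q" and f: "f \<in> smooth_fns UNIV"
  shows "rapid (dual_sol_coeff \<tau> \<mu> q f) (\<lambda>k. lat (neg k))"
proof (rule rapid_lat[where D=0])
  fix s
  obtain C where "C \<ge> 0" and C: "\<And>\<tau> \<mu> q K f N k. good_data \<tau> \<mu> \<Longrightarrow> good_symbol K D q \<Longrightarrow> f \<in> smooth_fns UNIV \<Longrightarrow>
     (\<And>x. x \<in> cball z (2 * \<rho>) \<Longrightarrow> jet ((s + D) * CARD('n)) 1 f x \<le> N) \<Longrightarrow>
     cmod (dual_coeff \<tau> q f k) * W 1 k ^ s \<le> C * K * N \<and> cmod (dual_sol_coeff \<tau> \<mu> q f k) * W 1 k ^ s \<le> C * K * N" by (rule dual_sol_coeff_bound[where D=D and s=s]) blast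
  obtain N where "\<And>x. x \<in> cball z (2 * \<rho>) \<Longrightarrow> jet ((s + D) * CARD('n)) 1 f x \<le> N" by (rule jet_cball_bounded[OF f, where d="(s + D) * CARD('n)"]) blast
  from C[OF g q f this] show "\<exists>M. \<forall>k. cmod (dual_sol_coeff \<tau> \<mu> q f k) * W 1 k ^ s \<le> M" by blast
qed (auto simp: norm1_lat_neg)

lemma cut_bound:
  assumes "w \<in> smooth_fns UNIV"
  shows "jet d 1 (\<lambda>x. cutoff x * w x) x \<le> jet d 1 cutoff x * jet d 1 w x"
  by (rule jet_mult[OF open_UNIV UNIV_I cutoff(1) assms]) simp

text \<open>The constants are fixed before the shifts, the quotients and the symbol values, so they
  are uniform in \<epsilon>. In the order \<open>d + 2 + D\<close>, the 2 pays for lattice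
  summability and \<open>D\<close> for the division by \<open>q\<close>.\<close>

theorem local_sol_bound:
  obtains C s where "C \<ge> 0" "\<And>\<tau> \<mu> q K f N x. good_data \<tau> \<mu> \<Longrightarrow> good_symbol K D q \<Longrightarrow> f \<in> smooth_fns UNIV \<Longrightarrow>
     (\<And>x. x \<in> cball z (2 * \<rho>) \<Longrightarrow> jet s 1 f x \<le> N) \<Longrightarrow> jet d 1 (local_sol \<tau> \<mu> q f) x \<le> C * K * N"
proof -
  obtain C where C: "C \<ge> 0" "\<And>\<tau> \<mu> f N k. good_data \<tau> \<mu> \<Longrightarrow> f \<in> smooth_fns UNIV \<Longrightarrow>
     (\<And>x. x \<in> cball z (2 * \<rho>) \<Longrightarrow> jet ((d + 2 + D) * CARD('n)) 1 f x \<le> N) \<Longrightarrow> cmod (sol_coeff \<tau> \<mu> f k) * W 1 k ^ (d + 2 + D) \<le> C * N" by (rule sol_coeff_bound[where s="d + 2 + D"]) blast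
  obtain Mc where Mc: "Mc \<ge> 0" "\<And>x r. 0 \<le> r \<Longrightarrow> r \<le> 1 \<Longrightarrow> jet d r cutoff x \<le> Mc" by (rule jet_cutoff[where d=d]) blast
  let ?e = "(1 + 1 / \<rho> + real (CARD('n) * m)) ^ d * wsum TYPE('n)"
  have e0: "?e \<ge> 0" unfolding wsum_def using rho by (intro mult_nonneg_nonneg infsum_nonneg zero_le_power) auto
  show ?thesis
  proof (rule that[of "Mc * (?e * C)" "(d + 2 + D) * CARD('n)"])
    show "0 \<le> Mc * (?e * C)" by (rule mult_nonneg_nonneg[OF Mc(1) mult_nonneg_nonneg[OF e0 C(1)]])
    fix \<tau> \<mu> q K f N x
    assume g: "good_data \<tau> \<mu>" and q: "good_symbol K D q" and f: "f \<in> smooth_fns UNIV" "\<And>x. x \<in> cball z (2 * \<rho>) \<Longrightarrow> jet ((d + 2 + D) * CARD('n)) 1 f x \<le> N"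
    have "jet d 1 (sol_series \<tau> \<mu> q f) x \<le> ?e * (K * (C * N))"
      unfolding sol_series_def by (rule wave_series_decay_bound[OF div_q_bound[OF q C(2)[OF g f]] _ norm1_freq[OF g] rapid_w(1)[OF g q f(1)]]) auto
    then have "jet d 1 cutoff x * jet d 1 (sol_series \<tau> \<mu> q f) x \<le> Mc * (?e * (K * (C * N)))"
      by (intro mult_mono Mc) (auto intro: jet_nonneg Mc)
    moreover have "sol_series \<tau> \<mu> q f \<in> smooth_fns UNIV" unfolding sol_series_def by (rule smooth_wave_series[OF rapid_w(1)[OF g q f(1)]])
    ultimately have "jet d 1 (local_sol \<tau> \<mu> q f) x \<le> Mc * (?e * (K * (C * N)))"
      unfolding local_sol_def using cut_bound[of "sol_series \<tau> \<mu> q f" d x] by linarith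
    then show "jet d 1 (local_sol \<tau> \<mu> q f) x \<le> Mc * (?e * C) * K * N" by (simp only: mult_ac)
  qed
qed

theorem dual_sol_bound:
  obtains C s where "C \<ge> 0" "\<And>\<tau> \<mu> q K f N x. good_data \<tau> \<mu> \<Longrightarrow> good_symbol K D q \<Longrightarrow> f \<in> smooth_fns UNIV \<Longrightarrow>
     (\<And>x. x \<in> cball z (2 * \<rho>) \<Longrightarrow> jet s 1 f x \<le> N) \<Longrightarrow> jet d 1 (dual_sol \<tau> \<mu> q f) x \<le> C * K * N"
proof -
  obtain C where C: "C \<ge> 0" "\<And>\<tau> \<mu> q K f N k. good_data \<tau> \<mu> \<Longrightarrow> good_symbol K D q \<Longrightarrow> f \<in> smooth_fns UNIV \<Longrightarrow>
     (\<And>x. x \<in> cball z (2 * \<rho>) \<Longrightarrow> jet ((d + 2 + D) * CARD('n)) 1 f x \<le> N) \<Longrightarrow>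
     cmod (dual_coeff \<tau> q f k) * W 1 k ^ (d + 2) \<le> C * K * N \<and> cmod (dual_sol_coeff \<tau> \<mu> q f k) * W 1 k ^ (d + 2) \<le> C * K * N" by (rule dual_sol_coeff_bound[where D=D and s="d + 2"]) blast
  obtain Mc where Mc: "Mc \<ge> 0" "\<And>x r. 0 \<le> r \<Longrightarrow> r \<le> 1 \<Longrightarrow> jet d r cutoff x \<le> Mc" by (rule jet_cutoff[where d=d]) blast
  let ?e = "(1 + 1 / \<rho> + 0) ^ d * wsum TYPE('n)"
  have e0: "?e \<ge> 0" unfolding wsum_def using rho by (intro mult_nonneg_nonneg infsum_nonneg zero_le_power) auto
  show ?thesis
  proof (rule that[of "Mc * (?e * C)" "(d + 2 + D) * CARD('n)"])
    show "0 \<le> Mc * (?e * C)" by (rule mult_nonneg_nonneg[OF Mc(1) mult_nonneg_nonneg[OF e0 C(1)]])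
    fix \<tau> \<mu> q K f N x
    assume g: "good_data \<tau> \<mu>" and q: "good_symbol K D q" and f: "f \<in> smooth_fns UNIV" "\<And>x. x \<in> cball z (2 * \<rho>) \<Longrightarrow> jet ((d + 2 + D) * CARD('n)) 1 f x \<le> N"
    let ?w = "wave_series z (dual_sol_coeff \<tau> \<mu> q f) (\<lambda>k. lat (neg k))"
    note ra = rapid_h[OF g q f(1)]
    have "jet d 1 ?w x \<le> ?e * (C * K * N)"
      by (rule wave_series_decay_bound[OF conjunct2[OF C(2)[OF g q f]] _ _ ra]) (auto simp: norm1_lat_neg)
    then have "jet d 1 cutoff x * jet d 1 ?w x \<le> Mc * (?e * (C * K * N))"
      by (intro mult_mono Mc) (auto intro: jet_nonneg Mc)
    then have "jet d 1 (dual_sol \<tau> \<mu> q f) x \<le> Mc * (?e * (C * K * N))"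
      unfolding dual_sol_def using cut_bound[OF smooth_wave_series[OF ra, of z], of d x] by linarith
    then show "jet d 1 (dual_sol \<tau> \<mu> q f) x \<le> Mc * (?e * C) * K * N" by (simp only: mult_ac)
  qed
qed

end

text \<open>For \<open>E n\<close> the value of the exponential of index \<open>n\<close> at a fixed
  point. The majorant is the absolutely summable sequence \<open>g\<close> convolved with the kernel
  \<beta>, so trivial weights suffice.\<close>

lemma (in contraction) swap_matrix:
  assumes w: "\<And>k. \<omega> k = 1" and g: "(\<lambda>k. cmod (g k)) summable_on UNIV" and E: "\<And>n. cmod (E n) \<le> 1"
  shows "(\<Sum>\<^sub>\<infinity>n. E n * matrix_op A g n) = (\<Sum>\<^sub>\<infinity>k. g k * (\<Sum>\<^sub>\<infinity>n. A n k * E n))"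
    and "(\<lambda>n. E n * matrix_op A g n) summable_on UNIV"
    and "(\<lambda>k. g k * (\<Sum>\<^sub>\<infinity>n. A n k * E n)) summable_on UNIV"
proof -
  have sb: "\<beta> summable_on UNIV" using summ by (simp add: w)
  let ?F = "\<lambda>(k, n). cmod (g k) * \<beta> (\<lambda>i. n i - k i)"
  have bij: "bij_betw (\<lambda>n i. n i - k i) UNIV (UNIV :: ('n \<Rightarrow> int) set)" for k :: "'n \<Rightarrow> int"
    by (rule bij_betwI[of _ _ _ "\<lambda>n i. n i + k i"]) auto
  have shift: "(\<lambda>n. \<beta> (\<lambda>i. n i - k i)) summable_on UNIV" "(\<Sum>\<^sub>\<infinity>n. \<beta> (\<lambda>i. n i - k i)) = infsum \<beta> UNIV" for k
    using summable_on_reindex_bij_betw[OF bij, of \<beta> k] infsum_reindex_bij_betw[OF bij, of \<beta> k] sb by auto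
  have b0: "\<beta> (\<lambda>i. n i - k i) \<ge> 0" for n k using A_le[of n k] norm_ge_zero order_trans by blast
  have F: "?F summable_on (UNIV \<times> UNIV)"
  proof (rule summable_on_SigmaI[where g="\<lambda>k. cmod (g k) * infsum \<beta> UNIV"])
    show "((\<lambda>n. ?F (k, n)) has_sum cmod (g k) * infsum \<beta> UNIV) UNIV" for k
      unfolding prod.case by (intro has_sum_cmult_right) (use shift[of k] in \<open>simp add: has_sum_iff\<close>)
    show "(\<lambda>k. cmod (g k) * infsum \<beta> UNIV) summable_on UNIV" by (intro summable_on_cmult_left g)
    show "0 \<le> ?F (k, n)" for k n using b0[of n k] by simp
  qed
  have s: "(\<lambda>(k, n). E n * (A n k * g k)) summable_on (UNIV \<times> UNIV)"
  proof (rule summable_comparison(1)[OF F])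
    fix p :: "('n \<Rightarrow> int) \<times> ('n \<Rightarrow> int)"
    obtain k n where p: "p = (k, n)" by fastforce
    have "cmod (E n) * (cmod (A n k) * cmod (g k)) \<le> 1 * (\<beta> (\<lambda>i. n i - k i) * cmod (g k))"
      by (intro mult_mono E A_le) (auto simp: b0)
    then show "norm (case p of (k, n) \<Rightarrow> E n * (A n k * g k)) \<le> ?F p"
      by (simp add: p norm_mult mult_ac)
  qed
  have s': "(\<lambda>(n, k). E n * (A n k * g k)) summable_on (UNIV \<times> UNIV)"
    using s summable_on_swap[of "\<lambda>(k, n). E n * (A n k * g k)" UNIV UNIV] by (simp add: case_prod_unfold)
  have c1: "(\<Sum>\<^sub>\<infinity>k. E n * (A n k * g k)) = E n * matrix_op A g n" for n
    unfolding matrix_op_def by (rule infsum_cmult_right')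
  have c2: "(\<Sum>\<^sub>\<infinity>n. E n * (A n k * g k)) = g k * (\<Sum>\<^sub>\<infinity>n. A n k * E n)" for k
    unfolding infsum_cmult_right'[symmetric] by (intro infsum_cong) (simp add: mult_ac)
  show "(\<Sum>\<^sub>\<infinity>n. E n * matrix_op A g n) = (\<Sum>\<^sub>\<infinity>k. g k * (\<Sum>\<^sub>\<infinity>n. A n k * E n))"
    using infsum_swap_banach[OF s'] unfolding c1 c2 .
  show "(\<lambda>n. E n * matrix_op A g n) summable_on UNIV"
    using summable_on_Sigma_banach[of "\<lambda>n k. E n * (A n k * g k)" UNIV "\<lambda>_. UNIV"] s' by (simp add: c1)
  show "(\<lambda>k. g k * (\<Sum>\<^sub>\<infinity>n. A n k * E n)) summable_on UNIV"
    using summable_on_Sigma_banach[of "\<lambda>k n. E n * (A n k * g k)" UNIV "\<lambda>_. UNIV"] s by (simp add: c2)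
qed

section \<open>Exactness of the local inverses\<close>

context parametrix
begin

lemma contraction_error_matrix:
  assumes "good_data \<tau> \<mu>"
  obtains \<beta> where "contraction (error_matrix \<tau> \<mu>) \<beta> (\<lambda>_. 1)" "contraction (\<lambda>k n. error_matrix \<tau> \<mu> n k) \<beta> (\<lambda>_. 1)"
proof -
  obtain M where M: "\<And>\<tau> \<mu>. good_data \<tau> \<mu> \<Longrightarrow> decay_class cA M (error_matrix \<tau> \<mu>)" by (rule error_matrix_decay_class) blast
  obtain h \<beta> where cutoff: "\<And>A :: ('n \<Rightarrow> int) \<Rightarrow> ('n \<Rightarrow> int) \<Rightarrow> complex. decay_class cA M A \<Longrightarrow> contraction A \<beta> (\<lambda>k. W h k ^ 0)"
    by (rule decay_class_contraction[OF cA, of M 0]) blast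
  show ?thesis
    using that[of \<beta>] cutoff[OF M[OF assms]] cutoff[OF decay_class_transpose[OF M[OF assms]]] by simp
qed

lemma near: "dist z x \<le> \<rho> \<Longrightarrow> \<bar>x $ i - z $ i\<bar> < pi * \<rho>"
proof -
  assume x: "dist z x \<le> \<rho>"
  have "\<bar>x $ i - z $ i\<bar> \<le> \<rho>" using component_le_norm_cart[of "x - z" i] x by (simp add: dist_norm norm_minus_commute)
  also have "\<rho> < pi * \<rho>" using pi_gt3 rho by simp
  finally show ?thesis .
qed

lemma near2: "dist z x \<le> 2 * \<rho> \<Longrightarrow> \<bar>x $ i - z $ i\<bar> < pi * \<rho>"
proof -
  assume x: "dist z x \<le> 2 * \<rho>"
  have "\<bar>x $ i - z $ i\<bar> \<le> 2 * \<rho>" using component_le_norm_cart[of "x - z" i] x by (simp add: dist_norm norm_minus_commute)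
  also have "2 * \<rho> < pi * \<rho>" using pi_gt3 rho by simp
  finally show ?thesis .
qed

text \<open>Fourier inversion of the relative error, with indices translated by \<open>k\<close> so
  that its coefficients become column \<open>k\<close> of the matrix.\<close>

lemma rel_error_expand:
  assumes x: "dist z x \<le> 2 * \<rho>"
  shows "wave z (lat k) x * rel_error (\<tau> k) (\<lambda>j. \<mu> j k) x = (\<Sum>\<^sub>\<infinity>n. error_matrix \<tau> \<mu> n k * wave z (lat n) x)"
proof -
  have bij: "bij_betw (\<lambda>n i. n i - k i) UNIV (UNIV :: ('n \<Rightarrow> int) set)"
    by (rule bij_betwI[of _ _ _ "\<lambda>n i. n i + k i"]) auto
  let ?b = "rel_error (\<tau> k) (\<lambda>j. \<mu> j k)"
  have e: "wave z (lat n) x = wave z (lat k) x * wave z (lat (\<lambda>i. n i - k i)) x" for n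
    using lat_add[of k "\<lambda>i. n i - k i"] by (simp flip: wave_add)
  have "wave z (lat k) x * ?b x = wave z (lat k) x * (\<Sum>\<^sub>\<infinity>l. fourier_coeff ?b l * wave z (lat l) x)"
    using inversion[OF rel_error_smooth rel_error_sup near2[OF x]] by (simp add: wave_series_def)
  also have "(\<Sum>\<^sub>\<infinity>l. fourier_coeff ?b l * wave z (lat l) x) = (\<Sum>\<^sub>\<infinity>n. fourier_coeff ?b (\<lambda>i. n i - k i) * wave z (lat (\<lambda>i. n i - k i)) x)"
    by (rule infsum_reindex_bij_betw[OF bij, symmetric])
  also have "wave z (lat k) x * \<dots> = (\<Sum>\<^sub>\<infinity>n. wave z (lat k) x * (fourier_coeff ?b (\<lambda>i. n i - k i) * wave z (lat (\<lambda>i. n i - k i)) x))"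
    by (rule infsum_cmult_right'[symmetric])
  also have "\<dots> = (\<Sum>\<^sub>\<infinity>n. error_matrix \<tau> \<mu> n k * wave z (lat n) x)"
    unfolding error_matrix_def by (intro infsum_cong) (subst (2) e, simp add: mult_ac)
  finally show ?thesis .
qed

lemma cutoff_mult_smooth: "f \<in> smooth_fns UNIV \<Longrightarrow> (\<lambda>x. cutoff x * f x) \<in> smooth_fns UNIV"
  by (intro smooth_mult cutoff open_UNIV)

lemma fourier_coeff_bounded: "f \<in> smooth_fns UNIV \<Longrightarrow> supp_cball z (2 * \<rho>) f \<Longrightarrow> \<exists>M. \<forall>k. cmod (fourier_coeff f k) * 1 \<le> M"
proof -
  assume f: "f \<in> smooth_fns UNIV" "supp_cball z (2 * \<rho>) f"
  obtain M where "M \<ge> 0" "\<And>x. cmod (f x) \<le> M" by (rule supp_cball_bounded[OF smooth_continuous_on[OF f(1)] f(2)]) blast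
  then have "\<And>x. jet (0 * CARD('n)) \<rho> f x \<le> M" by simp
  from fourier_coeff_decay[OF f this] show ?thesis by (intro exI[of _ M]) simp
qed

text \<open>Expanding each relative error and summing over the columns collects the coefficients of
  (1 + A) applied to \<open>sol_coeff\<close>. By construction these are the Fourier coefficients of
  the cut-off \<open>f\<close>.\<close>

lemma sol_coeff_series:
  assumes g: "good_data \<tau> \<mu>" and q: "good_symbol K D q" and f: "f \<in> smooth_fns UNIV" and x: "dist z x \<le> \<rho>"
  shows "(\<Sum>\<^sub>\<infinity>k. sol_coeff \<tau> \<mu> f k * wave z (lat k) x * (1 + rel_error (\<tau> k) (\<lambda>j. \<mu> j k) x)) = f x"
proof -
  obtain \<beta> where "contraction (error_matrix \<tau> \<mu>) \<beta> (\<lambda>_. 1)" by (rule contraction_error_matrix[OF g]) blast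
  then interpret c: contraction "error_matrix \<tau> \<mu>" \<beta> "\<lambda>_. 1" .
  let ?g = "sol_coeff \<tau> \<mu> f" and ?A = "error_matrix \<tau> \<mu>" and ?e = "\<lambda>n. wave z (lat n) x"
  have x2: "dist z x \<le> 2 * \<rho>" using x rho by simp
  have sg: "(\<lambda>k. cmod (?g k)) summable_on UNIV" by (rule rapid_abs[OF rapid_w(2)[OF g q f]])
  have s1: "(\<lambda>k. ?e k * ?g k) summable_on UNIV"
    by (rule summable_comparison(1)[OF sg]) (simp add: norm_mult)
  note sw = c.swap_matrix[OF _ sg, of ?e]
  have cutoff_mult: "(\<lambda>x. cutoff x * f x) \<in> smooth_fns UNIV" "supp_cball z (2 * \<rho>) (\<lambda>x. cutoff x * f x)"
    using cutoff_mult_smooth[OF f] supp_cball_mult1[OF cutoff_sup] by auto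
  obtain M where M: "\<And>k. cmod (fourier_coeff (\<lambda>x. cutoff x * f x) k) * 1 \<le> M" using fourier_coeff_bounded[OF cutoff_mult] by blast
  have eq: "?g n + matrix_op ?A ?g n = fourier_coeff (\<lambda>x. cutoff x * f x) n" for n
    unfolding sol_coeff_def by (rule c.neumann_sol_eq[OF M])
  have b: "?g k * ?e k * (1 + rel_error (\<tau> k) (\<lambda>j. \<mu> j k) x) = ?e k * ?g k + ?g k * (\<Sum>\<^sub>\<infinity>n. ?A n k * ?e n)" for k
    unfolding rel_error_expand[OF x2, symmetric] by (simp add: algebra_simps)
  have "(\<Sum>\<^sub>\<infinity>k. ?g k * ?e k * (1 + rel_error (\<tau> k) (\<lambda>j. \<mu> j k) x)) = (\<Sum>\<^sub>\<infinity>k. ?e k * ?g k) + (\<Sum>\<^sub>\<infinity>k. ?g k * (\<Sum>\<^sub>\<infinity>n. ?A n k * ?e n))"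
    unfolding b by (rule infsum_add[OF s1 sw(3)]) auto
  also have "\<dots> = (\<Sum>\<^sub>\<infinity>k. ?e k * ?g k) + (\<Sum>\<^sub>\<infinity>n. ?e n * matrix_op ?A ?g n)"
    by (subst sw(1)) auto
  also have "\<dots> = (\<Sum>\<^sub>\<infinity>n. ?e n * ?g n + ?e n * matrix_op ?A ?g n)"
    by (rule infsum_add[symmetric, OF s1 sw(2)]) auto
  also have "\<dots> = wave_series z (fourier_coeff (\<lambda>x. cutoff x * f x)) lat x"
    unfolding wave_series_def distrib_left[symmetric] eq by (simp add: mult.commute)
  also have "\<dots> = cutoff x * f x" by (rule inversion[OF cutoff_mult near[OF x]])
  finally show ?thesis using cutoff(2)[OF x] by simp
qed

lemma sol_series_smooth:
  assumes "good_data \<tau> \<mu>" "good_symbol K D q" "f \<in> smooth_fns UNIV"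
  shows "sol_series \<tau> \<mu> q f \<in> smooth_fns UNIV" "local_sol \<tau> \<mu> q f \<in> smooth_fns UNIV" "supp_cball z (2 * \<rho>) (local_sol \<tau> \<mu> q f)"
proof -
  show 1: "sol_series \<tau> \<mu> q f \<in> smooth_fns UNIV" unfolding sol_series_def by (rule smooth_wave_series[OF rapid_w(1)[OF assms]])
  show "local_sol \<tau> \<mu> q f \<in> smooth_fns UNIV" unfolding local_sol_def by (rule cutoff_mult_smooth[OF 1])
  show "supp_cball z (2 * \<rho>) (local_sol \<tau> \<mu> q f)" unfolding local_sol_def by (rule supp_cball_mult1[OF cutoff_sup])
qed

lemma rel_error_eq: "dist z x \<le> \<rho> \<Longrightarrow> 1 + rel_error \<tau> \<mu> x = wave z (node \<tau>) x * (1 + (\<Sum>j=1..r. c j x * \<mu> j))"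
  unfolding rel_error_def using cutoff(2)[of x] by (simp add: algebra_simps)

text \<open>The operator multiplies the exponential of frequency \<open>freq \<tau> k\<close> by its
  symbol. Divided by \<open>q k\<close>, this leaves the lattice exponential times 1 plus the
  relative error wherever the cutoff is 1.\<close>

theorem local_sol_solves:
  assumes g: "good_data \<tau> \<mu>" and q: "good_symbol K D q" and f: "f \<in> smooth_fns UNIV" and x: "dist z x < \<rho>"
    and sy: "\<And>k. symb mo pc x (freq \<tau> k) = q k * (1 + (\<Sum>j=1..r. c j x * \<mu> j k))"
  shows "diffop mo pc (local_sol \<tau> \<mu> q f) x = f x"
proof -
  have q0: "q k \<noteq> 0" for k using q by (simp add: good_symbol_def)
  have "diffop mo pc (local_sol \<tau> \<mu> q f) x = diffop mo pc (sol_series \<tau> \<mu> q f) x"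
    by (rule diffop_cong_open[of "ball z \<rho>"]) (use x in \<open>auto simp: local_sol_def cutoff(2)\<close>)
  also have "\<dots> = (\<Sum>\<^sub>\<infinity>k. sol_coeff \<tau> \<mu> f k / q k * symb mo pc x (freq \<tau> k) * wave z (freq \<tau> k) x)"
    unfolding sol_series_def by (rule diffop_wave_series[OF rapid_w(1)[OF g q f]])
  also have "\<dots> = (\<Sum>\<^sub>\<infinity>k. sol_coeff \<tau> \<mu> f k * wave z (lat k) x * (1 + rel_error (\<tau> k) (\<lambda>j. \<mu> j k) x))"
    unfolding sy rel_error_eq[OF less_imp_le[OF x]] unfolding freq_def wave_add using q0
    by (intro infsum_cong) (simp add: mult_ac)
  also have "\<dots> = f x" by (rule sol_coeff_series[OF g q f less_imp_le[OF x]])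
  finally show ?thesis .
qed

lemma dual_coeff_bounded:
  assumes "good_data \<tau> \<mu>" "good_symbol K D q" "f \<in> smooth_fns UNIV"
  shows "\<exists>M. \<forall>k. cmod (dual_coeff \<tau> q f k) * 1 \<le> M"
proof -
  obtain C where "C \<ge> 0" and C: "\<And>\<tau> \<mu> q K f N k. good_data \<tau> \<mu> \<Longrightarrow> good_symbol K D q \<Longrightarrow> f \<in> smooth_fns UNIV \<Longrightarrow>
     (\<And>x. x \<in> cball z (2 * \<rho>) \<Longrightarrow> jet ((0 + D) * CARD('n)) 1 f x \<le> N) \<Longrightarrow>
     cmod (dual_coeff \<tau> q f k) * W 1 k ^ 0 \<le> C * K * N \<and> cmod (dual_sol_coeff \<tau> \<mu> q f k) * W 1 k ^ 0 \<le> C * K * N" by (rule dual_sol_coeff_bound[where D=D and s=0]) blast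
  obtain N where "\<And>x. x \<in> cball z (2 * \<rho>) \<Longrightarrow> jet ((0 + D) * CARD('n)) 1 f x \<le> N" by (rule jet_cball_bounded[OF assms(3), where d="(0 + D) * CARD('n)"]) blast
  from C[OF assms this] show ?thesis by auto
qed

lemma dual_sol_smooth:
  assumes "good_data \<tau> \<mu>" "good_symbol K D q" "f \<in> smooth_fns UNIV"
  shows "dual_sol \<tau> \<mu> q f \<in> smooth_fns UNIV" "supp_cball z (2 * \<rho>) (dual_sol \<tau> \<mu> q f)"
  unfolding dual_sol_def by (rule cutoff_mult_smooth[OF smooth_wave_series[OF rapid_h[OF assms]]], rule supp_cball_mult1[OF cutoff_sup])

text \<open>This makes the composition of a distribution with \<open>dual_sol\<close> linear again.
  It rests on the linearity of the Neumann solution for bounded right-hand sides.\<close>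

theorem dual_sol_lin:
  assumes g: "good_data \<tau> \<mu>" and q: "good_symbol K D q" and f: "f \<in> smooth_fns UNIV" and f': "f' \<in> smooth_fns UNIV"
  shows "dual_sol \<tau> \<mu> q (\<lambda>x. a * f x + b * f' x) x = a * dual_sol \<tau> \<mu> q f x + b * dual_sol \<tau> \<mu> q f' x"
proof -
  obtain \<beta> where "contraction (\<lambda>k n. error_matrix \<tau> \<mu> n k) \<beta> (\<lambda>_. 1)" by (rule contraction_error_matrix[OF g]) blast
  then interpret c: contraction "\<lambda>k n. error_matrix \<tau> \<mu> n k" \<beta> "\<lambda>_. 1" .
  have B: "dual_coeff \<tau> q (\<lambda>x. a * f x + b * f' x) = (\<lambda>k. a * dual_coeff \<tau> q f k + b * dual_coeff \<tau> q f' k)"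
  proof
    fix k
    let ?e = "\<lambda>f x. cutoff x * (f x * wave z (node (\<tau> k)) x) * wave z (lat (neg (neg k))) x"
    have i: "integrable lborel (?e f)" if "f \<in> smooth_fns UNIV" for f
      by (rule smooth_supp_cball_integrable_wave[of _ z "2 * \<rho>"]) (intro smooth_mult cutoff that smooth_wave open_UNIV supp_cball_mult1 cutoff_sup)+
    have "(\<integral>x. ?e (\<lambda>x. a * f x + b * f' x) x \<partial>lborel) = (\<integral>x. a * ?e f x + b * ?e f' x \<partial>lborel)"
      by (intro Bochner_Integration.integral_cong refl) (simp add: algebra_simps)
    also have "\<dots> = a * (\<integral>x. ?e f x \<partial>lborel) + b * (\<integral>x. ?e f' x \<partial>lborel)"
      unfolding Bochner_Integration.integral_add[OF integrable_mult_right[OF i[OF f]] integrable_mult_right[OF i[OF f']]] by simp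
    finally show "dual_coeff \<tau> q (\<lambda>x. a * f x + b * f' x) k = a * dual_coeff \<tau> q f k + b * dual_coeff \<tau> q f' k"
      unfolding dual_coeff_def fourier_coeff_def by (simp only: add_divide_distrib times_divide_eq_right)
  qed
  obtain M where M: "\<And>k. cmod (dual_coeff \<tau> q f k) * 1 \<le> M" using dual_coeff_bounded[OF g q f] by blast
  obtain M' where M': "\<And>k. cmod (dual_coeff \<tau> q f' k) * 1 \<le> M'" using dual_coeff_bounded[OF g q f'] by blast
  have h: "dual_sol_coeff \<tau> \<mu> q (\<lambda>x. a * f x + b * f' x) = (\<lambda>k. a * dual_sol_coeff \<tau> \<mu> q f k + b * dual_sol_coeff \<tau> \<mu> q f' k)"
    unfolding dual_sol_coeff_def B by (rule c.neumann_sol_lin[OF M M'])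
  have s: "(\<lambda>k. dual_sol_coeff \<tau> \<mu> q f k * wave z (lat (neg k)) x) summable_on UNIV" if "f \<in> smooth_fns UNIV" for f
    by (rule summable_comparison(1)[OF rapid_abs[OF rapid_h[OF g q that]]]) (simp add: norm_mult)
  have "wave_series z (dual_sol_coeff \<tau> \<mu> q (\<lambda>x. a * f x + b * f' x)) (\<lambda>k. lat (neg k)) x
    = (\<Sum>\<^sub>\<infinity>k. a * (dual_sol_coeff \<tau> \<mu> q f k * wave z (lat (neg k)) x) + b * (dual_sol_coeff \<tau> \<mu> q f' k * wave z (lat (neg k)) x))"
    unfolding wave_series_def h by (simp add: algebra_simps)
  also have "\<dots> = a * wave_series z (dual_sol_coeff \<tau> \<mu> q f) (\<lambda>k. lat (neg k)) x + b * wave_series z (dual_sol_coeff \<tau> \<mu> q f') (\<lambda>k. lat (neg k)) x"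
    unfolding wave_series_def
    by (subst infsum_add) (auto intro!: summable_on_cmult_right s f f' simp: infsum_cmult_right')
  finally show ?thesis unfolding dual_sol_def by (simp add: algebra_simps)
qed

text \<open>Pairing the transposed operator applied to \<open>f\<close> with the exponential of
  frequency \<open>freq \<tau> k\<close> moves the symbol onto the exponential. Divided by
  \<open>q k\<close>, this is (1 + transposed A) acting on the Fourier coefficients of
  \<open>f\<close>, and the transposed equation determines them uniquely.\<close>

theorem dual_sol_left_inverse:
  assumes g: "good_data \<tau> \<mu>" and q: "good_symbol K D q"
    and pc: "\<And>\<alpha>. mdeg \<alpha> \<le> mo \<Longrightarrow> pc \<alpha> \<in> smooth_fns S"
    and sy: "\<And>k x. x \<in> S \<Longrightarrow> symb mo pc x (freq \<tau> k) = q k * (1 + (\<Sum>j=1..r. c j x * \<mu> j k))"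
    and f: "f \<in> smooth_fns UNIV" "supp_cball z R f" and R: "R \<le> \<rho>"
  shows "dual_sol \<tau> \<mu> q (diffop_transpose mo pc f) = f"
proof -
  obtain \<beta> where "contraction (\<lambda>k n. error_matrix \<tau> \<mu> n k) \<beta> (\<lambda>_. 1)" by (rule contraction_error_matrix[OF g]) blast
  then interpret c: contraction "\<lambda>k n. error_matrix \<tau> \<mu> n k" \<beta> "\<lambda>_. 1" .
  have q0: "q k \<noteq> 0" for k using q by (simp add: good_symbol_def)
  have RS: "cball z R \<subseteq> S" using S(2) R rho by (auto simp: subset_iff)
  have f2: "supp_cball z (2 * \<rho>) f" using supp_cball_mono[OF f(2)] R rho by simp
  have cutoff_mult: "cutoff x * f x = f x" for x
    using cutoff(2)[of x] f(2) R by (cases "dist z x \<le> \<rho>") (auto simp: supp_cball_def)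
  have smp: "(\<lambda>y. pc \<alpha> y * f y) \<in> smooth_fns UNIV" if "mdeg \<alpha> \<le> mo" for \<alpha>
    by (rule pc_smooth_cutoff[OF S(1) RS pc[OF that] f])
  let ?P = "diffop_transpose mo pc f"
  have P: "?P \<in> smooth_fns UNIV" by (rule smooth_diffop_transpose[OF open_UNIV smp])
  have Psup: "supp_cball z R ?P" by (rule supp_cball_diffop_transpose[OF f(2)])
  have ctP: "cutoff x * ?P x = ?P x" for x
    using cutoff(2)[of x] Psup R by (cases "dist z x \<le> \<rho>") (auto simp: supp_cball_def)
  \<comment> \<open>The candidate: the true coefficients of \<open>f\<close>, reflected because the
    dual side pairs with exponentials without conjugation.\<close>
  define h where "h k = fourier_coeff f (neg k)" for k
  have hi: "(\<integral>x. f x * wave z (lat k) x \<partial>lborel) / of_real vol = h k" for k by (simp add: h_def fourier_coeff_def)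
  obtain M where M: "\<And>k. cmod (fourier_coeff f k) * 1 \<le> M" using fourier_coeff_bounded[OF f(1) f2] by blast
  obtain M' where M': "\<And>k. cmod (dual_coeff \<tau> q ?P k) * 1 \<le> M'" using dual_coeff_bounded[OF g q P] by blast
  have "h = neumann_sol (\<lambda>k n. error_matrix \<tau> \<mu> n k) (dual_coeff \<tau> q ?P)"
  proof (rule c.unique[OF _ M'])
    show "cmod (h k) * 1 \<le> M" for k unfolding h_def by (rule M)
    fix k
    let ?b = "rel_error (\<tau> k) (\<lambda>j. \<mu> j k)"
    have bij: "bij_betw (\<lambda>n i. n i - k i) UNIV (UNIV :: ('n \<Rightarrow> int) set)"
      by (rule bij_betwI[of _ _ _ "\<lambda>n i. n i + k i"]) auto
    have w: "integrable lborel (\<lambda>x. f x * wave z (lat k) x)" by (rule smooth_supp_cball_integrable_wave[OF f])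
    have rb: "rapid (fourier_coeff ?b) lat" by (rule rapid_fourier_coeff[OF rel_error_smooth rel_error_sup])
    have b: "f x * wave z (lat k) x * ?b x = f x * wave z (lat k) x * wave_series z (fourier_coeff ?b) lat x" for x
    proof (cases "dist z x \<le> R")
      case True
      then have "dist z x \<le> \<rho>" using R by linarith
      from inversion[OF rel_error_smooth rel_error_sup near[OF this]] show ?thesis by simp
    qed (use f(2) in \<open>simp add: supp_cball_def\<close>)
    \<comment> \<open>On the support of \<open>f\<close> the relative error equals its own Fourier
      series, so the error term can be integrated term by term; this produces the row sums of the
      transposed matrix.\<close>
    have wb: "integrable lborel (\<lambda>x. f x * wave z (lat k) x * ?b x)" unfolding b by (rule integral_wave_series(3)[OF rb w])
    have Aopk: "(\<integral>x. f x * wave z (lat k) x * ?b x \<partial>lborel) = of_real vol * matrix_op (\<lambda>k n. error_matrix \<tau> \<mu> n k) h k"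
    proof -
      have "(\<integral>x. f x * wave z (lat k) x * ?b x \<partial>lborel) = (\<Sum>\<^sub>\<infinity>l. fourier_coeff ?b l * (\<integral>x. f x * wave z (lat k) x * wave z (lat l) x \<partial>lborel))"
        unfolding b by (rule integral_wave_series(1)[OF rb w])
      also have "\<dots> = (\<Sum>\<^sub>\<infinity>l. of_real vol * (fourier_coeff ?b l * h (\<lambda>i. k i + l i)))"
      proof (rule infsum_cong)
        fix l
        have "(\<lambda>x. f x * wave z (lat k) x * wave z (lat l) x) = (\<lambda>x. f x * wave z (lat (\<lambda>i. k i + l i)) x)"
          by (simp add: lat_add wave_add mult.assoc)
        then show "fourier_coeff ?b l * (\<integral>x. f x * wave z (lat k) x * wave z (lat l) x \<partial>lborel) = of_real vol * (fourier_coeff ?b l * h (\<lambda>i. k i + l i))"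
          using hi[of "\<lambda>i. k i + l i"] vol_pos by (simp add: field_simps)
      qed
      also have "\<dots> = of_real vol * (\<Sum>\<^sub>\<infinity>l. fourier_coeff ?b l * h (\<lambda>i. k i + l i))" by (rule infsum_cmult_right')
      also have "(\<Sum>\<^sub>\<infinity>l. fourier_coeff ?b l * h (\<lambda>i. k i + l i)) = (\<Sum>\<^sub>\<infinity>n. fourier_coeff ?b (\<lambda>i. n i - k i) * h (\<lambda>i. k i + (n i - k i)))"
        by (rule infsum_reindex_bij_betw[OF bij, symmetric])
      finally show ?thesis by (simp add: matrix_op_def error_matrix_def)
    qed
    have "(\<integral>x. cutoff x * (?P x * wave z (node (\<tau> k)) x) * wave z (lat k) x \<partial>lborel) = (\<integral>x. ?P x * wave z (freq \<tau> k) x \<partial>lborel)"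
    proof (intro Bochner_Integration.integral_cong refl)
      fix x
      have "cutoff x * (?P x * wave z (node (\<tau> k)) x) * wave z (lat k) x = (cutoff x * ?P x) * (wave z (lat k) x * wave z (node (\<tau> k)) x)"
        by (simp only: mult_ac)
      then show "cutoff x * (?P x * wave z (node (\<tau> k)) x) * wave z (lat k) x = ?P x * wave z (freq \<tau> k) x"
        by (simp add: ctP freq_def wave_add)
    qed
    also have "\<dots> = (\<integral>x. f x * symb mo pc x (freq \<tau> k) * wave z (freq \<tau> k) x \<partial>lborel)"
      by (rule integral_diffop_transpose[OF S(1) RS pc f])
    also have "\<dots> = (\<integral>x. q k * (f x * wave z (lat k) x + f x * wave z (lat k) x * ?b x) \<partial>lborel)"
    proof (intro Bochner_Integration.integral_cong refl)
      fix x
      show "f x * symb mo pc x (freq \<tau> k) * wave z (freq \<tau> k) x = q k * (f x * wave z (lat k) x + f x * wave z (lat k) x * ?b x)"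
      proof (cases "dist z x \<le> R")
        case True
        then have "x \<in> S" "dist z x \<le> \<rho>" using RS R by auto
        have "f x * wave z (lat k) x + f x * wave z (lat k) x * ?b x = f x * wave z (lat k) x * (1 + ?b x)" by (simp add: algebra_simps)
        then show ?thesis
          unfolding sy[OF \<open>x \<in> S\<close>] rel_error_eq[OF \<open>dist z x \<le> \<rho>\<close>] unfolding freq_def wave_add
          by (simp add: mult_ac)
      qed (use f(2) in \<open>simp add: supp_cball_def\<close>)
    qed
    also have "\<dots> = q k * ((\<integral>x. f x * wave z (lat k) x \<partial>lborel) + (\<integral>x. f x * wave z (lat k) x * ?b x \<partial>lborel))"
      unfolding integral_mult_right_zero Bochner_Integration.integral_add[OF w wb] ..
    finally have "dual_coeff \<tau> q ?P k = ((\<integral>x. f x * wave z (lat k) x \<partial>lborel) + (\<integral>x. f x * wave z (lat k) x * ?b x \<partial>lborel)) / of_real vol"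
      unfolding dual_coeff_def fourier_coeff_def neg_neg using q0[of k] by simp
    also have "\<dots> = h k + matrix_op (\<lambda>k n. error_matrix \<tau> \<mu> n k) h k"
      unfolding Aopk add_divide_distrib hi using vol_pos by simp
    finally show "h k + matrix_op (\<lambda>k n. error_matrix \<tau> \<mu> n k) h k = dual_coeff \<tau> q ?P k" ..
  qed
  then have hs: "dual_sol_coeff \<tau> \<mu> q ?P = h" unfolding dual_sol_coeff_def ..
  show ?thesis
  proof
    fix x
    show "dual_sol \<tau> \<mu> q ?P x = f x"
    proof (cases "dist z x \<le> \<rho>")
      case True
      have bn: "bij_betw neg UNIV UNIV" by (rule bij_betwI[of _ _ _ neg]) auto
      have "wave_series z h (\<lambda>k. lat (neg k)) x = (\<Sum>\<^sub>\<infinity>k. fourier_coeff f (neg k) * wave z (lat (neg k)) x)" by (simp add: wave_series_def h_def)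
      also have "\<dots> = (\<Sum>\<^sub>\<infinity>k. fourier_coeff f k * wave z (lat k) x)" by (rule infsum_reindex_bij_betw[OF bn])
      also have "\<dots> = f x" using inversion[OF f(1) f2 near[OF True]] by (simp add: wave_series_def)
      finally show ?thesis unfolding dual_sol_def hs by (simp add: cutoff_mult)
    next
      case False
      have "f x = 0" using False f(2) R by (simp add: supp_cball_def)
      \<comment> \<open>Here the cutoff need not be 1, but inversion holds on the whole ball of
        radius 2\<rho> and returns \<open>f x = 0\<close>; beyond that ball the cutoff itself
        vanishes.\<close>
      moreover have "wave_series z h (\<lambda>k. lat (neg k)) x * cutoff x = 0"
      proof (cases "dist z x \<le> 2 * \<rho>")
        case True
        have bn: "bij_betw neg UNIV UNIV" by (rule bij_betwI[of _ _ _ neg]) auto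
        have "wave_series z h (\<lambda>k. lat (neg k)) x = (\<Sum>\<^sub>\<infinity>k. fourier_coeff f (neg k) * wave z (lat (neg k)) x)" by (simp add: wave_series_def h_def)
        also have "\<dots> = (\<Sum>\<^sub>\<infinity>k. fourier_coeff f k * wave z (lat k) x)" by (rule infsum_reindex_bij_betw[OF bn])
        also have "\<dots> = f x" using inversion[OF f(1) f2 near2[OF True]] by (simp add: wave_series_def)
        finally show ?thesis using \<open>f x = 0\<close> by simp
      qed (use cutoff(3)[of x] in simp)
      ultimately show ?thesis unfolding dual_sol_def hs by (simp add: mult.commute)
    qed
  qed
qed

end

section \<open>Existence of a parametrix for small radii\<close>

lemma wsum_nonneg: "wsum TYPE('n::finite) \<ge> 0"
  unfolding wsum_def by (intro infsum_nonneg) auto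

text \<open>All constants are fixed before \<rho>: the jets of the cutoff are scale invariant in the
  weight \<rho>, and those of the finitely many shift exponentials are bounded. Both
  \<open>wave z (node \<tau>) - 1\<close> and the \<open>c j\<close> vanish at \<open>z\<close>, so
  their weighted jets become small.\<close>

lemma parametrix_exists:
  fixes z :: "real^'n::finite"
  assumes S: "open S" "z \<in> S" and c: "\<And>j. j \<in> {1..r} \<Longrightarrow> c j \<in> smooth_fns S" "\<And>j. j \<in> {1..r} \<Longrightarrow> c j z = 0"
    and C1: "C1 \<ge> 0"
  obtains \<rho> e0 cutoff where "parametrix z \<rho> S c r m C1 e0 cutoff"
proof -
  let ?d = "2 * CARD('n)"
  obtain b where b: "b \<in> smooth_fns UNIV" "\<And>x :: real^'n. dist 0 x \<le> 1 \<Longrightarrow> b x = 1" "\<And>x. dist 0 x \<ge> 2 \<Longrightarrow> b x = 0"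
    using bump_exists[of 1 2 "0 :: real^'n"] by auto
  have sb: "supp_cball 0 2 b" using b(3) by (auto simp: supp_cball_def)
  obtain M0 where M0: "M0 \<ge> 0" "\<And>x. x \<in> cball 0 2 \<Longrightarrow> jet ?d 1 b x \<le> M0"
    using jet_bounded[OF b(1) compact_cball subset_UNIV] by blast
  have M0': "jet ?d 1 b x \<le> M0" for x
    using M0 supp_cball_jet[OF sb, of x ?d 1] by (cases "x \<in> cball 0 2") (auto simp: not_le)
  define E where "E = (1 + real (CARD('n) * m)) ^ ?d"
  have E: "E \<ge> 0" by (simp add: E_def)
  \<comment> \<open>Chosen so that the lattice sum of the resulting matrix bound is at most 1/4; the
    added 1 keeps the denominator positive.\<close>
  define e0 where "e0 = 1 / (4 * 2 ^ ?d * (wsum TYPE('n) + 1))"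
  have w: "wsum TYPE('n) + 1 > 0" using wsum_nonneg[where 'n='n] by linarith
  have e0: "e0 > 0" unfolding e0_def using w by simp
  have e0w: "2 ^ ?d * e0 * wsum TYPE('n) \<le> 1 / 4"
  proof -
    have "2 ^ ?d * e0 * wsum TYPE('n) = (wsum TYPE('n) / (wsum TYPE('n) + 1)) / 4"
      unfolding e0_def by simp
    also have "\<dots> \<le> 1 / 4" using w wsum_nonneg[where 'n='n] by simp
    finally show ?thesis .
  qed
  \<comment> \<open>The factor by which the smallness \<open>e'\<close> of the building blocks is
    amplified in the full relative error; the added 1 makes division by it safe.\<close>
  define B where "B = M0 * (1 + E * (real r * C1)) + 1"
  have B: "B > 0" unfolding B_def using M0 E C1 by (simp add: add_nonneg_pos)
  define e' where "e' = e0 / B"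
  have e': "e' > 0" using e0 B by (simp add: e'_def)
  have ev1: "\<forall>\<^sub>F \<rho> in at_right 0. \<forall>\<tau>\<in>nodes m. \<forall>x\<in>cball z (2 * \<rho>). jet ?d \<rho> (\<lambda>x. wave z (node \<tau>) x - 1) x \<le> e'"
    unfolding eventually_ball_finite_distrib[OF finite_nodes]
  proof
    fix \<tau> :: "'n \<Rightarrow> nat"
    show "\<forall>\<^sub>F \<rho> in at_right 0. \<forall>x\<in>cball z (2 * \<rho>). jet ?d \<rho> (\<lambda>x. wave z (node \<tau>) x - 1) x \<le> e'"
    proof (rule jet_eventually_small[OF open_UNIV UNIV_I _ _ e'])
      show "(\<lambda>x. wave z (node \<tau>) x - 1) \<in> smooth_fns UNIV" by (intro smooth_minus smooth_wave smooth_const open_UNIV)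
    qed (simp add: wave_def)
  qed
  have ev2: "\<forall>\<^sub>F \<rho> in at_right 0. \<forall>j\<in>{1..r}. \<forall>x\<in>cball z (2 * \<rho>). jet ?d \<rho> (c j) x \<le> e'"
    unfolding eventually_ball_finite_distrib[OF finite_atLeastAtMost]
    using jet_eventually_small[OF S c e'] by blast
  obtain R where R: "R > 0" "cball z R \<subseteq> S" using S open_contains_cball by blast
  have "\<forall>\<^sub>F \<rho> in at_right 0. 0 < \<rho> \<and> \<rho> < min 1 (R / 2)"
    by (rule eventually_at_rightI[of 0 "min 1 (R / 2)"]) (use R in auto)
  with ev1 ev2 have "\<forall>\<^sub>F \<rho> in at_right 0. (0 < \<rho> \<and> \<rho> < min 1 (R / 2)) \<and>
      (\<forall>\<tau>\<in>nodes m. \<forall>x\<in>cball z (2 * \<rho>). jet ?d \<rho> (\<lambda>x. wave z (node \<tau>) x - 1) x \<le> e') \<and>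
      (\<forall>j\<in>{1..r}. \<forall>x\<in>cball z (2 * \<rho>). jet ?d \<rho> (c j) x \<le> e')"
    by eventually_elim blast
  from eventually_happens'[OF trivial_limit_at_right_real this]
  obtain \<rho> where rho': "0 < \<rho> \<and> \<rho> < min 1 (R / 2)"
    and s1: "\<And>\<tau> x. \<tau> \<in> nodes m \<Longrightarrow> x \<in> cball z (2 * \<rho>) \<Longrightarrow> jet ?d \<rho> (\<lambda>x. wave z (node \<tau>) x - 1) x \<le> e'"
    and s2: "\<And>j x. j \<in> {1..r} \<Longrightarrow> x \<in> cball z (2 * \<rho>) \<Longrightarrow> jet ?d \<rho> (c j) x \<le> e'"
    by blast
  then have rho: "0 < \<rho>" "\<rho> \<le> 1" "2 * \<rho> \<le> R" by auto
  have RS: "cball z (2 * \<rho>) \<subseteq> S" using R rho by (auto simp: subset_iff)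
  \<comment> \<open>The unit bump is dilated rather than constructed anew at each scale, so that
    \<open>M0\<close> bounds its jets for every \<rho>.\<close>
  let ?cutoff = "\<lambda>x. b ((1 / \<rho>) *\<^sub>R x + (- (1 / \<rho>) *\<^sub>R z))"
  have nb: "dist 0 ((1 / \<rho>) *\<^sub>R x + (- (1 / \<rho>) *\<^sub>R z)) = dist z x / \<rho>" for x
  proof -
    have "(1 / \<rho>) *\<^sub>R x + (- (1 / \<rho>) *\<^sub>R z) = (1 / \<rho>) *\<^sub>R (x - z)" by (simp add: scaleR_diff_right)
    then show ?thesis using rho by (simp add: dist_norm norm_minus_commute)
  qed
  have "parametrix z \<rho> S c r m C1 e0 ?cutoff"
  proof
    show "?cutoff \<in> smooth_fns UNIV" by (rule smooth_scale[OF b(1)])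
    show "?cutoff x = 1" if "dist z x \<le> \<rho>" for x using that rho by (intro b(2)) (unfold nb, simp)
    show "?cutoff x = 0" if "2 * \<rho> \<le> dist z x" for x using that rho by (intro b(3)) (unfold nb, simp add: field_simps)
    show "0 < \<rho>" "\<rho> \<le> 1" "0 \<le> e0" "0 \<le> C1" "open S" using rho e0 C1 S by auto
    show "2 ^ (2 * CARD('n)) * e0 * wsum TYPE('n) \<le> 1 / 4" by (rule e0w)
    show "cball z (2 * \<rho>) \<subseteq> S" by (rule RS)
    show "c j \<in> smooth_fns S" if "j \<in> {1..r}" for j by (rule c(1)[OF that])
    fix \<tau> :: "'n \<Rightarrow> nat" and \<mu> :: "nat \<Rightarrow> complex" and x
    assume t: "\<tau> \<in> nodes m" and \<mu>: "\<And>j. j \<in> {1..r} \<Longrightarrow> cmod (\<mu> j) \<le> C1" and x: "x \<in> cball z (2 * \<rho>)"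
    have xS: "x \<in> S" using RS x by auto
    have r0: "0 \<le> \<rho>" using rho by simp
    let ?e = "wave z (node \<tau>)" and ?s = "\<lambda>x. \<Sum>j=1..r. c j x * \<mu> j"
    have sm: "?s \<in> smooth_fns S" by (intro smooth_sum smooth_mult smooth_const S c(1))
    have "jet ?d \<rho> ?s x \<le> (\<Sum>j=1..r. jet ?d \<rho> (\<lambda>x. c j x * \<mu> j) x)"
      by (rule jet_sum[OF S(1) xS _ r0]) (intro smooth_mult smooth_const S c(1))
    also have "\<dots> \<le> (\<Sum>j=1..r. e' * C1)"
    proof (rule sum_mono)
      fix j assume j: "j \<in> {1..r}"
      have "jet ?d \<rho> (\<lambda>x. c j x * \<mu> j) x \<le> jet ?d \<rho> (c j) x * jet ?d \<rho> (\<lambda>_. \<mu> j) x"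
        by (intro jet_mult[OF S(1) xS _ _ r0] c(1) j smooth_const)
      also have "\<dots> \<le> e' * C1" unfolding jet_const using s2[OF j x] e' \<mu>[OF j] by (intro mult_mono) auto
      finally show "jet ?d \<rho> (\<lambda>x. c j x * \<mu> j) x \<le> e' * C1" .
    qed
    finally have s: "jet ?d \<rho> ?s x \<le> real r * (e' * C1)" by simp
    have "jet ?d \<rho> ?e x \<le> jet ?d 1 ?e x" by (intro jet_mono_r r0 rho)
    also have "\<dots> \<le> (1 + norm1 (node \<tau> :: real^'n)) ^ ?d" by (rule jet_wave)
    also have "\<dots> \<le> E" unfolding E_def using norm1_node[OF t] norm1_nonneg[of "node \<tau> :: real^'n"] by (intro power_mono) auto
    finally have eE: "jet ?d \<rho> ?e x \<le> E" .
    have "jet ?d \<rho> (\<lambda>x. ?e x * ?s x) x \<le> jet ?d \<rho> ?e x * jet ?d \<rho> ?s x"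
      by (intro jet_mult[OF S(1) xS _ _ r0] smooth_wave sm)
    also have "\<dots> \<le> E * (real r * (e' * C1))" by (intro mult_mono eE s E jet_nonneg r0)
    finally have es: "jet ?d \<rho> (\<lambda>x. ?e x * ?s x) x \<le> E * (real r * (e' * C1))" .
    have "jet ?d \<rho> (\<lambda>x. (?e x - 1) + ?e x * ?s x) x \<le> jet ?d \<rho> (\<lambda>x. ?e x - 1) x + jet ?d \<rho> (\<lambda>x. ?e x * ?s x) x"
      by (intro jet_add[OF S(1) xS _ _ r0] smooth_minus smooth_mult smooth_wave smooth_const sm S)
    then have inn: "jet ?d \<rho> (\<lambda>x. ?e x - 1 + ?e x * ?s x) x \<le> e' * (1 + E * (real r * C1))"
      using s1[OF t x] es by (simp add: algebra_simps)
    have ctj: "jet ?d \<rho> ?cutoff x \<le> M0"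
      using jet_scale[OF b(1), of "1 / \<rho>" ?d \<rho> "- (1 / \<rho>) *\<^sub>R z" x] rho M0' by simp
    have "jet ?d \<rho> (\<lambda>x. ?cutoff x * (?e x - 1 + ?e x * ?s x)) x \<le> jet ?d \<rho> ?cutoff x * jet ?d \<rho> (\<lambda>x. ?e x - 1 + ?e x * ?s x) x"
      by (intro jet_mult[OF S(1) xS _ _ r0] smooth_subset[OF smooth_scale[OF b(1)] subset_UNIV]
          smooth_add smooth_minus smooth_mult smooth_wave smooth_const sm S)
    also have "\<dots> \<le> M0 * (e' * (1 + E * (real r * C1)))"
      by (intro mult_mono ctj inn M0 jet_nonneg r0)
    also have "\<dots> = e0 * (M0 * (1 + E * (real r * C1)) / B)" by (simp add: e'_def)
    also have "\<dots> \<le> e0 * 1" using B e0 by (intro mult_left_mono) (auto simp: B_def)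
    finally show "jet ?d \<rho> (\<lambda>x. ?cutoff x * (?e x - 1 + ?e x * ?s x)) x \<le> e0" by simp
  qed
  then show ?thesis by (rule that)
qed

section \<open>Symbols for a fixed value of the parameter\<close>

subsection \<open>Choice of the frequencies\<close>

definition coef_ext :: "nat \<Rightarrow> ('n::finite mindex \<Rightarrow> complex) \<Rightarrow> 'n mindex \<Rightarrow> complex" where
  "coef_ext d a \<alpha> = (if mdeg \<alpha> \<le> d then a \<alpha> else 0)"

text \<open>The counterpart of \<open>P_coeff\<close> with freely chosen coefficient
  representatives, so that those for which the weight inequality holds can be inserted.\<close>

definition pcoef :: "nat \<Rightarrow> (nat \<Rightarrow> real^'n \<Rightarrow> complex) \<Rightarrow> (nat \<Rightarrow> nat) \<Rightarrow> (nat \<Rightarrow> 'n::finite mindex \<Rightarrow> complex)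
    \<Rightarrow> 'n mindex \<Rightarrow> real^'n \<Rightarrow> complex" where
  "pcoef r c ms a \<alpha> x = coef_ext (ms 0) (a 0) \<alpha> + (\<Sum>j=1..r. c j x * coef_ext (ms j) (a j) \<alpha>)"

lemma mpoly_ext:
  fixes a :: "'n::finite mindex \<Rightarrow> complex"
  assumes "d \<le> mo"
  shows "(\<Sum>\<alpha> | mdeg \<alpha> \<le> mo. coef_ext d a \<alpha> * of_real (\<Prod>i\<in>UNIV. (\<xi> $ i) ^ \<alpha> i)) = mpoly_fun d a \<xi>"
  unfolding mpoly_fun_def
  by (rule sum.mono_neutral_cong_right[OF finite_mdeg]) (use assms in \<open>auto simp: coef_ext_def\<close>)

lemma symb_pcoef:
  assumes "\<And>j. j \<le> r \<Longrightarrow> ms j \<le> mo"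
  shows "symb mo (pcoef r c ms a) x \<xi> = mpoly_fun (ms 0) (a 0) \<xi> + (\<Sum>j=1..r. c j x * mpoly_fun (ms j) (a j) \<xi>)"
proof -
  let ?p = "\<lambda>\<alpha>. of_real (\<Prod>i\<in>UNIV. (\<xi> $ i) ^ \<alpha> i) :: complex"
  have "symb mo (pcoef r c ms a) x \<xi> = (\<Sum>\<alpha> | mdeg \<alpha> \<le> mo. coef_ext (ms 0) (a 0) \<alpha> * ?p \<alpha>)
     + (\<Sum>\<alpha> | mdeg \<alpha> \<le> mo. \<Sum>j=1..r. c j x * (coef_ext (ms j) (a j) \<alpha> * ?p \<alpha>))"
    unfolding symb_def pcoef_def distrib_right sum.distrib sum_distrib_right by (simp add: mult.assoc)
  also have "(\<Sum>\<alpha> | mdeg \<alpha> \<le> mo. \<Sum>j=1..r. c j x * (coef_ext (ms j) (a j) \<alpha> * ?p \<alpha>))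
     = (\<Sum>j=1..r. c j x * (\<Sum>\<alpha> | mdeg \<alpha> \<le> mo. coef_ext (ms j) (a j) \<alpha> * ?p \<alpha>))"
    by (subst sum.swap) (simp only: sum_distrib_left)
  also have "\<dots> = (\<Sum>j=1..r. c j x * mpoly_fun (ms j) (a j) \<xi>)"
  proof (rule sum.cong[OF refl])
    fix j assume "j \<in> {1..r}"
    then have "ms j \<le> mo" using assms by simp
    from mpoly_ext[OF this, of "a j" \<xi>]
    show "c j x * (\<Sum>\<alpha> | mdeg \<alpha> \<le> mo. coef_ext (ms j) (a j) \<alpha> * ?p \<alpha>) = c j x * mpoly_fun (ms j) (a j) \<xi>"
      by (rule arg_cong)
  qed
  also have "(\<Sum>\<alpha> | mdeg \<alpha> \<le> mo. coef_ext (ms 0) (a 0) \<alpha> * ?p \<alpha>) = mpoly_fun (ms 0) (a 0) \<xi>"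
    by (rule mpoly_ext) (use assms in simp)
  finally show ?thesis .
qed

text \<open>One inequality is used at two points. At the shifted frequency itself it compares the
  weight of the leading symbol with its value and so bounds the quotients; at the fixed point
  \<open>\<xi>0\<close> it turns the lower bound \<kappa> into a lower bound for all
  \<open>q k\<close>.\<close>

lemma (in parametrix) data_exist:
  fixes a :: "nat \<Rightarrow> 'n mindex \<Rightarrow> complex"
  assumes gs: "\<And>(a :: 'n mindex \<Rightarrow> complex) \<eta>. \<exists>\<tau>\<in>nodes m. \<forall>\<xi>. jet m 1 (mpoly_fun m a) \<xi> \<le> C * (1 + norm (\<xi> - \<eta>)) ^ D * cmod (mpoly_fun m a (\<eta> + node \<tau>))"
    and C: "C \<ge> 0" and ms0: "ms 0 = m"
    and hw: "\<And>j \<xi>. j \<in> {1..r} \<Longrightarrow> weight (mpoly_fun (ms j) (a j)) \<xi> \<le> L * weight (mpoly_fun m (a 0)) \<xi>" and L: "L \<ge> 0"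
    and C1eq: "C1 = L * (card {\<alpha> :: 'n mindex. mdeg \<alpha> \<le> m} * (C * (1 + real (CARD('n) * m)) ^ D))"
    and \<kappa>: "\<kappa> > 0" "\<kappa> \<le> jet m 1 (mpoly_fun m (a 0)) \<xi>0"
  shows "\<exists>\<tau> \<mu> q. good_data \<tau> \<mu> \<and> good_symbol (C * (norm \<xi>0 + (1 + 1 / \<rho>)) ^ D / \<kappa>) D q \<and>
     (\<forall>mo x k. (\<forall>j\<le>r. ms j \<le> mo) \<longrightarrow> symb mo (pcoef r c ms a) x (freq \<tau> k) = q k * (1 + (\<Sum>j=1..r. c j x * \<mu> j k)))"
proof -
  let ?Q = "mpoly_fun m (a 0)"
  have "\<forall>k. \<exists>\<tau>. \<tau> \<in> nodes m \<and> (\<forall>\<xi>. jet m 1 ?Q \<xi> \<le> C * (1 + norm (\<xi> - lat k)) ^ D * cmod (?Q (lat k + node \<tau>)))"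
    using gs by blast
  then obtain \<tau> where t: "\<And>k. \<tau> k \<in> nodes m"
    and tb: "\<And>k \<xi>. jet m 1 ?Q \<xi> \<le> C * (1 + norm (\<xi> - lat k)) ^ D * cmod (?Q (lat k + node (\<tau> k)))" by metis
  define q where "q k = ?Q (freq \<tau> k)" for k
  define \<mu> where "\<mu> j k = mpoly_fun (ms j) (a j) (freq \<tau> k) / q k" for j k
  let ?B = "norm \<xi>0 + (1 + 1 / \<rho>)"
  \<comment> \<open>The distance from the lattice point to \<open>\<xi>0\<close> grows linearly in
    \<open>k\<close>, hence the loss of \<open>W 1\<close> to the power \<open>D\<close>.\<close>
  have nb: "1 + norm (\<xi>0 - lat k) \<le> ?B * W 1 k" for k
  proof -
    have "norm (\<xi>0 - lat k) \<le> norm \<xi>0 + norm1 (lat k)"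
      using norm_triangle_ineq4[of \<xi>0 "lat k"] norm_le_norm1[of "lat k"] by linarith
    moreover have "norm \<xi>0 * 1 \<le> norm \<xi>0 * W 1 k" by (intro mult_left_mono) (auto simp: W_ge_1)
    ultimately show ?thesis using norm1_lat_le[of k] by (simp add: distrib_right)
  qed
  have lower: "\<kappa> \<le> C * (?B * W 1 k) ^ D * cmod (q k)" for k
  proof -
    have "\<kappa> \<le> C * (1 + norm (\<xi>0 - lat k)) ^ D * cmod (q k)"
      using tb[of \<xi>0 k] \<kappa>(2) unfolding q_def freq_def by linarith
    also have "\<dots> \<le> C * (?B * W 1 k) ^ D * cmod (q k)"
      by (intro mult_right_mono mult_left_mono power_mono nb C) auto
    finally show ?thesis .
  qed
  have q0: "q k \<noteq> 0" for k using lower[of k] \<kappa>(1) by auto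
  have qg: "good_symbol (C * ?B ^ D / \<kappa>) D q"
    unfolding good_symbol_def
  proof (intro allI conjI q0)
    fix k
    have "\<kappa> \<le> (C * ?B ^ D * W 1 k ^ D) * cmod (q k)" using lower[of k] by (simp add: power_mult_distrib mult_ac)
    then have "1 / cmod (q k) \<le> (C * ?B ^ D * W 1 k ^ D) / \<kappa>" using \<kappa>(1) q0[of k] by (simp add: field_simps)
    then show "1 / cmod (q k) \<le> C * ?B ^ D / \<kappa> * W 1 k ^ D" by (simp add: mult_ac)
  qed
  have gd: "good_data \<tau> \<mu>"
    unfolding good_data_def
  proof (intro conjI allI ballI t)
    fix j k assume j: "j \<in> {1..r}"
    let ?x = "freq \<tau> k" and ?N = "card {\<alpha> :: 'n mindex. mdeg \<alpha> \<le> m}"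
    have nn: "norm (node (\<tau> k) :: real^'n) \<le> real (CARD('n) * m)"
      using norm_le_norm1[of "node (\<tau> k) :: real^'n"] norm1_node[OF t[of k]] by linarith
    have "jet m 1 ?Q ?x \<le> C * (1 + norm (node (\<tau> k) :: real^'n)) ^ D * cmod (q k)"
      using tb[of ?x k] by (simp add: q_def freq_def)
    also have "\<dots> \<le> C * (1 + real (CARD('n) * m)) ^ D * cmod (q k)"
      by (intro mult_right_mono mult_left_mono power_mono C) (use nn in auto)
    finally have jq: "jet m 1 ?Q ?x \<le> C * (1 + real (CARD('n) * m)) ^ D * cmod (q k)" .
    have "cmod (mpoly_fun (ms j) (a j) ?x) \<le> weight (mpoly_fun (ms j) (a j)) ?x" by (rule weight_ge[OF Pol_mpoly])
    also have "\<dots> \<le> L * weight ?Q ?x" by (rule hw[OF j])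
    also have "\<dots> \<le> L * (?N * jet m 1 ?Q ?x)" by (intro mult_left_mono L weight_le Pol_mpoly)
    also have "\<dots> \<le> L * (?N * (C * (1 + real (CARD('n) * m)) ^ D * cmod (q k)))"
      by (intro mult_left_mono L jq) auto
    finally have "cmod (mpoly_fun (ms j) (a j) ?x) \<le> C1 * cmod (q k)" unfolding C1eq by (simp only: mult_ac)
    then show "cmod (\<mu> j k) \<le> C1" using q0[of k] by (simp add: \<mu>_def norm_divide field_simps)
  qed
  have "symb mo (pcoef r c ms a) x (freq \<tau> k) = q k * (1 + (\<Sum>j=1..r. c j x * \<mu> j k))" if "\<forall>j\<le>r. ms j \<le> mo" for mo x k
  proof -
    have "q k * (c j x * \<mu> j k) = c j x * mpoly_fun (ms j) (a j) (freq \<tau> k)" for j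
      using q0[of k] by (simp add: \<mu>_def)
    then have "q k * (1 + (\<Sum>j=1..r. c j x * \<mu> j k)) = q k + (\<Sum>j=1..r. c j x * mpoly_fun (ms j) (a j) (freq \<tau> k))"
      by (simp only: distrib_left sum_distrib_left mult_1_right)
    then show ?thesis using symb_pcoef[of r ms mo c a x "freq \<tau> k"] that by (simp add: q_def ms0)
  qed
  with gd qg show ?thesis by blast
qed

subsection \<open>Nets of functions\<close>

text \<open>Moderate growth of nonnegative nets, stated with constant 1: a constant in front is
  absorbed by one further power of \<epsilon>, so this agrees with the formulation by O.\<close>

definition tempered :: "(real \<Rightarrow> real) \<Rightarrow> bool" where
  "tempered f \<longleftrightarrow> (\<forall>\<epsilon>. f \<epsilon> \<ge> 0) \<and> (\<exists>N. \<forall>\<^sub>F \<epsilon> in at_right 0. f \<epsilon> \<le> 1 / \<epsilon> ^ N)"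

definition rapidly_null :: "(real \<Rightarrow> real) \<Rightarrow> bool" where
  "rapidly_null f \<longleftrightarrow> (\<forall>\<epsilon>. f \<epsilon> \<ge> 0) \<and> (\<forall>q. \<forall>\<^sub>F \<epsilon> in at_right 0. f \<epsilon> \<le> \<epsilon> ^ q)"

lemma ev_pos: "\<forall>\<^sub>F \<epsilon> in at_right (0::real). 0 < \<epsilon> \<and> \<epsilon> \<le> 1"
  by (rule eventually_mono[OF eventually_at_right_unit]) auto

lemma ev_const_le: "\<forall>\<^sub>F \<epsilon> in at_right (0::real). C * \<epsilon> \<le> 1"
proof -
  have "((\<lambda>\<epsilon>::real. C * \<epsilon>) \<longlongrightarrow> C * 0) (at_right 0)" by (intro tendsto_intros)
  then have "\<forall>\<^sub>F \<epsilon> in at_right 0. C * \<epsilon> < 1" by (rule order_tendstoD) simp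
  then show ?thesis by eventually_elim simp
qed

lemma tempered_bigo:
  assumes "\<And>\<epsilon>. f \<epsilon> \<ge> 0"
  shows "tempered f \<longleftrightarrow> (\<exists>N. f \<in> O[at_right 0](\<lambda>\<epsilon>. 1 / \<epsilon> ^ N))"
proof
  assume "tempered f"
  then obtain N where "\<forall>\<^sub>F \<epsilon> in at_right 0. f \<epsilon> \<le> 1 / \<epsilon> ^ N" unfolding tempered_def by blast
  then have "\<forall>\<^sub>F \<epsilon> in at_right 0. norm (f \<epsilon>) \<le> 1 * norm (1 / \<epsilon> ^ N)"
    using ev_pos by eventually_elim (use assms in auto)
  then show "\<exists>N. f \<in> O[at_right 0](\<lambda>\<epsilon>. 1 / \<epsilon> ^ N)" using bigoI by blast
next
  assume "\<exists>N. f \<in> O[at_right 0](\<lambda>\<epsilon>. 1 / \<epsilon> ^ N)"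
  then obtain N C where "C > 0" and C: "\<forall>\<^sub>F \<epsilon> in at_right 0. norm (f \<epsilon>) \<le> C * norm (1 / \<epsilon> ^ N)"
    by (auto elim!: landau_o.bigE)
  have "\<forall>\<^sub>F \<epsilon> in at_right 0. f \<epsilon> \<le> 1 / \<epsilon> ^ Suc N"
    using C ev_pos ev_const_le[of C]
  proof eventually_elim
    fix \<epsilon> :: real assume a: "norm (f \<epsilon>) \<le> C * norm (1 / \<epsilon> ^ N)" "0 < \<epsilon> \<and> \<epsilon> \<le> 1" "C * \<epsilon> \<le> 1"
    have "f \<epsilon> \<le> C * (1 / \<epsilon> ^ N)" using a(1,2) by simp
    also have "\<dots> = (C * \<epsilon>) / \<epsilon> ^ Suc N" using a(2) by simp
    also have "\<dots> \<le> 1 / \<epsilon> ^ Suc N" using a by (intro divide_right_mono) auto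
    finally show "f \<epsilon> \<le> 1 / \<epsilon> ^ Suc N" .
  qed
  then show "tempered f" using assms unfolding tempered_def by blast
qed

lemma rapidly_null_bigo:
  assumes "\<And>\<epsilon>. f \<epsilon> \<ge> 0"
  shows "rapidly_null f \<longleftrightarrow> (\<forall>q. f \<in> O[at_right 0](\<lambda>\<epsilon>. \<epsilon> ^ q))"
proof
  assume f: "rapidly_null f"
  show "\<forall>q. f \<in> O[at_right 0](\<lambda>\<epsilon>. \<epsilon> ^ q)"
  proof
    fix q
    have "\<forall>\<^sub>F \<epsilon> in at_right 0. f \<epsilon> \<le> \<epsilon> ^ q" using f unfolding rapidly_null_def by blast
    then have "\<forall>\<^sub>F \<epsilon> in at_right 0. norm (f \<epsilon>) \<le> 1 * norm (\<epsilon> ^ q)"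
      using ev_pos by eventually_elim (use assms in auto)
    then show "f \<in> O[at_right 0](\<lambda>\<epsilon>. \<epsilon> ^ q)" by (rule bigoI)
  qed
next
  assume f: "\<forall>q. f \<in> O[at_right 0](\<lambda>\<epsilon>. \<epsilon> ^ q)"
  have "\<forall>\<^sub>F \<epsilon> in at_right 0. f \<epsilon> \<le> \<epsilon> ^ q" for q
  proof -
    have "f \<in> O[at_right 0](\<lambda>\<epsilon>. \<epsilon> ^ Suc q)" using f by blast
    then obtain C where "C > 0" and C: "\<forall>\<^sub>F \<epsilon> in at_right 0. norm (f \<epsilon>) \<le> C * norm (\<epsilon> ^ Suc q)"
      by (rule landau_o.bigE)
    show ?thesis using C ev_pos ev_const_le[of C]
    proof eventually_elim
      fix \<epsilon> :: real assume a: "norm (f \<epsilon>) \<le> C * norm (\<epsilon> ^ Suc q)" "0 < \<epsilon> \<and> \<epsilon> \<le> 1" "C * \<epsilon> \<le> 1"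
      have "f \<epsilon> \<le> (C * \<epsilon>) * \<epsilon> ^ q" using a(1,2) by (simp add: mult.assoc)
      also have "\<dots> \<le> 1 * \<epsilon> ^ q" using a by (intro mult_right_mono) auto
      finally show "f \<epsilon> \<le> \<epsilon> ^ q" by simp
    qed
  qed
  then show "rapidly_null f" using assms unfolding rapidly_null_def by blast
qed

lemma moderate_tempered: "moderate u \<longleftrightarrow> tempered (\<lambda>\<epsilon>. norm (u \<epsilon>))"
  unfolding moderate_iff by (subst tempered_bigo) auto

lemma negligible_rapidly_null: "negligible_net u \<longleftrightarrow> rapidly_null (\<lambda>\<epsilon>. norm (u \<epsilon>))"
  unfolding negligible_iff by (subst rapidly_null_bigo) auto

text \<open>The common closure properties of moderate and of negligible bounds. Every estimate for
  nets is proved once for such a \<open>Z\<close> and then used for both.\<close>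

definition tempered_ideal :: "((real \<Rightarrow> real) \<Rightarrow> bool) \<Rightarrow> bool" where
  "tempered_ideal Z \<longleftrightarrow> Z (\<lambda>_. 0) \<and> (\<forall>f g. Z f \<longrightarrow> Z g \<longrightarrow> Z (\<lambda>\<epsilon>. f \<epsilon> + g \<epsilon>)) \<and>
     (\<forall>f g. tempered f \<longrightarrow> Z g \<longrightarrow> Z (\<lambda>\<epsilon>. f \<epsilon> * g \<epsilon>)) \<and> (\<forall>f \<epsilon>. Z f \<longrightarrow> f \<epsilon> \<ge> 0) \<and>
     (\<forall>f g. Z f \<longrightarrow> (\<forall>\<epsilon>. 0 \<le> g \<epsilon>) \<longrightarrow> (\<forall>\<^sub>F \<epsilon> in at_right 0. g \<epsilon> \<le> f \<epsilon>) \<longrightarrow> Z g)"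

lemma tempered_add: "tempered f \<Longrightarrow> tempered g \<Longrightarrow> tempered (\<lambda>\<epsilon>. f \<epsilon> + g \<epsilon>)"
  using moderate_add[of f g] unfolding moderate_tempered by (simp add: tempered_def)

lemma tempered_mult: "tempered f \<Longrightarrow> tempered g \<Longrightarrow> tempered (\<lambda>\<epsilon>. f \<epsilon> * g \<epsilon>)"
  using moderate_mult[of f g] unfolding moderate_tempered by (simp add: tempered_def)

lemma tempered_const: "C \<ge> 0 \<Longrightarrow> tempered (\<lambda>_. C)"
  using moderate_const[of C] unfolding moderate_tempered by simp

lemma tempered_ideal_tempered: "tempered_ideal tempered"
  unfolding tempered_ideal_def
proof (intro conjI allI impI)
  show "tempered (\<lambda>_. 0)" by (rule tempered_const) simp
  show "f \<epsilon> \<ge> 0" if "tempered f" for f \<epsilon> using that by (simp add: tempered_def)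
  show "tempered g" if fg: "tempered f" "\<forall>\<epsilon>. 0 \<le> g \<epsilon>" "\<forall>\<^sub>F \<epsilon> in at_right 0. g \<epsilon> \<le> f \<epsilon>" for f g
  proof -
    obtain N where "\<forall>\<^sub>F \<epsilon> in at_right 0. f \<epsilon> \<le> 1 / \<epsilon> ^ N" using fg(1) unfolding tempered_def by blast
    with fg(3) have "\<forall>\<^sub>F \<epsilon> in at_right 0. g \<epsilon> \<le> 1 / \<epsilon> ^ N" by eventually_elim linarith
    then show ?thesis using fg(2) unfolding tempered_def by blast
  qed
qed (erule (1) tempered_add tempered_mult)+

lemma rapidly_null_add: "rapidly_null f \<Longrightarrow> rapidly_null g \<Longrightarrow> rapidly_null (\<lambda>\<epsilon>. f \<epsilon> + g \<epsilon>)"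
  using negligible_add[of f g] unfolding negligible_rapidly_null by (simp add: rapidly_null_def)

lemma rapidly_null_mult: "tempered f \<Longrightarrow> rapidly_null g \<Longrightarrow> rapidly_null (\<lambda>\<epsilon>. f \<epsilon> * g \<epsilon>)"
  using negligible_mult[of f g] unfolding negligible_rapidly_null moderate_tempered by (simp add: rapidly_null_def tempered_def)

lemma tempered_ideal_rapidly_null: "tempered_ideal rapidly_null"
  unfolding tempered_ideal_def
proof (intro conjI allI impI)
  show "rapidly_null (\<lambda>_. 0)" using negligible_zero[where 'a=real] unfolding negligible_rapidly_null by simp
  show "f \<epsilon> \<ge> 0" if "rapidly_null f" for f \<epsilon> using that by (simp add: rapidly_null_def)
  show "rapidly_null g" if "rapidly_null f" "\<forall>\<epsilon>. 0 \<le> g \<epsilon>" "\<forall>\<^sub>F \<epsilon> in at_right 0. g \<epsilon> \<le> f \<epsilon>" for f g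
    unfolding rapidly_null_def
  proof (intro conjI allI)
    fix q
    have "\<forall>\<^sub>F \<epsilon> in at_right 0. f \<epsilon> \<le> \<epsilon> ^ q" using that(1) unfolding rapidly_null_def by blast
    with that(3) show "\<forall>\<^sub>F \<epsilon> in at_right 0. g \<epsilon> \<le> \<epsilon> ^ q" by eventually_elim linarith
  qed (use that in auto)
qed (erule (1) rapidly_null_add rapidly_null_mult)+

lemma tempered_ideal_zero: "tempered_ideal Z \<Longrightarrow> Z (\<lambda>_. 0)"
  and tempered_ideal_add: "tempered_ideal Z \<Longrightarrow> Z f \<Longrightarrow> Z g \<Longrightarrow> Z (\<lambda>\<epsilon>. f \<epsilon> + g \<epsilon>)"
  and tempered_ideal_mult: "tempered_ideal Z \<Longrightarrow> tempered f \<Longrightarrow> Z g \<Longrightarrow> Z (\<lambda>\<epsilon>. f \<epsilon> * g \<epsilon>)"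
  and tempered_ideal_nonneg: "tempered_ideal Z \<Longrightarrow> Z f \<Longrightarrow> f \<epsilon> \<ge> 0"
  and tempered_ideal_mono: "tempered_ideal Z \<Longrightarrow> Z f \<Longrightarrow> (\<And>\<epsilon>. 0 \<le> g \<epsilon>) \<Longrightarrow> (\<forall>\<^sub>F \<epsilon> in at_right 0. g \<epsilon> \<le> f \<epsilon>) \<Longrightarrow> Z g"
  unfolding tempered_ideal_def by blast+

lemma tempered_ideal_sum: "tempered_ideal Z \<Longrightarrow> (\<And>i. i \<in> I \<Longrightarrow> Z (f i)) \<Longrightarrow> Z (\<lambda>\<epsilon>. \<Sum>i\<in>I. f i \<epsilon>)"
  by (induction I rule: infinite_finite_induct) (auto intro: tempered_ideal_zero tempered_ideal_add)

text \<open>With \<open>Z\<close> equal to \<open>tempered\<close> these are the moderate nets, with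
  \<open>rapidly_null\<close> the negligible ones. Jets replace the seminorms because they are
  submultiplicative.\<close>

definition bounded_net :: "((real \<Rightarrow> real) \<Rightarrow> bool) \<Rightarrow> (real^'n::finite) set \<Rightarrow> 'n fnet \<Rightarrow> bool" where
  "bounded_net Z S u \<longleftrightarrow> (\<forall>\<epsilon>\<in>{0<..1}. u \<epsilon> \<in> smooth_fns S) \<and>
     (\<forall>K j. compact K \<longrightarrow> K \<subseteq> S \<longrightarrow> (\<exists>f. Z f \<and> (\<forall>\<^sub>F \<epsilon> in at_right 0. \<forall>x\<in>K. jet j 1 (u \<epsilon>) x \<le> f \<epsilon>)))"

lemma bounded_net_smooth: "bounded_net Z S u \<Longrightarrow> \<epsilon> \<in> {0<..1} \<Longrightarrow> u \<epsilon> \<in> smooth_fns S"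
  by (simp add: bounded_net_def)

lemma bounded_netE:
  assumes "bounded_net Z S u" "compact K" "K \<subseteq> S"
  obtains f where "Z f" "\<forall>\<^sub>F \<epsilon> in at_right 0. \<forall>x\<in>K. jet j 1 (u \<epsilon>) x \<le> f \<epsilon>"
  using assms unfolding bounded_net_def by blast

lemma bounded_netI:
  assumes "\<And>\<epsilon>. \<epsilon> \<in> {0<..1} \<Longrightarrow> u \<epsilon> \<in> smooth_fns S"
    and "\<And>K j. compact K \<Longrightarrow> K \<subseteq> S \<Longrightarrow> \<exists>f. Z f \<and> (\<forall>\<^sub>F \<epsilon> in at_right 0. \<forall>x\<in>K. jet j 1 (u \<epsilon>) x \<le> f \<epsilon>)"
  shows "bounded_net Z S u"
  using assms unfolding bounded_net_def by blast

lemma bounded_net_ex: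
  assumes "Z f" "\<forall>\<^sub>F \<epsilon> in at_right 0. \<forall>x\<in>K. jet j 1 (u \<epsilon>) x \<le> f \<epsilon>"
  shows "\<exists>f. Z f \<and> (\<forall>\<^sub>F \<epsilon> in at_right 0. \<forall>x\<in>K. jet j 1 (u \<epsilon>) x \<le> f \<epsilon>)"
  by (rule exI[of _ f], rule conjI[OF assms])

lemma bounded_net_cong_ev:
  assumes S: "open S" and u: "bounded_net Z S u" and v: "\<And>\<epsilon>. \<epsilon> \<in> {0<..1} \<Longrightarrow> v \<epsilon> \<in> smooth_fns S"
    and eq: "\<forall>\<^sub>F \<epsilon> in at_right 0. \<forall>x\<in>S. u \<epsilon> x = v \<epsilon> x"
  shows "bounded_net Z S v"
proof (rule bounded_netI, erule v)
  fix K j assume K: "compact K" "K \<subseteq> S"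
  obtain f where f: "Z f" "\<forall>\<^sub>F \<epsilon> in at_right 0. \<forall>x\<in>K. jet j 1 (u \<epsilon>) x \<le> f \<epsilon>"
    using bounded_netE[OF u K] by blast
  have "\<forall>\<^sub>F \<epsilon> in at_right 0. \<forall>x\<in>K. jet j 1 (v \<epsilon>) x \<le> f \<epsilon>"
    using f(2) eq
  proof eventually_elim
    fix \<epsilon> assume a: "\<forall>x\<in>K. jet j 1 (u \<epsilon>) x \<le> f \<epsilon>" "\<forall>x\<in>S. u \<epsilon> x = v \<epsilon> x"
    show "\<forall>x\<in>K. jet j 1 (v \<epsilon>) x \<le> f \<epsilon>"
    proof
      fix x assume x: "x \<in> K"
      then have eq: "jet j 1 (u \<epsilon>) x = jet j 1 (v \<epsilon>) x" by (intro jet_cong_open[OF S]) (use K a(2) in auto)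
      have "jet j 1 (u \<epsilon>) x \<le> f \<epsilon>" using a(1) x by blast
      then show "jet j 1 (v \<epsilon>) x \<le> f \<epsilon>" unfolding eq .
    qed
  qed
  then show "\<exists>f. Z f \<and> (\<forall>\<^sub>F \<epsilon> in at_right 0. \<forall>x\<in>K. jet j 1 (v \<epsilon>) x \<le> f \<epsilon>)" by (rule bounded_net_ex[of Z f, OF f(1)])
qed

lemma bounded_net_cong:
  assumes S: "open S" and u: "bounded_net Z S u" and eq: "\<And>\<epsilon> x. \<epsilon> \<in> {0<..1} \<Longrightarrow> x \<in> S \<Longrightarrow> u \<epsilon> x = v \<epsilon> x"
  shows "bounded_net Z S v"
proof (rule bounded_net_cong_ev[OF S u])
  show "v \<epsilon> \<in> smooth_fns S" if "\<epsilon> \<in> {0<..1}" for \<epsilon>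
    by (rule smooth_cong[OF S eq[OF that] bounded_net_smooth[OF u that]])
  show "\<forall>\<^sub>F \<epsilon> in at_right 0. \<forall>x\<in>S. u \<epsilon> x = v \<epsilon> x"
    using ev_pos by eventually_elim (use eq in auto)
qed

lemma bounded_net_subset: "bounded_net Z S u \<Longrightarrow> T \<subseteq> S \<Longrightarrow> bounded_net Z T u"
  unfolding bounded_net_def by (meson smooth_subset subset_trans)

lemma bounded_net_add:
  assumes Z: "tempered_ideal Z" and S: "open S" and u: "bounded_net Z S u" and v: "bounded_net Z S v"
  shows "bounded_net Z S (\<lambda>\<epsilon> x. u \<epsilon> x + v \<epsilon> x)"
proof (rule bounded_netI, rule smooth_add[OF S], erule bounded_net_smooth[OF u], erule bounded_net_smooth[OF v])
  fix K j assume K: "compact K" "K \<subseteq> S"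
  obtain f where f: "Z f" "\<forall>\<^sub>F \<epsilon> in at_right 0. \<forall>x\<in>K. jet j 1 (u \<epsilon>) x \<le> f \<epsilon>" using bounded_netE[OF u K] by blast
  obtain g where g: "Z g" "\<forall>\<^sub>F \<epsilon> in at_right 0. \<forall>x\<in>K. jet j 1 (v \<epsilon>) x \<le> g \<epsilon>" using bounded_netE[OF v K] by blast
  have "\<forall>\<^sub>F \<epsilon> in at_right 0. \<forall>x\<in>K. jet j 1 (\<lambda>x. u \<epsilon> x + v \<epsilon> x) x \<le> f \<epsilon> + g \<epsilon>"
    using f(2) g(2) ev_pos
  proof eventually_elim
    fix \<epsilon> assume a: "\<forall>x\<in>K. jet j 1 (u \<epsilon>) x \<le> f \<epsilon>" "\<forall>x\<in>K. jet j 1 (v \<epsilon>) x \<le> g \<epsilon>" "0 < \<epsilon> \<and> \<epsilon> \<le> 1"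
    show "\<forall>x\<in>K. jet j 1 (\<lambda>x. u \<epsilon> x + v \<epsilon> x) x \<le> f \<epsilon> + g \<epsilon>"
    proof
      fix x assume x: "x \<in> K"
      have "jet j 1 (\<lambda>x. u \<epsilon> x + v \<epsilon> x) x \<le> jet j 1 (u \<epsilon>) x + jet j 1 (v \<epsilon>) x"
        by (rule jet_add[OF S]) (use x K a(3) bounded_net_smooth[OF u] bounded_net_smooth[OF v] in auto)
      with a(1,2) x show "jet j 1 (\<lambda>x. u \<epsilon> x + v \<epsilon> x) x \<le> f \<epsilon> + g \<epsilon>" by fastforce
    qed
  qed
  then show "\<exists>f. Z f \<and> (\<forall>\<^sub>F \<epsilon> in at_right 0. \<forall>x\<in>K. jet j 1 (\<lambda>x. u \<epsilon> x + v \<epsilon> x) x \<le> f \<epsilon>)"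
    by (rule bounded_net_ex[of Z "\<lambda>\<epsilon>. f \<epsilon> + g \<epsilon>", OF tempered_ideal_add[of Z f g, OF Z f(1) g(1)]])
qed

lemma bounded_net_mult:
  assumes Z: "tempered_ideal Z" and S: "open S" and u: "bounded_net tempered S u" and v: "bounded_net Z S v"
  shows "bounded_net Z S (\<lambda>\<epsilon> x. u \<epsilon> x * v \<epsilon> x)"
proof (rule bounded_netI, rule smooth_mult[OF S], erule bounded_net_smooth[OF u], erule bounded_net_smooth[OF v])
  fix K j assume K: "compact K" "K \<subseteq> S"
  obtain f where f: "tempered f" "\<forall>\<^sub>F \<epsilon> in at_right 0. \<forall>x\<in>K. jet j 1 (u \<epsilon>) x \<le> f \<epsilon>" using bounded_netE[OF u K] by blast
  obtain g where g: "Z g" "\<forall>\<^sub>F \<epsilon> in at_right 0. \<forall>x\<in>K. jet j 1 (v \<epsilon>) x \<le> g \<epsilon>" using bounded_netE[OF v K] by blast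
  have "\<forall>\<^sub>F \<epsilon> in at_right 0. \<forall>x\<in>K. jet j 1 (\<lambda>x. u \<epsilon> x * v \<epsilon> x) x \<le> f \<epsilon> * g \<epsilon>"
    using f(2) g(2) ev_pos
  proof eventually_elim
    fix \<epsilon> assume a: "\<forall>x\<in>K. jet j 1 (u \<epsilon>) x \<le> f \<epsilon>" "\<forall>x\<in>K. jet j 1 (v \<epsilon>) x \<le> g \<epsilon>" "0 < \<epsilon> \<and> \<epsilon> \<le> 1"
    show "\<forall>x\<in>K. jet j 1 (\<lambda>x. u \<epsilon> x * v \<epsilon> x) x \<le> f \<epsilon> * g \<epsilon>"
    proof
      fix x assume x: "x \<in> K"
      have "jet j 1 (\<lambda>x. u \<epsilon> x * v \<epsilon> x) x \<le> jet j 1 (u \<epsilon>) x * jet j 1 (v \<epsilon>) x"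
        by (rule jet_mult[OF S]) (use x K a(3) bounded_net_smooth[OF u] bounded_net_smooth[OF v] in auto)
      also have "\<dots> \<le> f \<epsilon> * g \<epsilon>" using a x
        by (intro mult_mono) (auto intro: jet_nonneg tempered_ideal_nonneg[OF tempered_ideal_tempered f(1)])
      finally show "jet j 1 (\<lambda>x. u \<epsilon> x * v \<epsilon> x) x \<le> f \<epsilon> * g \<epsilon>" .
    qed
  qed
  then show "\<exists>f. Z f \<and> (\<forall>\<^sub>F \<epsilon> in at_right 0. \<forall>x\<in>K. jet j 1 (\<lambda>x. u \<epsilon> x * v \<epsilon> x) x \<le> f \<epsilon>)"
    by (rule bounded_net_ex[of Z "\<lambda>\<epsilon>. f \<epsilon> * g \<epsilon>", OF tempered_ideal_mult[of Z f g, OF Z f(1) g(1)]])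
qed

lemma bounded_net_fixed:
  assumes "f \<in> smooth_fns S"
  shows "bounded_net tempered S (\<lambda>_. f)"
proof (rule bounded_netI, rule assms)
  fix K j assume K: "compact K" "K \<subseteq> S"
  obtain M where "M \<ge> 0" "\<And>x. x \<in> K \<Longrightarrow> jet j 1 f x \<le> M" using jet_bounded[OF assms K] by blast
  then show "\<exists>g. tempered g \<and> (\<forall>\<^sub>F \<epsilon> in at_right 0. \<forall>x\<in>K. jet j 1 f x \<le> g \<epsilon>)"
    by (intro exI[of _ "\<lambda>_. M"]) (auto intro: tempered_const)
qed

lemma bounded_net_num:
  assumes "Z (\<lambda>\<epsilon>. cmod (a \<epsilon>))"
  shows "bounded_net Z S (\<lambda>\<epsilon> _. a \<epsilon>)"
proof (rule bounded_netI, rule smooth_const)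
  fix K j
  show "\<exists>f. Z f \<and> (\<forall>\<^sub>F \<epsilon> in at_right 0. \<forall>x\<in>K. jet j 1 (\<lambda>_. a \<epsilon>) x \<le> f \<epsilon>)"
    by (rule exI[of _ "\<lambda>\<epsilon>. cmod (a \<epsilon>)"]) (simp add: jet_const assms)
qed

lemma bounded_net_zero: "tempered_ideal Z \<Longrightarrow> bounded_net Z S (\<lambda>_ _. 0)"
  by (rule bounded_net_num) (simp add: tempered_ideal_zero)

lemma bounded_net_partials:
  assumes "bounded_net Z S u"
  shows "bounded_net Z S (\<lambda>\<epsilon>. partials is (u \<epsilon>))"
proof (rule bounded_netI, rule smooth_partials, erule bounded_net_smooth[OF assms])
  fix K j assume K: "compact K" "K \<subseteq> S"
  obtain f where f: "Z f" "\<forall>\<^sub>F \<epsilon> in at_right 0. \<forall>x\<in>K. jet (j + length is) 1 (u \<epsilon>) x \<le> f \<epsilon>" using bounded_netE[OF assms K] by blast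
  have "\<forall>\<^sub>F \<epsilon> in at_right 0. \<forall>x\<in>K. jet j 1 (partials is (u \<epsilon>)) x \<le> f \<epsilon>"
    using f(2)
  proof eventually_elim
    fix \<epsilon> assume a: "\<forall>x\<in>K. jet (j + length is) 1 (u \<epsilon>) x \<le> f \<epsilon>"
    show "\<forall>x\<in>K. jet j 1 (partials is (u \<epsilon>)) x \<le> f \<epsilon>"
    proof
      fix x assume "x \<in> K"
      then have le: "jet (j + length is) 1 (u \<epsilon>) x \<le> f \<epsilon>" using a by blast
      have "1 ^ length is * jet j 1 (partials is (u \<epsilon>)) x \<le> jet (j + length is) 1 (u \<epsilon>) x" by (rule jet_partials) simp
      with le show "jet j 1 (partials is (u \<epsilon>)) x \<le> f \<epsilon>" by (simp only: power_one mult_1_left)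
    qed
  qed
  then show "\<exists>f. Z f \<and> (\<forall>\<^sub>F \<epsilon> in at_right 0. \<forall>x\<in>K. jet j 1 (partials is (u \<epsilon>)) x \<le> f \<epsilon>)" by (rule bounded_net_ex[of Z f, OF f(1)])
qed

lemma tempered_num_const: "tempered (\<lambda>_. cmod a)"
  by (rule tempered_const) simp

lemma bounded_net_cmult: "tempered_ideal Z \<Longrightarrow> open S \<Longrightarrow> bounded_net Z S u \<Longrightarrow> bounded_net Z S (\<lambda>\<epsilon> x. a * u \<epsilon> x)"
  by (rule bounded_net_mult[OF _ _ bounded_net_num]) (auto intro: tempered_num_const)

lemma bounded_net_mD:
  assumes "tempered_ideal Z" "open S" "bounded_net Z S u"
  shows "bounded_net Z S (\<lambda>\<epsilon>. mD \<alpha> (u \<epsilon>))"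
proof -
  have "mD \<alpha> f = (\<lambda>x. (- \<i>) ^ mdeg \<alpha> * partials (mlist \<alpha>) f x)" for f :: "real^'a \<Rightarrow> complex"
    by (rule ext) (simp add: mD_def mpartial_partials)
  then show ?thesis using bounded_net_cmult[OF assms(1,2) bounded_net_partials[OF assms(3)]] by simp
qed

lemma bounded_net_sum:
  assumes "tempered_ideal Z" "open S" "\<And>j. j \<in> J \<Longrightarrow> bounded_net Z S (u j)"
  shows "bounded_net Z S (\<lambda>\<epsilon> x. \<Sum>j\<in>J. u j \<epsilon> x)"
  using assms(3)
proof (induction J rule: infinite_finite_induct)
  case (insert j J)
  have "bounded_net Z S (\<lambda>\<epsilon> x. u j \<epsilon> x + (\<Sum>j\<in>J. u j \<epsilon> x))"
    by (rule bounded_net_add[OF assms(1,2)]) (use insert in auto)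
  then show ?case using insert by simp
qed (simp_all add: bounded_net_zero[OF assms(1)])

text \<open>A compact set is covered by finitely many balls on which a bound is known, and the sum
  of these bounds is again in the ideal.\<close>

lemma bounded_net_local:
  fixes S :: "(real^'n::finite) set" and u :: "'n fnet"
  assumes Z: "tempered_ideal Z" and loc: "\<And>x. x \<in> S \<Longrightarrow> \<exists>T. open T \<and> x \<in> T \<and> bounded_net Z T u"
  shows "bounded_net Z S u"
proof (rule bounded_netI)
  fix \<epsilon> :: real assume e: "\<epsilon> \<in> {0<..1}"
  show "u \<epsilon> \<in> smooth_fns S"
  proof (rule smooth_local)
    fix x assume "x \<in> S"
    then obtain T where "open T" "x \<in> T" "bounded_net Z T u" using loc by blast
    then show "\<exists>T. open T \<and> x \<in> T \<and> u \<epsilon> \<in> smooth_fns T" using bounded_net_smooth[OF _ e] by blast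
  qed
next
  fix K j assume K: "compact K" "K \<subseteq> S"
  have "\<exists>d>0. bounded_net Z (cball x d) u" if xK: "x \<in> K" for x
  proof -
    have "x \<in> S" using xK K(2) by auto
    then obtain T where T: "open T" "x \<in> T" "bounded_net Z T u" using loc by blast
    obtain d where "d > 0" "cball x d \<subseteq> T" using T open_contains_cball by blast
    then show ?thesis using bounded_net_subset[OF T(3)] by blast
  qed
  then obtain d where d: "\<And>x. x \<in> K \<Longrightarrow> d x > 0" "\<And>x. x \<in> K \<Longrightarrow> bounded_net Z (cball x (d x)) u" by metis
  define PF where "PF x f \<longleftrightarrow> Z f \<and> (\<forall>\<^sub>F \<epsilon> in at_right 0. \<forall>y\<in>cball x (d x). jet j 1 (u \<epsilon>) y \<le> f \<epsilon>)" for x f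
  have PF: "\<exists>f. PF x f" if xK: "x \<in> K" for x
  proof -
    obtain g where "Z g" "\<forall>\<^sub>F \<epsilon> in at_right 0. \<forall>y\<in>cball x (d x). jet j 1 (u \<epsilon>) y \<le> g \<epsilon>"
      by (rule bounded_netE[OF d(2)[OF xK] compact_cball subset_refl])
    then have "PF x g" unfolding PF_def by blast
    then show ?thesis by (rule exI[of "PF x" g])
  qed
  have f': "PF x (SOME f. PF x f)" if "x \<in> K" for x by (rule someI_ex[of "PF x", OF PF[OF that]])
  define f where "f x = (SOME f. PF x f)" for x
  note f'' = f'[folded f_def, unfolded PF_def]
  note f = conjunct1[OF f''] conjunct2[OF f'']
  obtain I where I: "I \<subseteq> K" "finite I" "K \<subseteq> (\<Union>x\<in>I. ball x (d x))"
  proof (rule compactE_image[OF K(1), of K "\<lambda>x. ball x (d x)"])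
    show "K \<subseteq> (\<Union>x\<in>K. ball x (d x))" using d(1) by force
  qed auto
  have "\<forall>\<^sub>F \<epsilon> in at_right 0. \<forall>x\<in>I. \<forall>y\<in>cball x (d x). jet j 1 (u \<epsilon>) y \<le> f x \<epsilon>"
    unfolding eventually_ball_finite_distrib[OF I(2)] using f(2) I(1) by blast
  then have ev: "\<forall>\<^sub>F \<epsilon> in at_right 0. \<forall>y\<in>K. jet j 1 (u \<epsilon>) y \<le> (\<Sum>x\<in>I. f x \<epsilon>)"
  proof eventually_elim
    fix \<epsilon> assume a: "\<forall>x\<in>I. \<forall>y\<in>cball x (d x). jet j 1 (u \<epsilon>) y \<le> f x \<epsilon>"
    show "\<forall>y\<in>K. jet j 1 (u \<epsilon>) y \<le> (\<Sum>x\<in>I. f x \<epsilon>)"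
    proof
      fix y assume "y \<in> K"
      then obtain x where x: "x \<in> I" "y \<in> ball x (d x)" using I(3) by blast
      have "jet j 1 (u \<epsilon>) y \<le> f x \<epsilon>" using a x by auto
      also have "\<dots> \<le> (\<Sum>x\<in>I. f x \<epsilon>)"
        by (rule member_le_sum[OF x(1) _ I(2)]) (use f(1) I(1) tempered_ideal_nonneg[OF Z] in blast)
      finally show "jet j 1 (u \<epsilon>) y \<le> (\<Sum>x\<in>I. f x \<epsilon>)" .
    qed
  qed
  have Zs: "Z (\<lambda>\<epsilon>. \<Sum>x\<in>I. f x \<epsilon>)" by (rule tempered_ideal_sum[OF Z]) (use f(1) I(1) in blast)
  show "\<exists>f. Z f \<and> (\<forall>\<^sub>F \<epsilon> in at_right 0. \<forall>x\<in>K. jet j 1 (u \<epsilon>) x \<le> f \<epsilon>)"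
    by (rule bounded_net_ex[of Z "\<lambda>\<epsilon>. \<Sum>x\<in>I. f x \<epsilon>", OF Zs ev])
qed

lemma bounded_net_seminorm:
  fixes u :: "'n::finite fnet"
  assumes Z: "tempered_ideal Z" and S: "open S" and u: "\<And>\<epsilon>. \<epsilon> \<in> {0<..1} \<Longrightarrow> u \<epsilon> \<in> smooth_fns S"
  shows "bounded_net Z S u \<longleftrightarrow>
    (\<forall>K j. compact K \<longrightarrow> K \<subseteq> S \<longrightarrow> Z (\<lambda>\<epsilon>. \<bar>smooth_seminorm (K, j) (u \<epsilon>)\<bar>))"
proof
  assume b: "bounded_net Z S u"
  show "\<forall>K j. compact K \<longrightarrow> K \<subseteq> S \<longrightarrow> Z (\<lambda>\<epsilon>. \<bar>smooth_seminorm (K, j) (u \<epsilon>)\<bar>)"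
  proof (intro allI impI)
    fix K j assume K: "compact K" "K \<subseteq> S"
    obtain f where f: "Z f" "\<forall>\<^sub>F \<epsilon> in at_right 0. \<forall>x\<in>K. jet j 1 (u \<epsilon>) x \<le> f \<epsilon>" using bounded_netE[OF b K] by blast
    have "\<forall>\<^sub>F \<epsilon> in at_right 0. \<bar>smooth_seminorm (K, j) (u \<epsilon>)\<bar> \<le> f \<epsilon>"
      using f(2) ev_pos
    proof eventually_elim
      fix \<epsilon> assume a: "\<forall>x\<in>K. jet j 1 (u \<epsilon>) x \<le> f \<epsilon>" "0 < \<epsilon> \<and> \<epsilon> \<le> 1"
      have "smooth_seminorm (K, j) (u \<epsilon>) \<le> f \<epsilon>"
        by (rule smooth_seminorm_le) (use a tempered_ideal_nonneg[OF Z f(1)] in auto)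
      moreover have "smooth_seminorm (K, j) (u \<epsilon>) \<ge> 0"
        by (rule smooth_seminorm_ge(1)[OF S u K]) (use a in auto)
      ultimately show "\<bar>smooth_seminorm (K, j) (u \<epsilon>)\<bar> \<le> f \<epsilon>" by simp
    qed
    then show "Z (\<lambda>\<epsilon>. \<bar>smooth_seminorm (K, j) (u \<epsilon>)\<bar>)" using tempered_ideal_mono[OF Z f(1)] by simp
  qed
next
  assume a: "\<forall>K j. compact K \<longrightarrow> K \<subseteq> S \<longrightarrow> Z (\<lambda>\<epsilon>. \<bar>smooth_seminorm (K, j) (u \<epsilon>)\<bar>)"
  show "bounded_net Z S u"
  proof (rule bounded_netI, erule u)
    fix K j assume K: "compact K" "K \<subseteq> S"
    let ?f = "\<lambda>\<epsilon>. (1 + real CARD('n)) ^ j * \<bar>smooth_seminorm (K, j) (u \<epsilon>)\<bar>"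
    have Zf: "Z ?f" using a K by (intro tempered_ideal_mult[OF Z] tempered_const) auto
    have ev: "\<forall>\<^sub>F \<epsilon> in at_right 0. \<forall>x\<in>K. jet j 1 (u \<epsilon>) x \<le> ?f \<epsilon>"
      using ev_pos
    proof eventually_elim
      fix \<epsilon> :: real assume "0 < \<epsilon> \<and> \<epsilon> \<le> 1"
      then have "u \<epsilon> \<in> smooth_fns S" using u by auto
      from smooth_seminorm_ge[OF S this K, where j=j]
      show "\<forall>x\<in>K. jet j 1 (u \<epsilon>) x \<le> ?f \<epsilon>" by auto
    qed
    show "\<exists>f. Z f \<and> (\<forall>\<^sub>F \<epsilon> in at_right 0. \<forall>x\<in>K. jet j 1 (u \<epsilon>) x \<le> f \<epsilon>)"
      by (rule bounded_net_ex[of Z ?f, OF Zf ev])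
  qed
qed

lemma moderate_fnets_iff:
  assumes S: "open S"
  shows "u \<in> moderate_fnets S \<longleftrightarrow> bounded_net tempered S u"
proof (cases "\<forall>\<epsilon>\<in>{0<..1}. u \<epsilon> \<in> smooth_fns S")
  case True
  then have u: "\<And>\<epsilon>. \<epsilon> \<in> {0<..1} \<Longrightarrow> u \<epsilon> \<in> smooth_fns S" by blast
  have "bounded_net tempered S u \<longleftrightarrow> (\<forall>K j. compact K \<longrightarrow> K \<subseteq> S \<longrightarrow> tempered (\<lambda>\<epsilon>. \<bar>smooth_seminorm (K, j) (u \<epsilon>)\<bar>))"
    by (rule bounded_net_seminorm[OF tempered_ideal_tempered S u])
  also have "\<dots> \<longleftrightarrow> (\<forall>K j. compact K \<longrightarrow> K \<subseteq> S \<longrightarrow> (\<exists>N. (\<lambda>\<epsilon>. smooth_seminorm (K, j) (u \<epsilon>)) \<in> O[at_right 0](\<lambda>\<epsilon>. 1 / \<epsilon> ^ N)))"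
    by (simp only: tempered_bigo[OF abs_ge_zero] landau_o.big.abs_in_iff)
  finally show ?thesis
    using True unfolding moderate_fnets_def moderate_nets_def seminorm_indices_def by auto
next
  case False
  then show ?thesis by (auto simp: bounded_net_def moderate_fnets_def moderate_nets_def)
qed

lemma negligible_fnets_iff:
  assumes S: "open S"
  shows "u \<in> negligible_nets (smooth_fns S) (seminorm_indices S) smooth_seminorm \<longleftrightarrow> bounded_net rapidly_null S u"
proof (cases "\<forall>\<epsilon>\<in>{0<..1}. u \<epsilon> \<in> smooth_fns S")
  case True
  then have u: "\<And>\<epsilon>. \<epsilon> \<in> {0<..1} \<Longrightarrow> u \<epsilon> \<in> smooth_fns S" by blast
  have "bounded_net rapidly_null S u \<longleftrightarrow> (\<forall>K j. compact K \<longrightarrow> K \<subseteq> S \<longrightarrow> rapidly_null (\<lambda>\<epsilon>. \<bar>smooth_seminorm (K, j) (u \<epsilon>)\<bar>))"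
    by (rule bounded_net_seminorm[OF tempered_ideal_rapidly_null S u])
  also have "\<dots> \<longleftrightarrow> (\<forall>K j. compact K \<longrightarrow> K \<subseteq> S \<longrightarrow> (\<forall>q. (\<lambda>\<epsilon>. smooth_seminorm (K, j) (u \<epsilon>)) \<in> O[at_right 0](\<lambda>\<epsilon>. \<epsilon> ^ q)))"
    by (simp only: rapidly_null_bigo[OF abs_ge_zero] landau_o.big.abs_in_iff)
  finally show ?thesis
    using True unfolding negligible_nets_def seminorm_indices_def by auto
next
  case False
  then show ?thesis by (auto simp: bounded_net_def negligible_nets_def)
qed

subsection \<open>Classes of nets and extension by zero\<close>

definition net_eq :: "(real^'n::finite) set \<Rightarrow> 'n fnet \<Rightarrow> 'n fnet \<Rightarrow> bool" where
  "net_eq S u v \<longleftrightarrow> bounded_net tempered S u \<and> bounded_net tempered S v \<and> bounded_net rapidly_null S (\<lambda>\<epsilon> x. u \<epsilon> x - v \<epsilon> x)"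

abbreviation zero_net :: "'n::finite fnet" where "zero_net \<equiv> \<lambda>_ _. 0"

lemma G_rel_net_eq: "open S \<Longrightarrow> (u, v) \<in> G_rel S \<longleftrightarrow> net_eq S u v"
  using moderate_fnets_iff[of S u] moderate_fnets_iff[of S v] negligible_fnets_iff[of S "\<lambda>\<epsilon> x. u \<epsilon> x - v \<epsilon> x"]
  unfolding G_rel_def colombeau_rel_def net_eq_def moderate_fnets_def by (simp add: fun_diff_def)

lemma net_eq_refl: "bounded_net tempered S u \<Longrightarrow> net_eq S u u"
  by (simp add: net_eq_def bounded_net_zero[OF tempered_ideal_rapidly_null])

lemma net_eq_sym:
  assumes "open S" "net_eq S u v"
  shows "net_eq S v u"
proof -
  have "bounded_net rapidly_null S (\<lambda>\<epsilon> x. (-1) * (u \<epsilon> x - v \<epsilon> x))"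
    by (rule bounded_net_cmult[OF tempered_ideal_rapidly_null assms(1)]) (use assms(2) net_eq_def in blast)
  then show ?thesis using assms(2) by (simp add: net_eq_def)
qed

lemma net_eq_trans:
  assumes "open S" "net_eq S u v" "net_eq S v w"
  shows "net_eq S u w"
proof -
  have "bounded_net rapidly_null S (\<lambda>\<epsilon> x. (u \<epsilon> x - v \<epsilon> x) + (v \<epsilon> x - w \<epsilon> x))"
    by (rule bounded_net_add[OF tempered_ideal_rapidly_null assms(1)]) (use assms(2,3) net_eq_def in blast)+
  then show ?thesis using assms(2,3) by (simp add: net_eq_def)
qed

lemma net_eq_left: "net_eq S u v \<Longrightarrow> bounded_net tempered S u"
  and net_eq_right: "net_eq S u v \<Longrightarrow> bounded_net tempered S v"
  by (simp_all add: net_eq_def)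

lemma net_eq_subset: "net_eq S u v \<Longrightarrow> T \<subseteq> S \<Longrightarrow> net_eq T u v"
  unfolding net_eq_def by (auto intro: bounded_net_subset)

lemma net_eq_cong:
  assumes S: "open S" and u: "bounded_net tempered S u" and eq: "\<And>\<epsilon> x. \<epsilon> \<in> {0<..1} \<Longrightarrow> x \<in> S \<Longrightarrow> u \<epsilon> x = v \<epsilon> x"
  shows "net_eq S u v"
  unfolding net_eq_def
proof (intro conjI u)
  show "bounded_net tempered S v" by (rule bounded_net_cong[OF S u eq])
  show "bounded_net rapidly_null S (\<lambda>\<epsilon> x. u \<epsilon> x - v \<epsilon> x)"
    by (rule bounded_net_cong[OF S bounded_net_zero[OF tempered_ideal_rapidly_null]]) (use eq in auto)
qed

lemma net_eq_cong':
  assumes S: "open S" and v: "bounded_net tempered S v" and eq: "\<And>\<epsilon> x. \<epsilon> \<in> {0<..1} \<Longrightarrow> x \<in> S \<Longrightarrow> u \<epsilon> x = v \<epsilon> x"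
  shows "net_eq S u v"
  by (rule net_eq_sym[OF S net_eq_cong[OF S v]]) (use eq in auto)

lemma net_eq_zero: "open S \<Longrightarrow> (\<And>\<epsilon> x. \<epsilon> \<in> {0<..1} \<Longrightarrow> x \<in> S \<Longrightarrow> u \<epsilon> x = 0) \<Longrightarrow> net_eq S u zero_net"
  by (rule net_eq_cong'[OF _ bounded_net_zero[OF tempered_ideal_tempered]]) auto

text \<open>The separation half of the sheaf property: equality of classes can be checked on an open
  cover.\<close>

lemma net_eq_local:
  fixes S :: "(real^'n::finite) set"
  assumes "\<And>x. x \<in> S \<Longrightarrow> \<exists>T. open T \<and> x \<in> T \<and> net_eq T u v"
  shows "net_eq S u v"
  unfolding net_eq_def
proof (intro conjI)
  show "bounded_net tempered S u" by (rule bounded_net_local[OF tempered_ideal_tempered]) (use assms net_eq_def in blast)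
  show "bounded_net tempered S v" by (rule bounded_net_local[OF tempered_ideal_tempered]) (use assms net_eq_def in blast)
  show "bounded_net rapidly_null S (\<lambda>\<epsilon> x. u \<epsilon> x - v \<epsilon> x)" by (rule bounded_net_local[OF tempered_ideal_rapidly_null]) (use assms net_eq_def in blast)
qed

lemma net_eq_mult:
  assumes S: "open S" and u: "net_eq S u u'" and v: "net_eq S v v'"
  shows "net_eq S (\<lambda>\<epsilon> x. u \<epsilon> x * v \<epsilon> x) (\<lambda>\<epsilon> x. u' \<epsilon> x * v' \<epsilon> x)"
  unfolding net_eq_def
proof (intro conjI)
  note b = net_eq_left[OF u] net_eq_left[OF v] net_eq_right[OF u] net_eq_right[OF v]
  show "bounded_net tempered S (\<lambda>\<epsilon> x. u \<epsilon> x * v \<epsilon> x)" by (rule bounded_net_mult[OF tempered_ideal_tempered S b(1,2)])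
  show "bounded_net tempered S (\<lambda>\<epsilon> x. u' \<epsilon> x * v' \<epsilon> x)" by (rule bounded_net_mult[OF tempered_ideal_tempered S b(3,4)])
  have "bounded_net rapidly_null S (\<lambda>\<epsilon> x. u \<epsilon> x * (v \<epsilon> x - v' \<epsilon> x) + v' \<epsilon> x * (u \<epsilon> x - u' \<epsilon> x))"
    by (rule bounded_net_add[OF tempered_ideal_rapidly_null S]; rule bounded_net_mult[OF tempered_ideal_rapidly_null S]) (use u v in \<open>auto simp: net_eq_def\<close>)
  then show "bounded_net rapidly_null S (\<lambda>\<epsilon> x. u \<epsilon> x * v \<epsilon> x - u' \<epsilon> x * v' \<epsilon> x)"
    by (rule bounded_net_cong[OF S]) (simp add: algebra_simps)
qed

lemma net_eq_num:
  assumes "moderate (a :: real \<Rightarrow> complex)" "moderate b" "negligible_net (\<lambda>\<epsilon>. a \<epsilon> - b \<epsilon>)"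
  shows "net_eq S (\<lambda>\<epsilon> _. a \<epsilon>) (\<lambda>\<epsilon> _. b \<epsilon>)"
  unfolding net_eq_def using assms unfolding moderate_tempered negligible_rapidly_null
  by (intro conjI; intro bounded_net_num)

lemma net_eq_mD:
  assumes S: "open S" and u: "net_eq S u v"
  shows "net_eq S (\<lambda>\<epsilon>. mD \<alpha> (u \<epsilon>)) (\<lambda>\<epsilon>. mD \<alpha> (v \<epsilon>))"
  unfolding net_eq_def
proof (intro conjI bounded_net_mD[OF tempered_ideal_tempered S])
  show "bounded_net tempered S u" "bounded_net tempered S v" using u by (auto simp: net_eq_def)
  have "bounded_net rapidly_null S (\<lambda>\<epsilon>. mD \<alpha> (\<lambda>x. u \<epsilon> x - v \<epsilon> x))"
    using u by (intro bounded_net_mD[OF tempered_ideal_rapidly_null S]) (simp add: net_eq_def)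
  then show "bounded_net rapidly_null S (\<lambda>\<epsilon> x. mD \<alpha> (u \<epsilon>) x - mD \<alpha> (v \<epsilon>) x)"
  proof (rule bounded_net_cong[OF S])
    fix \<epsilon> x assume e: "\<epsilon> \<in> {0<..1::real}" and x: "x \<in> S"
    have sm: "u \<epsilon> \<in> smooth_fns S" "v \<epsilon> \<in> smooth_fns S"
      using bounded_net_smooth[OF net_eq_left[OF u] e] bounded_net_smooth[OF net_eq_right[OF u] e] by auto
    have "partials is (\<lambda>x. u \<epsilon> x + (-1) * v \<epsilon> x) x = partials is (u \<epsilon>) x + (-1) * partials is (v \<epsilon>) x" for "is"
      using partials_add[OF S x sm(1) smooth_cmult[OF S sm(2)]] partials_cmult[OF S x sm(2)] by metis
    then have "partials is (\<lambda>x. u \<epsilon> x - v \<epsilon> x) x = partials is (u \<epsilon>) x - partials is (v \<epsilon>) x" for "is" by simp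
    then show "mD \<alpha> (\<lambda>x. u \<epsilon> x - v \<epsilon> x) x = mD \<alpha> (u \<epsilon>) x - mD \<alpha> (v \<epsilon>) x"
      by (simp add: mD_def mpartial_partials right_diff_distrib)
  qed
qed

lemma net_eq_sum:
  assumes S: "open S" and u: "\<And>j. j \<in> J \<Longrightarrow> net_eq S (u j) (v j)"
  shows "net_eq S (\<lambda>\<epsilon> x. \<Sum>j\<in>J. u j \<epsilon> x) (\<lambda>\<epsilon> x. \<Sum>j\<in>J. v j \<epsilon> x)"
  unfolding net_eq_def sum_subtractf[symmetric]
proof (intro conjI)
  show "bounded_net tempered S (\<lambda>\<epsilon> x. \<Sum>j\<in>J. u j \<epsilon> x)" by (rule bounded_net_sum[OF tempered_ideal_tempered S net_eq_left[OF u]])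
  show "bounded_net tempered S (\<lambda>\<epsilon> x. \<Sum>j\<in>J. v j \<epsilon> x)" by (rule bounded_net_sum[OF tempered_ideal_tempered S net_eq_right[OF u]])
  show "bounded_net rapidly_null S (\<lambda>\<epsilon> x. \<Sum>j\<in>J. u j \<epsilon> x - v j \<epsilon> x)"
    by (rule bounded_net_sum[OF tempered_ideal_rapidly_null S]) (use u in \<open>simp add: net_eq_def\<close>)
qed

lemma net_eq_add:
  assumes S: "open S" and u: "net_eq S u u'" and v: "net_eq S v v'"
  shows "net_eq S (\<lambda>\<epsilon> x. u \<epsilon> x + v \<epsilon> x) (\<lambda>\<epsilon> x. u' \<epsilon> x + v' \<epsilon> x)"
  using net_eq_sum[OF S, of "UNIV :: bool set" "\<lambda>b. if b then u else v" "\<lambda>b. if b then u' else v'"] u v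
  by (simp add: UNIV_bool add.commute)

text \<open>Independence of representatives for the function and the coefficients at once; it lets
  the representatives with good weight inequalities replace the canonical ones.\<close>

lemma net_eq_diffop:
  assumes S: "open S" and a: "\<And>\<alpha>. net_eq S (\<lambda>\<epsilon>. a \<epsilon> \<alpha>) (\<lambda>\<epsilon>. b \<epsilon> \<alpha>)" and u: "net_eq S u v"
  shows "net_eq S (\<lambda>\<epsilon>. diffop mo (a \<epsilon>) (u \<epsilon>)) (\<lambda>\<epsilon>. diffop mo (b \<epsilon>) (v \<epsilon>))"
  unfolding diffop_def by (intro net_eq_sum[OF S] net_eq_mult[OF S a net_eq_mD[OF S u]])

lemma net_eq_diffop_transpose:
  assumes S: "open S" and a: "\<And>\<alpha>. net_eq S (\<lambda>\<epsilon>. a \<epsilon> \<alpha>) (\<lambda>\<epsilon>. b \<epsilon> \<alpha>)" and u: "net_eq S u v"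
  shows "net_eq S (\<lambda>\<epsilon>. diffop_transpose mo (a \<epsilon>) (u \<epsilon>)) (\<lambda>\<epsilon>. diffop_transpose mo (b \<epsilon>) (v \<epsilon>))"
  unfolding diffop_transpose_def
  by (intro net_eq_sum[OF S] net_eq_mult[OF S] net_eq_mD[OF S] a u net_eq_refl bounded_net_fixed smooth_const)

lemma mD_zero: "mD \<alpha> (\<lambda>_. 0) x = 0"
  by (simp add: mD_def mpartial_partials partials_zero)

lemma diffop_transpose_zero: "diffop_transpose mo a (\<lambda>_. 0) x = 0"
  by (simp add: diffop_transpose_def mD_zero)

lemma mod_refl: "net_eq S u v \<Longrightarrow> net_eq S u u" "net_eq S u v \<Longrightarrow> net_eq S v v"
  by (simp_all add: net_eq_def bounded_net_zero[OF tempered_ideal_rapidly_null])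

lemma in_G_class: "open S \<Longrightarrow> w \<in> G_class S u \<longleftrightarrow> net_eq S u w"
  by (simp add: G_class_def G_rel_net_eq)

lemma G_class_eqI:
  assumes "open S" "net_eq S u v"
  shows "G_class S u = G_class S v"
proof (rule set_eqI)
  fix w
  show "w \<in> G_class S u \<longleftrightarrow> w \<in> G_class S v"
    unfolding in_G_class[OF assms(1)]
    using net_eq_trans[OF assms(1) assms(2), of w] net_eq_trans[OF assms(1) net_eq_sym[OF assms], of w] by argo
qed

lemma G_class_eqD: "open S \<Longrightarrow> bounded_net tempered S v \<Longrightarrow> G_class S u = G_class S v \<Longrightarrow> net_eq S u v"
  using net_eq_refl[of S v] unfolding G_class_def by (auto simp: G_rel_net_eq)

lemma G_class_in: "open S \<Longrightarrow> bounded_net tempered S u \<Longrightarrow> G_class S u \<in> G S"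
  unfolding G_class_def G_def by (rule quotientI) (simp add: moderate_fnets_iff)

lemma G_rep_class:
  assumes "open S" "bounded_net tempered S u"
  shows "net_eq S (G_rep (G_class S u)) u"
proof -
  have "u \<in> G_class S u" using assms by (simp add: G_class_def G_rel_net_eq net_eq_refl)
  then have "G_rep (G_class S u) \<in> G_class S u" unfolding G_rep_def by (rule someI[of "\<lambda>w. w \<in> G_class S u"])
  then show ?thesis using assms(1) by (simp add: G_class_def G_rel_net_eq net_eq_sym)
qed

lemma G_rep:
  assumes S: "open S" and U: "U \<in> G S"
  shows "bounded_net tempered S (G_rep U)" "G_class S (G_rep U) = U"
proof -
  obtain u where u: "bounded_net tempered S u" "U = G_class S u"
    using U unfolding G_def quotient_def G_class_def[symmetric] by (auto simp: moderate_fnets_iff[OF S])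
  show "bounded_net tempered S (G_rep U)" "G_class S (G_rep U) = U"
    using G_rep_class[OF S u(1)] G_class_eqI[OF S] u(2) net_eq_left by blast+
qed

lemma G_restrict_class:
  assumes "open S" "open V" "V \<subseteq> S" "bounded_net tempered S u"
  shows "G_restrict V (G_class S u) = G_class V u"
  unfolding G_restrict_def by (intro G_class_eqI[OF assms(2)] net_eq_subset[OF _ assms(3)] G_rep_class[OF assms(1,4)])

lemma in_support_class:
  assumes S: "open S" and u: "bounded_net tempered S u"
  shows "x \<in> G_support S (G_class S u) \<longleftrightarrow> x \<in> S \<and> \<not> (\<exists>V. open V \<and> x \<in> V \<and> V \<subseteq> S \<and> net_eq V u zero_net)"
proof -
  have "G_restrict V (G_class S u) = G_class V zero_net \<longleftrightarrow> net_eq V u zero_net" if "open V" "V \<subseteq> S" for V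
    unfolding G_restrict_class[OF S that u]
    using G_class_eqI[OF that(1)] G_class_eqD[OF that(1) bounded_net_zero[OF tempered_ideal_tempered]] by blast
  then show ?thesis unfolding G_support_def by blast
qed

lemma support_null:
  assumes S: "open S" and u: "bounded_net tempered S u" and K: "G_support S (G_class S u) \<subseteq> K"
  shows "net_eq (S - K) u zero_net"
proof (rule net_eq_local)
  fix x assume "x \<in> S - K"
  then show "\<exists>T. open T \<and> x \<in> T \<and> net_eq T u zero_net" using K in_support_class[OF S u, of x] by blast
qed

text \<open>Multiplication by a cutoff that is 1 near \<open>K\<close> and vanishes outside a closed
  subset of \<open>S\<close> realizes the extension by zero. Any competitor agrees with it on
  \<open>S\<close> by restriction and off \<open>K\<close> by the support condition; these two open
  sets cover the space.\<close>

lemma G_extend_class: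
  fixes S :: "(real^'n::finite) set"
  assumes S: "open S" and w: "bounded_net tempered S w" and K: "closed K" "K \<subseteq> S" "net_eq (S - K) w zero_net"
    and k: "k \<in> smooth_fns UNIV" and K': "closed K'" "K' \<subseteq> S" "\<And>x. x \<notin> K' \<Longrightarrow> k x = 0"
    and O: "open Q" "K \<subseteq> Q" "\<And>x. x \<in> Q \<Longrightarrow> k x = 1"
  shows "bounded_net tempered UNIV (\<lambda>\<epsilon> x. k x * w \<epsilon> x)"
    and "G_extend S (G_class S w) = G_class UNIV (\<lambda>\<epsilon> x. k x * w \<epsilon> x)"
proof -
  let ?w = "\<lambda>\<epsilon> x. k x * w \<epsilon> x"
  have SK: "open (S - K)" using S K(1) by (rule open_Diff)
  have cK: "open (- K)" "open (- K')" using K(1) K'(1) by auto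
  have kS: "net_eq T (\<lambda>_. k) (\<lambda>_. k)" for T using smooth_subset[OF k subset_UNIV] by (intro net_eq_refl bounded_net_fixed)
  have sm: "bounded_net tempered S ?w" using net_eq_mult[OF S kS net_eq_refl[OF w]] by (rule net_eq_left)
  have z': "net_eq (- K') ?w zero_net" by (rule net_eq_zero[OF cK(2)]) (use K'(3) in auto)
  show w': "bounded_net tempered UNIV ?w"
  proof (rule bounded_net_local[OF tempered_ideal_tempered])
    fix x
    show "\<exists>T. open T \<and> x \<in> T \<and> bounded_net tempered T ?w"
    proof (cases "x \<in> S")
      case True then show ?thesis using S sm by blast
    next
      case False then show ?thesis using cK(2) K'(2) net_eq_left[OF z'] by blast
    qed
  qed
  have SKz: "net_eq (S - K) ?w zero_net"
    using net_eq_mult[OF SK kS K(3)] by simp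
  have ww: "net_eq S ?w w"
  proof (rule net_eq_local)
    fix x assume x: "x \<in> S"
    show "\<exists>T. open T \<and> x \<in> T \<and> net_eq T ?w w"
    proof (cases "x \<in> K")
      case True
      have op: "open (S \<inter> Q)" using S O(1) by auto
      have "net_eq (S \<inter> Q) ?w w" by (rule net_eq_cong'[OF op bounded_net_subset[OF w]]) (use O(3) in auto)
      moreover have "x \<in> S \<inter> Q" using True O(2) x by auto
      ultimately show ?thesis using op by blast
    next
      case False
      then show ?thesis using SK net_eq_trans[OF SK SKz net_eq_sym[OF SK K(3)]] x by blast
    qed
  qed
  have Kz: "net_eq (- K) ?w zero_net"
  proof (rule net_eq_local)
    fix x assume x: "x \<in> - K"
    show "\<exists>T. open T \<and> x \<in> T \<and> net_eq T ?w zero_net"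
    proof (cases "x \<in> S")
      case True then show ?thesis using SK SKz x by blast
    next
      case False then show ?thesis using cK(2) z' K'(2) by blast
    qed
  qed
  have supp: "G_support UNIV (G_class UNIV ?w) = G_support S (G_class S w)"
  proof (rule set_eqI)
    fix x
    have "(\<exists>V. open V \<and> x \<in> V \<and> net_eq V ?w zero_net) \<longleftrightarrow> x \<notin> S \<or> (\<exists>V. open V \<and> x \<in> V \<and> V \<subseteq> S \<and> net_eq V w zero_net)"
    proof
      assume "\<exists>V. open V \<and> x \<in> V \<and> net_eq V ?w zero_net"
      then obtain V where V: "open V" "x \<in> V" "net_eq V ?w zero_net" by blast
      have op: "open (V \<inter> S)" using V S by auto
      have "net_eq (V \<inter> S) w zero_net"
        by (rule net_eq_trans[OF op net_eq_sym[OF op net_eq_subset[OF ww]] net_eq_subset[OF V(3)]]) auto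
      then show "x \<notin> S \<or> (\<exists>V. open V \<and> x \<in> V \<and> V \<subseteq> S \<and> net_eq V w zero_net)" using op V(2) by blast
    next
      assume a: "x \<notin> S \<or> (\<exists>V. open V \<and> x \<in> V \<and> V \<subseteq> S \<and> net_eq V w zero_net)"
      show "\<exists>V. open V \<and> x \<in> V \<and> net_eq V ?w zero_net"
      proof (cases "x \<in> S")
        case True
        then obtain V where V: "open V" "x \<in> V" "V \<subseteq> S" "net_eq V w zero_net" using a by blast
        have "net_eq V ?w zero_net" by (rule net_eq_trans[OF V(1) net_eq_subset[OF ww V(3)] V(4)])
        then show ?thesis using V by blast
      next
        case False then show ?thesis using cK(1) Kz K(2) by blast
      qed
    qed
    then show "x \<in> G_support UNIV (G_class UNIV ?w) \<longleftrightarrow> x \<in> G_support S (G_class S w)"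
      unfolding in_support_class[OF open_UNIV w'] in_support_class[OF S w] by auto
  qed
  have suppK: "G_support S (G_class S w) \<subseteq> K"
    using in_support_class[OF S w] SK K(3) by blast
  show "G_extend S (G_class S w) = G_class UNIV ?w"
    unfolding G_extend_def
  proof (rule the_equality)
    show "G_class UNIV ?w \<in> G UNIV \<and> G_restrict S (G_class UNIV ?w) = G_class S w \<and>
        G_support UNIV (G_class UNIV ?w) = G_support S (G_class S w)"
      using G_class_in[OF open_UNIV w'] supp G_restrict_class[OF open_UNIV S subset_UNIV w'] G_class_eqI[OF S ww] by simp
  next
    fix W assume W: "W \<in> G UNIV \<and> G_restrict S W = G_class S w \<and> G_support UNIV W = G_support S (G_class S w)"
    then have W1: "bounded_net tempered UNIV (G_rep W)" "G_class UNIV (G_rep W) = W" using G_rep[OF open_UNIV] by blast+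
    have e1: "net_eq S (G_rep W) w" using W G_class_eqD[OF S w] unfolding G_restrict_def by blast
    have e2: "net_eq (- K) (G_rep W) zero_net"
      using support_null[OF open_UNIV W1(1), of K] W W1(2) suppK by (simp add: Compl_eq_Diff_UNIV)
    have "net_eq UNIV (G_rep W) ?w"
    proof (rule net_eq_local)
      fix x
      show "\<exists>T. open T \<and> x \<in> T \<and> net_eq T (G_rep W) ?w"
      proof (cases "x \<in> S")
        case True then show ?thesis using S net_eq_trans[OF S e1 net_eq_sym[OF S ww]] by blast
      next
        case False then show ?thesis using cK(1) K(2) net_eq_trans[OF cK(1) e2 net_eq_sym[OF cK(1) Kz]] by blast
      qed
    qed
    then show "W = G_class UNIV ?w" using G_class_eqI[OF open_UNIV] W1(2) by metis
  qed
qed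

subsection \<open>Basic functionals\<close>

lemma abs_gen_eqI: "gen_rel a b \<Longrightarrow> abs_gen a = abs_gen b"
  by (rule Quotient_rel_abs[OF Quotient_gen])

lemma gen_rel_rep_abs: "moderate a \<Longrightarrow> gen_rel (rep_gen (abs_gen a)) a"
  by (rule Quotient_rep_abs[OF Quotient_gen]) (rule gen_rel_refl)

lemma moderate_rep_gen: "moderate (rep_gen a)"
  using Quotient_rep_reflp[OF Quotient_gen, of a] by (simp add: gen_rel_iff)

lemma abs_rep_gen: "abs_gen (rep_gen a) = a"
  by (rule Quotient_abs_rep[OF Quotient_gen])

lemma gen_rel_sym: "gen_rel a b \<Longrightarrow> gen_rel b a"
  and gen_rel_trans: "gen_rel a b \<Longrightarrow> gen_rel b c \<Longrightarrow> gen_rel a c"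
  using part_equivp_gen_rel by (auto dest: part_equivp_symp part_equivp_transp)

lemma net_eq_gen_rel: "gen_rel a b \<Longrightarrow> net_eq S (\<lambda>\<epsilon> _. a \<epsilon>) (\<lambda>\<epsilon> _. b \<epsilon>)"
  unfolding gen_rel_iff by (rule net_eq_num) auto

lemma negligible_ev:
  assumes "\<forall>\<^sub>F \<epsilon> in at_right 0. a \<epsilon> = b \<epsilon>" "negligible_net a"
  shows "negligible_net b"
  using assms(2) unfolding negligible_rapidly_null
  by (rule tempered_ideal_mono[OF tempered_ideal_rapidly_null]) (use assms(1) in \<open>auto elim: eventually_mono\<close>)

lemma moderate_ev:
  assumes "\<forall>\<^sub>F \<epsilon> in at_right 0. a \<epsilon> = b \<epsilon>" "moderate a"
  shows "moderate b"
  using assms(2) unfolding moderate_tempered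
  by (rule tempered_ideal_mono[OF tempered_ideal_tempered]) (use assms(1) in \<open>auto elim: eventually_mono\<close>)

lemma gen_rel_ev: "\<forall>\<^sub>F \<epsilon> in at_right 0. a \<epsilon> = b \<epsilon> \<Longrightarrow> moderate a \<Longrightarrow> gen_rel a b"
  unfolding gen_rel_iff
  by (intro conjI moderate_ev[of a b] negligible_ev[OF _ negligible_zero]) (auto elim: eventually_mono)

definition dist_bound :: "(real \<Rightarrow> (real^'n::finite \<Rightarrow> complex) \<Rightarrow> complex) \<Rightarrow> bool" where
  "dist_bound t \<longleftrightarrow> (\<exists>K j c (N::nat) \<eta>. compact K \<and> c > 0 \<and> \<eta> \<in> {0<..1} \<and>
     (\<forall>f\<in>smooth_fns UNIV. \<forall>\<epsilon>\<in>{0<..\<eta>}. cmod (t \<epsilon> f) \<le> c * (1 / \<epsilon> ^ N) * smooth_seminorm (K, j) f))"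

lemma tempered_power: "tempered (\<lambda>\<epsilon>. \<bar>1 / \<epsilon> ^ N\<bar>)"
  unfolding tempered_def
proof (intro conjI allI exI[of _ N])
  show "\<forall>\<^sub>F \<epsilon> in at_right (0::real). \<bar>1 / \<epsilon> ^ N\<bar> \<le> 1 / \<epsilon> ^ N"
    using ev_pos by eventually_elim simp
qed simp

text \<open>For moderate bounds this shows that the values of a basic functional are moderate; for
  negligible bounds, that they do not depend on the representative.\<close>

lemma dist_bound_net:
  assumes Z: "tempered_ideal Z" and t: "dist_bound t" and u: "bounded_net Z UNIV u"
  shows "Z (\<lambda>\<epsilon>. cmod (t \<epsilon> (u \<epsilon>)))"
proof -
  obtain K j c N \<eta> where K: "compact K" "c > 0" "\<eta> \<in> {0<..1::real}"
    and b: "\<And>f \<epsilon>. f \<in> smooth_fns UNIV \<Longrightarrow> \<epsilon> \<in> {0<..\<eta>} \<Longrightarrow> cmod (t \<epsilon> f) \<le> c * (1 / \<epsilon> ^ N) * smooth_seminorm (K, j) f"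
    using t unfolding dist_bound_def by blast
  obtain f where f: "Z f" "\<forall>\<^sub>F \<epsilon> in at_right 0. \<forall>x\<in>K. jet j 1 (u \<epsilon>) x \<le> f \<epsilon>"
    by (rule bounded_netE[OF u K(1) subset_UNIV])
  let ?g = "\<lambda>\<epsilon>. (c * \<bar>1 / \<epsilon> ^ N\<bar>) * f \<epsilon>"
  have cr: "tempered (\<lambda>\<epsilon>. c * \<bar>1 / \<epsilon> ^ N\<bar>)"
    by (rule tempered_mult[of "\<lambda>_. c" "\<lambda>\<epsilon>. \<bar>1 / \<epsilon> ^ N\<bar>", OF tempered_const tempered_power]) (use K in simp)
  have g: "Z ?g" by (rule tempered_ideal_mult[of Z "\<lambda>\<epsilon>. c * \<bar>1 / \<epsilon> ^ N\<bar>" f, OF Z cr f(1)])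
  show ?thesis
  proof (rule tempered_ideal_mono[of Z ?g "\<lambda>\<epsilon>. cmod (t \<epsilon> (u \<epsilon>))", OF Z g])
    have "\<forall>\<^sub>F \<epsilon> in at_right 0. 0 < \<epsilon> \<and> \<epsilon> < \<eta>" by (rule eventually_at_rightI[of 0 \<eta>]) (use K in auto)
    with f(2) show "\<forall>\<^sub>F \<epsilon> in at_right 0. cmod (t \<epsilon> (u \<epsilon>)) \<le> ?g \<epsilon>"
    proof eventually_elim
      fix \<epsilon> assume a: "\<forall>x\<in>K. jet j 1 (u \<epsilon>) x \<le> f \<epsilon>" "0 < \<epsilon> \<and> \<epsilon> < \<eta>"
      have "cmod (t \<epsilon> (u \<epsilon>)) \<le> c * (1 / \<epsilon> ^ N) * smooth_seminorm (K, j) (u \<epsilon>)"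
        by (rule b[OF bounded_net_smooth[OF u]]) (use a K in auto)
      also have "\<dots> \<le> c * (1 / \<epsilon> ^ N) * f \<epsilon>"
        by (intro mult_left_mono smooth_seminorm_le tempered_ideal_nonneg[OF Z f(1)]) (use a K in auto)
      also have "\<dots> = ?g \<epsilon>" using a by simp
      finally show "cmod (t \<epsilon> (u \<epsilon>)) \<le> ?g \<epsilon>" .
    qed
  qed simp
qed

lemma compact_distributions_add:
    "t \<in> compact_distributions \<Longrightarrow> f \<in> smooth_fns UNIV \<Longrightarrow> g \<in> smooth_fns UNIV \<Longrightarrow> t (\<lambda>x. f x + g x) = t f + t g"
  and compact_distributions_cmult:
    "t \<in> compact_distributions \<Longrightarrow> f \<in> smooth_fns UNIV \<Longrightarrow> t (\<lambda>x. a * f x) = a * t f"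
  by (simp_all add: compact_distributions_def)

lemma compact_distributions_minus:
  assumes t: "t \<in> compact_distributions" and f: "f \<in> smooth_fns UNIV" and g: "g \<in> smooth_fns UNIV"
  shows "t (\<lambda>x. f x - g x) = t f - t g"
proof -
  have "t (\<lambda>x. f x + (-1) * g x) = t f + t (\<lambda>x. (-1) * g x)"
    by (rule compact_distributions_add[OF t f smooth_cmult[OF open_UNIV g]])
  also have "t (\<lambda>x. (-1) * g x) = (-1) * t g" by (rule compact_distributions_cmult[OF t g])
  finally show ?thesis by simp
qed

lemma dist_net_gen_rel:
  assumes t: "dist_bound t" "\<And>\<epsilon>. \<epsilon> \<in> {0<..1} \<Longrightarrow> t \<epsilon> \<in> compact_distributions" and uv: "net_eq UNIV u v"
  shows "gen_rel (\<lambda>\<epsilon>. t \<epsilon> (u \<epsilon>)) (\<lambda>\<epsilon>. t \<epsilon> (v \<epsilon>))"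
  unfolding gen_rel_iff
proof (intro conjI)
  show "moderate (\<lambda>\<epsilon>. t \<epsilon> (u \<epsilon>))" "moderate (\<lambda>\<epsilon>. t \<epsilon> (v \<epsilon>))"
    unfolding moderate_tempered using dist_bound_net[OF tempered_ideal_tempered t(1)] net_eq_left[OF uv] net_eq_right[OF uv] by auto
  have n: "negligible_net (\<lambda>\<epsilon>. t \<epsilon> (\<lambda>x. u \<epsilon> x - v \<epsilon> x))"
    unfolding negligible_rapidly_null using dist_bound_net[OF tempered_ideal_rapidly_null t(1)] uv unfolding net_eq_def by blast
  have ev: "\<forall>\<^sub>F \<epsilon> in at_right 0. t \<epsilon> (\<lambda>x. u \<epsilon> x - v \<epsilon> x) = t \<epsilon> (u \<epsilon>) - t \<epsilon> (v \<epsilon>)"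
    using ev_pos
  proof eventually_elim
    fix \<epsilon> :: real assume "0 < \<epsilon> \<and> \<epsilon> \<le> 1"
    then have e: "\<epsilon> \<in> {0<..1}" by simp
    show "t \<epsilon> (\<lambda>x. u \<epsilon> x - v \<epsilon> x) = t \<epsilon> (u \<epsilon>) - t \<epsilon> (v \<epsilon>)"
      by (rule compact_distributions_minus[OF t(2)[OF e]])
         (use bounded_net_smooth[OF net_eq_left[OF uv] e] bounded_net_smooth[OF net_eq_right[OF uv] e] in auto)
  qed
  show "negligible_net (\<lambda>\<epsilon>. t \<epsilon> (u \<epsilon>) - t \<epsilon> (v \<epsilon>))" by (rule negligible_ev[OF ev n])
qed

text \<open>The functional is evaluated on chosen representatives; the uniform bound makes the
  choice immaterial, so linearity of each distribution passes to the classes.\<close>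

lemma basicI:
  fixes t :: "real \<Rightarrow> (real^'n::finite \<Rightarrow> complex) \<Rightarrow> complex"
  assumes t: "dist_bound t" "\<And>\<epsilon>. \<epsilon> \<in> {0<..1} \<Longrightarrow> t \<epsilon> \<in> compact_distributions"
  obtains T where "T \<in> basic_functionals" "\<And>u. bounded_net tempered UNIV u \<Longrightarrow> T (G_class UNIV u) = abs_gen (\<lambda>\<epsilon>. t \<epsilon> (u \<epsilon>))"
proof -
  define T where "T U = abs_gen (\<lambda>\<epsilon>. t \<epsilon> (G_rep U \<epsilon>))" for U
  have rel: "gen_rel (\<lambda>\<epsilon>. t \<epsilon> (u \<epsilon>)) (\<lambda>\<epsilon>. t \<epsilon> (v \<epsilon>))" if "net_eq UNIV u v" for u v
    by (rule dist_net_gen_rel[of t u v, OF t(1) _ that]) (rule t(2))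
  have T: "T (G_class UNIV u) = abs_gen (\<lambda>\<epsilon>. t \<epsilon> (u \<epsilon>))" if "bounded_net tempered UNIV u" for u
    unfolding T_def by (rule abs_gen_eqI[OF rel[OF G_rep_class[OF open_UNIV that]]])
  have mod: "gen_rel (\<lambda>\<epsilon>. t \<epsilon> (u \<epsilon>)) (\<lambda>\<epsilon>. t \<epsilon> (u \<epsilon>))" if "bounded_net tempered UNIV u" for u
    by (rule rel[OF net_eq_refl[OF that]])
  have T_add: "T (G_add UNIV U V) = T U + T V" if U: "U \<in> G UNIV" and V: "V \<in> G UNIV" for U V
  proof -
    note u = G_rep(1)[OF open_UNIV U] G_rep(1)[OF open_UNIV V]
    have "T (G_add UNIV U V) = abs_gen (\<lambda>\<epsilon>. t \<epsilon> (\<lambda>x. G_rep U \<epsilon> x + G_rep V \<epsilon> x))"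
      unfolding G_add_def by (rule T[OF bounded_net_add[OF tempered_ideal_tempered open_UNIV u]])
    also have "\<dots> = abs_gen (\<lambda>\<epsilon>. t \<epsilon> (G_rep U \<epsilon>) + t \<epsilon> (G_rep V \<epsilon>))"
    proof (intro abs_gen_eqI gen_rel_ev)
      show "moderate (\<lambda>\<epsilon>. t \<epsilon> (\<lambda>x. G_rep U \<epsilon> x + G_rep V \<epsilon> x))"
        using mod[OF bounded_net_add[OF tempered_ideal_tempered open_UNIV u]] by (simp add: gen_rel_iff)
      show "\<forall>\<^sub>F \<epsilon> in at_right 0. t \<epsilon> (\<lambda>x. G_rep U \<epsilon> x + G_rep V \<epsilon> x) = t \<epsilon> (G_rep U \<epsilon>) + t \<epsilon> (G_rep V \<epsilon>)"
        using ev_pos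
      proof eventually_elim
        fix \<epsilon> :: real assume "0 < \<epsilon> \<and> \<epsilon> \<le> 1"
        then have e: "\<epsilon> \<in> {0<..1}" by simp
        show "t \<epsilon> (\<lambda>x. G_rep U \<epsilon> x + G_rep V \<epsilon> x) = t \<epsilon> (G_rep U \<epsilon>) + t \<epsilon> (G_rep V \<epsilon>)"
          by (rule compact_distributions_add[OF t(2)[OF e] bounded_net_smooth[OF u(1) e] bounded_net_smooth[OF u(2) e]])
      qed
    qed
    also have "\<dots> = T U + T V" unfolding T_def by (rule plus_gen.abs_eq[symmetric]) (rule mod[OF u(1)], rule mod[OF u(2)])
    finally show ?thesis .
  qed
  have T_scale: "T (G_scale UNIV a U) = a * T U" if U: "U \<in> G UNIV" for a U
  proof -
    note u = G_rep(1)[OF open_UNIV U]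
    have am: "moderate (rep_gen a)" by (rule moderate_rep_gen)
    then have au: "bounded_net tempered UNIV (\<lambda>\<epsilon> x. rep_gen a \<epsilon> * G_rep U \<epsilon> x)"
      by (intro bounded_net_mult[OF tempered_ideal_tempered open_UNIV bounded_net_num u]) (simp add: moderate_tempered)
    have "T (G_scale UNIV a U) = abs_gen (\<lambda>\<epsilon>. t \<epsilon> (\<lambda>x. rep_gen a \<epsilon> * G_rep U \<epsilon> x))"
      unfolding G_scale_def by (rule T[OF au])
    also have "\<dots> = abs_gen (\<lambda>\<epsilon>. rep_gen a \<epsilon> * t \<epsilon> (G_rep U \<epsilon>))"
    proof (intro abs_gen_eqI gen_rel_ev)
      show "moderate (\<lambda>\<epsilon>. t \<epsilon> (\<lambda>x. rep_gen a \<epsilon> * G_rep U \<epsilon> x))"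
        using mod[OF au] by (simp add: gen_rel_iff)
      show "\<forall>\<^sub>F \<epsilon> in at_right 0. t \<epsilon> (\<lambda>x. rep_gen a \<epsilon> * G_rep U \<epsilon> x) = rep_gen a \<epsilon> * t \<epsilon> (G_rep U \<epsilon>)"
        using ev_pos
      proof eventually_elim
        fix \<epsilon> :: real assume "0 < \<epsilon> \<and> \<epsilon> \<le> 1"
        then have e: "\<epsilon> \<in> {0<..1}" by simp
        show "t \<epsilon> (\<lambda>x. rep_gen a \<epsilon> * G_rep U \<epsilon> x) = rep_gen a \<epsilon> * t \<epsilon> (G_rep U \<epsilon>)"
          by (rule compact_distributions_cmult[OF t(2)[OF e] bounded_net_smooth[OF u e]])
      qed
    qed
    also have "\<dots> = abs_gen (rep_gen a) * T U"
      unfolding T_def by (rule times_gen.abs_eq[symmetric]) (rule gen_rel_refl[OF am], rule mod[OF u])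
    finally show ?thesis by (simp add: abs_rep_gen)
  qed
  have "T \<in> basic_functionals"
    unfolding basic_functionals_def mem_Collect_eq moderate_fnets_iff[OF open_UNIV]
  proof (intro conjI ballI allI exI[of _ t] T_add T_scale t(2))
    show "\<exists>K j c (N::nat) \<eta>. compact K \<and> c > 0 \<and> \<eta> \<in> {0<..1} \<and>
     (\<forall>f\<in>smooth_fns UNIV. \<forall>\<epsilon>\<in>{0<..\<eta>}. cmod (t \<epsilon> f) \<le> c * (1 / \<epsilon> ^ N) * smooth_seminorm (K, j) f)"
      using t(1) unfolding dist_bound_def .
    show "T (G_class UNIV u) = abs_gen (\<lambda>\<epsilon>. t \<epsilon> (u \<epsilon>))" if "u \<in> moderate_fnets UNIV" for u
      using that T moderate_fnets_iff[OF open_UNIV] by blast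
  qed
  with T show ?thesis by (intro that[of T])
qed

lemma basicE:
  assumes "F \<in> basic_functionals"
  obtains t where "dist_bound t" "\<And>\<epsilon>. \<epsilon> \<in> {0<..1} \<Longrightarrow> t \<epsilon> \<in> compact_distributions"
    "\<And>u. bounded_net tempered UNIV u \<Longrightarrow> F (G_class UNIV u) = abs_gen (\<lambda>\<epsilon>. t \<epsilon> (u \<epsilon>))"
proof -
  have "\<exists>t. (\<forall>\<epsilon>\<in>{0<..1}. t \<epsilon> \<in> compact_distributions) \<and> dist_bound t \<and>
      (\<forall>u\<in>moderate_fnets UNIV. F (G_class UNIV u) = abs_gen (\<lambda>\<epsilon>. t \<epsilon> (u \<epsilon>)))"
    using assms unfolding basic_functionals_def mem_Collect_eq dist_bound_def by (elim conjE)
  then obtain t where "\<forall>\<epsilon>\<in>{0<..1}. t \<epsilon> \<in> compact_distributions" "dist_bound t"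
      "\<forall>u\<in>moderate_fnets UNIV. F (G_class UNIV u) = abs_gen (\<lambda>\<epsilon>. t \<epsilon> (u \<epsilon>))" by (elim exE conjE)
  then show ?thesis by (intro that[of t]) (auto simp: moderate_fnets_iff)
qed

lemma net_eq_ev:
  assumes S: "open S" and u: "bounded_net tempered S u" and v: "bounded_net tempered S v" and eq: "\<forall>\<^sub>F \<epsilon> in at_right 0. \<forall>x\<in>S. u \<epsilon> x = v \<epsilon> x"
  shows "net_eq S u v"
  unfolding net_eq_def
proof (intro conjI u v)
  show "bounded_net rapidly_null S (\<lambda>\<epsilon> x. u \<epsilon> x - v \<epsilon> x)"
  proof (rule bounded_net_cong_ev[OF S bounded_net_zero[OF tempered_ideal_rapidly_null]])
    show "(\<lambda>x. u \<epsilon> x - v \<epsilon> x) \<in> smooth_fns S" if "\<epsilon> \<in> {0<..1}" for \<epsilon>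
      by (intro smooth_minus S bounded_net_smooth[OF u that] bounded_net_smooth[OF v that])
    show "\<forall>\<^sub>F \<epsilon> in at_right 0. \<forall>x\<in>S. 0 = u \<epsilon> x - v \<epsilon> x"
      using eq by eventually_elim simp
  qed
qed

lemma diffop_transpose_cong_open:
  assumes "open S" "x \<in> S" "\<And>y. y \<in> S \<Longrightarrow> f y = g y"
  shows "diffop_transpose mo pc f x = diffop_transpose mo pc g x"
  unfolding diffop_transpose_def
proof (intro sum.cong refl)
  fix \<alpha>
  have "mD \<alpha> (\<lambda>y. pc \<alpha> y * f y) x = mD \<alpha> (\<lambda>y. pc \<alpha> y * g y) x"
    by (rule mD_cong_open[OF assms(1,2)]) (simp add: assms(3))
  then show "(-1) ^ mdeg \<alpha> * mD \<alpha> (\<lambda>y. pc \<alpha> y * f y) x = (-1) ^ mdeg \<alpha> * mD \<alpha> (\<lambda>y. pc \<alpha> y * g y) x" by simp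
qed

lemma compact_in_ball:
  fixes z :: "real^'n::finite"
  assumes "compact K" "K \<subseteq> ball z \<rho>" "\<rho> > 0"
  obtains r where "0 \<le> r" "r < \<rho>" "K \<subseteq> cball z r"
proof (cases "K = {}")
  case True then show ?thesis using assms(3) by (intro that[of 0]) auto
next
  case False
  have "continuous_on K (dist z)" by (intro continuous_intros)
  from continuous_attains_sup[OF assms(1) False this]
  obtain x where "x \<in> K" "\<forall>y\<in>K. dist z y \<le> dist z x" by blast
  then show ?thesis using assms(2) by (intro that[of "dist z x"]) auto
qed

lemma closed_support: "closed (G_support UNIV U)"
  unfolding G_support_def by (intro closed_Diff closed_UNIV open_Union) auto

subsection \<open>Solving with a net of parametrices\<close>

text \<open>The net \<open>a\<close> represents the coefficients of the given operator, whereas the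
  parametrices are exact for \<open>pc\<close>. The two differ by negligible nets on
  \<open>S\<close>, and the data are available only up to the threshold \<eta>.\<close>

locale parametrix_net = parametrix z \<rho> S c r m C1 e0 cutoff
  for z :: "real^'n::finite" and \<rho> S c r m C1 e0 cutoff +
  fixes \<tau> :: "real \<Rightarrow> ('n \<Rightarrow> int) \<Rightarrow> 'n \<Rightarrow> nat" and \<mu> :: "real \<Rightarrow> nat \<Rightarrow> ('n \<Rightarrow> int) \<Rightarrow> complex"
    and q :: "real \<Rightarrow> ('n \<Rightarrow> int) \<Rightarrow> complex" and a pc :: "real \<Rightarrow> 'n mindex \<Rightarrow> real^'n \<Rightarrow> complex"
    and mo N D :: nat and B \<eta> :: real
  assumes eta: "0 < \<eta>" "\<eta> \<le> 1"
    and gd: "\<And>\<epsilon>. 0 < \<epsilon> \<Longrightarrow> \<epsilon> \<le> \<eta> \<Longrightarrow> good_data (\<tau> \<epsilon>) (\<mu> \<epsilon>)"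
    and qg: "\<And>\<epsilon>. 0 < \<epsilon> \<Longrightarrow> \<epsilon> \<le> \<eta> \<Longrightarrow> good_symbol (B * (1 / \<epsilon> ^ N)) D (q \<epsilon>)"
    and sy: "\<And>\<epsilon> k x. 0 < \<epsilon> \<Longrightarrow> \<epsilon> \<le> \<eta> \<Longrightarrow> symb mo (pc \<epsilon>) x (freq (\<tau> \<epsilon>) k) = q \<epsilon> k * (1 + (\<Sum>j=1..r. c j x * \<mu> \<epsilon> j k))"
    and apc: "\<And>\<alpha>. net_eq S (\<lambda>\<epsilon>. a \<epsilon> \<alpha>) (\<lambda>\<epsilon>. pc \<epsilon> \<alpha>)"
begin

lemma ev_eta: "\<forall>\<^sub>F \<epsilon> in at_right 0. 0 < \<epsilon> \<and> \<epsilon> \<le> \<eta>"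
proof -
  have "\<forall>\<^sub>F \<epsilon> in at_right 0. 0 < \<epsilon> \<and> \<epsilon> < \<eta>" by (rule eventually_at_rightI[of 0 \<eta>]) (use eta in auto)
  then show ?thesis by eventually_elim auto
qed

lemma ball_S: "ball z \<rho> \<subseteq> S"
  using S(2) rho by (auto simp: subset_iff)

lemma B_nonneg: "B \<ge> 0"
proof -
  have "0 \<le> B * (1 / \<eta> ^ N)" using good_symbol_nonneg[OF qg[OF eta(1) order_refl]] .
  then show ?thesis using zero_less_power[OF eta(1), of N] by (auto simp: zero_le_divide_iff)
qed

text \<open>Above \<eta> there are no data; 0 is a harmless default, since classes depend only on
  small \<epsilon>.\<close>

definition unet :: "'n fnet \<Rightarrow> 'n fnet" where
  "unet v \<epsilon> = (if 0 < \<epsilon> \<and> \<epsilon> \<le> \<eta> then local_sol (\<tau> \<epsilon>) (\<mu> \<epsilon>) (q \<epsilon>) (v \<epsilon>) else (\<lambda>_. 0))"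

lemma unet_moderate:
  assumes v: "bounded_net tempered UNIV v"
  shows "bounded_net tempered UNIV (unet v)"
proof (rule bounded_netI)
  show "unet v \<epsilon> \<in> smooth_fns UNIV" if "\<epsilon> \<in> {0<..1}" for \<epsilon>
    using sol_series_smooth(2)[OF gd qg bounded_net_smooth[OF v that]] by (auto simp: unet_def smooth_const)
next
  fix K j assume K: "compact K" "K \<subseteq> (UNIV :: (real^'n) set)"
  obtain C s where C: "C \<ge> 0" "\<And>\<tau> \<mu> q K f N x. good_data \<tau> \<mu> \<Longrightarrow> good_symbol K D q \<Longrightarrow> f \<in> smooth_fns UNIV \<Longrightarrow>
     (\<And>x. x \<in> cball z (2 * \<rho>) \<Longrightarrow> jet s 1 f x \<le> N) \<Longrightarrow> jet j 1 (local_sol \<tau> \<mu> q f) x \<le> C * K * N"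
    by (rule local_sol_bound[where d=j and D=D]) blast
  obtain f where f: "tempered f" "\<forall>\<^sub>F \<epsilon> in at_right 0. \<forall>x\<in>cball z (2 * \<rho>). jet s 1 (v \<epsilon>) x \<le> f \<epsilon>"
    by (rule bounded_netE[OF v compact_cball subset_UNIV])
  let ?g = "\<lambda>\<epsilon>. ((C * B) * \<bar>1 / \<epsilon> ^ N\<bar>) * f \<epsilon>"
  have "tempered (\<lambda>\<epsilon>. (C * B) * \<bar>1 / \<epsilon> ^ N\<bar>)"
    by (rule tempered_mult[of "\<lambda>_. C * B" "\<lambda>\<epsilon>. \<bar>1 / \<epsilon> ^ N\<bar>", OF tempered_const tempered_power]) (use C(1) B_nonneg in simp)
  then have g: "tempered ?g" by (rule tempered_mult[OF _ f(1)])
  have "\<forall>\<^sub>F \<epsilon> in at_right 0. \<forall>x\<in>K. jet j 1 (unet v \<epsilon>) x \<le> ?g \<epsilon>"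
    using f(2) ev_eta
  proof eventually_elim
    fix \<epsilon> assume b: "\<forall>x\<in>cball z (2 * \<rho>). jet s 1 (v \<epsilon>) x \<le> f \<epsilon>" and e: "0 < \<epsilon> \<and> \<epsilon> \<le> \<eta>"
    have v': "v \<epsilon> \<in> smooth_fns UNIV" by (rule bounded_net_smooth[OF v]) (use e eta in auto)
    show "\<forall>x\<in>K. jet j 1 (unet v \<epsilon>) x \<le> ?g \<epsilon>"
    proof
      fix x
      have "jet j 1 (local_sol (\<tau> \<epsilon>) (\<mu> \<epsilon>) (q \<epsilon>) (v \<epsilon>)) x \<le> C * (B * (1 / \<epsilon> ^ N)) * f \<epsilon>"
        by (rule C(2)[OF gd qg v']) (use e b in auto)
      then show "jet j 1 (unet v \<epsilon>) x \<le> ?g \<epsilon>" using e by (simp add: unet_def)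
    qed
  qed
  then show "\<exists>f. tempered f \<and> (\<forall>\<^sub>F \<epsilon> in at_right 0. \<forall>x\<in>K. jet j 1 (unet v \<epsilon>) x \<le> f \<epsilon>)"
    by (rule bounded_net_ex[of tempered ?g, OF g])
qed

text \<open>The right inverse is applied for each \<epsilon> to a representative of
  \<open>V\<close>. The equation then holds exactly for \<open>pc\<close> and small \<epsilon>, and
  modulo negligible nets for \<open>a\<close>.\<close>

lemma solve_function:
  assumes V: "V \<in> G_c UNIV"
  shows "\<exists>u\<in>G_c UNIV. solves_function (ball z \<rho>) mo a u V"
proof
  let ?S = "ball z \<rho>" and ?v = "G_rep V"
  let ?u = "unet ?v" and ?U = "G_class UNIV (unet ?v)"
  have v: "bounded_net tempered UNIV ?v" using V G_rep(1)[OF open_UNIV] unfolding G_c_def by blast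
  note u = unet_moderate[OF v]
  have vS: "bounded_net tempered ?S ?v" by (rule bounded_net_subset[OF v subset_UNIV])
  have op: "open (- cball z (2 * \<rho>))" by auto
  \<comment> \<open>The cutoff in \<open>local_sol\<close> confines the solution to one fixed ball
    for all \<epsilon>, which gives compact support of the class.\<close>
  have "net_eq (- cball z (2 * \<rho>)) ?u zero_net"
  proof (rule net_eq_zero[OF op])
    fix \<epsilon> x assume e: "\<epsilon> \<in> {0<..1::real}" and x: "x \<in> - cball z (2 * \<rho>)"
    show "?u \<epsilon> x = 0"
      using sol_series_smooth(3)[OF gd qg bounded_net_smooth[OF v e]] x by (auto simp: unet_def supp_cball_def)
  qed
  then have "G_support UNIV ?U \<subseteq> cball z (2 * \<rho>)"
    using in_support_class[OF open_UNIV u] op by (metis ComplI subset_UNIV subsetI)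
  then have "compact (G_support UNIV ?U)"
    using closed_support compact_cball by (metis compact_Int_closed inf.absorb2)
  then show "?U \<in> G_c UNIV" using G_class_in[OF open_UNIV u] by (simp add: G_c_def)
  let ?w = "G_rep (G_restrict ?S ?U)"
  have uS: "bounded_net tempered ?S ?u" by (rule bounded_net_subset[OF u subset_UNIV])
  have "net_eq ?S ?w ?u"
    unfolding G_restrict_class[OF open_UNIV open_ball subset_UNIV u] by (rule G_rep_class[OF open_ball uS])
  then have e1: "net_eq ?S (\<lambda>\<epsilon>. diffop mo (a \<epsilon>) (?w \<epsilon>)) (\<lambda>\<epsilon>. diffop mo (pc \<epsilon>) (?u \<epsilon>))"
    by (rule net_eq_diffop[OF open_ball net_eq_subset[OF apc ball_S]])
  have "net_eq ?S (\<lambda>\<epsilon>. diffop mo (pc \<epsilon>) (?u \<epsilon>)) ?v"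
  proof (rule net_eq_ev[OF open_ball net_eq_right[OF e1] vS])
    show "\<forall>\<^sub>F \<epsilon> in at_right 0. \<forall>x\<in>?S. diffop mo (pc \<epsilon>) (?u \<epsilon>) x = ?v \<epsilon> x"
      using ev_eta
    proof eventually_elim
      fix \<epsilon> assume e: "0 < \<epsilon> \<and> \<epsilon> \<le> \<eta>"
      have v': "?v \<epsilon> \<in> smooth_fns UNIV" by (rule bounded_net_smooth[OF v]) (use e eta in auto)
      show "\<forall>x\<in>?S. diffop mo (pc \<epsilon>) (?u \<epsilon>) x = ?v \<epsilon> x"
      proof
        fix x assume "x \<in> ?S"
        then have x: "dist z x < \<rho>" by simp
        have "diffop mo (pc \<epsilon>) (local_sol (\<tau> \<epsilon>) (\<mu> \<epsilon>) (q \<epsilon>) (?v \<epsilon>)) x = ?v \<epsilon> x"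
          by (rule local_sol_solves[OF gd qg v' x sy]) (use e in auto)
        then show "diffop mo (pc \<epsilon>) (?u \<epsilon>) x = ?v \<epsilon> x" using e by (simp add: unet_def)
      qed
    qed
  qed
  then have "G_class ?S (\<lambda>\<epsilon>. diffop mo (a \<epsilon>) (?w \<epsilon>)) = G_class ?S ?v"
    by (rule G_class_eqI[OF open_ball net_eq_trans[OF open_ball e1]])
  then show "solves_function ?S mo a ?U V"
    unfolding solves_function_def G_op_def G_restrict_def[of _ V] .
qed

text \<open>Composing with the left inverse of the transpose: on transposed operators applied to
  functions supported near \<open>z\<close>, the value of \<open>t\<close> is recovered.\<close>

definition tnet :: "(real \<Rightarrow> (real^'n \<Rightarrow> complex) \<Rightarrow> complex) \<Rightarrow> real \<Rightarrow> (real^'n \<Rightarrow> complex) \<Rightarrow> complex" where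
  "tnet t \<epsilon> f = (if 0 < \<epsilon> \<and> \<epsilon> \<le> \<eta> then t \<epsilon> (dual_sol (\<tau> \<epsilon>) (\<mu> \<epsilon>) (q \<epsilon>) f) else 0)"

lemma dual_sol_seminorm:
  obtains M s where "M \<ge> 0" "\<And>\<epsilon> f. 0 < \<epsilon> \<Longrightarrow> \<epsilon> \<le> \<eta> \<Longrightarrow> f \<in> smooth_fns UNIV \<Longrightarrow>
    smooth_seminorm (K, j) (dual_sol (\<tau> \<epsilon>) (\<mu> \<epsilon>) (q \<epsilon>) f) \<le> M * (1 / \<epsilon> ^ N) * smooth_seminorm (cball z (2 * \<rho>), s) f"
proof -
  obtain C s where C: "C \<ge> 0" "\<And>\<tau> \<mu> q K f N x. good_data \<tau> \<mu> \<Longrightarrow> good_symbol K D q \<Longrightarrow> f \<in> smooth_fns UNIV \<Longrightarrow>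
     (\<And>x. x \<in> cball z (2 * \<rho>) \<Longrightarrow> jet s 1 f x \<le> N) \<Longrightarrow> jet j 1 (dual_sol \<tau> \<mu> q f) x \<le> C * K * N"
    by (rule dual_sol_bound[where d=j and D=D]) blast
  let ?M = "C * B * (1 + real CARD('n)) ^ s"
  show ?thesis
  proof (rule that[of ?M s])
    show "?M \<ge> 0" using C(1) B_nonneg by simp
    fix \<epsilon> f assume e: "0 < \<epsilon>" "\<epsilon> \<le> \<eta>" and f: "f \<in> smooth_fns (UNIV :: (real^'n) set)"
    let ?F = "(1 + real CARD('n)) ^ s * smooth_seminorm (cball z (2 * \<rho>), s) f"
    note ge = smooth_seminorm_ge[OF open_UNIV f compact_cball subset_UNIV]
    have "jet j 1 (dual_sol (\<tau> \<epsilon>) (\<mu> \<epsilon>) (q \<epsilon>) f) x \<le> C * (B * (1 / \<epsilon> ^ N)) * ?F" for x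
      by (rule C(2)[OF gd[OF e] qg[OF e] f ge(2)])
    then have "smooth_seminorm (K, j) (dual_sol (\<tau> \<epsilon>) (\<mu> \<epsilon>) (q \<epsilon>) f) \<le> C * (B * (1 / \<epsilon> ^ N)) * ?F"
      by (intro smooth_seminorm_le mult_nonneg_nonneg C(1) B_nonneg ge(1)) (use e in auto)
    then show "smooth_seminorm (K, j) (dual_sol (\<tau> \<epsilon>) (\<mu> \<epsilon>) (q \<epsilon>) f) \<le> ?M * (1 / \<epsilon> ^ N) * smooth_seminorm (cball z (2 * \<rho>), s) f"
      by (simp only: mult_ac)
  qed
qed

lemma tnet_compact:
  assumes t: "\<And>\<epsilon>. \<epsilon> \<in> {0<..1} \<Longrightarrow> t \<epsilon> \<in> compact_distributions" and e1: "\<epsilon> \<in> {0<..1}"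
  shows "tnet t \<epsilon> \<in> compact_distributions"
proof (cases "0 < \<epsilon> \<and> \<epsilon> \<le> \<eta>")
  case False
  then have "tnet t \<epsilon> = (\<lambda>_. 0)" by (intro ext) (simp only: tnet_def if_False)
  moreover have "(\<lambda>_. 0) \<in> compact_distributions"
    unfolding compact_distributions_def by (auto intro!: exI[of _ "{}"] exI[of _ 0])
  ultimately show ?thesis by simp
next
  case True
  let ?R = "dual_sol (\<tau> \<epsilon>) (\<mu> \<epsilon>) (q \<epsilon>)"
  have e: "0 < \<epsilon>" "\<epsilon> \<le> \<eta>" using True by auto
  have T: "tnet t \<epsilon> = (\<lambda>f. t \<epsilon> (?R f))" using True by (intro ext) (simp add: tnet_def)
  note d = t[OF e1]
  have Rs: "?R f \<in> smooth_fns UNIV" if "f \<in> smooth_fns UNIV" for f by (rule dual_sol_smooth(1)[OF gd[OF e] qg[OF e] that])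
  have ad: "?R (\<lambda>x. f x + g x) = (\<lambda>x. ?R f x + ?R g x)" if "f \<in> smooth_fns UNIV" "g \<in> smooth_fns UNIV" for f g
    using dual_sol_lin[OF gd[OF e] qg[OF e] that, of 1 1] by (simp add: fun_eq_iff)
  have cm: "?R (\<lambda>x. b * f x) = (\<lambda>x. b * ?R f x)" if "f \<in> smooth_fns UNIV" for f b
    using dual_sol_lin[OF gd[OF e] qg[OF e] that that, of b 0] by (simp add: fun_eq_iff)
  obtain K j c where K: "compact K" "\<And>f. f \<in> smooth_fns UNIV \<Longrightarrow> cmod (t \<epsilon> f) \<le> c * smooth_seminorm (K, j) f"
    using d unfolding compact_distributions_def by blast
  obtain M s where M: "M \<ge> 0" "\<And>\<epsilon> f. 0 < \<epsilon> \<Longrightarrow> \<epsilon> \<le> \<eta> \<Longrightarrow> f \<in> smooth_fns UNIV \<Longrightarrow>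
    smooth_seminorm (K, j) (dual_sol (\<tau> \<epsilon>) (\<mu> \<epsilon>) (q \<epsilon>) f) \<le> M * (1 / \<epsilon> ^ N) * smooth_seminorm (cball z (2 * \<rho>), s) f"
    by (rule dual_sol_seminorm[where K=K and j=j]) blast
  have b: "cmod (t \<epsilon> (?R f)) \<le> (\<bar>c\<bar> * (M * (1 / \<epsilon> ^ N))) * smooth_seminorm (cball z (2 * \<rho>), s) f"
    if f: "f \<in> smooth_fns UNIV" for f
  proof -
    have "cmod (t \<epsilon> (?R f)) \<le> c * smooth_seminorm (K, j) (?R f)" by (rule K(2)[OF Rs[OF f]])
    also have "\<dots> \<le> \<bar>c\<bar> * smooth_seminorm (K, j) (?R f)"
      by (intro mult_right_mono smooth_seminorm_ge(1)[OF open_UNIV Rs[OF f] K(1) subset_UNIV]) simp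
    also have "\<dots> \<le> \<bar>c\<bar> * (M * (1 / \<epsilon> ^ N) * smooth_seminorm (cball z (2 * \<rho>), s) f)"
      by (intro mult_left_mono M(2)[OF e f]) simp
    finally show ?thesis by (simp only: mult_ac)
  qed
  show ?thesis
    unfolding compact_distributions_def mem_Collect_eq T
  proof (intro conjI ballI allI)
    fix f g assume fg: "f \<in> smooth_fns (UNIV :: (real^'n) set)" "g \<in> smooth_fns (UNIV :: (real^'n) set)"
    show "t \<epsilon> (?R (\<lambda>x. f x + g x)) = t \<epsilon> (?R f) + t \<epsilon> (?R g)"
      unfolding ad[OF fg] by (rule compact_distributions_add[OF d Rs[OF fg(1)] Rs[OF fg(2)]])
  next
    fix f b assume f: "f \<in> smooth_fns (UNIV :: (real^'n) set)"
    show "t \<epsilon> (?R (\<lambda>x. b * f x)) = b * t \<epsilon> (?R f)"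
      unfolding cm[OF f] by (rule compact_distributions_cmult[OF d Rs[OF f]])
  next
    show "\<exists>K j c. compact K \<and> (\<forall>f\<in>smooth_fns UNIV. cmod (t \<epsilon> (?R f)) \<le> c * smooth_seminorm (K, j) f)"
      using b compact_cball by blast
  qed
qed

lemma tnet_bound:
  assumes t: "dist_bound t"
  shows "dist_bound (tnet t)"
proof -
  obtain K j c N' \<eta>' where K: "compact K" "c > 0" "\<eta>' \<in> {0<..1::real}"
    and b: "\<And>f \<epsilon>. f \<in> smooth_fns UNIV \<Longrightarrow> \<epsilon> \<in> {0<..\<eta>'} \<Longrightarrow> cmod (t \<epsilon> f) \<le> c * (1 / \<epsilon> ^ N') * smooth_seminorm (K, j) f"
    using t unfolding dist_bound_def by blast
  obtain M s where M: "M \<ge> 0" "\<And>\<epsilon> f. 0 < \<epsilon> \<Longrightarrow> \<epsilon> \<le> \<eta> \<Longrightarrow> f \<in> smooth_fns UNIV \<Longrightarrow>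
    smooth_seminorm (K, j) (dual_sol (\<tau> \<epsilon>) (\<mu> \<epsilon>) (q \<epsilon>) f) \<le> M * (1 / \<epsilon> ^ N) * smooth_seminorm (cball z (2 * \<rho>), s) f"
    by (rule dual_sol_seminorm[where K=K and j=j]) blast
  have "cmod (tnet t \<epsilon> f) \<le> (c * (M + 1)) * (1 / \<epsilon> ^ (N' + N)) * smooth_seminorm (cball z (2 * \<rho>), s) f"
    if f: "f \<in> smooth_fns UNIV" and e: "\<epsilon> \<in> {0<..min \<eta> \<eta>'}" for f \<epsilon>
  proof -
    let ?R = "dual_sol (\<tau> \<epsilon>) (\<mu> \<epsilon>) (q \<epsilon>)" and ?F = "smooth_seminorm (cball z (2 * \<rho>), s) f"
    have e': "0 < \<epsilon>" "\<epsilon> \<le> \<eta>" "\<epsilon> \<in> {0<..\<eta>'}" using e by auto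
    have F: "0 \<le> ?F" by (rule smooth_seminorm_ge(1)[OF open_UNIV f compact_cball subset_UNIV])
    have "cmod (tnet t \<epsilon> f) = cmod (t \<epsilon> (?R f))" using e' by (simp add: tnet_def)
    also have "\<dots> \<le> c * (1 / \<epsilon> ^ N') * smooth_seminorm (K, j) (?R f)"
      by (rule b[OF dual_sol_smooth(1)[OF gd[OF e'(1,2)] qg[OF e'(1,2)] f] e'(3)])
    also have "\<dots> \<le> c * (1 / \<epsilon> ^ N') * (M * (1 / \<epsilon> ^ N) * ?F)"
      by (intro mult_left_mono M(2)[OF e'(1,2) f]) (use K e' in auto)
    also have "\<dots> \<le> c * (1 / \<epsilon> ^ N') * ((M + 1) * (1 / \<epsilon> ^ N) * ?F)"
      by (intro mult_left_mono mult_right_mono F) (use K e' in auto)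
    also have "\<dots> = (c * (M + 1)) * (1 / \<epsilon> ^ (N' + N)) * ?F" by (simp add: power_add)
    finally show ?thesis .
  qed
  then show ?thesis unfolding dist_bound_def
    by (intro exI[of _ "cball z (2 * \<rho>)"] exI[of _ s] exI[of _ "c * (M + 1)"] exI[of _ "N' + N"] exI[of _ "min \<eta> \<eta>'"])
       (use K M(1) eta in auto)
qed

text \<open>Both extensions by zero are realized with one cutoff \<open>k\<close>. Up to a
  negligible net, \<open>k\<close> times the transpose of \<open>w\<close> is the transpose of
  \<open>k\<close> times \<open>w\<close>, and there \<open>dual_sol\<close> is an exact left
  inverse.\<close>

lemma solve_functional:
  assumes F: "F \<in> basic_functionals"
  shows "\<exists>T\<in>basic_functionals. solves_functional (ball z \<rho>) mo a T F"
proof -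
  obtain t where t: "dist_bound t" "\<And>\<epsilon>. \<epsilon> \<in> {0<..1} \<Longrightarrow> t \<epsilon> \<in> compact_distributions"
    and Ft: "\<And>u. bounded_net tempered UNIV u \<Longrightarrow> F (G_class UNIV u) = abs_gen (\<lambda>\<epsilon>. t \<epsilon> (u \<epsilon>))"
    by (rule basicE[OF F]) blast
  have tc: "tnet t \<epsilon> \<in> compact_distributions" if "\<epsilon> \<in> {0<..1}" for \<epsilon> by (rule tnet_compact[OF t(2) that])
  obtain T where T: "T \<in> basic_functionals"
    and Tt: "\<And>u. bounded_net tempered UNIV u \<Longrightarrow> T (G_class UNIV u) = abs_gen (\<lambda>\<epsilon>. tnet t \<epsilon> (u \<epsilon>))"
    by (rule basicI[OF tnet_bound[OF t(1)] tc]) blast+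
  let ?S = "ball z \<rho>"
  have "T (G_extend ?S (G_op_transpose ?S mo a U)) = F (G_extend ?S U)" if U: "U \<in> G_c ?S" for U
  proof -
    let ?w = "G_rep U"
    let ?p = "\<lambda>\<epsilon>. diffop_transpose mo (a \<epsilon>) (?w \<epsilon>)"
    have w: "bounded_net tempered ?S ?w" "G_class ?S ?w = U" using U G_rep[OF open_ball] unfolding G_c_def by blast+
    obtain r0 where r0: "0 \<le> r0" "r0 < \<rho>" "G_support ?S U \<subseteq> cball z r0"
      by (rule compact_in_ball[of "G_support ?S U" z \<rho>]) (use U rho in \<open>auto simp: G_c_def G_support_def\<close>)
    \<comment> \<open>Two radii between the support radius \<open>r0\<close> and \<rho>: the cutoff
      \<open>k\<close> is 1 up to \<open>r1\<close> and 0 from \<open>r2\<close> on, so the cut-off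
      function stays inside the ball where the left inverse is exact.\<close>
    define r1 where "r1 = r0 + (\<rho> - r0) / 3"
    define r2 where "r2 = r0 + 2 * (\<rho> - r0) / 3"
    have rr: "r0 < r1" "r1 < r2" "r2 < \<rho>" "0 \<le> r1" using r0(1,2) by (auto simp: r1_def r2_def field_simps)
    obtain k where k: "k \<in> smooth_fns UNIV" "\<And>x. dist z x \<le> r1 \<Longrightarrow> k x = 1" "\<And>x. dist z x \<ge> r2 \<Longrightarrow> k x = 0"
      using bump_exists[OF rr(4,2), of z] by blast
    have Kb: "cball z r0 \<subseteq> ?S" "cball z r2 \<subseteq> ?S" "cball z r0 \<subseteq> ball z r1" using rr r0 by auto
    have op: "open (?S - cball z r0)" "open (- cball z r2)" by auto
    have wz: "net_eq (?S - cball z r0) ?w zero_net" by (rule support_null[OF open_ball w(1)]) (use w(2) r0(3) in simp)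
    have ps: "net_eq ?S ?p (\<lambda>\<epsilon>. diffop_transpose mo (pc \<epsilon>) (?w \<epsilon>))"
      by (rule net_eq_diffop_transpose[OF open_ball net_eq_subset[OF apc ball_S] net_eq_refl[OF w(1)]])
    note p = net_eq_left[OF ps]
    have aR: "net_eq (?S - cball z r0) (\<lambda>\<epsilon>. a \<epsilon> \<alpha>) (\<lambda>\<epsilon>. pc \<epsilon> \<alpha>)" for \<alpha>
      by (rule net_eq_subset[OF apc]) (use ball_S in auto)
    have "net_eq (?S - cball z r0) ?p (\<lambda>\<epsilon>. diffop_transpose mo (pc \<epsilon>) (\<lambda>_. 0))"
      by (rule net_eq_diffop_transpose[OF op(1) aR wz])
    then have pz: "net_eq (?S - cball z r0) ?p zero_net" by (simp add: diffop_transpose_zero[abs_def])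
    have k0: "k x = 0" if "x \<notin> cball z r2" for x by (rule k(3)) (use that in auto)
    have k1: "k x = 1" if "x \<in> ball z r1" for x by (rule k(2)) (use that in auto)
    note ext = G_extend_class[OF open_ball _ closed_cball Kb(1) _ k(1) closed_cball Kb(2) k0 open_ball Kb(3) k1]
    let ?f = "\<lambda>\<epsilon> x. k x * ?w \<epsilon> x" and ?g = "\<lambda>\<epsilon> x. k x * ?p \<epsilon> x"
    have f: "bounded_net tempered UNIV ?f" "G_extend ?S U = G_class UNIV ?f" using ext[OF w(1) wz] w(2) by simp_all
    have g: "bounded_net tempered UNIV ?g" "G_extend ?S (G_op_transpose ?S mo a U) = G_class UNIV ?g"
      using ext[OF p pz] unfolding G_op_transpose_def by simp_all
    let ?h = "\<lambda>\<epsilon>. diffop_transpose mo (pc \<epsilon>) (?f \<epsilon>)"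
    have sf: "supp_cball z r2 (?f \<epsilon>)" for \<epsilon> using k(3) by (auto simp: supp_cball_def)
    \<comment> \<open>Three open sets cover the space. Inside radius \<open>r1\<close> the cutoff is
      1; between \<open>r0\<close> and \<rho> both nets are negligible because \<open>w\<close> is;
      outside \<open>r2\<close> both vanish identically. The commutator of \<open>k\<close> with the
      operator thus never has to be computed.\<close>
    have gh: "net_eq UNIV ?g ?h"
    proof (rule net_eq_local)
      fix x
      consider "x \<in> ball z r1" | "x \<in> ?S - cball z r0" | "x \<in> - cball z r2" using rr by fastforce
      then show "\<exists>Q. open Q \<and> x \<in> Q \<and> net_eq Q ?g ?h"
      proof cases
        case 1
        have sub: "ball z r1 \<subseteq> ?S" using rr by auto
        have "net_eq (ball z r1) ?g ?p"
          by (rule net_eq_cong'[OF open_ball bounded_net_subset[OF p sub]]) (use k1 in simp)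
        moreover have "net_eq (ball z r1) ?p (\<lambda>\<epsilon>. diffop_transpose mo (pc \<epsilon>) (?w \<epsilon>))"
          by (rule net_eq_subset[OF ps sub])
        moreover have "net_eq (ball z r1) (\<lambda>\<epsilon>. diffop_transpose mo (pc \<epsilon>) (?w \<epsilon>)) ?h"
        proof (rule net_eq_cong[OF open_ball bounded_net_subset[OF net_eq_right[OF ps] sub]])
          fix \<epsilon> x assume "x \<in> ball z r1"
          then show "diffop_transpose mo (pc \<epsilon>) (?w \<epsilon>) x = ?h \<epsilon> x"
            by (rule diffop_transpose_cong_open[OF open_ball]) (use k1 in simp)
        qed
        ultimately have "net_eq (ball z r1) ?g ?h" using net_eq_trans[OF open_ball] by blast
        with 1 show ?thesis by blast
      next
        case 2
        have kR: "net_eq (?S - cball z r0) (\<lambda>_. k) (\<lambda>_. k)"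
          by (intro net_eq_refl bounded_net_fixed smooth_subset[OF k(1) subset_UNIV])
        have "net_eq (?S - cball z r0) ?g zero_net" using net_eq_mult[OF op(1) kR pz] by simp
        moreover have "net_eq (?S - cball z r0) ?f zero_net" using net_eq_mult[OF op(1) kR wz] by simp
        then have "net_eq (?S - cball z r0) ?h (\<lambda>\<epsilon>. diffop_transpose mo (pc \<epsilon>) (\<lambda>_. 0))"
          by (rule net_eq_diffop_transpose[OF op(1) mod_refl(2)[OF aR]])
        then have "net_eq (?S - cball z r0) ?h zero_net" by (simp add: diffop_transpose_zero[abs_def])
        ultimately have "net_eq (?S - cball z r0) ?g ?h" using net_eq_trans[OF op(1)] net_eq_sym[OF op(1)] by blast
        with 2 op(1) show ?thesis by blast
      next
        case 3
        have "net_eq (- cball z r2) ?g zero_net" by (rule net_eq_zero[OF op(2)]) (use k0 in simp)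
        moreover have "net_eq (- cball z r2) ?h zero_net"
          by (rule net_eq_zero[OF op(2)]) (use supp_cball_diffop_transpose[OF sf] in \<open>auto simp: supp_cball_def\<close>)
        ultimately have "net_eq (- cball z r2) ?g ?h" using net_eq_trans[OF op(2)] net_eq_sym[OF op(2)] by blast
        with 3 op(2) show ?thesis by blast
      qed
    qed
    have th: "gen_rel (\<lambda>\<epsilon>. tnet t \<epsilon> (?h \<epsilon>)) (\<lambda>\<epsilon>. t \<epsilon> (?f \<epsilon>))"
    proof (rule gen_rel_ev)
      show "moderate (\<lambda>\<epsilon>. tnet t \<epsilon> (?h \<epsilon>))"
        unfolding moderate_tempered by (rule dist_bound_net[OF tempered_ideal_tempered tnet_bound[OF t(1)] net_eq_right[OF gh]])
      show "\<forall>\<^sub>F \<epsilon> in at_right 0. tnet t \<epsilon> (?h \<epsilon>) = t \<epsilon> (?f \<epsilon>)"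
        using ev_eta
      proof eventually_elim
        fix \<epsilon> assume e: "0 < \<epsilon> \<and> \<epsilon> \<le> \<eta>"
        then have e': "0 < \<epsilon>" "\<epsilon> \<le> \<eta>" "\<epsilon> \<in> {0<..1}" using eta by auto
        have "dual_sol (\<tau> \<epsilon>) (\<mu> \<epsilon>) (q \<epsilon>) (?h \<epsilon>) = ?f \<epsilon>"
          by (rule dual_sol_left_inverse[OF gd[OF e'(1,2)] qg[OF e'(1,2)] bounded_net_smooth[OF net_eq_right[OF apc] e'(3)]
              sy[OF e'(1,2)] bounded_net_smooth[OF f(1) e'(3)] sf]) (use rr in simp)
        then show "tnet t \<epsilon> (?h \<epsilon>) = t \<epsilon> (?f \<epsilon>)" using e by (simp add: tnet_def)
      qed
    qed
    have "T (G_extend ?S (G_op_transpose ?S mo a U)) = T (G_class UNIV ?h)"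
      unfolding g(2) by (rule arg_cong[OF G_class_eqI[OF open_UNIV gh]])
    also have "\<dots> = abs_gen (\<lambda>\<epsilon>. tnet t \<epsilon> (?h \<epsilon>))" by (rule Tt[OF net_eq_right[OF gh]])
    also have "\<dots> = abs_gen (\<lambda>\<epsilon>. t \<epsilon> (?f \<epsilon>))" by (rule abs_gen_eqI[OF th])
    also have "\<dots> = F (G_extend ?S U)" unfolding f(2) by (rule Ft[OF f(1), symmetric])
    finally show ?thesis .
  qed
  then show ?thesis using T unfolding solves_functional_def by blast
qed

end

subsection \<open>Solvability\<close>

lemma net_eq_mpoly:
  assumes "\<And>\<alpha>. mdeg \<alpha> \<le> d \<Longrightarrow> gen_rel (\<lambda>\<epsilon>. a \<epsilon> \<alpha>) (\<lambda>\<epsilon>. b \<epsilon> \<alpha>)"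
  shows "net_eq (UNIV :: (real^'n::finite) set) (\<lambda>\<epsilon>. mpoly_fun d (a \<epsilon>)) (\<lambda>\<epsilon>. mpoly_fun d (b \<epsilon>))"
proof -
  have e: "mpoly_fun d c = (\<lambda>\<xi>. \<Sum>\<alpha> | mdeg \<alpha> \<le> d. c \<alpha> * of_real (\<Prod>i\<in>UNIV. (\<xi> $ i) ^ \<alpha> i))"
    for c :: "'n mindex \<Rightarrow> complex" by (rule ext) (simp add: mpoly_fun_def)
  have s: "(\<lambda>\<xi>. of_real (\<Prod>i\<in>UNIV. (\<xi> $ i) ^ \<alpha> i)) \<in> smooth_fns (UNIV :: (real^'n) set)" for \<alpha>
    unfolding of_real_prod of_real_power
    by (intro smooth_prod open_UNIV Pol_smooth[OF Pol_coord_power])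
  show ?thesis
    unfolding e
    by (intro net_eq_sum[OF open_UNIV] net_eq_mult[OF open_UNIV] net_eq_gen_rel net_eq_refl[OF bounded_net_fixed[OF s]] assms) simp
qed

text \<open>A moderate inverse keeps the weight above a multiple of \<open>\<epsilon> ^ N\<close>
  for small \<epsilon>. The weight is at most a constant times the jet, and passing to other
  representatives changes the jet by a negligible amount.\<close>

lemma gen_weight_lower:
  fixes a :: "real \<Rightarrow> 'n::finite mindex \<Rightarrow> complex" and P :: "'n cc_operator"
  defines "d \<equiv> cc_order P"
  assumes inv: "gen_weight P \<xi> dvd 1"
    and a: "\<And>\<alpha>. mdeg \<alpha> \<le> d \<Longrightarrow> gen_rel (\<lambda>\<epsilon>. rep_gen (cc_coeff P \<alpha>) \<epsilon>) (\<lambda>\<epsilon>. a \<epsilon> \<alpha>)"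
  obtains N where "\<forall>\<^sub>F \<epsilon> in at_right 0. \<epsilon> ^ N \<le> jet d 1 (mpoly_fun d (a \<epsilon>)) \<xi>"
proof -
  let ?R = "\<lambda>\<epsilon> \<alpha>. rep_gen (cc_coeff P \<alpha>) \<epsilon>"
  define p where "p \<epsilon> = mpoly_fun d (?R \<epsilon>)" for \<epsilon>
  define w where "w \<epsilon> = weight (p \<epsilon>) \<xi>" for \<epsilon>
  let ?n = "real (card {\<alpha> :: 'n mindex. mdeg \<alpha> \<le> d})"
  have E: "net_eq UNIV p (\<lambda>\<epsilon>. mpoly_fun d (a \<epsilon>))" unfolding p_def by (rule net_eq_mpoly[OF a])
  have w0: "w \<epsilon> \<ge> 0" and wj: "w \<epsilon> \<le> ?n * jet d 1 (p \<epsilon>) \<xi>" for \<epsilon>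
    unfolding w_def p_def by (rule weight_nonneg[OF Pol_mpoly], rule weight_le[OF Pol_mpoly])
  obtain f where f: "tempered f" "\<forall>\<^sub>F \<epsilon> in at_right 0. \<forall>x\<in>{\<xi>}. jet d 1 (p \<epsilon>) x \<le> f \<epsilon>"
    by (rule bounded_netE[OF net_eq_left[OF E], of "{\<xi>}"]) auto
  have "tempered (\<lambda>\<epsilon>. norm (w \<epsilon>))"
  proof (rule tempered_ideal_mono[of tempered "\<lambda>\<epsilon>. ?n * f \<epsilon>", OF tempered_ideal_tempered tempered_mult[of "\<lambda>_. ?n" f, OF tempered_const f(1)]])
    show "\<forall>\<^sub>F \<epsilon> in at_right 0. norm (w \<epsilon>) \<le> ?n * f \<epsilon>"
      using f(2)
    proof eventually_elim
      fix \<epsilon> assume "\<forall>x\<in>{\<xi>}. jet d 1 (p \<epsilon>) x \<le> f \<epsilon>"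
      then have "?n * jet d 1 (p \<epsilon>) \<xi> \<le> ?n * f \<epsilon>" by (intro mult_left_mono) auto
      then show "norm (w \<epsilon>) \<le> ?n * f \<epsilon>" using w0[of \<epsilon>] wj[of \<epsilon>] by simp
    qed
  qed auto
  then have wm: "moderate w" by (simp add: moderate_tempered)
  obtain b where b: "1 = gen_weight P \<xi> * b" using inv by (elim dvdE)
  have gw: "gen_weight P \<xi> = abs_gen w" unfolding gen_weight_def w_def p_def d_def ..
  have bm: "moderate (rep_gen b)" by (rule moderate_rep_gen)
  have wbm: "moderate (\<lambda>\<epsilon>. w \<epsilon> * rep_gen b \<epsilon>)" by (rule moderate_mult[OF wm bm])
  have "abs_gen (\<lambda>\<epsilon>. w \<epsilon> * rep_gen b \<epsilon>) = abs_gen w * abs_gen (rep_gen b)"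
    by (rule times_gen.abs_eq[symmetric]) (rule gen_rel_refl[OF wm], rule gen_rel_refl[OF bm])
  also have "\<dots> = abs_gen (\<lambda>_. 1)" using b by (simp add: gw abs_rep_gen one_gen_def)
  finally have eq: "abs_gen (\<lambda>\<epsilon>. w \<epsilon> * rep_gen b \<epsilon>) = abs_gen (\<lambda>_. 1)" .
  have "gen_rel (\<lambda>\<epsilon>. w \<epsilon> * rep_gen b \<epsilon>) (\<lambda>_. 1)"
    using gen_rel_trans[OF gen_rel_sym[OF gen_rel_rep_abs[OF wbm]]] gen_rel_rep_abs[OF moderate_const[of 1]]
    unfolding eq by blast
  then have "rapidly_null (\<lambda>\<epsilon>. norm (w \<epsilon> * rep_gen b \<epsilon> - 1))" by (simp add: gen_rel_iff negligible_rapidly_null)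
  then have norm1: "\<forall>\<^sub>F \<epsilon> in at_right 0. norm (w \<epsilon> * rep_gen b \<epsilon> - 1) \<le> \<epsilon> ^ 1" unfolding rapidly_null_def by blast
  obtain N where N: "\<forall>\<^sub>F \<epsilon> in at_right 0. norm (rep_gen b \<epsilon>) \<le> 1 / \<epsilon> ^ N"
    using bm unfolding moderate_tempered tempered_def by blast
  have "bounded_net rapidly_null UNIV (\<lambda>\<epsilon> x. p \<epsilon> x - mpoly_fun d (a \<epsilon>) x)" using E by (simp add: net_eq_def)
  then obtain g where g: "rapidly_null g" "\<forall>\<^sub>F \<epsilon> in at_right 0. \<forall>x\<in>{\<xi>}. jet d 1 (\<lambda>x. p \<epsilon> x - mpoly_fun d (a \<epsilon>) x) x \<le> g \<epsilon>"
    by (rule bounded_netE[of _ _ _ "{\<xi>}"]) auto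
  have g': "\<forall>\<^sub>F \<epsilon> in at_right 0. g \<epsilon> \<le> \<epsilon> ^ Suc N" using g(1) unfolding rapidly_null_def by blast
  have "\<forall>\<^sub>F \<epsilon> in at_right 0. \<epsilon> ^ Suc N \<le> jet d 1 (mpoly_fun d (a \<epsilon>)) \<xi>"
    using norm1 N g(2) g' ev_pos ev_const_le[of 2] ev_const_le[of "4 * (?n + 1)"]
  proof eventually_elim
    fix \<epsilon> :: real
    assume h1: "norm (w \<epsilon> * rep_gen b \<epsilon> - 1) \<le> \<epsilon> ^ 1" and h2: "norm (rep_gen b \<epsilon>) \<le> 1 / \<epsilon> ^ N"
      and h3: "\<forall>x\<in>{\<xi>}. jet d 1 (\<lambda>x. p \<epsilon> x - mpoly_fun d (a \<epsilon>) x) x \<le> g \<epsilon>" and h4: "g \<epsilon> \<le> \<epsilon> ^ Suc N"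
      and e: "0 < \<epsilon> \<and> \<epsilon> \<le> 1" "2 * \<epsilon> \<le> 1" "4 * (?n + 1) * \<epsilon> \<le> 1"
    have "1 / 2 \<le> w \<epsilon> * rep_gen b \<epsilon>" using h1 e by (simp add: abs_le_iff)
    also have "\<dots> \<le> w \<epsilon> * (1 / \<epsilon> ^ N)" using h2 by (intro mult_left_mono w0) auto
    \<comment> \<open>The product with the inverse is at least 1/2 because it differs from 1 by at
      most \<epsilon>, and \<epsilon> is at most 1/2.\<close>
    finally have "\<epsilon> ^ N \<le> 2 * w \<epsilon>" using e by (simp add: field_simps)
    then have l: "\<epsilon> ^ N \<le> 2 * (?n + 1) * jet d 1 (p \<epsilon>) \<xi>"
      using wj[of \<epsilon>] jet_nonneg[of 1 d "p \<epsilon>" \<xi>] by (simp add: algebra_simps)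
    have sm: "mpoly_fun d c \<in> smooth_fns (UNIV :: (real^'n) set)" for c by (rule Pol_smooth[OF Pol_mpoly])
    have "jet d 1 (\<lambda>x. (p \<epsilon> x - mpoly_fun d (a \<epsilon>) x) + mpoly_fun d (a \<epsilon>) x) \<xi> \<le>
        jet d 1 (\<lambda>x. p \<epsilon> x - mpoly_fun d (a \<epsilon>) x) \<xi> + jet d 1 (mpoly_fun d (a \<epsilon>)) \<xi>"
      by (rule jet_add[OF open_UNIV UNIV_I _ sm]) (auto simp: p_def intro!: smooth_minus sm)
    then have u: "jet d 1 (p \<epsilon>) \<xi> \<le> \<epsilon> ^ Suc N + jet d 1 (mpoly_fun d (a \<epsilon>)) \<xi>"
      using h3 h4 by simp
    \<comment> \<open>One power of \<epsilon> is given up to beat the constant, leaving twice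
      \<open>\<epsilon> ^ Suc N\<close>; one half is then lost to the change of
      representatives.\<close>
    have "4 * (?n + 1) * \<epsilon> * \<epsilon> ^ N \<le> 1 * \<epsilon> ^ N" using e by (intro mult_right_mono) auto
    also have "\<dots> \<le> 2 * (?n + 1) * jet d 1 (p \<epsilon>) \<xi>" using l by simp
    also have "4 * (?n + 1) * \<epsilon> * \<epsilon> ^ N = 2 * (?n + 1) * (2 * \<epsilon> ^ Suc N)" by simp
    finally have "2 * \<epsilon> ^ Suc N \<le> jet d 1 (p \<epsilon>) \<xi>" by (rule mult_left_le_imp_le) (simp add: add_nonneg_pos)
    with u show "\<epsilon> ^ Suc N \<le> jet d 1 (mpoly_fun d (a \<epsilon>)) \<xi>" by linarith
  qed
  then show ?thesis by (rule that)
qed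

text \<open>The operator is defined through \<open>rep_gen\<close>, while the weight inequality
  holds for other representatives of the same coefficients; this is the bridge between them.\<close>

lemma P_coeff_net_eq:
  assumes S: "open S" and c: "\<And>j. j \<in> {1..r} \<Longrightarrow> c j \<in> smooth_fns S"
    and a: "\<And>j \<alpha>. j \<le> r \<Longrightarrow> mdeg \<alpha> \<le> cc_order (P j) \<Longrightarrow> gen_rel (\<lambda>\<epsilon>. rep_gen (cc_coeff (P j) \<alpha>) \<epsilon>) (\<lambda>\<epsilon>. a j \<epsilon> \<alpha>)"
  shows "net_eq S (\<lambda>\<epsilon>. P_coeff r c P \<epsilon> \<alpha>) (\<lambda>\<epsilon>. pcoef r c (\<lambda>j. cc_order (P j)) (\<lambda>j. a j \<epsilon>) \<alpha>)"
proof -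
  have e: "(\<lambda>\<epsilon>. P_coeff r c P \<epsilon> \<alpha>) = (\<lambda>\<epsilon> x. cc_net (P 0) \<epsilon> \<alpha> + (\<Sum>j=1..r. c j x * cc_net (P j) \<epsilon> \<alpha>))"
    "(\<lambda>\<epsilon>. pcoef r c (\<lambda>j. cc_order (P j)) (\<lambda>j. a j \<epsilon>) \<alpha>) =
      (\<lambda>\<epsilon> x. coef_ext (cc_order (P 0)) (a 0 \<epsilon>) \<alpha> + (\<Sum>j=1..r. c j x * coef_ext (cc_order (P j)) (a j \<epsilon>) \<alpha>))"
    by (auto simp: fun_eq_iff P_coeff_def pcoef_def)
  have g: "net_eq S (\<lambda>\<epsilon> _. cc_net (P j) \<epsilon> \<alpha>) (\<lambda>\<epsilon> _. coef_ext (cc_order (P j)) (a j \<epsilon>) \<alpha>)" if "j \<le> r" for j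
  proof (rule net_eq_gen_rel)
    show "gen_rel (\<lambda>\<epsilon>. cc_net (P j) \<epsilon> \<alpha>) (\<lambda>\<epsilon>. coef_ext (cc_order (P j)) (a j \<epsilon>) \<alpha>)"
      using a[OF that] gen_rel_refl[OF moderate_const[of 0]]
      by (cases "mdeg \<alpha> \<le> cc_order (P j)") (simp_all add: cc_net_def coef_ext_def)
  qed
  show ?thesis
    unfolding e
  proof (rule net_eq_add[OF S g net_eq_sum[OF S net_eq_mult[OF S]]])
    show "net_eq S (\<lambda>_. c j) (\<lambda>_. c j)" if "j \<in> {1..r}" for j by (rule net_eq_refl[OF bounded_net_fixed[OF c[OF that]]])
    show "net_eq S (\<lambda>\<epsilon> _. cc_net (P j) \<epsilon> \<alpha>) (\<lambda>\<epsilon> _. coef_ext (cc_order (P j)) (a j \<epsilon>) \<alpha>)" if "j \<in> {1..r}" for j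
      by (rule g) (use that in auto)
  qed simp
qed

theorem theorem5p3:
  fixes \<Omega> :: "(real^'n::finite) set"
    and x\<^sub>0 :: "real^'n"
    and r :: nat
    and c :: "nat \<Rightarrow> real^'n \<Rightarrow> complex"
    and P :: "nat \<Rightarrow> 'n cc_operator"
  assumes "open \<Omega>" "x\<^sub>0 \<in> \<Omega>"
    and c_smooth: "\<forall>j\<in>{1..r}. c j \<in> smooth_fns \<Omega>"
    and h1: "\<forall>j\<in>{1..r}. c j x\<^sub>0 = 0"
    and h2: "\<exists>\<xi>. gen_weight (P 0) \<xi> dvd 1"
    and h3: "\<forall>j\<in>{1..r}. stronger (P 0) (P j)"
    and h4: "\<exists>p :: nat \<Rightarrow> real \<Rightarrow> real^'n \<Rightarrow> complex. \<exists>\<Lambda> :: nat \<Rightarrow> real \<Rightarrow> real.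
       (\<forall>j\<in>{0..r}. p j \<in> cc_representatives (P j)) \<and>
       (\<forall>j\<in>{1..r}. \<Lambda> j \<in> O[at_right 0](\<lambda>_. 1) \<and>
          (\<forall>\<xi>. \<forall>\<epsilon>\<in>{0<..1}. weight (p j \<epsilon>) \<xi> \<le> \<Lambda> j \<epsilon> * weight (p 0 \<epsilon>) \<xi>))"
  shows "\<exists>\<delta>>0. ball x\<^sub>0 \<delta> \<subseteq> \<Omega> \<and>
    (\<forall>F\<in>basic_functionals. \<exists>T\<in>basic_functionals.
       solves_functional (ball x\<^sub>0 \<delta>) (P_order r P) (P_coeff r c P) T F) \<and>
    (\<forall>v\<in>G_c UNIV. \<exists>u\<in>G_c UNIV.
       solves_function (ball x\<^sub>0 \<delta>) (P_order r P) (P_coeff r c P) u v)"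
proof -
  obtain p \<Lambda> where p: "\<And>j. j \<le> r \<Longrightarrow> p j \<in> cc_representatives (P j)"
    and \<Lambda>: "\<And>j. j \<in> {1..r} \<Longrightarrow> \<Lambda> j \<in> O[at_right 0](\<lambda>_. 1)"
    and pw: "\<And>j \<xi> \<epsilon>. j \<in> {1..r} \<Longrightarrow> \<epsilon> \<in> {0<..1} \<Longrightarrow> weight (p j \<epsilon>) \<xi> \<le> \<Lambda> j \<epsilon> * weight (p 0 \<epsilon>) \<xi>"
    using h4 by (metis atLeast0AtMost atMost_iff)
  let ?ms = "\<lambda>j. cc_order (P j)"
  define m where "m = ?ms 0"
  have "\<forall>j\<in>{..r}. \<exists>a. (\<forall>\<alpha>. mdeg \<alpha> \<le> ?ms j \<longrightarrow>
      moderate (\<lambda>\<epsilon>. a \<epsilon> \<alpha>) \<and> abs_gen (\<lambda>\<epsilon>. a \<epsilon> \<alpha>) = cc_coeff (P j) \<alpha>) \<and>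
      (\<forall>\<epsilon>\<in>{0<..1}. p j \<epsilon> = mpoly_fun (?ms j) (a \<epsilon>))"
    using p unfolding cc_representatives_def by blast
  from bchoice[OF this] obtain a where aa: "\<forall>j\<in>{..r}. (\<forall>\<alpha>. mdeg \<alpha> \<le> ?ms j \<longrightarrow>
      moderate (\<lambda>\<epsilon>. a j \<epsilon> \<alpha>) \<and> abs_gen (\<lambda>\<epsilon>. a j \<epsilon> \<alpha>) = cc_coeff (P j) \<alpha>) \<and>
      (\<forall>\<epsilon>\<in>{0<..1}. p j \<epsilon> = mpoly_fun (?ms j) (a j \<epsilon>))" by (elim exE)
  then have a1: "\<And>j \<alpha>. j \<le> r \<Longrightarrow> mdeg \<alpha> \<le> ?ms j \<Longrightarrow>
      moderate (\<lambda>\<epsilon>. a j \<epsilon> \<alpha>) \<and> abs_gen (\<lambda>\<epsilon>. a j \<epsilon> \<alpha>) = cc_coeff (P j) \<alpha>"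
    and a2: "\<And>j \<epsilon>. j \<le> r \<Longrightarrow> \<epsilon> \<in> {0<..1} \<Longrightarrow> p j \<epsilon> = mpoly_fun (?ms j) (a j \<epsilon>)" by blast+
  have a: "gen_rel (\<lambda>\<epsilon>. rep_gen (cc_coeff (P j) \<alpha>) \<epsilon>) (\<lambda>\<epsilon>. a j \<epsilon> \<alpha>)" if "j \<le> r" "mdeg \<alpha> \<le> ?ms j" for j \<alpha>
    using a1[OF that] gen_rel_rep_abs[of "\<lambda>\<epsilon>. a j \<epsilon> \<alpha>"] by simp
  have "\<forall>j\<in>{1..r}. \<exists>L. \<forall>\<^sub>F \<epsilon> in at_right 0. \<Lambda> j \<epsilon> \<le> L"
  proof
    fix j assume "j \<in> {1..r}"
    from \<Lambda>[OF this] obtain L where "\<forall>\<^sub>F \<epsilon> in at_right 0. norm (\<Lambda> j \<epsilon>) \<le> L * norm (1::real)" by (rule landau_o.bigE)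
    then have "\<forall>\<^sub>F \<epsilon> in at_right 0. \<Lambda> j \<epsilon> \<le> L" by eventually_elim auto
    then show "\<exists>L. \<forall>\<^sub>F \<epsilon> in at_right 0. \<Lambda> j \<epsilon> \<le> L" by blast
  qed
  from bchoice[OF this] obtain L' where L': "\<And>j. j \<in> {1..r} \<Longrightarrow> \<forall>\<^sub>F \<epsilon> in at_right 0. \<Lambda> j \<epsilon> \<le> L' j" by blast
  \<comment> \<open>A common bound for all factors in the weight inequalities, valid for small
    \<epsilon> because each of them is O(1); the sum also covers \<open>r = 0\<close>.\<close>
  define L where "L = (\<Sum>j=1..r. \<bar>L' j\<bar>)"
  have L0: "L \<ge> 0" by (simp add: L_def sum_nonneg)
  have evL: "\<forall>\<^sub>F \<epsilon> in at_right 0. \<forall>j\<in>{1..r}. \<Lambda> j \<epsilon> \<le> L"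
    unfolding eventually_ball_finite_distrib[OF finite_atLeastAtMost]
  proof
    fix j assume j: "j \<in> {1..r}"
    have "\<bar>L' j\<bar> \<le> L" unfolding L_def by (rule member_le_sum[OF j]) auto
    then show "\<forall>\<^sub>F \<epsilon> in at_right 0. \<Lambda> j \<epsilon> \<le> L" using L'[OF j] by (auto elim: eventually_mono)
  qed
  obtain C D where C: "C \<ge> (0::real)"
    and gs: "\<And>(a :: 'n mindex \<Rightarrow> complex) \<eta>. \<exists>\<tau>\<in>nodes m. \<forall>\<xi>. jet m 1 (mpoly_fun m a) \<xi> \<le> C * (1 + norm (\<xi> - \<eta>)) ^ D * cmod (mpoly_fun m a (\<eta> + node \<tau>))"
    by (rule good_shift[of m]) blast
  \<comment> \<open>Composed of \<open>L\<close>, the degree, the dimension and the interpolation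
    constants only. This independence of \<rho> is what permits the parametrix to be chosen for this
    bound afterwards.\<close>
  define C1 where "C1 = L * (card {\<alpha> :: 'n mindex. mdeg \<alpha> \<le> m} * (C * (1 + real (CARD('n) * m)) ^ D))"
  have C10: "C1 \<ge> 0" unfolding C1_def using L0 C by (intro mult_nonneg_nonneg) auto
  obtain \<rho> e0 cutoff where par: "parametrix x\<^sub>0 \<rho> \<Omega> c r m C1 e0 cutoff"
    by (rule parametrix_exists[OF \<open>open \<Omega>\<close> \<open>x\<^sub>0 \<in> \<Omega>\<close> _ _ C10, of r c m]) (use c_smooth h1 in auto)
  interpret parametrix x\<^sub>0 \<rho> \<Omega> c r m C1 e0 cutoff by (rule par)
  obtain \<xi>0 where "gen_weight (P 0) \<xi>0 dvd 1" using h2 by blast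
  from gen_weight_lower[OF this a[OF le0]]
  obtain N where N: "\<forall>\<^sub>F \<epsilon> in at_right 0. \<epsilon> ^ N \<le> jet m 1 (mpoly_fun m (a 0 \<epsilon>)) \<xi>0" unfolding m_def by blast
  let ?B = "C * (norm \<xi>0 + (1 + 1 / \<rho>)) ^ D"
  let ?pc = "\<lambda>\<epsilon>. pcoef r c ?ms (\<lambda>j. a j \<epsilon>)"
  let ?mo = "P_order r P"
  have mo: "\<forall>j\<le>r. ?ms j \<le> ?mo" unfolding P_order_def by (intro allI impI Max_ge) auto
  have "\<forall>\<^sub>F \<epsilon> in at_right 0. \<exists>\<tau> \<mu> q. good_data \<tau> \<mu> \<and> good_symbol (?B * (1 / \<epsilon> ^ N)) D q \<and>
     (\<forall>x k. symb ?mo (?pc \<epsilon>) x (freq \<tau> k) = q k * (1 + (\<Sum>j=1..r. c j x * \<mu> j k)))"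
    using evL N ev_pos
  proof eventually_elim
    fix \<epsilon> :: real assume l: "\<forall>j\<in>{1..r}. \<Lambda> j \<epsilon> \<le> L" and n: "\<epsilon> ^ N \<le> jet m 1 (mpoly_fun m (a 0 \<epsilon>)) \<xi>0" and e: "0 < \<epsilon> \<and> \<epsilon> \<le> 1"
    have hw: "weight (mpoly_fun (?ms j) (a j \<epsilon>)) \<xi> \<le> L * weight (mpoly_fun m (a 0 \<epsilon>)) \<xi>" if j: "j \<in> {1..r}" for j \<xi>
    proof -
      have e': "\<epsilon> \<in> {0<..1}" using e by simp
      have "weight (p j \<epsilon>) \<xi> \<le> \<Lambda> j \<epsilon> * weight (p 0 \<epsilon>) \<xi>" by (rule pw[OF j e'])
      also have "\<dots> \<le> L * weight (p 0 \<epsilon>) \<xi>"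
        unfolding a2[OF le0 e'] by (intro mult_right_mono weight_nonneg[OF Pol_mpoly]) (use l j in auto)
      finally show ?thesis using a2[OF _ e', of j] a2[OF le0 e'] j by (simp add: m_def)
    qed
    have "\<epsilon> ^ N > 0" using e by simp
    from data_exist[of C D ?ms "\<lambda>j. a j \<epsilon>" L "\<epsilon> ^ N" \<xi>0, OF gs C m_def[symmetric] hw L0 C1_def this n]
    show "\<exists>\<tau> \<mu> q. good_data \<tau> \<mu> \<and> good_symbol (?B * (1 / \<epsilon> ^ N)) D q \<and>
     (\<forall>x k. symb ?mo (?pc \<epsilon>) x (freq \<tau> k) = q k * (1 + (\<Sum>j=1..r. c j x * \<mu> j k)))"
      using mo by (simp add: divide_inverse) blast
  qed
  then obtain \<eta>' where eta': "\<eta>' > 0" and wave: "\<And>\<epsilon>. 0 < \<epsilon> \<Longrightarrow> \<epsilon> < \<eta>' \<Longrightarrow>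
     \<exists>\<tau> \<mu> q. good_data \<tau> \<mu> \<and> good_symbol (?B * (1 / \<epsilon> ^ N)) D q \<and>
     (\<forall>x k. symb ?mo (?pc \<epsilon>) x (freq \<tau> k) = q k * (1 + (\<Sum>j=1..r. c j x * \<mu> j k)))"
    unfolding eventually_at_right_field by auto
  \<comment> \<open>Half of the threshold, so that the data exist on the closed end of the interval
    as well; the minimum keeps it in the index set of the nets.\<close>
  define \<eta> where "\<eta> = min 1 (\<eta>' / 2)"
  have eta: "0 < \<eta>" "\<eta> \<le> 1" "\<eta> < \<eta>'" using eta' by (auto simp: \<eta>_def)
  \<comment> \<open>Shifts, quotients and symbol values are packed into one triple, so that a single
    choice over \<epsilon> selects them consistently.\<close>
  have "\<forall>\<epsilon>\<in>{0<..\<eta>}. \<exists>d. good_data (fst d) (fst (snd d)) \<and> good_symbol (?B * (1 / \<epsilon> ^ N)) D (snd (snd d)) \<and>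
     (\<forall>x k. symb ?mo (?pc \<epsilon>) x (freq (fst d) k) = snd (snd d) k * (1 + (\<Sum>j=1..r. c j x * fst (snd d) j k)))"
    using wave eta(3) by fastforce
  from bchoice[OF this] obtain d where d: "\<And>\<epsilon>. \<epsilon> \<in> {0<..\<eta>} \<Longrightarrow> good_data (fst (d \<epsilon>)) (fst (snd (d \<epsilon>))) \<and>
     good_symbol (?B * (1 / \<epsilon> ^ N)) D (snd (snd (d \<epsilon>))) \<and>
     (\<forall>x k. symb ?mo (?pc \<epsilon>) x (freq (fst (d \<epsilon>)) k) = snd (snd (d \<epsilon>)) k * (1 + (\<Sum>j=1..r. c j x * fst (snd (d \<epsilon>)) j k)))"
    by blast
  interpret parametrix_net x\<^sub>0 \<rho> \<Omega> c r m C1 e0 cutoff "\<lambda>\<epsilon>. fst (d \<epsilon>)" "\<lambda>\<epsilon>. fst (snd (d \<epsilon>))" "\<lambda>\<epsilon>. snd (snd (d \<epsilon>))"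
    "P_coeff r c P" ?pc ?mo N D ?B \<eta>
  proof
    show "0 < \<eta>" "\<eta> \<le> 1" by (rule eta)+
    show "net_eq \<Omega> (\<lambda>\<epsilon>. P_coeff r c P \<epsilon> \<alpha>) (\<lambda>\<epsilon>. ?pc \<epsilon> \<alpha>)" for \<alpha>
      by (rule P_coeff_net_eq[OF \<open>open \<Omega>\<close> _ a]) (use c_smooth in auto)
  qed (use d in auto)
  show ?thesis
    using rho ball_S solve_functional solve_function by blast
qed

end
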